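(* Let $f$ be a bounded Riemann-integrable periodic function with unit period on $\mathbb{R}$ such that $\int_0^1f(s)\,ds=0$. Let $(B_t)_{t\in[0,1]}$ be the standard Brownian motion on the Wiener space and $B^n_t=B_t+\int_0^t\frac1nf(ns)\,dB_s$. Let $\xi\in L^2([0,1])$. (a) Let $X$ be a random variable defined on the Wiener space (a Wiener functional). Then, as $n\to\infty$, $$\Big(X,\,n\big(e^{i\int_0^1\xi\,dB^n}-e^{i\int_0^1\xi\,dB}\big)\Big)\stackrel{d}{\Longrightarrow}\Big(X,\,\|f\|_{L^2}\big(e^{i\int_0^1\xi\,dB}\big)^{\#}\Big).$$ (b) Writing $\xi.B=\int_0^1\xi\,dB$ and $\xi.B^n=\int_0^1\xi\,dB^n$, $$n^2\,\mathbb{E}\Big[\big(e^{i\xi.B^n}-e^{i\xi.B}\big)^2\Big]\to-\mathbb{E}[e^{2i\xi.B}]\int_0^1\xi^2\,ds\;\|f\|_{L^2}^2 .$$ On the algebra $\mathcal{L}\{e^{i\xi.B}\}$ the quadratic form given by $e^{i\xi.B}\mapsto-\frac12\mathbb{E}[e^{2i\xi.B}]\int_0^1\xi^2\,ds$ is closable, and its closure is the Ornstein-Uhlenbeck form.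
   Context: $\xi$ is real-valued, $X$ is a real random variable and $\|f\|_{L^2}^2=\int_0^1f^2\,ds$. $\stackrel{d}{\Longrightarrow}$ is convergence in law. For a regular Wiener functional $Z$, $Z^{\#}(\omega,w)=\int_0^1D_sZ\,dW_s$, where $D$ is the Malliavin derivative and $W$ is a Brownian motion independent of $B$. $\mathcal{L}\{e^{i\xi.B}\}$ is the linear span of the functionals $e^{i\xi.B}$, $\xi\in L^2([0,1])$; the quadratic form on it is the one associated with the bilinear form obtained by polarization, $(e^{i\xi.B},e^{i\eta.B})\mapsto-\frac12\mathbb{E}[e^{i(\xi+\eta).B}]\int_0^1\xi\eta\,ds$ (extended bilinearly). The Ornstein-Uhlenbeck form is the Dirichlet form on $L^2$ of Wiener measure with domain $D^{2,1}$ (functionals in $L^2$ with Malliavin derivative in $L^2$), given by $\mathcal{E}[X]=\frac12\mathbb{E}\int_0^1(D_sX)^2\,ds$. *)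

theory Defs
  imports "HOL-Probability.Probability"
begin

section \<open>Square integrability, convergence in law, Riemann integrability\<close>

abbreviation leb01 :: "real measure"
  where "leb01 \<equiv> lebesgue_on {0..1}"

definition in_L2 :: "'a measure \<Rightarrow> ('a \<Rightarrow> 'b::euclidean_space) \<Rightarrow> bool"
  where "in_L2 M F \<longleftrightarrow> F \<in> borel_measurable M \<and> integrable M (\<lambda>x. (norm (F x))\<^sup>2)"

definition L2_tendsto :: "'a measure \<Rightarrow> (nat \<Rightarrow> 'a \<Rightarrow> 'b::euclidean_space) \<Rightarrow> ('a \<Rightarrow> 'b) \<Rightarrow> bool"
  where "L2_tendsto M F Z \<longleftrightarrow> (\<forall>k. in_L2 M (F k)) \<and> in_L2 M Z \<and>
    (\<lambda>k. \<integral>\<^sup>+ x. ennreal ((norm (F k x - Z x))\<^sup>2) \<partial>M) \<longlonglongrightarrow> 0"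

definition L2_norm01 :: "(real \<Rightarrow> real) \<Rightarrow> real"
  where "L2_norm01 f = sqrt (LINT s|leb01. (f s)\<^sup>2)"

text \<open>The limit variable may live on another probability space than the sequence.\<close>

definition conv_in_law ::
    "'a measure \<Rightarrow> (nat \<Rightarrow> 'a \<Rightarrow> 'c::topological_space) \<Rightarrow> 'b measure \<Rightarrow> ('b \<Rightarrow> 'c) \<Rightarrow> bool"
  where "conv_in_law M Y N Z \<longleftrightarrow>
    (\<forall>n. Y n \<in> borel_measurable M) \<and> Z \<in> borel_measurable N \<and>
    (\<forall>h :: 'c \<Rightarrow> real. continuous_on UNIV h \<longrightarrow> bounded (range h) \<longrightarrow>
      (\<lambda>n. LINT x|M. h (Y n x)) \<longlonglongrightarrow> (LINT x|N. h (Z x)))"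

text \<open>A constant gauge turns the Henstock--Kurzweil condition into Riemann's.\<close>

definition riemann_integrable_on :: "(real \<Rightarrow> real) \<Rightarrow> real set \<Rightarrow> bool"  (infixr \<open>riemann'_integrable'_on\<close> 46)
  where "f riemann_integrable_on S \<longleftrightarrow>
    (\<exists>I. \<forall>e>0. \<exists>d>0. \<forall>p. p tagged_division_of S \<and> (\<lambda>x. ball x d) fine p \<longrightarrow>
      \<bar>(\<Sum>(x, K)\<in>p. measure lborel K * f x) - I\<bar> < e)"


section \<open>Wiener space and Wiener integrals\<close>

definition brownian_motion :: "'a measure \<Rightarrow> (real \<Rightarrow> 'a \<Rightarrow> real) \<Rightarrow> bool"
  where "brownian_motion M B \<longleftrightarrow>
    prob_space M \<and>
    (\<forall>t\<in>{0..1}. B t \<in> borel_measurable M) \<and>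
    (\<forall>\<omega>\<in>space M. B 0 \<omega> = 0 \<and> continuous_on {0..1} (\<lambda>t. B t \<omega>)) \<and>
    (\<forall>s t. 0 \<le> s \<and> s < t \<and> t \<le> 1 \<longrightarrow>
      distributed M lborel (\<lambda>\<omega>. B t \<omega> - B s \<omega>) (normal_density 0 (sqrt (t - s)))) \<and>
    (\<forall>(m::nat) (ts :: nat \<Rightarrow> real). mono ts \<and> range ts \<subseteq> {0..1} \<longrightarrow>
      prob_space.indep_vars M (\<lambda>_. borel) (\<lambda>k \<omega>. B (ts (Suc k)) \<omega> - B (ts k) \<omega>) {..<m})"

definition coord :: "real \<Rightarrow> (real \<Rightarrow> real) \<Rightarrow> real"
  where "coord t \<omega> = \<omega> t"

text \<open>The canonical space of continuous paths on \<open>[0,1]\<close> starting at 0; the paths are extensional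
  functions on \<open>{0..1}\<close>, as the product space requires. The conditions determine \<open>M\<close> uniquely.\<close>

definition wiener_space :: "(real \<Rightarrow> real) measure \<Rightarrow> bool"
  where "wiener_space M \<longleftrightarrow>
    sets M = sets (restrict_space (\<Pi>\<^sub>M t\<in>{0..1}. borel) {\<omega>. continuous_on {0..1} \<omega> \<and> \<omega> 0 = 0}) \<and>
    brownian_motion M coord"

text \<open>A list of triples \<open>(c, a, b)\<close> encodes the step function \<open>\<Sum> c 1\<^bsub>(a,b]\<^esub>\<close>.\<close>

definition step_fun :: "('b::euclidean_space \<times> real \<times> real) list \<Rightarrow> real \<Rightarrow> 'b"
  where "step_fun ps s = (\<Sum>(c, a, b)\<leftarrow>ps. indicator {a<..b} s *\<^sub>R c)"

definition step_integral ::
    "(real \<Rightarrow> 'a \<Rightarrow> real) \<Rightarrow> ('b::euclidean_space \<times> real \<times> real) list \<Rightarrow> 'a \<Rightarrow> 'b"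
  where "step_integral Y ps \<omega> = (\<Sum>(c, a, b)\<leftarrow>ps. (Y b \<omega> - Y a \<omega>) *\<^sub>R c)"

text \<open>\<open>Z = \<integral>\<^sub>0\<^sup>1 \<xi> dY\<close> as an \<open>L\<^sup>2\<close> limit; like all random variables below it is determined
  up to almost sure equality only.\<close>

definition has_wiener_integral ::
    "'a measure \<Rightarrow> (real \<Rightarrow> 'a \<Rightarrow> real) \<Rightarrow> (real \<Rightarrow> 'b::euclidean_space) \<Rightarrow> ('a \<Rightarrow> 'b) \<Rightarrow> bool"
  where "has_wiener_integral M Y \<xi> Z \<longleftrightarrow>
    (\<exists>ps. (\<forall>k. \<forall>(c, a, b)\<in>set (ps k). 0 \<le> a \<and> a \<le> b \<and> b \<le> 1) \<and>
      L2_tendsto leb01 (\<lambda>k. step_fun (ps k)) \<xi> \<and>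
      L2_tendsto M (\<lambda>k. step_integral Y (ps k)) Z)"

definition wiener_integral ::
    "'a measure \<Rightarrow> (real \<Rightarrow> 'a \<Rightarrow> real) \<Rightarrow> (real \<Rightarrow> 'b::euclidean_space) \<Rightarrow> 'a \<Rightarrow> 'b"
  where "wiener_integral M Y \<xi> = (SOME Z. has_wiener_integral M Y \<xi> Z)"

definition perturbed_motion ::
    "(real \<Rightarrow> real) measure \<Rightarrow> (real \<Rightarrow> real) \<Rightarrow> nat \<Rightarrow> real \<Rightarrow> (real \<Rightarrow> real) \<Rightarrow> real"
  where "perturbed_motion M f n t \<omega> =
    coord t \<omega> + wiener_integral M coord (\<lambda>s. indicator {0..t} s * (1 / real n * f (real n * s))) \<omega>"

definition exp_functional ::
    "'a measure \<Rightarrow> (real \<Rightarrow> 'a \<Rightarrow> real) \<Rightarrow> (real \<Rightarrow> real) \<Rightarrow> 'a \<Rightarrow> complex"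
  where "exp_functional M Y \<xi> \<omega> = exp (\<i> * complex_of_real (wiener_integral M Y \<xi> \<omega>))"


section \<open>Malliavin derivative\<close>

text \<open>The derivative is the closure, in \<open>L\<^sup>2\<close>, of the gradient on polynomial functionals
  (as in Ikeda--Watanabe). A list of pairs \<open>(c, hs)\<close> encodes the polynomial functional
  \<open>\<Sum> c \<Prod>\<^bsub>h\<in>hs\<^esub> \<integral> h dB\<close>. Allowing complex coefficients gives the complex-linear
  extension to complex functionals.\<close>

definition polynomial_functional ::
    "(real \<Rightarrow> real) measure \<Rightarrow> ('b::euclidean_space \<times> (real \<Rightarrow> real) list) list \<Rightarrow> (real \<Rightarrow> real) \<Rightarrow> 'b"
  where "polynomial_functional M qs \<omega> =
    (\<Sum>(c, hs)\<leftarrow>qs. (\<Prod>i<length hs. wiener_integral M coord (hs ! i) \<omega>) *\<^sub>R c)"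

definition polynomial_gradient ::
    "(real \<Rightarrow> real) measure \<Rightarrow> ('b::euclidean_space \<times> (real \<Rightarrow> real) list) list
      \<Rightarrow> (real \<Rightarrow> real) \<times> real \<Rightarrow> 'b"
  where "polynomial_gradient M qs = (\<lambda>(\<omega>, s).
    (\<Sum>(c, hs)\<leftarrow>qs. (\<Sum>j<length hs. (hs ! j) s *
      (\<Prod>i\<in>{..<length hs} - {j}. wiener_integral M coord (hs ! i) \<omega>)) *\<^sub>R c))"

definition has_malliavin_derivative ::
    "(real \<Rightarrow> real) measure \<Rightarrow> ((real \<Rightarrow> real) \<Rightarrow> 'b::euclidean_space)
      \<Rightarrow> ((real \<Rightarrow> real) \<times> real \<Rightarrow> 'b) \<Rightarrow> bool"
  where "has_malliavin_derivative M Z U \<longleftrightarrow>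
    (\<exists>qs. (\<forall>k. \<forall>(c, hs)\<in>set (qs k). \<forall>h\<in>set hs. in_L2 leb01 h) \<and>
      L2_tendsto M (\<lambda>k. polynomial_functional M (qs k)) Z \<and>
      L2_tendsto (M \<Otimes>\<^sub>M leb01) (\<lambda>k. polynomial_gradient M (qs k)) U)"

definition D21 :: "(real \<Rightarrow> real) measure \<Rightarrow> ((real \<Rightarrow> real) \<Rightarrow> 'b::euclidean_space) set"
  where "D21 M = {Z. \<exists>U. has_malliavin_derivative M Z U}"

definition malliavin_derivative ::
    "(real \<Rightarrow> real) measure \<Rightarrow> ((real \<Rightarrow> real) \<Rightarrow> 'b::euclidean_space)
      \<Rightarrow> (real \<Rightarrow> real) \<times> real \<Rightarrow> 'b"
  where "malliavin_derivative M Z = (SOME U. has_malliavin_derivative M Z U)"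

text \<open>\<open>Z\<^sup>#(\<omega>, w) = \<integral>\<^sub>0\<^sup>1 D\<^sub>s Z(\<omega>) dW\<^sub>s(w)\<close>, where \<open>W\<close> is the coordinate process of the second factor
  of \<open>M \<Otimes>\<^sub>M M\<close>, hence independent of \<open>B\<close>. Given \<open>\<omega>\<close> the integrand is deterministic.\<close>

definition is_sharp ::
    "(real \<Rightarrow> real) measure \<Rightarrow> ((real \<Rightarrow> real) \<Rightarrow> 'b::euclidean_space)
      \<Rightarrow> ((real \<Rightarrow> real) \<times> (real \<Rightarrow> real) \<Rightarrow> 'b) \<Rightarrow> bool"
  where "is_sharp M Z V \<longleftrightarrow> V \<in> borel_measurable (M \<Otimes>\<^sub>M M) \<and>
    (AE \<omega> in M. has_wiener_integral M coord
      (\<lambda>s. malliavin_derivative M Z (\<omega>, s)) (\<lambda>w. V (\<omega>, w)))"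

definition sharp ::
    "(real \<Rightarrow> real) measure \<Rightarrow> ((real \<Rightarrow> real) \<Rightarrow> 'b::euclidean_space)
      \<Rightarrow> (real \<Rightarrow> real) \<times> (real \<Rightarrow> real) \<Rightarrow> 'b"
  where "sharp M Z = (SOME V. is_sharp M Z V)"

text \<open>On real functionals this is the Ornstein--Uhlenbeck Dirichlet form, with domain \<^const>\<open>D21\<close>;
  on complex functionals it is its complex-bilinear extension (there is no conjugate in the square).\<close>

definition ou_form ::
    "(real \<Rightarrow> real) measure \<Rightarrow> ((real \<Rightarrow> real) \<Rightarrow> 'b::{euclidean_space, real_normed_field}) \<Rightarrow> 'b"
  where "ou_form M Z = (LINT \<omega>|M. LINT s|leb01. (malliavin_derivative M Z (\<omega>, s))\<^sup>2) / 2"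


section \<open>The algebra of exponentials and its quadratic form\<close>

text \<open>Functionals are identified when they agree almost surely, so the span is taken up to
  almost sure equality.\<close>

definition exp_algebra :: "(real \<Rightarrow> real) measure \<Rightarrow> ((real \<Rightarrow> real) \<Rightarrow> complex) set"
  where "exp_algebra M = {F \<in> borel_measurable M.
    \<exists>ps. (\<forall>(c, \<xi>)\<in>set ps. in_L2 leb01 \<xi>) \<and>
      (AE \<omega> in M. F \<omega> = (\<Sum>(c, \<xi>)\<leftarrow>ps. c * exp_functional M coord \<xi> \<omega>))}"

definition real_exp_algebra :: "(real \<Rightarrow> real) measure \<Rightarrow> ((real \<Rightarrow> real) \<Rightarrow> complex) set"
  where "real_exp_algebra M = {F \<in> exp_algebra M. \<forall>\<omega>\<in>space M. F \<omega> \<in> \<real>}"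

text \<open>The symmetric complex-bilinear form with prescribed values on exponentials, well defined on
  classes modulo almost sure equality. These conditions determine it on \<^const>\<open>exp_algebra\<close>.\<close>

definition is_exp_form ::
    "(real \<Rightarrow> real) measure
      \<Rightarrow> (((real \<Rightarrow> real) \<Rightarrow> complex) \<Rightarrow> ((real \<Rightarrow> real) \<Rightarrow> complex) \<Rightarrow> complex) \<Rightarrow> bool"
  where "is_exp_form M b \<longleftrightarrow>
    (\<forall>F\<in>exp_algebra M. \<forall>G\<in>exp_algebra M. b F G = b G F) \<and>
    (\<forall>F\<in>exp_algebra M. \<forall>G\<in>exp_algebra M. \<forall>H\<in>exp_algebra M.
      b (\<lambda>\<omega>. F \<omega> + G \<omega>) H = b F H + b G H) \<and>
    (\<forall>c. \<forall>F\<in>exp_algebra M. \<forall>H\<in>exp_algebra M. b (\<lambda>\<omega>. c * F \<omega>) H = c * b F H) \<and>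
    (\<forall>F\<in>exp_algebra M. \<forall>G\<in>exp_algebra M. \<forall>H\<in>exp_algebra M.
      (AE \<omega> in M. F \<omega> = G \<omega>) \<longrightarrow> b F H = b G H) \<and>
    (\<forall>\<xi> \<eta>. in_L2 leb01 \<xi> \<longrightarrow> in_L2 leb01 \<eta> \<longrightarrow>
      b (exp_functional M coord \<xi>) (exp_functional M coord \<eta>) =
        - (1/2) * (LINT \<omega>|M. exp_functional M coord (\<lambda>s. \<xi> s + \<eta> s) \<omega>) *
          complex_of_real (LINT s|leb01. \<xi> s * \<eta> s))"

text \<open>The complex number \<open>b F F\<close> does not control \<open>F\<close> when \<open>F\<close> is complex (isotropic elements), so
  Cauchy sequences are taken for the associated nonnegative Hermitian form \<open>b F (cnj F)\<close>. On
  real-valued functionals this is the quadratic form \<open>b F F\<close> itself and the definitions below are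
  the usual ones for a Dirichlet form.\<close>

definition form_energy ::
    "(('a \<Rightarrow> complex) \<Rightarrow> ('a \<Rightarrow> complex) \<Rightarrow> complex) \<Rightarrow> ('a \<Rightarrow> complex) \<Rightarrow> complex"
  where "form_energy b F = b F (\<lambda>\<omega>. cnj (F \<omega>))"

definition form_Cauchy ::
    "(('a \<Rightarrow> complex) \<Rightarrow> ('a \<Rightarrow> complex) \<Rightarrow> complex) \<Rightarrow> (nat \<Rightarrow> 'a \<Rightarrow> complex) \<Rightarrow> bool"
  where "form_Cauchy b F \<longleftrightarrow>
    (\<forall>e>0. \<exists>N. \<forall>m\<ge>N. \<forall>n\<ge>N. cmod (form_energy b (\<lambda>\<omega>. F m \<omega> - F n \<omega>)) < e)"

definition form_closable ::
    "'a measure \<Rightarrow> ('a \<Rightarrow> complex) set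
      \<Rightarrow> (('a \<Rightarrow> complex) \<Rightarrow> ('a \<Rightarrow> complex) \<Rightarrow> complex) \<Rightarrow> bool"
  where "form_closable M A b \<longleftrightarrow>
    (\<forall>F. (\<forall>k. F k \<in> A) \<and> L2_tendsto M F (\<lambda>_. 0) \<and> form_Cauchy b F \<longrightarrow>
      (\<lambda>k. form_energy b (F k)) \<longlonglongrightarrow> 0)"

text \<open>\<open>form_closure M A b F c\<close>: \<open>F\<close> is in the domain of the closure of the quadratic form
  \<open>F \<mapsto> b F F\<close> on \<open>A\<close>, and the closure takes the value \<open>c\<close> at \<open>F\<close>.\<close>

definition form_closure ::
    "'a measure \<Rightarrow> ('a \<Rightarrow> complex) set
      \<Rightarrow> (('a \<Rightarrow> complex) \<Rightarrow> ('a \<Rightarrow> complex) \<Rightarrow> complex) \<Rightarrow> ('a \<Rightarrow> complex) \<Rightarrow> complex \<Rightarrow> bool"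
  where "form_closure M A b F c \<longleftrightarrow>
    (\<exists>G. (\<forall>k. G k \<in> A) \<and> L2_tendsto M G F \<and> form_Cauchy b G \<and> (\<lambda>k. b (G k) (G k)) \<longlonglongrightarrow> c)"

end

theory Submission
  imports Defs
begin

text \<open>Almost surely \<open>\<xi>.B\<^sup>n = \<xi>.B + G\<^sub>n / n\<close> with \<open>G\<^sub>n = \<integral> \<xi>(s) f(ns) dB\<^sub>s\<close>, so both parts reduce to the joint
  Gaussian law of \<open>B\<close> and \<open>G\<^sub>n\<close>. By the Riemann--Lebesgue lemma the covariance of \<open>G\<^sub>n\<close> with every
  \<open>\<zeta>.B\<close> tends to 0 and its variance to \<open>\<parallel>\<xi>\<parallel>\<^sup>2 \<parallel>f\<parallel>\<^sup>2\<close>. The second moment is then an explicit limit. For (a),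
  \<open>E[F e\<^bsup>itG\<^sub>n\<^esup>]\<close> converges to the product of \<open>E[F]\<close> and the Gaussian characteristic function, first for \<open>F\<close> an
  exponential and by density for \<open>F\<close> an indicator; hence \<open>G\<^sub>n\<close> converges in law under every
  conditional measure, and \<open>n (e\<^bsup>i\<xi>.B\<^sup>n\<^esup> - e\<^bsup>i\<xi>.B\<^esup>)\<close> is \<open>i e\<^bsup>i\<xi>.B\<^esup> G\<^sub>n\<close> up to \<open>O(G\<^sub>n\<^sup>2 / n)\<close>.

  For the form, the gradient is closable on the exponentials by Gaussian integration by parts, and its
  closure is the Malliavin derivative: Taylor polynomials of \<open>e\<^bsup>i\<xi>.B\<^esup>\<close> approximate exponentials, and
  the difference quotients of \<open>\<epsilon> \<mapsto> e\<^bsup>i\<epsilon> h.B\<^esup>\<close> at 0 approximate the factors \<open>h.B\<close> of a monomial. The prescribed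
  form is \<open>(F, G) \<mapsto> E \<integral> DF DG / 2\<close>, so its closure is the Ornstein--Uhlenbeck form.\<close>

section \<open>The space of square integrable functions\<close>

text \<open>In (a) the variable \<open>X\<close> is any measurable function, so convergence in law
  of the second component alone would say nothing about the pair. Convergence under all conditional
  measures says that the Gaussian limit is asymptotically independent of the whole path; the second
  factor of the product space carries this independent copy, and since the derivative of
  \<open>e \<xi>\<close> is \<open>\<i> * \<xi> * e \<xi>\<close>, multiplying the copy by
  \<open>\<i> * e \<xi>\<close> produces the sharp functional.

  For the form there are two obstacles. The derivative is defined from unbounded polynomials while
  the form is given on exponentials, so each kind of functional must be approximated by the other
  together with its gradient; Gaussian moments supply the dominating functions. Moreover
  \<open>b F F\<close> is complex-bilinear and has isotropic elements. Only the energy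
  \<open>b F (cnj F)\<close> is half the squared norm of the gradient; it makes form-Cauchy
  sequences the same as sequences with convergent gradients, and the values \<open>b F F\<close>
  then converge by continuity of the bilinear pairing.

  Integrals and derivatives are chosen representatives, so identities between them hold almost
  everywhere only.\<close>

definition sqn :: "'a measure \<Rightarrow> ('a \<Rightarrow> 'b::real_normed_vector) \<Rightarrow> ennreal"
  where "sqn M F = (\<integral>\<^sup>+x. ennreal ((norm (F x))\<^sup>2) \<partial>M)"

lemma norm_add_square_le:
  fixes a b :: "'b::real_normed_vector"
  shows "(norm (a + b))\<^sup>2 \<le> 2 * (norm a)\<^sup>2 + 2 * (norm b)\<^sup>2"
proof -
  have "(norm (a + b))\<^sup>2 \<le> (norm a + norm b)\<^sup>2"
    by (simp add: norm_triangle_ineq power_mono)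
  also have "\<dots> \<le> 2 * (norm a)\<^sup>2 + 2 * (norm b)\<^sup>2"
    using sum_squares_bound[of "norm a" "norm b"] by (simp add: power2_sum)
  finally show ?thesis .
qed

text \<open>The squared norm is kept as an \<open>ennreal\<close>, hence defined for every function;
  finiteness is then membership in \<open>in_L2\<close>, and estimates can be stated without
  integrability conditions.\<close>

lemma in_L2_iff_sqn: "in_L2 M F \<longleftrightarrow> F \<in> borel_measurable M \<and> sqn M F < \<infinity>"
  by (auto simp: in_L2_def sqn_def integrable_iff_bounded)

lemma in_L2_measurable [measurable_dest]: "in_L2 M F \<Longrightarrow> F \<in> borel_measurable M"
  by (simp add: in_L2_def)

lemma sqn_eq_integral: "in_L2 M F \<Longrightarrow> sqn M F = ennreal (LINT x|M. (norm (F x))\<^sup>2)"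
  unfolding sqn_def in_L2_def by (intro nn_integral_eq_integral) auto

lemma L2_tendsto_iff_sqn:
  "L2_tendsto M F Z \<longleftrightarrow>
    (\<forall>k. in_L2 M (F k)) \<and> in_L2 M Z \<and> (\<lambda>k. sqn M (\<lambda>x. F k x - Z x)) \<longlonglongrightarrow> 0"
  by (simp add: L2_tendsto_def sqn_def)

lemma sqn_cong_AE: "AE x in M. F x = G x \<Longrightarrow> sqn M F = sqn M G"
  unfolding sqn_def by (rule nn_integral_cong_AE) auto

lemma sqn_le:
  assumes "G \<in> borel_measurable M" "AE x in M. norm (F x) \<le> C * norm (G x)"
  shows "sqn M F \<le> ennreal (C\<^sup>2) * sqn M G"
proof -
  have "sqn M F \<le> (\<integral>\<^sup>+x. ennreal (C\<^sup>2) * ennreal ((norm (G x))\<^sup>2) \<partial>M)"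
    unfolding sqn_def
  proof (rule nn_integral_mono_AE, use assms(2) in eventually_elim)
    fix x assume "norm (F x) \<le> C * norm (G x)"
    then have "(norm (F x))\<^sup>2 \<le> (C * norm (G x))\<^sup>2" by (simp add: power_mono)
    then show "ennreal ((norm (F x))\<^sup>2) \<le> ennreal (C\<^sup>2) * ennreal ((norm (G x))\<^sup>2)"
      by (simp add: power_mult_distrib flip: ennreal_mult)
  qed
  also have "\<dots> = ennreal (C\<^sup>2) * sqn M G"
    unfolding sqn_def using assms(1) by (intro nn_integral_cmult) measurable
  finally show ?thesis .
qed

text \<open>The inequality \<open>(a + b)^2 <= 2 a^2 + 2 b^2\<close> takes the place of Minkowski's:
  the factor 2 is harmless in limits, and no square roots of \<open>ennreal\<close> values
  appear.\<close>

lemma sqn_add_le: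
  fixes F G :: "'a \<Rightarrow> 'b::euclidean_space"
  assumes [measurable]: "F \<in> borel_measurable M" "G \<in> borel_measurable M"
  shows "sqn M (\<lambda>x. F x + G x) \<le> 2 * sqn M F + 2 * sqn M G"
proof -
  have "sqn M (\<lambda>x. F x + G x)
      \<le> (\<integral>\<^sup>+x. 2 * ennreal ((norm (F x))\<^sup>2) + 2 * ennreal ((norm (G x))\<^sup>2) \<partial>M)"
    unfolding sqn_def
  proof (rule nn_integral_mono)
    fix x
    have "ennreal ((norm (F x + G x))\<^sup>2) \<le> ennreal (2 * (norm (F x))\<^sup>2 + 2 * (norm (G x))\<^sup>2)"
      by (intro ennreal_leI norm_add_square_le)
    also have "\<dots> = 2 * ennreal ((norm (F x))\<^sup>2) + 2 * ennreal ((norm (G x))\<^sup>2)"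
      by (simp add: ennreal_mult)
    finally show "ennreal ((norm (F x + G x))\<^sup>2)
      \<le> 2 * ennreal ((norm (F x))\<^sup>2) + 2 * ennreal ((norm (G x))\<^sup>2)" .
  qed
  also have "\<dots> = 2 * sqn M F + 2 * sqn M G"
    unfolding sqn_def by (subst nn_integral_add) (auto simp: nn_integral_cmult)
  finally show ?thesis .
qed

lemma sqn_minus_commute: "sqn M (\<lambda>x. F x - G x) = sqn M (\<lambda>x. G x - F x)"
  by (simp add: sqn_def norm_minus_commute)

lemma sqn_triangle:
  fixes F G K :: "'a \<Rightarrow> 'b::euclidean_space"
  assumes [measurable]: "F \<in> borel_measurable M" "G \<in> borel_measurable M" "K \<in> borel_measurable M"
  shows "sqn M (\<lambda>x. F x - K x) \<le> 2 * sqn M (\<lambda>x. F x - G x) + 2 * sqn M (\<lambda>x. G x - K x)"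
  using sqn_add_le[of "\<lambda>x. F x - G x" M "\<lambda>x. G x - K x"] by simp

lemma sqn_eq_0_iff:
  fixes F :: "'a \<Rightarrow> 'b::euclidean_space"
  assumes [measurable]: "F \<in> borel_measurable M"
  shows "sqn M F = 0 \<longleftrightarrow> (AE x in M. F x = 0)"
  unfolding sqn_def by (subst nn_integral_0_iff_AE) auto

lemma in_L2_bound:
  fixes F :: "'a \<Rightarrow> 'b::euclidean_space" and G :: "'a \<Rightarrow> 'c::euclidean_space"
  assumes "in_L2 M F" "G \<in> borel_measurable M" "AE x in M. norm (G x) \<le> C * norm (F x)"
  shows "in_L2 M G"
  using assms sqn_le[OF _ assms(3)]
  by (auto simp: in_L2_iff_sqn ennreal_mult_less_top intro: le_less_trans)

lemma in_L2_cong_AE: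
  assumes "in_L2 M F" "G \<in> borel_measurable M" "AE x in M. G x = F x"
  shows "in_L2 M G"
  using assms sqn_cong_AE[OF assms(3)] by (auto simp: in_L2_iff_sqn)

lemma in_L2_add:
  fixes F G :: "'a \<Rightarrow> 'b::euclidean_space"
  assumes "in_L2 M F" "in_L2 M G"
  shows "in_L2 M (\<lambda>x. F x + G x)"
  using assms sqn_add_le[of F M G]
  by (auto simp: in_L2_iff_sqn ennreal_mult_less_top intro: le_less_trans)

lemma in_L2_scaleR:
  fixes F :: "'a \<Rightarrow> 'b::euclidean_space"
  shows "in_L2 M F \<Longrightarrow> in_L2 M (\<lambda>x. c *\<^sub>R F x)"
  by (rule in_L2_bound[where F=F and C="\<bar>c\<bar>"]) auto

lemma in_L2_mult_left:
  fixes F :: "'a \<Rightarrow> 'b::{euclidean_space, real_normed_field}"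
  shows "in_L2 M F \<Longrightarrow> in_L2 M (\<lambda>x. c * F x)"
  by (rule in_L2_bound[where F=F and C="norm c"]) (auto simp: norm_mult)

lemma in_L2_minus:
  fixes F :: "'a \<Rightarrow> 'b::euclidean_space"
  shows "in_L2 M F \<Longrightarrow> in_L2 M (\<lambda>x. - F x)"
  by (rule in_L2_bound[where F=F and C=1]) auto

lemma in_L2_diff:
  fixes F G :: "'a \<Rightarrow> 'b::euclidean_space"
  assumes "in_L2 M F" "in_L2 M G"
  shows "in_L2 M (\<lambda>x. F x - G x)"
  using in_L2_add[OF assms(1) in_L2_minus[OF assms(2)]] by simp

lemma in_L2_zero: "in_L2 M (\<lambda>x. 0)"
  by (simp add: in_L2_def)

lemma in_L2_bounded:
  fixes F :: "'a \<Rightarrow> 'b::euclidean_space"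
  assumes "finite_measure M" "F \<in> borel_measurable M" "AE x in M. norm (F x) \<le> C"
  shows "in_L2 M F"
proof -
  interpret finite_measure M by fact
  have "in_L2 M (\<lambda>_. 1::real)" by (simp add: in_L2_def)
  then show ?thesis by (rule in_L2_bound[where C=C]) (use assms in auto)
qed

lemma borel_measurable_cnj [measurable (raw)]:
  "f \<in> borel_measurable M \<Longrightarrow> (\<lambda>x. cnj (f x)) \<in> borel_measurable M"
  by (rule measurable_compose[OF _ borel_measurable_continuous_onI]) (auto intro: continuous_intros)

lemma in_L2_of_real: "in_L2 M F \<Longrightarrow> in_L2 M (\<lambda>x. complex_of_real (F x))"
  by (rule in_L2_bound[where F=F and C=1]) auto

lemma in_L2_norm:
  fixes F :: "'a \<Rightarrow> 'b::euclidean_space"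
  shows "in_L2 M F \<Longrightarrow> in_L2 M (\<lambda>x. norm (F x))"
  by (rule in_L2_bound[where F=F and C=1]) auto

text \<open>Integrability comes from \<open>2 a b <= a^2 + b^2\<close>, the bound from the
  Cauchy-Schwarz inequality for nonnegative integrals. Only norms enter, so the two functions may
  take values in different spaces.\<close>

lemma integral_norm_mult_le:
  fixes F :: "'a \<Rightarrow> 'b::euclidean_space" and G :: "'a \<Rightarrow> 'c::euclidean_space"
  assumes "in_L2 M F" "in_L2 M G"
  shows "integrable M (\<lambda>x. norm (F x) * norm (G x))"
    and "(LINT x|M. norm (F x) * norm (G x)) \<le>
      sqrt (LINT x|M. (norm (F x))\<^sup>2) * sqrt (LINT x|M. (norm (G x))\<^sup>2)"
proof -
  have [measurable]: "F \<in> borel_measurable M" "G \<in> borel_measurable M"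
    using assms by (auto simp: in_L2_def)
  have int: "integrable M (\<lambda>x. (norm (F x))\<^sup>2)" "integrable M (\<lambda>x. (norm (G x))\<^sup>2)"
    using assms by (auto simp: in_L2_def)
  show i: "integrable M (\<lambda>x. norm (F x) * norm (G x))"
  proof (rule Bochner_Integration.integrable_bound[OF Bochner_Integration.integrable_add[OF int]])
    show "AE x in M. norm (norm (F x) * norm (G x)) \<le> norm ((norm (F x))\<^sup>2 + (norm (G x))\<^sup>2)"
    proof (intro AE_I2)
      fix x
      have "2 * (norm (F x) * norm (G x)) \<le> (norm (F x))\<^sup>2 + (norm (G x))\<^sup>2"
        using sum_squares_bound[of "norm (F x)" "norm (G x)"] by simp
      moreover have "0 \<le> norm (F x) * norm (G x)" by simp
      ultimately show "norm (norm (F x) * norm (G x)) \<le> norm ((norm (F x))\<^sup>2 + (norm (G x))\<^sup>2)"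
        unfolding real_norm_def by linarith
    qed
  qed auto
  have "(\<integral>\<^sup>+x. ennreal (norm (F x)) * ennreal (norm (G x)) \<partial>M)\<^sup>2
      \<le> (\<integral>\<^sup>+x. (ennreal (norm (F x)))\<^sup>2 \<partial>M) * (\<integral>\<^sup>+x. (ennreal (norm (G x)))\<^sup>2 \<partial>M)"
    by (rule Cauchy_Schwarz_nn_integral) auto
  then have "(\<integral>\<^sup>+x. ennreal (norm (F x) * norm (G x)) \<partial>M)\<^sup>2 \<le> sqn M F * sqn M G"
    by (simp add: sqn_def ennreal_power ennreal_mult)
  then have "ennreal ((LINT x|M. norm (F x) * norm (G x))\<^sup>2)
      \<le> ennreal ((LINT x|M. (norm (F x))\<^sup>2) * (LINT x|M. (norm (G x))\<^sup>2))"
    unfolding nn_integral_eq_integral[OF i AE_I2[OF mult_nonneg_nonneg[OF norm_ge_zero norm_ge_zero]]]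
      sqn_eq_integral[OF assms(1)] sqn_eq_integral[OF assms(2)]
    by (subst (asm) ennreal_power, simp, subst (asm) ennreal_mult[symmetric]) simp_all
  then have "(LINT x|M. norm (F x) * norm (G x))\<^sup>2
      \<le> (LINT x|M. (norm (F x))\<^sup>2) * (LINT x|M. (norm (G x))\<^sup>2)"
    by (simp add: ennreal_le_iff)
  then show "(LINT x|M. norm (F x) * norm (G x)) \<le>
      sqrt (LINT x|M. (norm (F x))\<^sup>2) * sqrt (LINT x|M. (norm (G x))\<^sup>2)"
    by (simp add: real_le_rsqrt flip: real_sqrt_mult)
qed

lemma in_L2_mult:
  fixes F G :: "'a \<Rightarrow> 'b::{euclidean_space, real_normed_field}"
  assumes "in_L2 M F" "in_L2 M G"
  shows "integrable M (\<lambda>x. F x * G x)"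
    and "norm (LINT x|M. F x * G x) \<le>
      sqrt (LINT x|M. (norm (F x))\<^sup>2) * sqrt (LINT x|M. (norm (G x))\<^sup>2)"
proof -
  have [measurable]: "F \<in> borel_measurable M" "G \<in> borel_measurable M"
    using assms by (auto simp: in_L2_def)
  show "integrable M (\<lambda>x. F x * G x)"
    by (rule Bochner_Integration.integrable_bound[OF integral_norm_mult_le(1)[OF assms]])
      (auto simp: norm_mult)
  have "norm (LINT x|M. F x * G x) \<le> (LINT x|M. norm (F x * G x))"
    by (rule integral_norm_bound)
  then show "norm (LINT x|M. F x * G x) \<le>
      sqrt (LINT x|M. (norm (F x))\<^sup>2) * sqrt (LINT x|M. (norm (G x))\<^sup>2)"
    using integral_norm_mult_le(2)[OF assms] by (simp add: norm_mult)
qed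

lemma in_L2_integrable:
  fixes F :: "'a \<Rightarrow> 'b::euclidean_space"
  assumes "finite_measure M" "in_L2 M F"
  shows "integrable M F"
proof -
  interpret finite_measure M by fact
  have "in_L2 M (\<lambda>_. 1::real)" by (simp add: in_L2_def)
  from integral_norm_mult_le(1)[OF assms(2) this] assms(2) show ?thesis
    by (simp add: integrable_norm_iff in_L2_def)
qed

section \<open>Convergence in mean square\<close>

lemma L2_tendsto_in_L2: "L2_tendsto M F Z \<Longrightarrow> in_L2 M (F k)" "L2_tendsto M F Z \<Longrightarrow> in_L2 M Z"
  by (auto simp: L2_tendsto_def)

lemma L2_tendsto_iff_integral:
  fixes F :: "nat \<Rightarrow> 'a \<Rightarrow> 'b::euclidean_space"
  shows "L2_tendsto M F Z \<longleftrightarrow>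
    (\<forall>k. in_L2 M (F k)) \<and> in_L2 M Z \<and> (\<lambda>k. LINT x|M. (norm (F k x - Z x))\<^sup>2) \<longlonglongrightarrow> 0"
proof (cases "(\<forall>k. in_L2 M (F k)) \<and> in_L2 M Z")
  case True
  then have "\<And>k. sqn M (\<lambda>x. F k x - Z x) = ennreal (LINT x|M. (norm (F k x - Z x))\<^sup>2)"
    by (intro sqn_eq_integral in_L2_diff) auto
  with True show ?thesis
    by (simp add: L2_tendsto_iff_sqn ennreal_0[symmetric] del: ennreal_0)
qed (auto simp: L2_tendsto_def)

lemma ennreal_tendsto_0_le:
  fixes f g :: "nat \<Rightarrow> ennreal"
  assumes "g \<longlonglongrightarrow> 0" "\<And>k. f k \<le> g k"
  shows "f \<longlonglongrightarrow> 0"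
  by (rule tendsto_sandwich[OF _ _ tendsto_const assms(1)]) (auto simp: assms(2))

text \<open>The two sequences may live on different measure spaces; this is what carries convergence
  on \<open>M\<close> over to the product with \<open>leb01\<close>.\<close>

lemma L2_tendsto_le:
  fixes F :: "nat \<Rightarrow> 'a \<Rightarrow> 'b::euclidean_space" and G :: "nat \<Rightarrow> 'd \<Rightarrow> 'c::euclidean_space"
  assumes F: "L2_tendsto M F Z" and G: "\<And>k. in_L2 N (G k)" "in_L2 N Y"
    and le: "\<And>k. sqn N (\<lambda>x. G k x - Y x) \<le> ennreal C * sqn M (\<lambda>x. F k x - Z x)"
  shows "L2_tendsto N G Y"
proof -
  have "(\<lambda>k. ennreal C * sqn M (\<lambda>x. F k x - Z x)) \<longlonglongrightarrow> ennreal C * 0"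
    using F by (intro ennreal_tendsto_cmult) (auto simp: L2_tendsto_iff_sqn)
  then have "(\<lambda>k. sqn N (\<lambda>x. G k x - Y x)) \<longlonglongrightarrow> 0"
    by (intro ennreal_tendsto_0_le[OF _ le]) simp
  with G show ?thesis by (simp add: L2_tendsto_iff_sqn)
qed

lemma L2_tendsto_bound:
  fixes F :: "nat \<Rightarrow> 'a \<Rightarrow> 'b::euclidean_space" and G :: "nat \<Rightarrow> 'a \<Rightarrow> 'c::euclidean_space"
  assumes F: "L2_tendsto M F Z" and G: "\<And>k. in_L2 M (G k)" "in_L2 M Y"
    and le: "\<And>k. AE x in M. norm (G k x - Y x) \<le> C * norm (F k x - Z x)"
  shows "L2_tendsto M G Y"
proof (rule L2_tendsto_le[OF F G])
  have [measurable]: "F k \<in> borel_measurable M" "Z \<in> borel_measurable M" for k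
    using L2_tendsto_in_L2[OF F] by (auto simp: in_L2_def)
  show "sqn M (\<lambda>x. G k x - Y x) \<le> ennreal (C\<^sup>2) * sqn M (\<lambda>x. F k x - Z x)" for k
    by (rule sqn_le[OF _ le]) measurable
qed

lemma L2_tendsto_const: "in_L2 M Z \<Longrightarrow> L2_tendsto M (\<lambda>_. Z) Z"
  by (simp add: L2_tendsto_def)

lemma L2_tendsto_add:
  fixes F G :: "nat \<Rightarrow> 'a \<Rightarrow> 'b::euclidean_space"
  assumes F: "L2_tendsto M F Z" and G: "L2_tendsto M G Y"
  shows "L2_tendsto M (\<lambda>k x. F k x + G k x) (\<lambda>x. Z x + Y x)"
proof -
  have [measurable]: "F k \<in> borel_measurable M" "Z \<in> borel_measurable M"
      "G k \<in> borel_measurable M" "Y \<in> borel_measurable M" for k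
    using L2_tendsto_in_L2[OF F] L2_tendsto_in_L2[OF G] by (auto simp: in_L2_def)
  have "(\<lambda>k. 2 * sqn M (\<lambda>x. F k x - Z x) + 2 * sqn M (\<lambda>x. G k x - Y x)) \<longlonglongrightarrow> 2 * 0 + 2 * 0"
    using F G by (intro tendsto_add ennreal_tendsto_cmult) (auto simp: L2_tendsto_iff_sqn)
  moreover have "sqn M (\<lambda>x. F k x + G k x - (Z x + Y x))
      \<le> 2 * sqn M (\<lambda>x. F k x - Z x) + 2 * sqn M (\<lambda>x. G k x - Y x)" for k
    using sqn_add_le[of "\<lambda>x. F k x - Z x" M "\<lambda>x. G k x - Y x"] by (simp add: algebra_simps)
  ultimately have "(\<lambda>k. sqn M (\<lambda>x. F k x + G k x - (Z x + Y x))) \<longlonglongrightarrow> 0"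
    by (simp add: ennreal_tendsto_0_le)
  with F G show ?thesis by (simp add: L2_tendsto_iff_sqn in_L2_add)
qed

lemma L2_tendsto_scaleR:
  fixes F :: "nat \<Rightarrow> 'a \<Rightarrow> 'b::euclidean_space"
  assumes F: "L2_tendsto M F Z"
  shows "L2_tendsto M (\<lambda>k x. c *\<^sub>R F k x) (\<lambda>x. c *\<^sub>R Z x)"
proof (rule L2_tendsto_bound[OF F, where C="\<bar>c\<bar>"])
  note L2 = L2_tendsto_in_L2[OF F]
  show "in_L2 M (\<lambda>x. c *\<^sub>R F k x)" "in_L2 M (\<lambda>x. c *\<^sub>R Z x)" for k
    by (intro in_L2_scaleR L2)+
  show "AE x in M. norm (c *\<^sub>R F k x - c *\<^sub>R Z x) \<le> \<bar>c\<bar> * norm (F k x - Z x)" for k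
    by (intro AE_I2) (metis norm_scaleR order_refl scaleR_diff_right)
qed

lemma L2_tendsto_mult_left:
  fixes F :: "nat \<Rightarrow> 'a \<Rightarrow> 'b::{euclidean_space, real_normed_field}"
  assumes F: "L2_tendsto M F Z"
  shows "L2_tendsto M (\<lambda>k x. c * F k x) (\<lambda>x. c * Z x)"
proof (rule L2_tendsto_bound[OF F, where C="norm c"])
  note L2 = L2_tendsto_in_L2[OF F]
  show "in_L2 M (\<lambda>x. c * F k x)" "in_L2 M (\<lambda>x. c * Z x)" for k
    by (intro in_L2_mult_left L2)+
  show "AE x in M. norm (c * F k x - c * Z x) \<le> norm c * norm (F k x - Z x)" for k
    by (intro AE_I2) (metis norm_mult order_refl right_diff_distrib)
qed

lemma L2_tendsto_diff:
  fixes F G :: "nat \<Rightarrow> 'a \<Rightarrow> 'b::euclidean_space"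
  assumes F: "L2_tendsto M F Z" and G: "L2_tendsto M G Y"
  shows "L2_tendsto M (\<lambda>k x. F k x - G k x) (\<lambda>x. Z x - Y x)"
  using L2_tendsto_add[OF F L2_tendsto_scaleR[OF G, of "-1"]] by simp

lemma L2_tendsto_cong_AE:
  fixes F G :: "nat \<Rightarrow> 'a \<Rightarrow> 'b::euclidean_space"
  assumes F: "L2_tendsto M F Z"
    and "\<And>k. G k \<in> borel_measurable M" "Y \<in> borel_measurable M"
    and eq: "\<And>k. AE x in M. G k x = F k x" "AE x in M. Y x = Z x"
  shows "L2_tendsto M G Y"
proof (rule L2_tendsto_bound[OF F, where C=1])
  show "in_L2 M (G k)" "in_L2 M Y" for k
    using assms L2_tendsto_in_L2[OF F] by (auto intro: in_L2_cong_AE)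
  show "AE x in M. norm (G k x - Y x) \<le> 1 * norm (F k x - Z x)" for k
    using eq(1)[of k] eq(2) by eventually_elim simp
qed

lemma linear_measurable:
  fixes g :: "'b::euclidean_space \<Rightarrow> 'c::euclidean_space"
  assumes "linear g"
  shows "g \<in> borel_measurable borel"
  using assms by (intro borel_measurable_continuous_onI linear_continuous_on) (simp add: linear_conv_bounded_linear)

lemma in_L2_linear:
  fixes F :: "'a \<Rightarrow> 'b::euclidean_space" and g :: "'b \<Rightarrow> 'c::euclidean_space"
  assumes F: "in_L2 M F" and g: "linear g"
  shows "in_L2 M (\<lambda>x. g (F x))"
proof -
  obtain C where C: "\<And>x. norm (g x) \<le> C * norm x"
    using linear_bounded[OF g] by blast
  show ?thesis
    by (rule in_L2_bound[OF F, where C=C])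
      (use C measurable_compose[OF in_L2_measurable[OF F] linear_measurable[OF g]] in auto)
qed

lemma linear_Re_Complex: "linear (\<lambda>z. complex_of_real (Re z))" "linear complex_of_real" "linear Re"
  by (intro linearI; simp add: scaleR_conv_of_real)+

lemma L2_tendsto_linear:
  fixes F :: "nat \<Rightarrow> 'a \<Rightarrow> 'b::euclidean_space" and g :: "'b \<Rightarrow> 'c::euclidean_space"
  assumes F: "L2_tendsto M F Z" and g: "linear g"
  shows "L2_tendsto M (\<lambda>k x. g (F k x)) (\<lambda>x. g (Z x))"
proof -
  obtain C where C: "\<And>x. norm (g x) \<le> C * norm x"
    using linear_bounded[OF g] by blast
  show ?thesis
  proof (rule L2_tendsto_bound[OF F, where C=C])
    note L2 = L2_tendsto_in_L2[OF F]
    show "in_L2 M (\<lambda>x. g (F k x))" "in_L2 M (\<lambda>x. g (Z x))" for k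
      by (rule in_L2_linear[OF L2(1) g], rule in_L2_linear[OF L2(2) g])
    show "AE x in M. norm (g (F k x) - g (Z x)) \<le> C * norm (F k x - Z x)" for k
    proof (rule AE_I2)
      fix x
      show "norm (g (F k x) - g (Z x)) \<le> C * norm (F k x - Z x)"
        using C[of "F k x - Z x"] by (simp add: linear_diff[OF g])
    qed
  qed
qed

lemma L2_tendsto_subseq: "L2_tendsto M F Z \<Longrightarrow> strict_mono r \<Longrightarrow> L2_tendsto M (\<lambda>k. F (r k)) Z"
  unfolding L2_tendsto_iff_sqn
  using LIMSEQ_subseq_LIMSEQ[of "\<lambda>k. sqn M (\<lambda>x. F k x - Z x)" 0 r] by (auto simp: o_def)

lemma L2_tendsto_unique:
  fixes F :: "nat \<Rightarrow> 'a \<Rightarrow> 'b::euclidean_space"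
  assumes Z: "L2_tendsto M F Z" and Y: "L2_tendsto M F Y"
  shows "AE x in M. Z x = Y x"
proof -
  have [measurable]: "Z \<in> borel_measurable M" "Y \<in> borel_measurable M"
    using L2_tendsto_in_L2[OF Z] L2_tendsto_in_L2[OF Y] by (auto simp: in_L2_def)
  have "(\<lambda>k. sqn M (\<lambda>x. (F k x - F k x) - (Z x - Y x))) \<longlonglongrightarrow> 0"
    using L2_tendsto_diff[OF Z Y] by (simp add: L2_tendsto_iff_sqn)
  then have "sqn M (\<lambda>x. Z x - Y x) = 0"
    by (simp add: sqn_def norm_minus_commute LIMSEQ_const_iff)
  then show ?thesis by (subst (asm) sqn_eq_0_iff) auto
qed

lemma L2_tendsto_dominated:
  fixes F :: "nat \<Rightarrow> 'a \<Rightarrow> 'b::euclidean_space" and g :: "'a \<Rightarrow> real"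
  assumes [measurable]: "\<And>k. F k \<in> borel_measurable M" "Z \<in> borel_measurable M"
    and g: "in_L2 M g" and le: "\<And>k. AE x in M. norm (F k x) \<le> g x"
    and lim: "AE x in M. (\<lambda>k. F k x) \<longlonglongrightarrow> Z x"
  shows "L2_tendsto M F Z"
proof -
  have [measurable]: "g \<in> borel_measurable M" using g by (simp add: in_L2_def)
  have "AE x in M. \<forall>k. norm (F k x) \<le> g x" using le by (simp add: AE_all_countable)
  with lim have lez: "AE x in M. norm (Z x) \<le> g x \<and> (\<forall>k. norm (F k x) \<le> g x)"
    by eventually_elim (auto intro: LIMSEQ_le_const2 tendsto_norm)
  have F: "in_L2 M (F k)" for k
    by (rule in_L2_bound[OF g, where C=1]) (auto intro: eventually_mono[OF lez] order_trans[OF _ abs_ge_self])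
  have Z: "in_L2 M Z"
    by (rule in_L2_bound[OF g, where C=1]) (use lez in auto)
  \<comment> \<open>The limit inherits the bound \<open>g\<close>, so
    \<open>norm (F k x - Z x) <= 2 * g x\<close>; hence the dominating function
    \<open>4 * (g x)^2\<close>.\<close>
  have "(\<lambda>k. LINT x|M. (norm (F k x - Z x))\<^sup>2) \<longlonglongrightarrow> (LINT x|M. 0)"
  proof (rule integral_dominated_convergence[where w="\<lambda>x. 4 * (g x)\<^sup>2"])
    show "integrable M (\<lambda>x. 4 * (g x)\<^sup>2)" using g by (simp add: in_L2_def)
    show "AE x in M. (\<lambda>k. (norm (F k x - Z x))\<^sup>2) \<longlonglongrightarrow> 0"
      using lim
    proof eventually_elim
      fix x assume "(\<lambda>k. F k x) \<longlonglongrightarrow> Z x"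
      then have "(\<lambda>k. (norm (F k x - Z x))\<^sup>2) \<longlonglongrightarrow> (norm (Z x - Z x))\<^sup>2"
        by (intro tendsto_intros)
      then show "(\<lambda>k. (norm (F k x - Z x))\<^sup>2) \<longlonglongrightarrow> 0" by simp
    qed
    show "AE x in M. norm ((norm (F k x - Z x))\<^sup>2) \<le> 4 * (g x)\<^sup>2" for k
      using lez
    proof eventually_elim
      fix x assume "norm (Z x) \<le> g x \<and> (\<forall>k. norm (F k x) \<le> g x)"
      then have "norm (F k x - Z x) \<le> 2 * g x"
        using norm_triangle_ineq4[of "F k x" "Z x"] by (auto dest!: spec[of _ k])
      then have "(norm (F k x - Z x))\<^sup>2 \<le> (2 * g x)\<^sup>2" by (rule power_mono) simp
      then show "norm ((norm (F k x - Z x))\<^sup>2) \<le> 4 * (g x)\<^sup>2" by (simp add: power_mult_distrib)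
    qed
  qed auto
  then show ?thesis using F Z by (simp add: L2_tendsto_iff_integral)
qed

text \<open>Continuity of the pairing, by Cauchy-Schwarz on each term of
  \<open>F G - Z Y = (F - Z) (G - Y) + (F - Z) Y + Z (G - Y)\<close>. The pairing is bilinear
  without a conjugate, which is the form needed for \<open>b F F\<close>; for Hermitian pairings
  \<open>cnj\<close> is applied to one of the sequences.\<close>

lemma L2_tendsto_integral_mult:
  fixes F G :: "nat \<Rightarrow> 'a \<Rightarrow> 'b::{euclidean_space, real_normed_field}"
  assumes F: "L2_tendsto M F Z" and G: "L2_tendsto M G Y"
  shows "(\<lambda>k. LINT x|M. F k x * G k x) \<longlonglongrightarrow> (LINT x|M. Z x * Y x)"
proof -
  note L2 = L2_tendsto_in_L2[OF F] L2_tendsto_in_L2[OF G]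
  define a where "a k = sqrt (LINT x|M. (norm (F k x - Z x))\<^sup>2)" for k
  define b where "b k = sqrt (LINT x|M. (norm (G k x - Y x))\<^sup>2)" for k
  define z where "z = sqrt (LINT x|M. (norm (Z x))\<^sup>2)"
  define y where "y = sqrt (LINT x|M. (norm (Y x))\<^sup>2)"
  have ab: "a \<longlonglongrightarrow> 0" "b \<longlonglongrightarrow> 0"
    using F G tendsto_real_sqrt[of "\<lambda>k. LINT x|M. (norm (F k x - Z x))\<^sup>2" 0 sequentially]
      tendsto_real_sqrt[of "\<lambda>k. LINT x|M. (norm (G k x - Y x))\<^sup>2" 0 sequentially]
    unfolding L2_tendsto_iff_integral a_def b_def by simp_all
  have "(\<lambda>k. a k * b k + a k * y + z * b k) \<longlonglongrightarrow> 0 * 0 + 0 * y + z * 0"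
    by (intro tendsto_intros ab)
  then have lim: "(\<lambda>k. a k * b k + a k * y + z * b k) \<longlonglongrightarrow> 0" by simp
  have "norm ((LINT x|M. F k x * G k x) - (LINT x|M. Z x * Y x)) \<le> a k * b k + a k * y + z * b k" for k
  proof -
    note i = in_L2_mult(1)[OF in_L2_diff[OF L2(1)[of k] L2(2)] in_L2_diff[OF L2(3)[of k] L2(4)]]
      in_L2_mult(1)[OF in_L2_diff[OF L2(1)[of k] L2(2)] L2(4)]
      in_L2_mult(1)[OF L2(2) in_L2_diff[OF L2(3)[of k] L2(4)]]
    have "(LINT x|M. F k x * G k x) - (LINT x|M. Z x * Y x) = (LINT x|M. F k x * G k x - Z x * Y x)"
      by (intro Bochner_Integration.integral_diff[symmetric] in_L2_mult L2)
    also have "\<dots> = (LINT x|M. (F k x - Z x) * (G k x - Y x) + (F k x - Z x) * Y x + Z x * (G k x - Y x))"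
      by (simp add: algebra_simps)
    also have "\<dots> = (LINT x|M. (F k x - Z x) * (G k x - Y x)) + (LINT x|M. (F k x - Z x) * Y x)
        + (LINT x|M. Z x * (G k x - Y x))"
      using i by (simp add: Bochner_Integration.integral_add)
    finally have eq: "(LINT x|M. F k x * G k x) - (LINT x|M. Z x * Y x) = \<dots>" .
    note n = in_L2_mult(2)[OF in_L2_diff[OF L2(1)[of k] L2(2)] in_L2_diff[OF L2(3)[of k] L2(4)]]
        in_L2_mult(2)[OF in_L2_diff[OF L2(1)[of k] L2(2)] L2(4)]
        in_L2_mult(2)[OF L2(2) in_L2_diff[OF L2(3)[of k] L2(4)]]
    show ?thesis unfolding eq a_def b_def y_def z_def
      by (intro order_trans[OF norm_triangle_ineq] add_mono n)
  qed
  then have "(\<lambda>k. (LINT x|M. F k x * G k x) - (LINT x|M. Z x * Y x)) \<longlonglongrightarrow> 0"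
    by (intro Lim_null_comparison[OF _ lim]) auto
  then show ?thesis by (simp add: LIM_zero_iff)
qed

text \<open>The Riesz-Fischer argument: a fast Cauchy subsequence converges almost everywhere, and
  Fatou's lemma shows that its pointwise limit is the limit of the whole sequence in mean
  square.\<close>

lemma L2_complete:
  fixes F :: "nat \<Rightarrow> 'a \<Rightarrow> 'b::euclidean_space"
  assumes L2: "\<And>k. in_L2 M (F k)"
    and Cauchy: "\<And>e. e > 0 \<Longrightarrow> \<exists>N. \<forall>m\<ge>N. \<forall>n\<ge>N. sqn M (\<lambda>x. F m x - F n x) < ennreal e"
  shows "\<exists>Z. L2_tendsto M F Z"
proof -
  have [measurable]: "F k \<in> borel_measurable M" for k using L2 by (simp add: in_L2_def)
  have "\<forall>j. \<exists>N. \<forall>m\<ge>N. \<forall>n\<ge>N. sqn M (\<lambda>x. F m x - F n x) < ennreal ((1/4)^j)"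
    by (intro allI Cauchy) simp
  then obtain N where N: "\<And>j m n. m \<ge> N j \<Longrightarrow> n \<ge> N j \<Longrightarrow> sqn M (\<lambda>x. F m x - F n x) < ennreal ((1/4)^j)"
    by metis
  \<comment> \<open>Summing the thresholds gives both \<open>r j\<close> and
    \<open>r (Suc j)\<close> at least \<open>N j\<close>; the extra \<open>j\<close> makes the
    indices unbounded.\<close>
  define r where "r j = (\<Sum>i\<le>j. N i) + j" for j
  have r_ge: "N j \<le> r j" "j \<le> r j" for j
    unfolding r_def by (auto simp: lessThan_Suc_atMost[symmetric])
  have r_Suc: "N j \<le> r (Suc j)" for j
    using r_ge(1)[of j] unfolding r_def by simp
  define d where "d j x = F (r (Suc j)) x - F (r j) x" for j x
  have [measurable]: "d j \<in> borel_measurable M" for j unfolding d_def by measurable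
  have "(\<integral>\<^sup>+x. (\<Sum>j. ennreal (2^j * (norm (d j x))\<^sup>2)) \<partial>M) = (\<Sum>j. \<integral>\<^sup>+x. ennreal (2^j * (norm (d j x))\<^sup>2) \<partial>M)"
    by (rule nn_integral_suminf) measurable
  also have "\<dots> = (\<Sum>j. ennreal (2^j) * sqn M (d j))"
    unfolding sqn_def by (subst nn_integral_cmult[symmetric]) (auto simp: ennreal_mult)
  also have "\<dots> \<le> (\<Sum>j. ennreal ((1/2)^j))"
  proof (intro suminf_le allI)
    fix j
    have "ennreal (2^j) * sqn M (d j) \<le> ennreal (2^j) * ennreal ((1/4)^j)"
      using N[OF r_Suc r_ge(1), of j] unfolding d_def by (intro mult_left_mono) auto
    also have "\<dots> = ennreal ((1/2)^j)"
      by (subst ennreal_mult[symmetric]) (auto simp flip: power_mult_distrib)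
    finally show "ennreal (2^j) * sqn M (d j) \<le> ennreal ((1/2)^j)" .
  qed auto
  also have "\<dots> = ennreal (\<Sum>j. (1/2)^j)"
    by (intro suminf_ennreal2) (auto intro: summable_geometric)
  also have "\<dots> < \<infinity>" by simp
  finally have "AE x in M. (\<Sum>j. ennreal (2^j * (norm (d j x))\<^sup>2)) \<noteq> \<infinity>"
    by (intro nn_integral_PInf_AE) auto
  then have conv: "AE x in M. convergent (\<lambda>j. F (r j) x)"
  proof eventually_elim
    fix x assume *: "(\<Sum>j. ennreal (2^j * (norm (d j x))\<^sup>2)) \<noteq> \<infinity>"
    then have "summable (\<lambda>j. 2^j * (norm (d j x))\<^sup>2)"
      by (intro summable_suminf_not_top) auto
    moreover have "summable (\<lambda>j. (1/2::real)^j)" by (rule summable_geometric) simp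
    ultimately have s: "summable (\<lambda>j. (1/2)^j + 2^j * (norm (d j x))\<^sup>2)"
      by (intro summable_add)
    have "summable (\<lambda>j. d j x)"
    proof (rule summable_comparison_test'[OF s])
      fix j :: nat
      \<comment> \<open>The squares of the increments are controlled, but convergence needs summable
        norms. Expanding this square gives
        \<open>2 * norm (d j x) <= (1/2)^j + 2^j * (norm (d j x))^2\<close>; the weight
        \<open>2^j\<close> is affordable because the squared distances decay like
        \<open>(1/4)^j\<close>.\<close>
      have "0 \<le> (sqrt ((1/2)^j) - sqrt (2^j) * norm (d j x))\<^sup>2" by simp
      also have "\<dots> = (1/2)^j + 2^j * (norm (d j x))\<^sup>2 - 2 * (sqrt ((1/2)^j) * sqrt (2^j)) * norm (d j x)"
        by (simp add: power2_diff power_mult_distrib)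
      also have "sqrt ((1/2)^j) * sqrt (2^j) = 1"
        by (simp flip: real_sqrt_mult power_mult_distrib)
      finally show "norm (d j x) \<le> (1/2)^j + 2^j * (norm (d j x))\<^sup>2"
        using norm_ge_zero[of "d j x"] by linarith
    qed
    then have "convergent (\<lambda>n. (\<Sum>j<n. d j x) + F (r 0) x)"
      by (intro convergent_add) (auto simp: summable_iff_convergent convergent_const)
    moreover have "(\<Sum>j<n. d j x) = F (r n) x - F (r 0) x" for n
      unfolding d_def by (rule sum_lessThan_telescope)
    ultimately show "convergent (\<lambda>j. F (r j) x)" by simp
  qed
  define Z where "Z x = lim (\<lambda>j. F (r j) x)" for x
  have [measurable]: "Z \<in> borel_measurable M" unfolding Z_def by (rule borel_measurable_lim_metric) simp
  have lim: "AE x in M. (\<lambda>j. F (r j) x) \<longlonglongrightarrow> Z x"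
    using conv by eventually_elim (simp add: Z_def convergent_LIMSEQ_iff)
  have le: "sqn M (\<lambda>x. F n x - Z x) \<le> ennreal e"
    if e: "\<forall>m\<ge>K. \<forall>n\<ge>K. sqn M (\<lambda>x. F m x - F n x) < ennreal e" and n: "n \<ge> K" for e K n
  proof -
    \<comment> \<open>Fatou's lemma along the subsequence turns the Cauchy bound into a bound on the
      distance to the pointwise limit \<open>Z\<close>.\<close>
    have "sqn M (\<lambda>x. F n x - Z x) = (\<integral>\<^sup>+x. liminf (\<lambda>j. ennreal ((norm (F n x - F (r j) x))\<^sup>2)) \<partial>M)"
      unfolding sqn_def
    proof (rule nn_integral_cong_AE, use lim in eventually_elim)
      fix x assume "(\<lambda>j. F (r j) x) \<longlonglongrightarrow> Z x"
      then have "(\<lambda>j. ennreal ((norm (F n x - F (r j) x))\<^sup>2)) \<longlonglongrightarrow> ennreal ((norm (F n x - Z x))\<^sup>2)"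
        by (intro tendsto_intros tendsto_ennrealI)
      then show "ennreal ((norm (F n x - Z x))\<^sup>2) = liminf (\<lambda>j. ennreal ((norm (F n x - F (r j) x))\<^sup>2))"
        by (rule lim_imp_Liminf[OF sequentially_bot, symmetric])
    qed
    also have "\<dots> \<le> liminf (\<lambda>j. sqn M (\<lambda>x. F n x - F (r j) x))"
      unfolding sqn_def by (rule nn_integral_liminf) measurable
    also have "\<dots> \<le> limsup (\<lambda>j. sqn M (\<lambda>x. F n x - F (r j) x))"
      by (rule Liminf_le_Limsup) simp
    also have "\<dots> \<le> ennreal e"
    proof (rule Limsup_bounded)
      show "\<forall>\<^sub>F j in sequentially. sqn M (\<lambda>x. F n x - F (r j) x) \<le> ennreal e"
        using e n r_ge(2) by (intro eventually_sequentiallyI[of K]) (meson less_imp_le order_trans)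
    qed
    finally show ?thesis .
  qed
  have Z: "in_L2 M Z"
  proof -
    obtain K where "\<forall>m\<ge>K. \<forall>n\<ge>K. sqn M (\<lambda>x. F m x - F n x) < ennreal 1" using Cauchy[of 1] by auto
    from le[OF this order_refl] have "in_L2 M (\<lambda>x. F K x - Z x)"
      by (auto simp: in_L2_iff_sqn intro: le_less_trans)
    from in_L2_diff[OF L2[of K] this] show ?thesis by simp
  qed
  have "(\<lambda>k. sqn M (\<lambda>x. F k x - Z x)) \<longlonglongrightarrow> 0"
  proof (rule order_tendstoI)
    fix e :: ennreal assume "0 < e"
    then obtain e' :: real where e': "0 < e'" "ennreal e' < e"
    proof -
      obtain b where b: "0 < b" "b < e" using dense \<open>0 < e\<close> by blast
      then have "b = ennreal (enn2real b)" by (cases b) auto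
      with b show ?thesis using that[of "enn2real b"] by (metis ennreal_less_zero_iff)
    qed
    then obtain K where K: "\<forall>m\<ge>K. \<forall>n\<ge>K. sqn M (\<lambda>x. F m x - F n x) < ennreal e'" using Cauchy by blast
    show "\<forall>\<^sub>F k in sequentially. sqn M (\<lambda>x. F k x - Z x) < e"
      using le[OF K] e'(2) by (intro eventually_sequentiallyI[of K]) (auto intro: le_less_trans)
  qed simp
  then show ?thesis using L2 Z by (auto simp: L2_tendsto_iff_sqn)
qed

text \<open>Closure of the graph of an operator under simultaneous convergence of argument and
  value. Two measures occur because a gradient lives on the product of \<open>M\<close> with
  \<open>leb01\<close>. That the closure is again a graph, that is, closability, is not part of the
  notion.\<close>

definition graph_closure ::
    "'a measure \<Rightarrow> 'd measure \<Rightarrow> (('a \<Rightarrow> 'b::euclidean_space) \<times> ('d \<Rightarrow> 'c::euclidean_space)) set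
      \<Rightarrow> ('a \<Rightarrow> 'b) \<Rightarrow> ('d \<Rightarrow> 'c) \<Rightarrow> bool"
  where "graph_closure M N S Z U \<longleftrightarrow>
    (\<exists>F G. (\<forall>k. (F k, G k) \<in> S) \<and> L2_tendsto M F Z \<and> L2_tendsto N G U)"

lemma graph_closureI:
  "(\<And>k. (F k, G k) \<in> S) \<Longrightarrow> L2_tendsto M F Z \<Longrightarrow> L2_tendsto N G U \<Longrightarrow> graph_closure M N S Z U"
  unfolding graph_closure_def by blast

lemma graph_closureE:
  assumes "graph_closure M N S Z U"
  obtains F G where "\<And>k. (F k, G k) \<in> S" "L2_tendsto M F Z" "L2_tendsto N G U"
proof -
  have "\<exists>p. (\<forall>k. (fst p k, snd p k) \<in> S) \<and> L2_tendsto M (fst p) Z \<and> L2_tendsto N (snd p) U"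
    using assms unfolding graph_closure_def by simp
  then show thesis using that by blast
qed

lemma graph_closure_in_L2:
  "graph_closure M N S Z U \<Longrightarrow> in_L2 M Z" "graph_closure M N S Z U \<Longrightarrow> in_L2 N U"
  by (auto simp: graph_closure_def dest: L2_tendsto_in_L2)

lemma graph_closure_base: "(Z, U) \<in> S \<Longrightarrow> in_L2 M Z \<Longrightarrow> in_L2 N U \<Longrightarrow> graph_closure M N S Z U"
  unfolding graph_closure_def
  by (rule exI[of _ "\<lambda>_. Z"], rule exI[of _ "\<lambda>_. U"]) (auto intro: L2_tendsto_const)

lemma graph_closure_approx:
  assumes "graph_closure M N S Z U" "e > 0"
  shows "\<exists>F G. (F, G) \<in> S \<and> in_L2 M F \<and> in_L2 N G \<and>
    sqn M (\<lambda>x. F x - Z x) < e \<and> sqn N (\<lambda>x. G x - U x) < e"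
proof -
  obtain F G where FG: "\<And>k. (F k, G k) \<in> S" "L2_tendsto M F Z" "L2_tendsto N G U"
    using graph_closureE[OF assms(1)] by blast
  then have "\<forall>\<^sub>F k in sequentially. sqn M (\<lambda>x. F k x - Z x) < e"
    "\<forall>\<^sub>F k in sequentially. sqn N (\<lambda>x. G k x - U x) < e"
    using assms(2) by (auto simp: L2_tendsto_iff_sqn intro: order_tendstoD)
  then have "\<forall>\<^sub>F k in sequentially. sqn M (\<lambda>x. F k x - Z x) < e \<and> sqn N (\<lambda>x. G k x - U x) < e"
    by eventually_elim simp
  then obtain k where "sqn M (\<lambda>x. F k x - Z x) < e" "sqn N (\<lambda>x. G k x - U x) < e"
    using eventually_happens'[OF sequentially_bot] by blast
  then show ?thesis
    using FG(1) L2_tendsto_in_L2(1)[OF FG(2)] L2_tendsto_in_L2(1)[OF FG(3)] by blast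
qed

text \<open>Choosing approximants with error \<open>1 / (k + 1)\<close> in both components turns an
  approximation property into a sequence; this spares diagonal arguments.\<close>

lemma graph_closure_approxI:
  assumes "in_L2 M Z" "in_L2 N U"
    and "\<And>e. (e::real) > 0 \<Longrightarrow> \<exists>F G. (F, G) \<in> S \<and> in_L2 M F \<and> in_L2 N G \<and>
      sqn M (\<lambda>x. F x - Z x) < ennreal e \<and> sqn N (\<lambda>x. G x - U x) < ennreal e"
  shows "graph_closure M N S Z U"
proof -
  have "\<exists>p. p \<in> S \<and> in_L2 M (fst p) \<and> in_L2 N (snd p) \<and>
      sqn M (\<lambda>x. fst p x - Z x) < ennreal (1 / real (Suc k)) \<and>
      sqn N (\<lambda>x. snd p x - U x) < ennreal (1 / real (Suc k))" for k
    using assms(3)[of "1 / real (Suc k)"] by force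
  then obtain p where p: "\<And>k. p k \<in> S" "\<And>k. in_L2 M (fst (p k))" "\<And>k. in_L2 N (snd (p k))"
      "\<And>k. sqn M (\<lambda>x. fst (p k) x - Z x) < ennreal (1 / real (Suc k))"
      "\<And>k. sqn N (\<lambda>x. snd (p k) x - U x) < ennreal (1 / real (Suc k))"
    using choice[of "\<lambda>k p. p \<in> S \<and> in_L2 M (fst p) \<and> in_L2 N (snd p) \<and>
      sqn M (\<lambda>x. fst p x - Z x) < ennreal (1 / real (Suc k)) \<and>
      sqn N (\<lambda>x. snd p x - U x) < ennreal (1 / real (Suc k))"] by blast
  define F where "F k = fst (p k)" for k
  define G where "G k = snd (p k)" for k
  note FG = p[folded F_def G_def]
  have inS: "(F k, G k) \<in> S" for k using p(1) by (simp add: F_def G_def)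
  have lim: "(\<lambda>k. ennreal (1 / real (Suc k))) \<longlonglongrightarrow> 0"
    using tendsto_ennrealI[OF LIMSEQ_inverse_real_of_nat] by (simp add: inverse_eq_divide)
  have "(\<lambda>k. sqn M (\<lambda>x. F k x - Z x)) \<longlonglongrightarrow> 0" "(\<lambda>k. sqn N (\<lambda>x. G k x - U x)) \<longlonglongrightarrow> 0"
    by (rule ennreal_tendsto_0_le[OF lim], rule less_imp_le, rule FG)+
  then have "L2_tendsto M F Z" "L2_tendsto N G U"
    using FG assms(1,2) by (simp_all add: L2_tendsto_iff_sqn)
  with inS show ?thesis unfolding graph_closure_def by blast
qed

lemma graph_closure_closed:
  assumes cl: "\<And>k. graph_closure M N S (F k) (G k)"
    and F: "L2_tendsto M F Z" and G: "L2_tendsto N G U"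
  shows "graph_closure M N S Z U"
proof (rule graph_closure_approxI)
  show Z: "in_L2 M Z" and U: "in_L2 N U" using F G by (auto dest: L2_tendsto_in_L2)
  fix e :: real assume "e > 0"
  then have e: "ennreal (e / 4) > 0" "ennreal e = 2 * ennreal (e/4) + 2 * ennreal (e/4)"
    by (auto simp flip: ennreal_plus ennreal_numeral ennreal_mult)
  \<comment> \<open>The given sequence itself is treated as a graph, so that a single index
    \<open>k\<close> is obtained which is close in both components.\<close>
  have "graph_closure M N (range (\<lambda>k. (F k, G k))) Z U"
    by (rule graph_closureI[OF _ F G]) simp
  from graph_closure_approx[OF this e(1)]
  obtain k where k: "sqn M (\<lambda>x. F k x - Z x) < ennreal (e/4)" "sqn N (\<lambda>x. G k x - U x) < ennreal (e/4)"
    by auto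
  from graph_closure_approx[OF cl e(1), of k]
  obtain F' G' where F': "(F', G') \<in> S" "in_L2 M F'" "in_L2 N G'"
      "sqn M (\<lambda>x. F' x - F k x) < ennreal (e/4)" "sqn N (\<lambda>x. G' x - G k x) < ennreal (e/4)"
    by blast
  have "sqn M (\<lambda>x. F' x - Z x) \<le> 2 * sqn M (\<lambda>x. F' x - F k x) + 2 * sqn M (\<lambda>x. F k x - Z x)"
    using F' F Z L2_tendsto_in_L2(1)[OF F] by (intro sqn_triangle) (auto simp: in_L2_def)
  also have "\<dots> < 2 * ennreal (e/4) + 2 * ennreal (e/4)"
    using F' k by (intro add_strict_mono ennreal_mult_strict_left_mono) auto
  finally have 1: "sqn M (\<lambda>x. F' x - Z x) < ennreal e" using e(2) by simp
  have "sqn N (\<lambda>x. G' x - U x) \<le> 2 * sqn N (\<lambda>x. G' x - G k x) + 2 * sqn N (\<lambda>x. G k x - U x)"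
    using F' G U L2_tendsto_in_L2(1)[OF G] by (intro sqn_triangle) (auto simp: in_L2_def)
  also have "\<dots> < 2 * ennreal (e/4) + 2 * ennreal (e/4)"
    using F' k by (intro add_strict_mono ennreal_mult_strict_left_mono) auto
  finally have "sqn N (\<lambda>x. G' x - U x) < ennreal e" using e(2) by simp
  with 1 F' show "\<exists>F G. (F, G) \<in> S \<and> in_L2 M F \<and> in_L2 N G \<and>
      sqn M (\<lambda>x. F x - Z x) < ennreal e \<and> sqn N (\<lambda>x. G x - U x) < ennreal e" by blast
qed

text \<open>It suffices to approximate the elements of one graph by another; used in both directions
  it shows that the polynomial and the exponential graph have the same closure.\<close>

lemma graph_closure_mono:
  assumes "\<And>F G. (F, G) \<in> S \<Longrightarrow> graph_closure M N T F G" "graph_closure M N S Z U"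
  shows "graph_closure M N T Z U"
proof -
  obtain F G where "\<And>k. (F k, G k) \<in> S" "L2_tendsto M F Z" "L2_tendsto N G U"
    using graph_closureE[OF assms(2)] by blast
  then show ?thesis using graph_closure_closed[of M N T F G Z U, OF assms(1)] by blast
qed

lemma graph_closure_add:
  assumes "\<And>F G F' G'. (F, G) \<in> S \<Longrightarrow> (F', G') \<in> S \<Longrightarrow> (\<lambda>x. F x + F' x, \<lambda>x. G x + G' x) \<in> S"
    and "graph_closure M N S Z U" "graph_closure M N S Z' U'"
  shows "graph_closure M N S (\<lambda>x. Z x + Z' x) (\<lambda>x. U x + U' x)"
proof -
  obtain F G where 1: "\<And>k. (F k, G k) \<in> S" "L2_tendsto M F Z" "L2_tendsto N G U"
    using graph_closureE[OF assms(2)] by blast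
  obtain F' G' where 2: "\<And>k. (F' k, G' k) \<in> S" "L2_tendsto M F' Z'" "L2_tendsto N G' U'"
    using graph_closureE[OF assms(3)] by blast
  show ?thesis
    by (rule graph_closureI[OF assms(1)[OF 1(1) 2(1)] L2_tendsto_add[OF 1(2) 2(2)] L2_tendsto_add[OF 1(3) 2(3)]])
qed

lemma graph_closure_mult:
  fixes Z :: "'a \<Rightarrow> 'b::{euclidean_space, real_normed_field}" and U :: "'d \<Rightarrow> 'b"
  assumes "\<And>F G. (F, G) \<in> S \<Longrightarrow> (\<lambda>x. c * F x, \<lambda>x. c * G x) \<in> S"
    and "graph_closure M N S Z U"
  shows "graph_closure M N S (\<lambda>x. c * Z x) (\<lambda>x. c * U x)"
proof -
  obtain F G where 1: "\<And>k. (F k, G k) \<in> S" "L2_tendsto M F Z" "L2_tendsto N G U"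
    using graph_closureE[OF assms(2)] by blast
  show ?thesis
    by (rule graph_closureI[OF assms(1)[OF 1(1)] L2_tendsto_mult_left[OF 1(2)] L2_tendsto_mult_left[OF 1(3)]])
qed

lemma graph_closure_cong_AE:
  assumes "graph_closure M N S Z U"
    and "Y \<in> borel_measurable M" "V \<in> borel_measurable N" "AE x in M. Y x = Z x" "AE x in N. V x = U x"
  shows "graph_closure M N S Y V"
proof -
  obtain F G where 1: "\<And>k. (F k, G k) \<in> S" "L2_tendsto M F Z" "L2_tendsto N G U"
    using graph_closureE[OF assms(1)] by blast
  have "L2_tendsto M F Y" "L2_tendsto N G V"
    by (rule L2_tendsto_cong_AE[OF 1(2)] L2_tendsto_cong_AE[OF 1(3)];
        use assms L2_tendsto_in_L2(1)[OF 1(2)] L2_tendsto_in_L2(1)[OF 1(3)] in \<open>simp add: in_L2_def\<close>)+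
  with 1(1) show ?thesis by (rule graph_closureI)
qed

section \<open>Density of algebras of bounded functions\<close>

context
  fixes M :: "'a measure" and A :: "('a \<Rightarrow> real) set"
  assumes fin: "finite_measure M"
    and meas: "\<And>f. f \<in> A \<Longrightarrow> f \<in> borel_measurable M"
    and bdd: "\<And>f. f \<in> A \<Longrightarrow> \<exists>C. \<forall>x\<in>space M. \<bar>f x\<bar> \<le> C"
    and const: "\<And>c. (\<lambda>_. c) \<in> A"
    and add: "\<And>f g. f \<in> A \<Longrightarrow> g \<in> A \<Longrightarrow> (\<lambda>x. f x + g x) \<in> A"
    and mult: "\<And>f g. f \<in> A \<Longrightarrow> g \<in> A \<Longrightarrow> (\<lambda>x. f x * g x) \<in> A"
begin

lemma algebra_polynomial:
  fixes p :: "real \<Rightarrow> real"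
  assumes "real_polynomial_function p" "f \<in> A"
  shows "(\<lambda>x. p (f x)) \<in> A"
  using assms(1)
proof induction
  case (linear h)
  then obtain c where "h = (\<lambda>x. x * c)" by (auto simp: real_bounded_linear)
  then show ?case using mult[OF assms(2) const[of c]] by simp
qed (auto intro: const add mult)

text \<open>The algebra is closed under polynomials only; its uniform closure is closed under all
  continuous functions, in particular under the truncations that produce indicators.\<close>

definition unif_closure :: "('a \<Rightarrow> real) set"
  where "unif_closure = {g. \<forall>e>0. \<exists>p\<in>A. \<forall>x\<in>space M. \<bar>g x - p x\<bar> \<le> e}"

lemma unif_closureD: "g \<in> unif_closure \<Longrightarrow> e > 0 \<Longrightarrow> \<exists>p\<in>A. \<forall>x\<in>space M. \<bar>g x - p x\<bar> \<le> e"
  by (simp add: unif_closure_def)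

lemma algebra_le_unif_closure: "f \<in> A \<Longrightarrow> f \<in> unif_closure"
  unfolding unif_closure_def by (auto intro!: bexI[of _ f])

lemma unif_closure_bounded:
  assumes "g \<in> unif_closure" shows "\<exists>C\<ge>0. \<forall>x\<in>space M. \<bar>g x\<bar> \<le> C"
proof -
  obtain p where p: "p \<in> A" "\<forall>x\<in>space M. \<bar>g x - p x\<bar> \<le> 1" using unif_closureD[OF assms, of 1] by auto
  obtain C where C: "\<forall>x\<in>space M. \<bar>p x\<bar> \<le> C" using bdd[OF p(1)] by auto
  have "\<bar>g x\<bar> \<le> max 0 C + 1" if "x \<in> space M" for x
    using bspec[OF p(2) that] bspec[OF C that] by linarith
  then show ?thesis by (intro exI[of _ "max 0 C + 1"]) auto
qed

lemma unif_closure_measurable: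
  assumes "g \<in> unif_closure" shows "g \<in> borel_measurable M"
proof -
  have "\<exists>p. p \<in> A \<and> (\<forall>x\<in>space M. \<bar>g x - p x\<bar> \<le> inverse (real (Suc n)))" for n
    using unif_closureD[OF assms, of "inverse (real (Suc n))"] by auto
  then obtain p where p: "\<And>n. p n \<in> A" "\<And>n x. x \<in> space M \<Longrightarrow> \<bar>g x - p n x\<bar> \<le> inverse (real (Suc n))"
    using choice[of "\<lambda>n p. p \<in> A \<and> (\<forall>x\<in>space M. \<bar>g x - p x\<bar> \<le> inverse (real (Suc n)))"] by blast
  show ?thesis
  proof (rule borel_measurable_LIMSEQ_real[where u=p])
    show "p n \<in> borel_measurable M" for n using p(1) by (rule meas)
    fix x assume x: "x \<in> space M"
    have "(\<lambda>n. p n x - g x) \<longlonglongrightarrow> 0"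
      using p(2)[OF x] by (intro Lim_null_comparison[OF _ LIMSEQ_inverse_real_of_nat])
        (auto intro!: always_eventually simp: abs_minus_commute)
    then show "(\<lambda>n. p n x) \<longlonglongrightarrow> g x" by (simp add: LIM_zero_iff)
  qed
qed

lemma unif_closure_mult:
  assumes g: "g \<in> unif_closure" and h: "h \<in> unif_closure"
  shows "(\<lambda>x. g x * h x) \<in> unif_closure"
  unfolding unif_closure_def
proof (intro CollectI allI impI)
  fix e :: real assume e: "e > 0"
  obtain C where C: "C \<ge> 0" "\<forall>x\<in>space M. \<bar>g x\<bar> \<le> C" using unif_closure_bounded[OF g] by blast
  obtain q where q: "q \<in> A" "\<forall>x\<in>space M. \<bar>h x - q x\<bar> \<le> e / (2 * (C + 1))"
    using unif_closureD[OF h, of "e / (2 * (C + 1))"] e C(1) by auto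
  obtain D where D: "D \<ge> 0" "\<forall>x\<in>space M. \<bar>q x\<bar> \<le> D"
    using unif_closure_bounded[OF algebra_le_unif_closure[OF q(1)]] by blast
  obtain p where p: "p \<in> A" "\<forall>x\<in>space M. \<bar>g x - p x\<bar> \<le> e / (2 * (D + 1))"
    using unif_closureD[OF g, of "e / (2 * (D + 1))"] e D(1) by auto
  have "\<bar>g x * h x - p x * q x\<bar> \<le> e" if x: "x \<in> space M" for x
  proof -
    have "g x * h x - p x * q x = g x * (h x - q x) + (g x - p x) * q x" by (simp add: algebra_simps)
    then have "\<bar>g x * h x - p x * q x\<bar> \<le> \<bar>g x\<bar> * \<bar>h x - q x\<bar> + \<bar>g x - p x\<bar> * \<bar>q x\<bar>"
      by (metis abs_mult abs_triangle_ineq)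
    also have "\<dots> \<le> (C + 1) * (e / (2 * (C + 1))) + e / (2 * (D + 1)) * (D + 1)"
      using x C D p(2) q(2) e by (intro add_mono mult_mono) (auto intro: order_trans)
    also have "\<dots> = e / 2 + e / 2" using C(1) D(1) by (intro arg_cong2[where f="(+)"]) (simp_all add: field_simps)
    finally show ?thesis by simp
  qed
  then show "\<exists>p\<in>A. \<forall>x\<in>space M. \<bar>g x * h x - p x\<bar> \<le> e"
    using mult[OF p(1) q(1)] by (intro bexI[of _ "\<lambda>x. p x * q x"]) auto
qed

lemma unif_closure_compose:
  fixes \<phi> :: "real \<Rightarrow> real"
  assumes g: "g \<in> unif_closure" and \<phi>: "continuous_on UNIV \<phi>"
  shows "(\<lambda>x. \<phi> (g x)) \<in> unif_closure"
  unfolding unif_closure_def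
proof (intro CollectI allI impI)
  fix e :: real assume e: "e > 0"
  obtain C where C: "C \<ge> 0" "\<forall>x\<in>space M. \<bar>g x\<bar> \<le> C" using unif_closure_bounded[OF g] by blast
  \<comment> \<open>An approximant within 1 of \<open>g\<close> has values in this interval as well,
    so polynomial approximation and uniform continuity of \<open>\<phi>\<close> are available at
    both \<open>g x\<close> and \<open>p x\<close>.\<close>
  let ?S = "{-(C + 1)..C + 1}"
  have cont: "continuous_on ?S \<phi>" using \<phi> continuous_on_subset by blast
  obtain q where q: "real_polynomial_function q" "\<And>y. y \<in> ?S \<Longrightarrow> \<bar>\<phi> y - q y\<bar> < e / 2"
    using Stone_Weierstrass_real_polynomial_function[OF compact_Icc cont, of "e/2"] e by auto
  have "uniformly_continuous_on ?S \<phi>" using cont by (rule compact_uniformly_continuous) simp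
  then obtain d where d: "d > 0" "\<And>y z. y \<in> ?S \<Longrightarrow> z \<in> ?S \<Longrightarrow> dist z y < d \<Longrightarrow> dist (\<phi> z) (\<phi> y) < e / 2"
    unfolding uniformly_continuous_on_def using e by (meson half_gt_zero)
  obtain p where p: "p \<in> A" "\<forall>x\<in>space M. \<bar>g x - p x\<bar> \<le> min 1 (d / 2)"
    using unif_closureD[OF g, of "min 1 (d / 2)"] d(1) by auto
  have "\<bar>\<phi> (g x) - q (p x)\<bar> \<le> e" if x: "x \<in> space M" for x
  proof -
    have 1: "\<bar>g x - p x\<bar> \<le> 1" "\<bar>g x - p x\<bar> < d" "\<bar>g x\<bar> \<le> C" using bspec[OF p(2) x] bspec[OF C(2) x] d(1) by auto
    then have S: "g x \<in> ?S" "p x \<in> ?S" by auto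
    have "\<bar>\<phi> (g x) - \<phi> (p x)\<bar> < e / 2" using d(2)[OF S(2) S(1)] 1 by (simp add: dist_real_def)
    with q(2)[OF S(2)] show ?thesis by linarith
  qed
  then show "\<exists>p\<in>A. \<forall>x\<in>space M. \<bar>\<phi> (g x) - p x\<bar> \<le> e"
    using algebra_polynomial[OF q(1) p(1)] by (intro bexI[of _ "\<lambda>x. q (p x)"]) auto
qed

text \<open>The mean square closure of the set \<open>A\<close> is the closure of the diagonal graph
  over \<open>A\<close>, so the rules for graph closures apply to it.\<close>

abbreviation L2_closure :: "('a \<Rightarrow> real) \<Rightarrow> bool"
  where "L2_closure Z \<equiv> graph_closure M M {(f, f) |f. f \<in> A} Z Z"

lemma algebra_in_L2: "f \<in> unif_closure \<Longrightarrow> in_L2 M f"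
  using unif_closure_bounded[of f] unif_closure_measurable[of f]
  by (auto intro!: in_L2_bounded[OF fin] AE_I2)

lemma L2_closure_algebra: "f \<in> A \<Longrightarrow> L2_closure f"
  by (rule graph_closure_base) (auto intro: algebra_in_L2 algebra_le_unif_closure)

lemma L2_closure_add: "L2_closure f \<Longrightarrow> L2_closure g \<Longrightarrow> L2_closure (\<lambda>x. f x + g x)"
  by (rule graph_closure_add) (auto intro: add)

lemma L2_closure_mult_left: "L2_closure f \<Longrightarrow> L2_closure (\<lambda>x. c * f x)"
  by (rule graph_closure_mult) (auto intro: mult const)

lemma L2_closure_limit: "(\<And>k. L2_closure (F k)) \<Longrightarrow> L2_tendsto M F Z \<Longrightarrow> L2_closure Z"
  by (rule graph_closure_closed)

lemma L2_closure_unif_closure: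
  assumes "g \<in> unif_closure" shows "L2_closure g"
proof -
  interpret finite_measure M by (rule fin)
  have "\<exists>p. p \<in> A \<and> (\<forall>x\<in>space M. \<bar>g x - p x\<bar> \<le> inverse (real (Suc n)))" for n
    using unif_closureD[OF assms, of "inverse (real (Suc n))"] by auto
  then obtain p where p: "\<And>n. p n \<in> A" "\<And>n x. x \<in> space M \<Longrightarrow> \<bar>g x - p n x\<bar> \<le> inverse (real (Suc n))"
    using choice[of "\<lambda>n p. p \<in> A \<and> (\<forall>x\<in>space M. \<bar>g x - p x\<bar> \<le> inverse (real (Suc n)))"] by blast
  obtain C where C: "C \<ge> 0" "\<forall>x\<in>space M. \<bar>g x\<bar> \<le> C" using unif_closure_bounded[OF assms] by blast
  have "L2_tendsto M p g"
  proof (rule L2_tendsto_dominated[where g="\<lambda>_. C + 1"])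
    show "p n \<in> borel_measurable M" for n using p(1) by (rule meas)
    show "g \<in> borel_measurable M" using assms by (rule unif_closure_measurable)
    show "in_L2 M (\<lambda>_. C + 1)" by (simp add: in_L2_def)
    show "AE x in M. norm (p n x) \<le> C + 1" for n
    proof (rule AE_I2)
      fix x assume x: "x \<in> space M"
      have "inverse (real (Suc n)) \<le> 1" by (simp add: inverse_le_1_iff)
      then show "norm (p n x) \<le> C + 1"
        using p(2)[OF x, of n] bspec[OF C(2) x] unfolding real_norm_def by linarith
    qed
    show "AE x in M. (\<lambda>n. p n x) \<longlonglongrightarrow> g x"
    proof (rule AE_I2)
      fix x assume x: "x \<in> space M"
      have "(\<lambda>n. p n x - g x) \<longlonglongrightarrow> 0"
        using p(2)[OF x] by (intro Lim_null_comparison[OF _ LIMSEQ_inverse_real_of_nat])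
          (auto intro!: always_eventually simp: abs_minus_commute)
      then show "(\<lambda>n. p n x) \<longlonglongrightarrow> g x" by (simp add: LIM_zero_iff)
    qed
  qed
  then show ?thesis by (intro L2_closure_limit[OF L2_closure_algebra[OF p(1)]])
qed

text \<open>A \<open>\<pi>\<close>-system generating the \<open>\<sigma>\<close>-algebra; the indicator of \<open>{g > 0}\<close> is the limit of \<open>min 1 (k g)\<close>.\<close>

definition positivity_sets :: "'a set set"
  where "positivity_sets = {{x\<in>space M. g x > 0} |g. g \<in> unif_closure \<and> (\<forall>x\<in>space M. 0 \<le> g x)}"

text \<open>For nonnegative functions, \<open>g * h\<close> is positive exactly where both factors
  are; this is why nonnegativity is built into \<open>positivity_sets\<close>.\<close>

lemma Int_stable_positivity_sets: "Int_stable positivity_sets"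
proof (rule Int_stableI)
  fix a b assume "a \<in> positivity_sets" "b \<in> positivity_sets"
  then obtain g h where gh: "g \<in> unif_closure" "\<forall>x\<in>space M. 0 \<le> g x" "h \<in> unif_closure" "\<forall>x\<in>space M. 0 \<le> h x"
      "a = {x\<in>space M. g x > 0}" "b = {x\<in>space M. h x > 0}"
    by (auto simp: positivity_sets_def)
  then have "a \<inter> b = {x\<in>space M. g x * h x > 0}"
    by (auto simp: zero_less_mult_iff order.strict_iff_order)
  then show "a \<inter> b \<in> positivity_sets"
    unfolding positivity_sets_def using unif_closure_mult[OF gh(1,3)] gh(2,4) by force
qed

lemma L2_closure_positivity_set:
  assumes "a \<in> positivity_sets" shows "L2_closure (indicator a)"
proof -
  interpret finite_measure M by (rule fin)
  obtain g where g: "g \<in> unif_closure" "\<forall>x\<in>space M. 0 \<le> g x" and a: "a = {x\<in>space M. g x > 0}"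
    using assms by (auto simp: positivity_sets_def)
  have [measurable]: "g \<in> borel_measurable M" using g(1) by (rule unif_closure_measurable)
  have "L2_tendsto M (\<lambda>k x. min 1 (real k * g x)) (indicator a)"
  proof (rule L2_tendsto_dominated[where g="\<lambda>_. 1"])
    show "indicator a \<in> borel_measurable M" unfolding a by measurable
    show "in_L2 M (\<lambda>_. 1::real)" by (simp add: in_L2_def)
    show "AE x in M. norm (min 1 (real k * g x)) \<le> 1" for k using g(2) by (intro AE_I2) auto
    show "AE x in M. (\<lambda>k. min 1 (real k * g x)) \<longlonglongrightarrow> indicator a x"
    proof (rule AE_I2)
      fix x assume x: "x \<in> space M"
      show "(\<lambda>k. min 1 (real k * g x)) \<longlonglongrightarrow> indicator a x"
      proof (cases "g x > 0")
        case True
        obtain n where n: "1 < real n * g x" using reals_Archimedean3[OF True] by blast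
        have "min 1 (real k * g x) = indicator a x" if "k \<ge> n" for k
        proof -
          have "real n * g x \<le> real k * g x" using that True by (intro mult_right_mono) auto
          then have "1 \<le> real k * g x" using n by linarith
          with x True show ?thesis by (simp add: a)
        qed
        then show ?thesis by (intro tendsto_eventually) (auto simp: eventually_sequentially)
      next
        case False
        then show ?thesis using g(2) x by (auto simp: a)
      qed
    qed
  qed measurable
  moreover have "(\<lambda>x. min 1 (real k * g x)) \<in> unif_closure" for k
    using unif_closure_compose[OF g(1), of "\<lambda>y. min 1 (real k * y)"]
    by (simp add: continuous_intros)
  ultimately show ?thesis by (intro L2_closure_limit[OF L2_closure_unif_closure])
qed

lemma positivity_sets_subset: "positivity_sets \<subseteq> sets M"
  using unif_closure_measurable by (auto simp: positivity_sets_def)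

lemma positivity_sets_Pow: "positivity_sets \<subseteq> Pow (space M)"
  using positivity_sets_subset sets.sets_into_space by blast

text \<open>Dynkin's \<pi>-\<lambda> theorem: the sets whose indicator lies in the closure are
  stable under complements and, by dominated convergence, under countable disjoint unions.\<close>

lemma L2_closure_sigma_sets:
  assumes "a \<in> sigma_sets (space M) positivity_sets" shows "L2_closure (indicator a)"
  using Int_stable_positivity_sets positivity_sets_Pow assms
proof (induction rule: sigma_sets_induct_disjoint)
  case (basic a) then show ?case by (rule L2_closure_positivity_set)
next
  case empty
  then show ?case using L2_closure_algebra[OF const[of 0]] by simp
next
  case (compl a)
  have a: "a \<in> sets M" using compl(1) positivity_sets_subset sets.sigma_sets_subset by blast
  have "L2_closure (\<lambda>x. 1 + (-1) * indicator a x)"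
    by (intro L2_closure_add L2_closure_mult_left compl L2_closure_algebra const)
  then show ?case
    by (rule graph_closure_cong_AE) (use a in \<open>auto simp: indicator_def\<close>)
next
  case (union a)
  interpret finite_measure M by (rule fin)
  have a: "a i \<in> sets M" for i using union(2) positivity_sets_subset sets.sigma_sets_subset by blast
  have cl: "L2_closure (\<lambda>x. \<Sum>i<n. indicator (a i) x)" for n
  proof (induction n)
    case 0
    then show ?case using L2_closure_algebra[OF const[of 0]] by simp
  next
    case (Suc n)
    then show ?case using L2_closure_add[OF Suc union(3)[of n]] by simp
  qed
  have eq: "(\<Sum>i<n. indicator (a i) x) = (indicator (\<Union>i<n. a i) x :: real)" for n x
    using union(1) by (intro indicator_UN_disjoint[symmetric]) (auto simp: disjoint_family_on_def)
  have "L2_tendsto M (\<lambda>n x. indicator (\<Union>i<n. a i) x :: real) (indicator (\<Union>i. a i))"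
  proof (rule L2_tendsto_dominated[where g="\<lambda>_. 1"])
    show "in_L2 M (\<lambda>_. 1::real)" by (simp add: in_L2_def)
    show "AE x in M. (\<lambda>n. indicator (\<Union>i<n. a i) x :: real) \<longlonglongrightarrow> indicator (\<Union>i. a i) x"
      by (intro AE_I2 LIMSEQ_indicator_UN)
    show "AE x in M. norm (indicator (\<Union>i<n. a i) x :: real) \<le> 1" for n
      by (auto simp: indicator_def)
  qed (use a in \<open>auto intro!: borel_measurable_indicator\<close>)
  then show ?case by (rule L2_closure_limit[rotated]) (use cl in \<open>simp add: eq\<close>)
qed

text \<open>The hypothesis \<open>gen\<close> says that \<open>A\<close> generates the
  \<sigma>-algebra of \<open>M\<close>. It is phrased with an arbitrary measure \<open>N\<close> on
  the same space, so that verifying it is a measurability proof.\<close>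

lemma L2_closure_all:
  assumes gen: "\<And>N. space N = space M \<Longrightarrow> A \<subseteq> borel_measurable N \<Longrightarrow> sets M \<subseteq> sets N"
    and g: "in_L2 M g"
  shows "L2_closure g"
proof -
  interpret finite_measure M by (rule fin)
  have [measurable]: "g \<in> borel_measurable M" using g by (simp add: in_L2_def)
  define N where "N = sigma (space M) positivity_sets"
  have sub: "positivity_sets \<subseteq> Pow (space M)" using positivity_sets_subset sets.sets_into_space by blast
  have N: "space N = space M" "sets N = sigma_sets (space M) positivity_sets"
    using sub by (auto simp: N_def space_measure_of sets_measure_of)
  have "A \<subseteq> borel_measurable N"
  proof
    fix f assume f: "f \<in> A"
    show "f \<in> borel_measurable N"
      unfolding borel_measurable_iff_greater
    proof
      fix c
      \<comment> \<open>The shifted positive part \<open>max 0 (f - c)\<close> exhibits the level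
        set of \<open>f\<close> as a set of positivity of a nonnegative member of
        \<open>unif_closure\<close>.\<close>
      have "{x \<in> space N. c < f x} = {x \<in> space M. max 0 (f x - c) > 0}" by (auto simp: N)
      also have "\<dots> \<in> positivity_sets"
        unfolding positivity_sets_def
      proof (intro CollectI exI conjI refl ballI)
        have "continuous_on UNIV (\<lambda>y::real. max 0 (y - c))" by (intro continuous_intros)
        then show "(\<lambda>x. max 0 (f x - c)) \<in> unif_closure"
          by (rule unif_closure_compose[OF algebra_le_unif_closure[OF f]])
      qed simp_all
      finally show "{w \<in> space N. c < f w} \<in> sets N" unfolding N by (rule sigma_sets.Basic)
    qed
  qed
  then have ind: "L2_closure (indicator a)" if "a \<in> sets M" for a
    using gen[OF N(1)] N(2) that by (auto intro: L2_closure_sigma_sets)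
  obtain F where F: "\<And>i. simple_function M (F i)" "\<And>x. x \<in> space M \<Longrightarrow> (\<lambda>i. F i x) \<longlonglongrightarrow> g x"
      "\<And>i x. x \<in> space M \<Longrightarrow> dist (F i x) 0 \<le> 2 * dist (g x) 0"
    using borel_measurable_implies_sequence_metric[OF \<open>g \<in> borel_measurable M\<close>, of 0] by blast
  have [measurable]: "F i \<in> borel_measurable M" for i using F(1) by (rule borel_measurable_simple_function)
  have "L2_closure (F i)" for i
  proof -
    have "finite (F i ` space M)" using F(1) by (simp add: simple_function_def)
    moreover have cl: "finite T \<Longrightarrow> L2_closure (\<lambda>x. \<Sum>y\<in>T. y * indicator (F i -` {y} \<inter> space M) x)" for T
    proof (induction rule: finite_induct)
      case empty then show ?case using L2_closure_algebra[OF const[of 0]] by simp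
    next
      case (insert y T)
      have "L2_closure (\<lambda>x. y * indicator (F i -` {y} \<inter> space M) x + (\<Sum>y\<in>T. y * indicator (F i -` {y} \<inter> space M) x))"
        by (intro L2_closure_add L2_closure_mult_left insert ind) measurable
      then show ?case unfolding sum.insert[OF insert(1,2)] .
    qed
    ultimately have "L2_closure (\<lambda>x. \<Sum>y\<in>F i ` space M. y * indicator (F i -` {y} \<inter> space M) x)" by blast
    then show ?thesis
    proof (rule graph_closure_cong_AE)
      show "AE x in M. F i x = (\<Sum>y\<in>F i ` space M. y * indicator (F i -` {y} \<inter> space M) x)"
      proof (rule AE_I2)
        fix x assume x: "x \<in> space M"
        have "(\<Sum>y\<in>F i ` space M. y * indicator (F i -` {y} \<inter> space M) x) = (\<Sum>y\<in>F i ` space M. if y = F i x then y else 0)"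
          using x by (intro sum.cong) (auto simp: indicator_def)
        also have "\<dots> = F i x" using x \<open>finite (F i ` space M)\<close> by (subst sum.delta) auto
        finally show "F i x = (\<Sum>y\<in>F i ` space M. y * indicator (F i -` {y} \<inter> space M) x)" ..
      qed
      then show "AE x in M. F i x = (\<Sum>y\<in>F i ` space M. y * indicator (F i -` {y} \<inter> space M) x)" .
    qed measurable
  qed
  moreover have "L2_tendsto M F g"
    by (rule L2_tendsto_dominated[where g="\<lambda>x. 2 * \<bar>g x\<bar>"])
      (use F(2,3) in_L2_scaleR[OF in_L2_norm[OF g], of 2] in \<open>auto simp: dist_real_def intro!: AE_I2\<close>)
  ultimately show ?thesis by (rule L2_closure_limit)
qed

lemma L2_dense_algebra:
  assumes "\<And>N. space N = space M \<Longrightarrow> A \<subseteq> borel_measurable N \<Longrightarrow> sets M \<subseteq> sets N"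
    and "in_L2 M g"
  shows "\<exists>F. (\<forall>k. F k \<in> A) \<and> L2_tendsto M F g"
  using L2_closure_all[OF assms] by (rule graph_closureE) auto

end

section \<open>Step functions\<close>

definition valid_steps :: "('b::euclidean_space \<times> real \<times> real) list \<Rightarrow> bool"
  where "valid_steps ps \<longleftrightarrow> (\<forall>(c, a, b)\<in>set ps. 0 \<le> a \<and> a \<le> b \<and> b \<le> 1)"

lemma valid_steps_simps [simp]:
  "valid_steps []" "valid_steps ((c, a, b) # ps) \<longleftrightarrow> 0 \<le> a \<and> a \<le> b \<and> b \<le> 1 \<and> valid_steps ps"
  "valid_steps (ps @ qs) \<longleftrightarrow> valid_steps ps \<and> valid_steps qs"
  by (simp_all add: valid_steps_def ball_Un)

lemma step_fun_simps [simp]: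
  "step_fun [] s = 0" "step_fun ((c, a, b) # ps) s = indicator {a<..b} s *\<^sub>R c + step_fun ps s"
  "step_fun (ps @ qs) s = step_fun ps s + step_fun qs s"
  by (auto simp: step_fun_def)

lemma step_integral_simps [simp]:
  "step_integral Y [] \<omega> = 0"
  "step_integral Y ((c, a, b) # ps) \<omega> = (Y b \<omega> - Y a \<omega>) *\<^sub>R c + step_integral Y ps \<omega>"
  "step_integral Y (ps @ qs) \<omega> = step_integral Y ps \<omega> + step_integral Y qs \<omega>"
  by (auto simp: step_integral_def)

text \<open>Applying a linear map to the coefficients commutes with \<open>step_fun\<close> and with
  \<open>step_integral\<close>. Negation of coefficients gives differences of step functions, and
  inner products with basis vectors reduce vector-valued integrals to real ones.\<close>

definition map_steps :: "('b \<Rightarrow> 'c) \<Rightarrow> ('b \<times> real \<times> real) list \<Rightarrow> ('c \<times> real \<times> real) list"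
  where "map_steps g = map (\<lambda>(c, a, b). (g c, a, b))"

lemma valid_map_steps [simp]: "valid_steps (map_steps g ps) \<longleftrightarrow> valid_steps ps"
  by (auto simp: valid_steps_def map_steps_def)

lemma linear_step_fun: "linear g \<Longrightarrow> step_fun (map_steps g ps) s = g (step_fun ps s)"
  by (induction ps) (auto simp: map_steps_def linear_0 linear_add linear_scale)

lemma linear_step_integral: "linear g \<Longrightarrow> step_integral Y (map_steps g ps) \<omega> = g (step_integral Y ps \<omega>)"
  by (induction ps) (auto simp: map_steps_def linear_0 linear_add linear_scale)

lemma step_fun_measurable [measurable]: "step_fun ps \<in> borel_measurable borel"
proof (induction ps)
  case Nil
  then show ?case by (simp add: step_fun_def)
next
  case (Cons p ps)
  obtain c a b where "p = (c, a, b)" by (cases p) auto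
  then have "step_fun (p # ps) = (\<lambda>s. indicator {a<..b} s *\<^sub>R c + step_fun ps s)" by (auto simp: fun_eq_iff)
  then show ?case using Cons by simp
qed

lemma step_fun_bounded: "\<exists>C. \<forall>s. norm (step_fun ps s) \<le> C"
proof (induction ps)
  case Nil then show ?case by auto
next
  case (Cons p ps)
  obtain c a b where p: "p = (c, a, b)" by (cases p) auto
  from Cons obtain C where C: "\<forall>s. norm (step_fun ps s) \<le> C" by blast
  have "norm (step_fun (p # ps) s) \<le> norm c + C" for s
    unfolding p step_fun_simps
    by (rule order_trans[OF norm_triangle_ineq add_mono]) (use C in \<open>auto simp: indicator_def\<close>)
  then show ?case by blast
qed

lemma finite_measure_leb01: "finite_measure leb01"
  by (rule finite_measureI) (simp add: space_restrict_space emeasure_restrict_space)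

lemma borel_measurable_leb01: "f \<in> borel_measurable borel \<Longrightarrow> f \<in> borel_measurable leb01"
  by (intro measurable_restrict_space1 borel_measurable_if_lebesgue_on | simp add: measurable_completion)+

lemma step_fun_leb01 [measurable]: "step_fun ps \<in> borel_measurable leb01"
  by (rule borel_measurable_leb01) measurable

lemma in_L2_step_fun: "in_L2 leb01 (step_fun ps)"
  using step_fun_bounded[of ps] by (auto intro!: in_L2_bounded[OF finite_measure_leb01])

lemma AE_leb01_greater: "AE s in leb01. 0 < s"
proof -
  have "AE s in lborel. s \<noteq> (0::real)" by (rule AE_lborel_singleton)
  then have "AE s in lebesgue. s \<noteq> (0::real)" by (rule AE_completion)
  then have "AE s in lebesgue. s \<in> {0..1} \<longrightarrow> 0 < (s::real)" by (rule eventually_mono) auto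
  then show ?thesis by (subst AE_restrict_space_iff) auto
qed

text \<open>Density is proved by a generation argument, and step functions generate the Borel sets
  of \<open>(0,1]\<close> but not the completed \<sigma>-algebra of \<open>leb01\<close>. The result
  is carried over by \<open>sqn_leb01_eq\<close>, the point 0 being a null set.\<close>

abbreviation bor01 :: "real measure"
  where "bor01 \<equiv> restrict_space lborel {0<..1}"

lemma sqn_leb01_eq:
  fixes F :: "real \<Rightarrow> 'b::euclidean_space"
  assumes [measurable]: "F \<in> borel_measurable borel"
  shows "sqn leb01 F = sqn bor01 F"
proof -
  have "sqn leb01 F = (\<integral>\<^sup>+s. ennreal ((norm (F s))\<^sup>2) * indicator {0..1} s \<partial>lebesgue)"
    unfolding sqn_def by (subst nn_integral_restrict_space) auto
  also have "\<dots> = (\<integral>\<^sup>+s. ennreal ((norm (F s))\<^sup>2) * indicator {0..1} s \<partial>lborel)"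
    by (rule nn_integral_completion)
  also have "\<dots> = (\<integral>\<^sup>+s. ennreal ((norm (F s))\<^sup>2) * indicator {0<..1} s \<partial>lborel)"
  proof (rule nn_integral_cong_AE, use AE_lborel_singleton[of 0] in eventually_elim)
    fix s :: real assume "s \<noteq> 0"
    then show "ennreal ((norm (F s))\<^sup>2) * indicator {0..1} s = ennreal ((norm (F s))\<^sup>2) * indicator {0<..1} s"
      by (auto simp: indicator_def)
  qed
  also have "\<dots> = sqn bor01 F"
    unfolding sqn_def by (subst nn_integral_restrict_space) auto
  finally show ?thesis .
qed

text \<open>The intervals of a step function never contain 0, so constants are step functions on \<open>(0,1]\<close> only.\<close>

definition step_algebra :: "(real \<Rightarrow> real) set"
  where "step_algebra = {f. \<exists>ps. valid_steps ps \<and> (\<forall>s\<in>{0<..1}. f s = step_fun ps s)}"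

lemma step_algebra_step_fun: "valid_steps ps \<Longrightarrow> step_fun ps \<in> step_algebra"
  by (auto simp: step_algebra_def)

lemma step_algebra_const: "(\<lambda>_. c) \<in> step_algebra"
  unfolding step_algebra_def by (intro CollectI exI[of _ "[(c, 0, 1)]"]) auto

lemma step_algebra_zero: "(\<lambda>_. 0) \<in> step_algebra"
  by (rule step_algebra_const)

lemma step_algebra_add: "f \<in> step_algebra \<Longrightarrow> g \<in> step_algebra \<Longrightarrow> (\<lambda>s. f s + g s) \<in> step_algebra"
proof -
  assume "f \<in> step_algebra" "g \<in> step_algebra"
  then obtain ps qs where "valid_steps ps" "valid_steps qs"
      "\<And>s. s \<in> {0<..1} \<Longrightarrow> f s = step_fun ps s" "\<And>s. s \<in> {0<..1} \<Longrightarrow> g s = step_fun qs s"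
    by (auto simp: step_algebra_def)
  then show ?thesis unfolding step_algebra_def by (intro CollectI exI[of _ "ps @ qs"]) auto
qed

lemma step_fun_mult_in: "valid_steps ps \<Longrightarrow> valid_steps qs \<Longrightarrow> (\<lambda>s. step_fun ps s * step_fun qs s) \<in> step_algebra"
proof (induction ps)
  case Nil
  then show ?case by (simp add: step_algebra_zero)
next
  case (Cons p ps)
  obtain c a b where p: "p = (c, a, b)" by (cases p) auto
  have ab: "0 \<le> a" "a \<le> b" "b \<le> 1" "valid_steps ps" using Cons(2) by (auto simp: p)
  have "(\<lambda>s. indicator {a<..b} s * c * step_fun qs s) \<in> step_algebra"
    using \<open>valid_steps qs\<close>
  proof (induction qs)
    case Nil
    then show ?case by (simp add: step_algebra_zero)
  next
    case (Cons q qs)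
    obtain d x y where q: "q = (d, x, y)" by (cases q) auto
    \<comment> \<open>The two intervals meet in \<open>(max a x, min b y]\<close>; the outer
      \<open>max\<close> in \<open>?r\<close> keeps the right end from falling below the left end
      when they are disjoint, in which case the step is empty.\<close>
    let ?l = "max a x" and ?r = "max (max a x) (min b y)"
    have v: "valid_steps [(c * d, ?l, ?r)]" using Cons(2) ab by (auto simp: q)
    have "(\<lambda>s. step_fun [(c * d, ?l, ?r)] s + indicator {a<..b} s * c * step_fun qs s) \<in> step_algebra"
      using Cons by (intro step_algebra_add step_algebra_step_fun v Cons(1)) (auto simp: q)
    also have "(\<lambda>s. step_fun [(c * d, ?l, ?r)] s + indicator {a<..b} s * c * step_fun qs s)
        = (\<lambda>s. indicator {a<..b} s * c * step_fun (q # qs) s)"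
      by (auto simp: q fun_eq_iff indicator_def algebra_simps max_def min_def)
    finally show ?case .
  qed
  from step_algebra_add[OF this Cons(1)[OF ab(4) Cons(3)]]
  show ?case by (simp add: p algebra_simps)
qed

lemma step_algebra_mult: "f \<in> step_algebra \<Longrightarrow> g \<in> step_algebra \<Longrightarrow> (\<lambda>s. f s * g s) \<in> step_algebra"
proof -
  assume "f \<in> step_algebra" "g \<in> step_algebra"
  then obtain ps qs where *: "valid_steps ps" "valid_steps qs"
      "\<And>s. s \<in> {0<..1} \<Longrightarrow> f s = step_fun ps s" "\<And>s. s \<in> {0<..1} \<Longrightarrow> g s = step_fun qs s"
    by (auto simp: step_algebra_def)
  obtain rs where "valid_steps rs" "\<And>s. s \<in> {0<..1} \<Longrightarrow> step_fun ps s * step_fun qs s = step_fun rs s"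
    using step_fun_mult_in[OF *(1,2)] by (auto simp: step_algebra_def)
  then show ?thesis unfolding step_algebra_def using * by (intro CollectI exI[of _ rs]) auto
qed

text \<open>The indicator of \<open>(0,c]\<close> is a step function, so any such \<open>N\<close>
  makes the half-lines, hence the identity map, measurable.\<close>

lemma step_algebra_generates:
  assumes N: "space N = space bor01" and A: "step_algebra \<subseteq> borel_measurable N"
  shows "sets bor01 \<subseteq> sets N"
proof -
  have sp: "space N = {0<..1}" using N by (simp add: space_restrict_space)
  have "(\<lambda>x. x) \<in> borel_measurable N"
    unfolding borel_measurable_iff_le
  proof
    fix c :: real
    consider "c < 0" | "0 \<le> c" "c \<le> 1" | "1 < c" by linarith
    then show "{w \<in> space N. w \<le> c} \<in> sets N"
    proof cases
      case 1
      then have "{w \<in> space N. w \<le> c} = {}" by (auto simp: sp)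
      then show ?thesis by (metis sets.empty_sets)
    next
      case 2
      then have "step_fun [(1::real, 0, c)] \<in> borel_measurable N"
        using A step_algebra_step_fun[of "[(1, 0, c)]"] by auto
      then have "{w \<in> space N. step_fun [(1::real, 0, c)] w \<ge> 1} \<in> sets N" by measurable
      also have "{w \<in> space N. step_fun [(1::real, 0, c)] w \<ge> 1} = {w \<in> space N. w \<le> c}"
        by (auto simp: sp indicator_def split: if_splits)
      finally show ?thesis .
    next
      case 3
      then have "{w \<in> space N. w \<le> c} = space N" by (auto simp: sp)
      then show ?thesis by simp
    qed
  qed
  then have "(\<lambda>x. x) -` B \<inter> space N \<in> sets N" if "B \<in> sets borel" for B :: "real set"
    using that by (rule measurable_sets)
  then show ?thesis by (auto simp: sets_restrict_space sp Int_commute)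
qed

lemma step_fun_dense:
  fixes \<xi> :: "real \<Rightarrow> real"
  assumes \<xi>: "in_L2 leb01 \<xi>"
  shows "\<exists>ps. (\<forall>k. valid_steps (ps k)) \<and> L2_tendsto leb01 (\<lambda>k. step_fun (ps k)) \<xi>"
proof -
  have [measurable]: "\<xi> \<in> borel_measurable leb01" using \<xi> by (simp add: in_L2_def)
  \<comment> \<open>Extended by zero, \<xi> is Lebesgue measurable on the line and agrees almost
    everywhere with a Borel function \<open>g\<close>, to which the density theorem on
    \<open>bor01\<close> applies.\<close>
  have "(\<lambda>x. if x \<in> {0..1} then \<xi> x else 0) \<in> borel_measurable (completion lborel)"
    by (rule borel_measurable_if_I) auto
  from completion_ex_borel_measurable_real[OF this]
  obtain g where g: "g \<in> borel_measurable lborel" "AE x in lborel. (if x \<in> {0..1} then \<xi> x else 0) = g x"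
    by blast
  have [measurable]: "g \<in> borel_measurable borel" using g(1) by simp
  have "AE x in lebesgue. (if x \<in> {0..1} then \<xi> x else 0) = g x" using g(2) by (rule AE_completion)
  then have "AE x in lebesgue. x \<in> {0..1} \<longrightarrow> \<xi> x = g x" by (rule eventually_mono) auto
  then have AEg: "AE x in leb01. \<xi> x = g x" by (subst AE_restrict_space_iff) auto
  then have "sqn leb01 g = sqn leb01 \<xi>" by (intro sqn_cong_AE) (auto elim: eventually_mono)
  then have g2: "in_L2 bor01 g"
    using \<xi> by (simp add: in_L2_iff_sqn sqn_leb01_eq measurable_restrict_space1)
  have "\<exists>F. (\<forall>k. F k \<in> step_algebra) \<and> L2_tendsto bor01 F g"
  proof (rule L2_dense_algebra)
    show "finite_measure bor01"
      by (rule finite_measureI) (simp add: space_restrict_space emeasure_restrict_space)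
    fix f h c
    assume f: "f \<in> step_algebra"
    then obtain ps where ps: "\<And>s. s \<in> {0<..1} \<Longrightarrow> f s = step_fun ps s" by (auto simp: step_algebra_def)
    have "step_fun ps \<in> borel_measurable bor01" by (intro measurable_restrict_space1) auto
    then show "f \<in> borel_measurable bor01"
      by (subst measurable_cong[where g="step_fun ps"]) (auto simp: space_restrict_space ps)
    show "\<exists>C. \<forall>x\<in>space bor01. \<bar>f x\<bar> \<le> C"
      using step_fun_bounded[of ps] ps by (auto simp: space_restrict_space)
    show "(\<lambda>x. f x + h x) \<in> step_algebra" "(\<lambda>x. f x * h x) \<in> step_algebra" if "h \<in> step_algebra"
      using f that by (auto intro: step_algebra_add step_algebra_mult)
  qed (use g2 step_algebra_generates step_algebra_const in auto)
  then obtain F where F: "\<And>k. F k \<in> step_algebra" "L2_tendsto bor01 F g" by blast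
  have "\<exists>ps. valid_steps ps \<and> (\<forall>s\<in>{0<..1}. F k s = step_fun ps s)" for k
    using F(1)[of k] by (auto simp: step_algebra_def)
  then obtain ps where ps: "\<And>k. valid_steps (ps k)" "\<And>k s. s \<in> {0<..1} \<Longrightarrow> F k s = step_fun (ps k) s"
    using choice[of "\<lambda>k ps. valid_steps ps \<and> (\<forall>s\<in>{0<..1}. F k s = step_fun ps s)"] by blast
  have "sqn bor01 (\<lambda>s. F k s - g s) = sqn leb01 (\<lambda>s. step_fun (ps k) s - \<xi> s)" for k
  proof -
    have "sqn bor01 (\<lambda>s. F k s - g s) = sqn bor01 (\<lambda>s. step_fun (ps k) s - g s)"
      by (rule sqn_cong_AE) (auto simp: space_restrict_space ps(2) intro!: AE_I2)
    also have "\<dots> = sqn leb01 (\<lambda>s. step_fun (ps k) s - g s)" by (rule sqn_leb01_eq[symmetric]) measurable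
    also have "\<dots> = sqn leb01 (\<lambda>s. step_fun (ps k) s - \<xi> s)"
      by (rule sqn_cong_AE) (use AEg in \<open>auto elim: eventually_mono\<close>)
    finally show ?thesis .
  qed
  then have "L2_tendsto leb01 (\<lambda>k. step_fun (ps k)) \<xi>"
    using F(2) \<xi> by (simp add: L2_tendsto_iff_sqn in_L2_step_fun)
  with ps(1) show ?thesis by blast
qed


section \<open>Rapidly oscillating periodic functions\<close>

context
  fixes \<phi> :: "real \<Rightarrow> real" and C :: real
  assumes bounded: "\<And>x. \<bar>\<phi> x\<bar> \<le> C"
    and integrable: "\<phi> integrable_on {0..1}"
    and periodic: "\<And>x. \<phi> (x + 1) = \<phi> x"
begin

lemma periodic_nat: "\<phi> (x + real k) = \<phi> x"
proof (induction k)
  case (Suc k)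
  have "\<phi> (x + real (Suc k)) = \<phi> ((x + real k) + 1)" by (simp add: add_ac)
  with Suc show ?case by (simp only: periodic)
qed simp

lemma has_integral_unit_shift: "(\<phi> has_integral (integral {0..1} \<phi>)) {real k..real k + 1}"
proof -
  have "(\<phi> has_integral (integral {0..1} \<phi>)) (cbox 0 1)"
    using integrable_integral[OF integrable] by simp
  from has_integral_affinity[OF this, of 1 "- real k"]
  have "((\<lambda>x. \<phi> (x - real k)) has_integral (integral {0..1} \<phi>)) ((\<lambda>x. x + real k) ` {0..1})" by simp
  moreover have "(\<lambda>x. x + real k) ` {0..1} = {real k..real k + 1}"
    using image_add_atLeastAtMost'[of "real k" 0 1] by (simp add: add.commute)
  moreover have "\<phi> (x - real k) = \<phi> x" for x using periodic_nat[of "x - real k" k] by simp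
  ultimately show ?thesis by simp (simp add: add.commute)
qed

lemma has_integral_periods: "(\<phi> has_integral (real k * integral {0..1} \<phi>)) {0..real k}"
proof (induction k)
  case (Suc k)
  from has_integral_combine[OF _ _ Suc has_integral_unit_shift[of k]]
  show ?case by (simp add: algebra_simps)
qed (simp add: has_integral_refl)

lemma has_integral_scaled_periods:
  assumes n: "n > 0"
  shows "((\<lambda>s. \<phi> (real n * s)) has_integral (real k * integral {0..1} \<phi> / real n)) {0..real k / real n}"
proof -
  have "(\<phi> has_integral (real k * integral {0..1} \<phi>)) (cbox 0 (real k))" using has_integral_periods by simp
  from has_integral_affinity[OF this, of "real n" 0]
  have "((\<lambda>s. \<phi> (real n * s)) has_integral (real k * integral {0..1} \<phi> / real n))
      ((\<lambda>x. x / real n) ` {0..real k})" using n by simp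
  moreover have "(\<lambda>x. x / real n) ` {0..real k} = {0..real k / real n}"
    using n image_divide_atLeastAtMost[of "real n" 0 "real k"] by simp
  ultimately show ?thesis by simp
qed

lemma integrable_scaled: "(\<lambda>s. \<phi> (real n * s)) integrable_on {0..1}"
proof (cases "n = 0")
  \<comment> \<open>For \<open>n = 0\<close> the function is the constant \<open>\<phi> 0\<close>;
    including it keeps a positivity condition out of the measurability and integrability statements
    that follow.\<close>
  case True
  then show ?thesis by (simp add: integrable_const_ivl)
next
  case False
  then show ?thesis using has_integral_scaled_periods[of n n] by (auto simp: integrable_on_def)
qed

lemma measurable_scaled: "(\<lambda>s. \<phi> (real n * s)) \<in> borel_measurable leb01"
  by (intro integrable_imp_measurable integrable_scaled)

text \<open>The \<open>k\<close> complete periods inside \<open>[0,b]\<close> contribute nothing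
  because the mean is zero; what is left is an interval of length at most
  \<open>1 / n\<close>.\<close>

lemma integral_scaled_bound:
  assumes mean: "integral {0..1} \<phi> = 0" and n: "n > 0" and b: "0 \<le> b" "b \<le> 1"
  shows "\<bar>integral {0..b} (\<lambda>s. \<phi> (real n * s))\<bar> \<le> C / real n"
proof -
  let ?\<psi> = "\<lambda>s. \<phi> (real n * s)"
  define k where "k = nat \<lfloor>real n * b\<rfloor>"
  have "0 \<le> real n * b" using b by simp
  then have k: "real k \<le> real n * b" "real n * b < real k + 1"
    unfolding k_def by (simp_all add: of_nat_nat)
  then have kb: "real k / real n \<le> b" "b - real k / real n \<le> 1 / real n"
  proof -
    show "real k / real n \<le> b" using n k(1) by (simp add: pos_divide_le_eq mult.commute)
    have "b \<le> (real k + 1) / real n" using n k(2) by (simp add: pos_le_divide_eq mult.commute)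
    then show "b - real k / real n \<le> 1 / real n" by (simp add: add_divide_distrib)
  qed
  have int: "?\<psi> integrable_on {0..b}"
    by (rule integrable_on_subinterval[OF integrable_scaled]) (use b in auto)
  have C: "0 \<le> C" using bounded[of 0] by linarith
  have "integral {0..b} ?\<psi> = integral {0..real k / real n} ?\<psi> + integral {real k / real n..b} ?\<psi>"
    using kb int n by (intro Henstock_Kurzweil_Integration.integral_combine[symmetric]) auto
  also have "integral {0..real k / real n} ?\<psi> = 0"
    using has_integral_scaled_periods[OF n, of k] mean by (simp add: integral_unique)
  finally have eq: "integral {0..b} ?\<psi> = integral {real k / real n..b} ?\<psi>" by simp
  have "?\<psi> integrable_on {real k / real n..b}"
    by (rule integrable_on_subinterval[OF int]) auto
  then have "norm (integral (cbox (real k / real n) b) ?\<psi>) \<le> C * measure lborel (cbox (real k / real n) b)"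
    using bounded C by (intro integrable_bound) auto
  also have "\<dots> = C * (b - real k / real n)" using kb by simp
  also have "\<dots> \<le> C * (1 / real n)" using C kb by (intro mult_left_mono) auto
  finally show ?thesis unfolding eq by simp
qed

lemma integrable_leb01_bounded_mult:
  fixes h :: "real \<Rightarrow> real"
  assumes "Bochner_Integration.integrable leb01 h"
  shows "Bochner_Integration.integrable leb01 (\<lambda>s. h s * \<phi> (real n * s))"
proof (rule Bochner_Integration.integrable_bound[OF integrable_mult_right[OF assms, of C]])
  show "(\<lambda>s. h s * \<phi> (real n * s)) \<in> borel_measurable leb01"
    using assms measurable_scaled by (intro borel_measurable_times) auto
  have "0 \<le> C" using bounded[of 0] by linarith
  then show "AE s in leb01. norm (h s * \<phi> (real n * s)) \<le> norm (C * h s)"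
    by (intro AE_I2) (auto simp: abs_mult mult.commute[of C] intro!: mult_left_mono bounded)
qed

lemma riemann_lebesgue_interval:
  assumes mean: "integral {0..1} \<phi> = 0" and b: "0 \<le> b" "b \<le> 1"
  shows "(\<lambda>n. LINT s|leb01. indicator {0<..b} s * \<phi> (real n * s)) \<longlonglongrightarrow> 0"
proof -
  have eq: "(LINT s|leb01. indicator {0<..b} s * \<phi> (real n * s)) = integral {0..b} (\<lambda>s. \<phi> (real n * s))" for n
  proof -
    have i: "Bochner_Integration.integrable leb01 (\<lambda>s. indicator {0<..b} s :: real)"
      by (intro in_L2_integrable in_L2_bounded[where C=1] finite_measure_leb01 borel_measurable_leb01)
        (auto simp: indicator_def)
    have "(LINT s|leb01. indicator {0<..b} s * \<phi> (real n * s))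
        = integral {0..1} (\<lambda>s. indicator {0<..b} s * \<phi> (real n * s))"
      by (intro lebesgue_integral_eq_integral integrable_leb01_bounded_mult i) auto
    also have "\<dots> = integral {0..1} (\<lambda>s. if s \<in> {0..b} then \<phi> (real n * s) else 0)"
      by (rule integral_spike[of "{0}"]) (auto simp: indicator_def)
    also have "\<dots> = integral ({0..b} \<inter> {0..1}) (\<lambda>s. \<phi> (real n * s))"
      by (subst integral_restrict_Int) (simp add: Int_commute)
    also have "{0..b} \<inter> {0..1} = {0..b}" using b by auto
    finally show ?thesis .
  qed
  have "(\<lambda>n. C * inverse (real n)) \<longlonglongrightarrow> C * 0"
    by (intro tendsto_mult tendsto_const lim_inverse_n)
  then have "(\<lambda>n. C / real n) \<longlonglongrightarrow> 0" by (simp add: divide_inverse)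
  then show ?thesis unfolding eq
  proof (rule Lim_null_comparison[rotated])
    show "\<forall>\<^sub>F n in sequentially. norm (integral {0..b} (\<lambda>s. \<phi> (real n * s))) \<le> C / real n"
      using integral_scaled_bound[OF mean _ b] by (auto simp: eventually_sequentially intro!: exI[of _ 1])
  qed
qed

lemma riemann_lebesgue_step:
  assumes mean: "integral {0..1} \<phi> = 0" and "valid_steps ps"
  shows "(\<lambda>n. LINT s|leb01. step_fun ps s * \<phi> (real n * s)) \<longlonglongrightarrow> 0"
  using assms(2)
proof (induction ps)
  case (Cons p ps)
  obtain c a b where p: "p = (c, a, b)" by (cases p) auto
  have ab: "0 \<le> a" "a \<le> b" "b \<le> 1" "valid_steps ps" using Cons(2) by (auto simp: p)
  have i: "Bochner_Integration.integrable leb01 (\<lambda>s. indicator {0<..b} s * \<phi> (real n * s))" for b n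
    by (intro integrable_leb01_bounded_mult in_L2_integrable in_L2_bounded[where C=1] finite_measure_leb01 borel_measurable_leb01)
      (auto simp: indicator_def)
  have j: "Bochner_Integration.integrable leb01 (\<lambda>s. step_fun ps s * \<phi> (real n * s))" for n
    by (intro integrable_leb01_bounded_mult in_L2_integrable in_L2_step_fun finite_measure_leb01)
  have "(LINT s|leb01. step_fun (p # ps) s * \<phi> (real n * s))
      = (LINT s|leb01. c * (indicator {0<..b} s * \<phi> (real n * s)) - c * (indicator {0<..a} s * \<phi> (real n * s))
          + step_fun ps s * \<phi> (real n * s))" for n
    by (rule Bochner_Integration.integral_cong)
      (use ab in \<open>auto simp: p indicator_def algebra_simps\<close>)
  also have "\<dots> n = c * (LINT s|leb01. indicator {0<..b} s * \<phi> (real n * s))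
      - c * (LINT s|leb01. indicator {0<..a} s * \<phi> (real n * s)) + (LINT s|leb01. step_fun ps s * \<phi> (real n * s))" for n
    using i[of b n] i[of a n] j[of n] by simp
  finally have eq: "(LINT s|leb01. step_fun (p # ps) s * \<phi> (real n * s)) = \<dots> n" for n .
  have "(\<lambda>n. c * (LINT s|leb01. indicator {0<..b} s * \<phi> (real n * s))
      - c * (LINT s|leb01. indicator {0<..a} s * \<phi> (real n * s)) + (LINT s|leb01. step_fun ps s * \<phi> (real n * s)))
      \<longlonglongrightarrow> c * 0 - c * 0 + 0"
    using ab by (intro tendsto_intros riemann_lebesgue_interval Cons(1)) (auto simp: mean)
  then show ?case unfolding eq by simp
qed simp

text \<open>Since \<phi> is bounded, replacing \<open>h\<close> by \<open>g\<close> changes the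
  integrals by at most \<open>C\<close> times the distance in mean, uniformly in \<open>n\<close>.
  The lemma passes the limit from step functions to square integrable functions, and from these to
  integrable ones.\<close>

lemma riemann_lebesgue_approx:
  fixes h :: "real \<Rightarrow> real"
  assumes h: "Bochner_Integration.integrable leb01 h"
    and approx: "\<And>e. e > 0 \<Longrightarrow> \<exists>g. Bochner_Integration.integrable leb01 g \<and> (LINT s|leb01. \<bar>h s - g s\<bar>) < e \<and>
      (\<lambda>n. LINT s|leb01. g s * \<phi> (real n * s)) \<longlonglongrightarrow> 0"
  shows "(\<lambda>n. LINT s|leb01. h s * \<phi> (real n * s)) \<longlonglongrightarrow> 0"
proof (rule LIMSEQ_I)
  fix e :: real assume e: "e > 0"
  have C: "0 \<le> C" using bounded[of 0] by linarith
  \<comment> \<open>Dividing by \<open>C + 1\<close> instead of \<open>C\<close> also covers the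
    case \<open>C = 0\<close>.\<close>
  obtain g where g: "Bochner_Integration.integrable leb01 g" "(LINT s|leb01. \<bar>h s - g s\<bar>) < e / (2 * (C + 1))"
      "(\<lambda>n. LINT s|leb01. g s * \<phi> (real n * s)) \<longlonglongrightarrow> 0"
    using approx[of "e / (2 * (C + 1))"] e C by auto
  obtain N where N: "\<And>n. n \<ge> N \<Longrightarrow> \<bar>LINT s|leb01. g s * \<phi> (real n * s)\<bar> < e / 2"
    using LIMSEQ_D[OF g(3), of "e / 2"] e by auto
  have "norm ((LINT s|leb01. h s * \<phi> (real n * s)) - 0) < e" if "n \<ge> N" for n
  proof -
    note i = integrable_leb01_bounded_mult[OF h, of n] integrable_leb01_bounded_mult[OF g(1), of n]
    have hg: "Bochner_Integration.integrable leb01 (\<lambda>s. \<bar>h s - g s\<bar>)" using h g(1) by simp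
    have "\<bar>(LINT s|leb01. h s * \<phi> (real n * s)) - (LINT s|leb01. g s * \<phi> (real n * s))\<bar>
        = \<bar>LINT s|leb01. (h s - g s) * \<phi> (real n * s)\<bar>"
      using i by (simp add: left_diff_distrib)
    also have "\<dots> \<le> (LINT s|leb01. \<bar>h s - g s\<bar> * (C + 1))"
      unfolding real_norm_def[symmetric]
    proof (rule Bochner_Integration.integral_norm_bound_integral)
      show "Bochner_Integration.integrable leb01 (\<lambda>s. (h s - g s) * \<phi> (real n * s))"
        using i by (simp add: left_diff_distrib)
      show "Bochner_Integration.integrable leb01 (\<lambda>s. norm (h s - g s) * (C + 1))" using hg by simp
      show "norm ((h s - g s) * \<phi> (real n * s)) \<le> norm (h s - g s) * (C + 1)" for s
        using bounded[of "real n * s"] by (auto simp: abs_mult intro!: mult_left_mono)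
    qed
    also have "\<dots> = (LINT s|leb01. \<bar>h s - g s\<bar>) * (C + 1)" by simp
    also have "\<dots> < e / (2 * (C + 1)) * (C + 1)" using g(2) C by (intro mult_strict_right_mono) auto
    also have "\<dots> = e / 2" using C by (simp add: field_simps)
    finally show ?thesis using N[OF that] unfolding real_norm_def diff_0_right by linarith
  qed
  then show "\<exists>no. \<forall>n\<ge>no. norm ((LINT s|leb01. h s * \<phi> (real n * s)) - 0) < e" by blast
qed

lemma riemann_lebesgue_L2:
  assumes mean: "integral {0..1} \<phi> = 0" and h: "in_L2 leb01 h"
  shows "(\<lambda>n. LINT s|leb01. h s * \<phi> (real n * s)) \<longlonglongrightarrow> 0"
proof (rule riemann_lebesgue_approx)
  interpret finite_measure leb01 by (rule finite_measure_leb01)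
  show "Bochner_Integration.integrable leb01 h" by (rule in_L2_integrable[OF finite_measure_leb01 h])
  fix e :: real assume e: "e > 0"
  obtain ps where ps: "\<And>k. valid_steps (ps k)" "L2_tendsto leb01 (\<lambda>k. step_fun (ps k)) h"
    using step_fun_dense[OF h] by blast
  have "L2_tendsto leb01 (\<lambda>k s. h s - step_fun (ps k) s) (\<lambda>s. h s - h s)"
    by (intro L2_tendsto_diff L2_tendsto_const h ps)
  then have lim: "L2_tendsto leb01 (\<lambda>k s. \<bar>h s - step_fun (ps k) s\<bar>) (\<lambda>s. 0)"
    by (rule L2_tendsto_bound[where C=1])
      (auto intro!: in_L2_norm[where 'b=real, unfolded real_norm_def] in_L2_diff h in_L2_step_fun in_L2_zero)
  have "in_L2 leb01 (\<lambda>_. 1::real)" by (simp add: in_L2_def)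
  from L2_tendsto_integral_mult[OF lim L2_tendsto_const[OF this]]
  have "(\<lambda>k. LINT s|leb01. \<bar>h s - step_fun (ps k) s\<bar>) \<longlonglongrightarrow> 0" by simp
  then obtain k where "norm ((LINT s|leb01. \<bar>h s - step_fun (ps k) s\<bar>) - 0) < e"
    using LIMSEQ_D[OF _ e] by blast
  then have "(LINT s|leb01. \<bar>h s - step_fun (ps k) s\<bar>) < e" by simp
  then show "\<exists>g. Bochner_Integration.integrable leb01 g \<and> (LINT s|leb01. \<bar>h s - g s\<bar>) < e \<and>
      (\<lambda>n. LINT s|leb01. g s * \<phi> (real n * s)) \<longlonglongrightarrow> 0"
    using riemann_lebesgue_step[OF mean ps(1)] in_L2_integrable[OF finite_measure_leb01 in_L2_step_fun[of "ps k"]]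
    by blast
qed

text \<open>Truncations of \<open>h\<close> are bounded, hence square integrable, and converge to
  \<open>h\<close> in mean. Mere integrability of \<open>h\<close> is what the applications offer,
  since there \<open>h\<close> is a product of two square integrable functions.\<close>

lemma riemann_lebesgue_mean_zero:
  assumes mean: "integral {0..1} \<phi> = 0" and h: "Bochner_Integration.integrable leb01 h"
  shows "(\<lambda>n. LINT s|leb01. h s * \<phi> (real n * s)) \<longlonglongrightarrow> 0"
proof (rule riemann_lebesgue_approx[OF h])
  interpret finite_measure leb01 by (rule finite_measure_leb01)
  fix e :: real assume e: "e > 0"
  have [measurable]: "h \<in> borel_measurable leb01" using h by simp
  define g where "g k s = max (- real k) (min (real k) (h s))" for k s
  have [measurable]: "g k \<in> borel_measurable leb01" for k unfolding g_def by measurable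
  have gb: "\<bar>g k s\<bar> \<le> real k" "\<bar>h s - g k s\<bar> \<le> \<bar>h s\<bar>" for k s unfolding g_def by auto
  have g2: "in_L2 leb01 (g k)" for k
    by (rule in_L2_bounded[OF finite_measure_leb01, where C="real k"]) (auto simp: gb)
  have "(\<lambda>k. LINT s|leb01. \<bar>h s - g k s\<bar>) \<longlonglongrightarrow> (LINT s|leb01. 0)"
  proof (rule integral_dominated_convergence[where w="\<lambda>s. \<bar>h s\<bar>"])
    show "AE s in leb01. (\<lambda>k. \<bar>h s - g k s\<bar>) \<longlonglongrightarrow> 0"
    proof (rule AE_I2, rule tendsto_eventually)
      fix s
      obtain n where n: "\<bar>h s\<bar> < real n" using reals_Archimedean2 by blast
      have "\<bar>h s - g k s\<bar> = 0" if "k \<ge> n" for k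
      proof -
        have "\<bar>h s\<bar> < real k" using n that by linarith
        then show ?thesis by (auto simp: g_def)
      qed
      then show "\<forall>\<^sub>F k in sequentially. \<bar>h s - g k s\<bar> = 0" unfolding eventually_sequentially by blast
    qed
  qed (use h gb in auto)
  then obtain k where "norm ((LINT s|leb01. \<bar>h s - g k s\<bar>) - (LINT s|leb01. 0)) < e"
    using LIMSEQ_D[OF _ e] by blast
  then have "(LINT s|leb01. \<bar>h s - g k s\<bar>) < e" by simp
  then show "\<exists>g. Bochner_Integration.integrable leb01 g \<and> (LINT s|leb01. \<bar>h s - g s\<bar>) < e \<and>
      (\<lambda>n. LINT s|leb01. g s * \<phi> (real n * s)) \<longlonglongrightarrow> 0"
    using riemann_lebesgue_L2[OF mean g2] in_L2_integrable[OF finite_measure_leb01 g2[of k]] by blast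
qed

end

text \<open>Subtracting the mean of \<phi> reduces to mean zero. In the applications \<phi> is
  \<open>f\<close>, with limit 0, or the square of \<open>f\<close>, whose mean is the squared norm
  of \<open>f\<close>.\<close>

lemma riemann_lebesgue:
  fixes \<phi> h :: "real \<Rightarrow> real"
  assumes bounded: "\<And>x. \<bar>\<phi> x\<bar> \<le> C" and int: "\<phi> integrable_on {0..1}" and per: "\<And>x. \<phi> (x + 1) = \<phi> x"
    and h: "Bochner_Integration.integrable leb01 h"
  shows "(\<lambda>n. LINT s|leb01. h s * \<phi> (real n * s)) \<longlonglongrightarrow> (LINT s|leb01. h s) * integral {0..1} \<phi>"
proof -
  define m where "m = integral {0..1} \<phi>"
  have "(\<lambda>n. LINT s|leb01. h s * (\<phi> (real n * s) - m)) \<longlonglongrightarrow> 0"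
  proof (rule riemann_lebesgue_mean_zero[where C="C + \<bar>m\<bar>" and \<phi>="\<lambda>x. \<phi> x - m"])
    show "\<bar>\<phi> x - m\<bar> \<le> C + \<bar>m\<bar>" for x using bounded[of x] by linarith
    show "(\<lambda>x. \<phi> x - m) integrable_on {0..1}" using int by (intro integrable_diff) auto
    show "integral {0..1} (\<lambda>x. \<phi> x - m) = 0"
      using int by (subst Henstock_Kurzweil_Integration.integral_diff) (auto simp: m_def)
  qed (use per h in auto)
  moreover have "(LINT s|leb01. h s * (\<phi> (real n * s) - m)) = (LINT s|leb01. h s * \<phi> (real n * s)) - (LINT s|leb01. h s) * m" for n
    using integrable_leb01_bounded_mult[OF bounded int per h, of n] h by (simp add: right_diff_distrib)
  ultimately show ?thesis by (simp add: LIM_zero_iff m_def)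
qed

lemma riemann_integrable_imp_integrable_on:
  assumes "f riemann_integrable_on {0..1}"
  shows "f integrable_on {0..1::real}"
proof -
  obtain I where I: "\<And>e. e > 0 \<Longrightarrow> \<exists>d>0. \<forall>p. p tagged_division_of {0..1} \<and> (\<lambda>x. ball x d) fine p \<longrightarrow>
      \<bar>(\<Sum>(x, K)\<in>p. measure lborel K * f x) - I\<bar> < e"
    using assms by (auto simp: riemann_integrable_on_def)
  have "(f has_integral I) {0..1}"
    unfolding has_integral_real
  proof (intro allI impI)
    fix e :: real assume "e > 0"
    then obtain d where d: "d > 0" "\<forall>p. p tagged_division_of {0..1} \<and> (\<lambda>x. ball x d) fine p \<longrightarrow>
      \<bar>(\<Sum>(x, K)\<in>p. measure lborel K * f x) - I\<bar> < e" using I by blast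
    then show "\<exists>\<gamma>. gauge \<gamma> \<and> (\<forall>p. p tagged_division_of {0..1} \<and> \<gamma> fine p \<longrightarrow>
        norm ((\<Sum>(x, k)\<in>p. measure lborel k *\<^sub>R f x) - I) < e)"
      by (intro exI[of _ "\<lambda>x. ball x d"]) (auto simp: gauge_def)
  qed
  then show ?thesis by (auto simp: integrable_on_def)
qed

section \<open>Centred Gaussian random variables\<close>

definition gaussian :: "'a measure \<Rightarrow> ('a \<Rightarrow> real) \<Rightarrow> real \<Rightarrow> bool"
  where "gaussian M X v \<longleftrightarrow> 0 \<le> v \<and> X \<in> borel_measurable M \<and>
    distr M borel X = distr std_normal_distribution borel (\<lambda>x. sqrt v * x)"

lemma gaussian_measurable: "gaussian M X v \<Longrightarrow> X \<in> borel_measurable M"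
  by (simp add: gaussian_def)

lemma char_scaled_normal:
  assumes "0 \<le> v"
  shows "char (distr std_normal_distribution borel (\<lambda>x. sqrt v * x)) t = complex_of_real (exp (- (t\<^sup>2 * v) / 2))"
proof -
  have "char (distr std_normal_distribution borel (\<lambda>x. sqrt v * x)) t = char std_normal_distribution (t * sqrt v)"
    unfolding char_def by (subst integral_distr) (auto simp: mult_ac)
  also have "\<dots> = complex_of_real (exp (- (t\<^sup>2 * v) / 2))"
    using assms by (simp add: char_std_normal_distribution power_mult_distrib)
  finally show ?thesis .
qed

lemma gaussianI:
  assumes "prob_space M" and [measurable]: "X \<in> borel_measurable M" and v: "0 \<le> v"
    and char: "\<And>t. (LINT \<omega>|M. iexp (t * X \<omega>)) = complex_of_real (exp (- (t\<^sup>2 * v) / 2))"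
  shows "gaussian M X v"
proof -
  interpret prob_space M by fact
  interpret N: real_distribution std_normal_distribution by (rule real_dist_normal_dist)
  have "distr M borel X = distr std_normal_distribution borel (\<lambda>x. sqrt v * x)"
  proof (rule Levy_uniqueness)
    show "real_distribution (distr M borel X)" by (rule real_distribution_distr) measurable
    show "real_distribution (distr std_normal_distribution borel (\<lambda>x. sqrt v * x))"
      by (rule N.real_distribution_distr) measurable
    show "char (distr M borel X) = char (distr std_normal_distribution borel (\<lambda>x. sqrt v * x))"
    proof
      fix t
      have "char (distr M borel X) t = (LINT \<omega>|M. iexp (t * X \<omega>))"
        unfolding char_def by (subst integral_distr) auto
      then show "char (distr M borel X) t = char (distr std_normal_distribution borel (\<lambda>x. sqrt v * x)) t"
        by (simp only: char char_scaled_normal[OF v])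
    qed
  qed
  then show ?thesis using v by (simp add: gaussian_def)
qed

lemma gaussian_integral:
  fixes g :: "real \<Rightarrow> 'b::euclidean_space"
  assumes X: "gaussian M X v" and [measurable]: "g \<in> borel_measurable borel"
  shows "(LINT \<omega>|M. g (X \<omega>)) = (LINT x|std_normal_distribution. g (sqrt v * x))"
    and "integrable M (\<lambda>\<omega>. g (X \<omega>)) \<longleftrightarrow> integrable std_normal_distribution (\<lambda>x. g (sqrt v * x))"
proof -
  have [measurable]: "X \<in> borel_measurable M" using X by (rule gaussian_measurable)
  have eq: "distr M borel X = distr std_normal_distribution borel (\<lambda>x. sqrt v * x)" using X by (simp add: gaussian_def)
  have "(LINT \<omega>|M. g (X \<omega>)) = (LINT x|distr M borel X. g x)" by (rule integral_distr[symmetric]) auto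
  also have "\<dots> = (LINT x|std_normal_distribution. g (sqrt v * x))" unfolding eq by (rule integral_distr) auto
  finally show "(LINT \<omega>|M. g (X \<omega>)) = (LINT x|std_normal_distribution. g (sqrt v * x))" .
  have "integrable M (\<lambda>\<omega>. g (X \<omega>)) \<longleftrightarrow> integrable (distr M borel X) g"
    by (rule integrable_distr_eq[symmetric]) auto
  also have "\<dots> \<longleftrightarrow> integrable std_normal_distribution (\<lambda>x. g (sqrt v * x))"
    unfolding eq by (rule integrable_distr_eq) auto
  finally show "integrable M (\<lambda>\<omega>. g (X \<omega>)) \<longleftrightarrow> integrable std_normal_distribution (\<lambda>x. g (sqrt v * x))" .
qed

lemma gaussian_char:
  assumes X: "gaussian M X v"
  shows "(LINT \<omega>|M. iexp (t * X \<omega>)) = complex_of_real (exp (- (t\<^sup>2 * v) / 2))"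
proof -
  have "(LINT \<omega>|M. iexp (t * X \<omega>)) = (LINT x|std_normal_distribution. iexp (t * (sqrt v * x)))"
    by (rule gaussian_integral(1)[OF X, of "\<lambda>x. iexp (t * x)"]) simp
  also have "\<dots> = char (distr std_normal_distribution borel (\<lambda>x. sqrt v * x)) t"
    unfolding char_def by (subst integral_distr) auto
  finally show ?thesis using X by (simp add: char_scaled_normal gaussian_def)
qed

lemma gaussian_square:
  assumes X: "gaussian M X v"
  shows "(LINT \<omega>|M. (X \<omega>)\<^sup>2) = v" and "integrable M (\<lambda>\<omega>. (X \<omega>)\<^sup>2)"
proof -
  have "0 \<le> v" using X by (simp add: gaussian_def)
  moreover have "(LINT x|std_normal_distribution. x\<^sup>2) = 1"
    using std_normal_distribution_even_moments(1)[of 1] by simp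
  ultimately have "(LINT x|std_normal_distribution. (sqrt v * x)\<^sup>2) = v" by (simp add: power_mult_distrib)
  then show "(LINT \<omega>|M. (X \<omega>)\<^sup>2) = v" by (subst gaussian_integral(1)[OF X]) auto
  show "integrable M (\<lambda>\<omega>. (X \<omega>)\<^sup>2)"
    by (subst gaussian_integral(2)[OF X])
      (auto simp: power_mult_distrib intro!: integrable_mult_right integrable_std_normal_distribution_moment)
qed

lemma gaussian_in_L2: "gaussian M X v \<Longrightarrow> in_L2 M X"
  using gaussian_square(2) gaussian_measurable by (auto simp: in_L2_def)

lemma gaussian_sqn: "gaussian M X v \<Longrightarrow> sqn M X = ennreal v"
  using gaussian_square(1)[of M X v] by (subst sqn_eq_integral[OF gaussian_in_L2]) simp_all

lemma gaussian_power:
  assumes X: "gaussian M X v"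
  shows "integrable M (\<lambda>\<omega>. (X \<omega>) ^ k)"
  by (subst gaussian_integral(2)[OF X])
    (auto simp: power_mult_distrib intro!: integrable_mult_right integrable_std_normal_distribution_moment)

lemma integrable_exp_abs_std_normal: "integrable std_normal_distribution (\<lambda>x. exp (c * \<bar>x\<bar>))"
proof -
  have "integrable lborel (\<lambda>x. std_normal_density x * exp (c * \<bar>x\<bar>))"
  proof (rule Bochner_Integration.integrable_bound)
    show "integrable lborel (\<lambda>x. sqrt 2 * exp (c\<^sup>2) * normal_density 0 (sqrt 2) x)"
      by (intro integrable_mult_right integrable_normal_density) simp
    have "std_normal_density x * exp (c * \<bar>x\<bar>) \<le> sqrt 2 * exp (c\<^sup>2) * normal_density 0 (sqrt 2) x" for x
    proof -
      \<comment> \<open>Completing the square gives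
        \<open>c * \<bar>x\<bar> <= c^2 + x^2 / 4\<close>; what remains of the exponent is
        \<open>- x^2 / 4\<close>, that of a normal density with variance 2.\<close>
      have "0 \<le> (c - \<bar>x\<bar> / 2)\<^sup>2" by simp
      then have "- x\<^sup>2 / 2 + c * \<bar>x\<bar> \<le> c\<^sup>2 + - x\<^sup>2 / 4"
        by (simp add: power2_diff power_divide)
      then have "exp (- x\<^sup>2 / 2) * exp (c * \<bar>x\<bar>) \<le> exp (c\<^sup>2) * exp (- x\<^sup>2 / 4)"
        by (simp flip: exp_add)
      then have "1 / sqrt (2 * pi) * (exp (- x\<^sup>2 / 2) * exp (c * \<bar>x\<bar>)) \<le> 1 / sqrt (2 * pi) * (exp (c\<^sup>2) * exp (- x\<^sup>2 / 4))"
        by (intro mult_left_mono) auto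
      also have "\<dots> = sqrt 2 * exp (c\<^sup>2) * normal_density 0 (sqrt 2) x"
        by (simp add: normal_density_def real_sqrt_mult field_simps)
      finally show ?thesis by (simp add: std_normal_density_def mult_ac)
    qed
    then show "AE x in lborel. norm (std_normal_density x * exp (c * \<bar>x\<bar>))
        \<le> norm (sqrt 2 * exp (c\<^sup>2) * normal_density 0 (sqrt 2) x)"
      by (intro AE_I2) (simp add: abs_mult normal_density_nonneg)
  qed measurable
  then show ?thesis by (subst integrable_density) (auto simp: normal_density_nonneg)
qed

lemma gaussian_exp_abs:
  assumes X: "gaussian M X v"
  shows "integrable M (\<lambda>\<omega>. exp (c * \<bar>X \<omega>\<bar>))"
proof (subst gaussian_integral(2)[OF X])
  have "0 \<le> v" using X by (simp add: gaussian_def)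
  then show "integrable std_normal_distribution (\<lambda>x. exp (c * \<bar>sqrt v * x\<bar>))"
    using integrable_exp_abs_std_normal[of "c * sqrt v"] by (simp add: abs_mult mult_ac)
qed measurable


section \<open>Wiener integrals\<close>

text \<open>A grid on which every increment between points of \<open>E\<close> telescopes. The
  function \<open>F\<close> is arbitrary because the same grid has to serve for the paths and for
  the indicators \<open>indicator {0<..t} s\<close> as functions of \<open>t\<close>.\<close>

lemma common_refinement:
  fixes E :: "real set"
  assumes E: "finite E" "E \<noteq> {}" "E \<subseteq> {0..1}"
  obtains ts :: "nat \<Rightarrow> real" and n where "mono ts" "range ts \<subseteq> {0..1}"
    "\<And>(F :: real \<Rightarrow> real) a b. a \<in> E \<Longrightarrow> b \<in> E \<Longrightarrow> a \<le> b \<Longrightarrow>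
      F b - F a = (\<Sum>k<n. indicator {a..<b} (ts k) * (F (ts (Suc k)) - F (ts k)))"
proof -
  define xs where "xs = sorted_list_of_set E"
  define n where "n = length xs"
  \<comment> \<open>The independence clause of \<open>brownian_motion\<close> asks for a monotone
    sequence on all naturals; the grid is therefore continued by its last point, where increments
    vanish.\<close>
  define ts where "ts k = xs ! min k (n - 1)" for k
  have xs: "set xs = E" "sorted_wrt (<) xs" using E(1) by (auto simp: xs_def)
  have n: "n > 0" using E(2) xs(1) by (cases xs) (auto simp: n_def)
  have less: "xs ! i < xs ! j" if "i < j" "j < n" for i j
    using sorted_wrt_nth_less[OF xs(2)] that by (simp add: n_def)
  have le: "xs ! i \<le> xs ! j" if "i \<le> j" "j < n" for i j
    using less[of i j] that by (cases "i = j") auto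
  have "mono ts" unfolding ts_def using n by (intro monoI le) auto
  moreover have "range ts \<subseteq> {0..1}"
  proof -
    have "ts k \<in> set xs" for k unfolding ts_def using n by (intro nth_mem) (simp add: n_def min_less_iff_disj)
    then show ?thesis using xs(1) E(3) by auto
  qed
  moreover have "F b - F a = (\<Sum>k<n. indicator {a..<b} (ts k) * (F (ts (Suc k)) - F (ts k)))"
    if ab: "a \<in> E" "b \<in> E" "a \<le> b" for F :: "real \<Rightarrow> real" and a b
  proof -
    obtain p q where pq: "p < n" "q < n" "a = xs ! p" "b = xs ! q"
      using ab xs(1) by (metis in_set_conv_nth n_def)
    have "p \<le> q" using less[of q p] pq ab(3) by (meson leD not_le_imp_less)
    have ind: "indicator {a..<b} (ts k) = (if p \<le> k \<and> k < q then 1 else (0::real))" if "k < n" for k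
    proof -
      have "ts k = xs ! k" using that by (simp add: ts_def)
      moreover have "xs ! p \<le> xs ! k \<longleftrightarrow> p \<le> k" using le[of p k] less[of k p] pq(1) that by (meson leD not_le_imp_less)
      moreover have "xs ! k < xs ! q \<longleftrightarrow> k < q" using le[of q k] less[of k q] pq(2) that by (meson leD not_le_imp_less)
      ultimately show ?thesis by (simp add: indicator_def pq)
    qed
    have "(\<Sum>k<n. indicator {a..<b} (ts k) * (F (ts (Suc k)) - F (ts k)))
        = (\<Sum>k<n. if k \<in> {p..<q} then F (ts (Suc k)) - F (ts k) else 0)"
      by (intro sum.cong) (auto simp: ind)
    also have "\<dots> = (\<Sum>k\<in>{..<n} \<inter> {p..<q}. F (ts (Suc k)) - F (ts k))"
      by (rule sum.inter_restrict[symmetric]) simp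
    also have "{..<n} \<inter> {p..<q} = {p..<q}" using pq(2) by auto
    also have "(\<Sum>k\<in>{p..<q}. F (ts (Suc k)) - F (ts k)) = F (ts q) - F (ts p)"
      using sum_Suc_diff'[OF \<open>p \<le> q\<close>, of "\<lambda>k. F (ts k)"] by simp
    also have "\<dots> = F b - F a" using pq by (simp add: ts_def)
    finally show ?thesis ..
  qed
  ultimately show thesis by (rule that)
qed

text \<open>The intervals in the list may overlap. On a common grid the integral and the function
  get the same coefficients, now over disjoint intervals, so independence of increments on one side
  and orthogonality on the other apply.\<close>

lemma step_integral_refinement:
  fixes ps :: "(real \<times> real \<times> real) list"
  assumes ps: "valid_steps ps"
  obtains ts :: "nat \<Rightarrow> real" and n d where "mono ts" "range ts \<subseteq> {0..1}"
    "\<And>(Y :: real \<Rightarrow> 'a \<Rightarrow> real) \<omega>. step_integral Y ps \<omega> = (\<Sum>k<n. d k * (Y (ts (Suc k)) \<omega> - Y (ts k) \<omega>))"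
    "\<And>s. step_fun ps s = (\<Sum>k<n. d k * indicator {ts k<..ts (Suc k)} s)"
proof -
  define E where "E = insert 0 (\<Union>(c, a, b)\<in>set ps. {a, b})"
  have E: "finite E" "E \<noteq> {}" "E \<subseteq> {0..1}" using ps unfolding E_def valid_steps_def by fastforce+
  obtain ts :: "nat \<Rightarrow> real" and n where ts: "mono ts" "range ts \<subseteq> {0..1}"
    "\<And>(F :: real \<Rightarrow> real) a b. a \<in> E \<Longrightarrow> b \<in> E \<Longrightarrow> a \<le> b \<Longrightarrow>
      F b - F a = (\<Sum>k<n. indicator {a..<b} (ts k) * (F (ts (Suc k)) - F (ts k)))"
    using common_refinement[OF E] by blast
  \<comment> \<open>On the grid interval starting at \<open>ts k\<close> the step function takes the
    sum of those \<open>c\<close> whose interval has \<open>ts k\<close> in \<open>{a..<b}\<close>;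
    the left end point decides.\<close>
  define d where "d k = (\<Sum>(c, a, b)\<leftarrow>ps. c * indicator {a..<b} (ts k))" for k
  have sum: "(\<Sum>(c, a, b)\<leftarrow>qs. (F b - F a) * c) =
      (\<Sum>k<n. (\<Sum>(c, a, b)\<leftarrow>qs. c * indicator {a..<b} (ts k)) * (F (ts (Suc k)) - F (ts k)))"
    if "set qs \<subseteq> set ps" for qs and F :: "real \<Rightarrow> real"
    using that
  proof (induction qs)
    case (Cons q qs)
    obtain c a b where q: "q = (c, a, b)" by (cases q) auto
    have "(c, a, b) \<in> set ps" using Cons(2) by (simp add: q)
    then have "a \<in> E" "b \<in> E" "a \<le> b" using ps by (force simp: E_def valid_steps_def)+
    note abE = this
    have "(F b - F a) * c = (\<Sum>k<n. c * indicator {a..<b} (ts k) * (F (ts (Suc k)) - F (ts k)))"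
      unfolding ts(3)[OF abE, of F] sum_distrib_right by (rule sum.cong) (simp_all only: mult_ac)
    with Cons show ?case by (simp add: q sum.distrib distrib_right)
  qed simp
  have 1: "step_integral Y ps \<omega> = (\<Sum>k<n. d k * (Y (ts (Suc k)) \<omega> - Y (ts k) \<omega>))"
    for Y :: "real \<Rightarrow> 'a \<Rightarrow> real" and \<omega>
    using sum[OF order_refl, of "\<lambda>t. Y t \<omega>"] by (simp add: step_integral_def d_def case_prod_beta)
  have 2: "step_fun ps s = (\<Sum>k<n. d k * indicator {ts k<..ts (Suc k)} s)" for s
  proof -
    have ind: "indicator {0<..b} s - indicator {0<..a} s = (indicator {a<..b} s :: real)" if "0 \<le> a" "a \<le> b" for a b
      using that by (auto simp: indicator_def)
    have "step_fun ps s = (\<Sum>(c, a, b)\<leftarrow>ps. (indicator {0<..b} s - indicator {0<..a} s) * c)"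
      unfolding step_fun_def
      by (intro arg_cong[where f=sum_list] map_cong refl) (use ps ind in \<open>auto simp: valid_steps_def\<close>)
    also have "\<dots> = (\<Sum>k<n. d k * (indicator {0<..ts (Suc k)} s - indicator {0<..ts k} s))"
      using sum[OF order_refl, of "\<lambda>t. indicator {0<..t} s"] by (simp add: d_def)
    also have "\<dots> = (\<Sum>k<n. d k * indicator {ts k<..ts (Suc k)} s)"
    proof (intro sum.cong refl arg_cong2[where f="(*)"] ind)
      show "0 \<le> ts k" for k using subsetD[OF ts(2) rangeI, of k] by simp
      show "ts k \<le> ts (Suc k)" for k using ts(1) by (simp add: monoD)
    qed
    finally show ?thesis .
  qed
  show thesis by (rule that[OF ts(1,2) 1 2])
qed

lemma LINT_leb01_indicator:
  assumes "0 \<le> a" "a \<le> b" "b \<le> 1"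
  shows "(LINT s|leb01. indicator {a<..b} s) = (b - a :: real)"
proof -
  have "measure leb01 {a<..b} = b - a"
    using assms by (subst measure_restrict_space) (auto simp: measure_completion)
  moreover have "{a<..b} \<inter> space leb01 = {a<..b}" using assms by (auto simp: space_restrict_space)
  ultimately show ?thesis by simp
qed

text \<open>At most one of the half-open grid intervals contains \<open>s\<close>, so the square of
  the sum has no cross terms.\<close>

lemma integral_square_disjoint_steps:
  fixes ts :: "nat \<Rightarrow> real"
  assumes ts: "mono ts" "range ts \<subseteq> {0..1}"
  shows "(LINT s|leb01. (\<Sum>k<n. d k * indicator {ts k<..ts (Suc k)} s)\<^sup>2) = (\<Sum>k<n. (d k)\<^sup>2 * (ts (Suc k) - ts k))"
proof -
  have sq: "(\<Sum>k<n. d k * indicator {ts k<..ts (Suc k)} s)\<^sup>2 = (\<Sum>k<n. (d k)\<^sup>2 * indicator {ts k<..ts (Suc k)} s)" for s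
  proof (cases "\<exists>k<n. s \<in> {ts k<..ts (Suc k)}")
    case True
    then obtain j where j: "j < n" "s \<in> {ts j<..ts (Suc j)}" by blast
    have z: "indicator {ts k<..ts (Suc k)} s = (if k = j then 1 else (0::real))" for k
    proof (cases k j rule: linorder_cases)
      case less
      then have "ts (Suc k) \<le> ts j" using ts(1) by (simp add: monoD)
      then show ?thesis using j less by auto
    next
      case greater
      then have "ts (Suc j) \<le> ts k" using ts(1) by (simp add: monoD)
      then show ?thesis using j greater by auto
    qed (use j in auto)
    show ?thesis unfolding z using j(1) by (simp add: if_distrib[of "(*) _"] cong: if_cong)
  next
    case False
    then have "indicator {ts k<..ts (Suc k)} s = (0::real)" if "k < n" for k using that by auto
    then show ?thesis by simp
  qed
  have ts': "0 \<le> ts k" "ts k \<le> ts (Suc k)" "ts k \<le> 1" for k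
    using subsetD[OF ts(2) rangeI, of k] monoD[OF ts(1), of k "Suc k"] by auto
  have i: "integrable leb01 (indicator {ts k<..ts (Suc k)} :: real \<Rightarrow> real)" for k
    by (intro in_L2_integrable in_L2_bounded[where C=1] finite_measure_leb01 borel_measurable_leb01)
      (auto simp: indicator_def)
  have "(LINT s|leb01. (\<Sum>k<n. (d k)\<^sup>2 * indicator {ts k<..ts (Suc k)} s))
      = (\<Sum>k<n. LINT s|leb01. (d k)\<^sup>2 * indicator {ts k<..ts (Suc k)} s)"
    by (rule Bochner_Integration.integral_sum) (use i in simp)
  also have "\<dots> = (\<Sum>k<n. (d k)\<^sup>2 * (ts (Suc k) - ts k))"
    by (simp only: integral_mult_right_zero LINT_leb01_indicator[OF ts'(1) ts'(2) ts'(3)])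
  finally show ?thesis unfolding sq .
qed

section \<open>Wiener integrals with respect to a Brownian motion\<close>

locale brownian =
  fixes M :: "'a measure" and B :: "real \<Rightarrow> 'a \<Rightarrow> real"
  assumes BM: "brownian_motion M B"
begin

sublocale prob_space M
  using BM by (simp add: brownian_motion_def)

lemma B_measurable [measurable]: "0 \<le> t \<Longrightarrow> t \<le> 1 \<Longrightarrow> B t \<in> borel_measurable M"
  using BM by (auto simp: brownian_motion_def)

lemma increment_char:
  assumes st: "0 \<le> s" "s \<le> t" "t \<le> 1"
  shows "char (distr M borel (\<lambda>\<omega>. B t \<omega> - B s \<omega>)) u = complex_of_real (exp (- (u\<^sup>2 * (t - s)) / 2))"
proof (cases "s = t")
  case True
  then show ?thesis unfolding True diff_self char_def by (subst integral_distr) (auto simp: prob_space)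
next
  case False
  then have "s < t" using st by simp
  then have "distributed M lborel (\<lambda>\<omega>. B t \<omega> - B s \<omega>) (normal_density 0 (sqrt (t - s)))"
    using BM st by (auto simp: brownian_motion_def)
  then have "distributed M lborel (\<lambda>\<omega>. (B t \<omega> - B s \<omega> - 0) / sqrt (t - s)) std_normal_density"
    using normal_standard_normal_convert[of "sqrt (t - s)" "\<lambda>\<omega>. B t \<omega> - B s \<omega>" 0] \<open>s < t\<close> by simp
  then have eq: "distr M lborel (\<lambda>\<omega>. (B t \<omega> - B s \<omega>) / sqrt (t - s)) = std_normal_distribution"
    by (simp add: distributed_def)
  have [measurable]: "B s \<in> borel_measurable M" "B t \<in> borel_measurable M" using st by auto
  have "char (distr M borel (\<lambda>\<omega>. B t \<omega> - B s \<omega>)) u = (LINT \<omega>|M. iexp (u * (B t \<omega> - B s \<omega>)))"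
    unfolding char_def by (subst integral_distr) auto
  also have "\<dots> = (LINT \<omega>|M. iexp ((u * sqrt (t - s)) * ((B t \<omega> - B s \<omega>) / sqrt (t - s))))"
    using \<open>s < t\<close> by simp
  also have "\<dots> = (LINT x|distr M lborel (\<lambda>\<omega>. (B t \<omega> - B s \<omega>) / sqrt (t - s)). iexp ((u * sqrt (t - s)) * x))"
    by (rule integral_distr[symmetric]) auto
  also have "\<dots> = char std_normal_distribution (u * sqrt (t - s))" unfolding eq char_def ..
  finally show ?thesis using \<open>s < t\<close> by (simp add: char_std_normal_distribution power_mult_distrib)
qed

lemma step_integral_measurable [measurable]:
  fixes ps :: "('b::euclidean_space \<times> real \<times> real) list"
  assumes "valid_steps ps" shows "step_integral B ps \<in> borel_measurable M"
  using assms
proof (induction ps)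
  case Nil
  then show ?case by (simp add: step_integral_def)
next
  case (Cons p ps)
  obtain c a b where p: "p = (c, a, b)" by (cases p) auto
  then have eq: "step_integral B (p # ps) = (\<lambda>\<omega>. (B b \<omega> - B a \<omega>) *\<^sub>R c + step_integral B ps \<omega>)"
    by (auto simp: fun_eq_iff)
  have [measurable]: "B a \<in> borel_measurable M" "B b \<in> borel_measurable M" "step_integral B ps \<in> borel_measurable M"
    using Cons by (auto simp: p)
  show ?case unfolding eq by measurable
qed

text \<open>Independent increments turn the characteristic function into a product, whose exponents
  add up to the squared norm of the step function. Both the Gaussian law and the isometry of step
  integrals are read off from this.\<close>

lemma step_integral_char:
  fixes ps :: "(real \<times> real \<times> real) list"
  assumes ps: "valid_steps ps"
  shows "(LINT \<omega>|M. iexp (t * step_integral B ps \<omega>)) = complex_of_real (exp (- (t\<^sup>2 * (LINT s|leb01. (step_fun ps s)\<^sup>2)) / 2))"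
proof (rule step_integral_refinement[OF ps, where 'a='a])
  fix ts :: "nat \<Rightarrow> real" and n d
  assume ts: "mono ts" "range ts \<subseteq> {0..1}"
    and si0: "\<And>(Y :: real \<Rightarrow> 'a \<Rightarrow> real) \<omega>. step_integral Y ps \<omega> = (\<Sum>k<n. d k * (Y (ts (Suc k)) \<omega> - Y (ts k) \<omega>))"
    and sf: "\<And>s. step_fun ps s = (\<Sum>k<n. d k * indicator {ts k<..ts (Suc k)} s)"
  note si = si0[of B]
  have ts': "0 \<le> ts k" "ts k \<le> ts (Suc k)" "ts k \<le> 1" for k
    using subsetD[OF ts(2) rangeI, of k] monoD[OF ts(1), of k "Suc k"] by auto
  have [measurable]: "B (ts k) \<in> borel_measurable M" for k using ts' by auto
  have "indep_vars (\<lambda>_. borel) (\<lambda>k \<omega>. B (ts (Suc k)) \<omega> - B (ts k) \<omega>) {..<n}"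
    using BM ts by (auto simp: brownian_motion_def)
  then have ind: "indep_vars (\<lambda>_. borel) (\<lambda>k \<omega>. d k * (B (ts (Suc k)) \<omega> - B (ts k) \<omega>)) {..<n}"
    by (rule indep_vars_compose2[where Y="\<lambda>k x. d k * x"]) simp
  have "(LINT \<omega>|M. iexp (t * step_integral B ps \<omega>))
      = char (distr M borel (\<lambda>\<omega>. \<Sum>k<n. d k * (B (ts (Suc k)) \<omega> - B (ts k) \<omega>))) t"
    unfolding char_def si by (subst integral_distr) auto
  also have "\<dots> = (\<Prod>k<n. char (distr M borel (\<lambda>\<omega>. d k * (B (ts (Suc k)) \<omega> - B (ts k) \<omega>))) t)"
    by (rule char_distr_sum[OF ind])
  also have "\<dots> = (\<Prod>k<n. complex_of_real (exp (- ((t * d k)\<^sup>2 * (ts (Suc k) - ts k)) / 2)))"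
  proof (rule prod.cong[OF refl])
    fix k
    have "char (distr M borel (\<lambda>\<omega>. d k * (B (ts (Suc k)) \<omega> - B (ts k) \<omega>))) t
        = char (distr M borel (\<lambda>\<omega>. B (ts (Suc k)) \<omega> - B (ts k) \<omega>)) (t * d k)"
      unfolding char_def by (subst (1 2) integral_distr) (auto simp: mult_ac)
    then show "char (distr M borel (\<lambda>\<omega>. d k * (B (ts (Suc k)) \<omega> - B (ts k) \<omega>))) t
        = complex_of_real (exp (- ((t * d k)\<^sup>2 * (ts (Suc k) - ts k)) / 2))"
      by (simp only: increment_char[OF ts'(1) ts'(2) ts'(3)])
  qed
  also have "\<dots> = complex_of_real (exp (\<Sum>k<n. - ((t * d k)\<^sup>2 * (ts (Suc k) - ts k)) / 2))"
    by (subst exp_sum) auto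
  also have "(\<Sum>k<n. - ((t * d k)\<^sup>2 * (ts (Suc k) - ts k)) / 2) = - (t\<^sup>2 * (LINT s|leb01. (step_fun ps s)\<^sup>2)) / 2"
    unfolding sf integral_square_disjoint_steps[OF ts]
    by (simp add: sum_negf sum_divide_distrib sum_distrib_left power_mult_distrib mult_ac)
  finally show "(LINT \<omega>|M. iexp (t * step_integral B ps \<omega>)) = complex_of_real (exp (- (t\<^sup>2 * (LINT s|leb01. (step_fun ps s)\<^sup>2)) / 2))" .
qed

lemma step_integral_gaussian:
  fixes ps :: "(real \<times> real \<times> real) list"
  assumes ps: "valid_steps ps"
  shows "gaussian M (step_integral B ps) (LINT s|leb01. (step_fun ps s)\<^sup>2)"
  by (intro gaussianI prob_space_axioms step_integral_measurable step_integral_char ps) simp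

lemma step_integral_isometry_real:
  fixes ps :: "(real \<times> real \<times> real) list"
  assumes ps: "valid_steps ps"
  shows "sqn M (step_integral B ps) = sqn leb01 (step_fun ps)"
  using gaussian_sqn[OF step_integral_gaussian[OF ps]] sqn_eq_integral[OF in_L2_step_fun, of ps] by simp

text \<open>The squared norm is the sum over \<open>Basis\<close> of the squared coordinates, and
  each coordinate is a real step integral. Vector values are needed for the complex integrands in
  \<open>is_sharp\<close>.\<close>

lemma step_integral_isometry:
  fixes ps :: "('b::euclidean_space \<times> real \<times> real) list"
  assumes ps: "valid_steps ps"
  shows "sqn M (step_integral B ps) = sqn leb01 (step_fun ps)"
proof -
  have sqn_sum: "sqn N F = (\<Sum>e\<in>Basis. sqn N (\<lambda>x. F x \<bullet> e))" if [measurable]: "F \<in> borel_measurable N"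
    for N :: "'z measure" and F :: "'z \<Rightarrow> 'b"
  proof -
    have "ennreal ((norm (F x))\<^sup>2) = (\<Sum>e\<in>Basis. ennreal ((norm (F x \<bullet> e))\<^sup>2))" for x
    proof -
      have "(norm (F x))\<^sup>2 = (\<Sum>e\<in>Basis. (norm (F x \<bullet> e))\<^sup>2)"
        unfolding power2_norm_eq_inner by (subst euclidean_inner) (simp add: power2_eq_square)
      then show ?thesis by (subst sum_ennreal) auto
    qed
    then show ?thesis unfolding sqn_def by (subst nn_integral_sum[symmetric]) auto
  qed
  have "sqn M (\<lambda>\<omega>. step_integral B ps \<omega> \<bullet> e) = sqn leb01 (\<lambda>s. step_fun ps s \<bullet> e)" for e
  proof -
    have lin: "linear (\<lambda>c::'b. c \<bullet> e)" by (rule bounded_linear.linear[OF bounded_linear_inner_left])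
    have "step_fun (map_steps (\<lambda>c. c \<bullet> e) ps) = (\<lambda>s. step_fun ps s \<bullet> e)"
      "step_integral B (map_steps (\<lambda>c. c \<bullet> e) ps) = (\<lambda>\<omega>. step_integral B ps \<omega> \<bullet> e)"
      using linear_step_fun[OF lin] linear_step_integral[OF lin] by (auto simp: fun_eq_iff)
    then show ?thesis using step_integral_isometry_real[of "map_steps (\<lambda>c. c \<bullet> e) ps"] ps by simp
  qed
  then show ?thesis
    by (simp add: sqn_sum[OF step_integral_measurable[OF ps]] sqn_sum[OF step_fun_leb01])
qed

lemma in_L2_step_integral:
  fixes ps :: "('b::euclidean_space \<times> real \<times> real) list"
  assumes ps: "valid_steps ps"
  shows "in_L2 M (step_integral B ps)"
  using in_L2_step_fun[of ps] by (simp add: in_L2_iff_sqn step_integral_isometry ps)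

lemma step_integral_diff:
  fixes ps qs :: "('b::euclidean_space \<times> real \<times> real) list"
  assumes "valid_steps ps" "valid_steps qs"
  shows "sqn M (\<lambda>\<omega>. step_integral B ps \<omega> - step_integral B qs \<omega>) = sqn leb01 (\<lambda>s. step_fun ps s - step_fun qs s)"
  using step_integral_isometry[of "ps @ map_steps uminus qs"] assms
    linear_step_fun[of "uminus :: 'b \<Rightarrow> 'b" qs] linear_step_integral[of "uminus :: 'b \<Rightarrow> 'b" B qs]
  by (simp add: linear_uminus step_integral_def[abs_def] step_fun_def[abs_def])

lemma has_wiener_integralE:
  assumes "has_wiener_integral M Y \<xi> Z"
  obtains ps where "\<And>k. valid_steps (ps k)" "L2_tendsto leb01 (\<lambda>k. step_fun (ps k)) \<xi>"
    "L2_tendsto M (\<lambda>k. step_integral Y (ps k)) Z"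
  using assms unfolding has_wiener_integral_def valid_steps_def by blast

lemma has_wiener_integralI:
  assumes "\<And>k. valid_steps (ps k)" "L2_tendsto leb01 (\<lambda>k. step_fun (ps k)) \<xi>"
    "L2_tendsto M (\<lambda>k. step_integral Y (ps k)) Z"
  shows "has_wiener_integral M Y \<xi> Z"
  using assms unfolding has_wiener_integral_def valid_steps_def by blast

lemma has_wiener_integral_in_L2:
  assumes "has_wiener_integral M Y \<xi> Z"
  shows "in_L2 leb01 \<xi>" "in_L2 M Z"
  using assms by (auto elim!: has_wiener_integralE dest: L2_tendsto_in_L2)

text \<open>By the isometry, the step integrals along any two approximations of almost everywhere
  equal integrands have distance tending to 0. Hence \<open>wiener_integral\<close>, which is a
  choice, is determined almost surely.\<close>

lemma has_wiener_integral_unique: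
  fixes \<xi> :: "real \<Rightarrow> 'b::euclidean_space"
  assumes Z: "has_wiener_integral M B \<xi> Z" and Y: "has_wiener_integral M B \<eta> Y"
    and eq: "AE s in leb01. \<xi> s = \<eta> s"
  shows "AE \<omega> in M. Z \<omega> = Y \<omega>"
proof -
  obtain ps where ps: "\<And>k. valid_steps (ps k)" "L2_tendsto leb01 (\<lambda>k. step_fun (ps k)) \<xi>"
    "L2_tendsto M (\<lambda>k. step_integral B (ps k)) Z" using Z by (rule has_wiener_integralE) blast
  obtain qs where qs: "\<And>k. valid_steps (qs k)" "L2_tendsto leb01 (\<lambda>k. step_fun (qs k)) \<eta>"
    "L2_tendsto M (\<lambda>k. step_integral B (qs k)) Y" using Y by (rule has_wiener_integralE) blast
  have m: "\<xi> \<in> borel_measurable leb01" using L2_tendsto_in_L2(2)[OF ps(2)] by (simp add: in_L2_def)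
  have "L2_tendsto leb01 (\<lambda>k. step_fun (qs k)) \<xi>"
    by (rule L2_tendsto_cong_AE[OF qs(2) _ m]) (use eq in auto)
  from L2_tendsto_diff[OF ps(2) this]
  have "L2_tendsto leb01 (\<lambda>k s. step_fun (ps k) s - step_fun (qs k) s) (\<lambda>s. 0)" by simp
  then have "(\<lambda>k. sqn leb01 (\<lambda>s. step_fun (ps k) s - step_fun (qs k) s)) \<longlonglongrightarrow> 0"
    by (simp add: L2_tendsto_iff_sqn)
  then have "L2_tendsto M (\<lambda>k \<omega>. step_integral B (ps k) \<omega> - step_integral B (qs k) \<omega>) (\<lambda>_. 0)"
    using ps(1) qs(1) by (simp add: L2_tendsto_iff_sqn step_integral_diff in_L2_zero in_L2_diff in_L2_step_integral)
  from L2_tendsto_unique[OF L2_tendsto_diff[OF ps(3) qs(3)] this]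
  show ?thesis by simp
qed

lemma has_wiener_integral_exists:
  fixes \<xi> :: "real \<Rightarrow> real"
  assumes \<xi>: "in_L2 leb01 \<xi>"
  shows "\<exists>Z. has_wiener_integral M B \<xi> Z"
proof -
  obtain ps where ps: "\<And>k. valid_steps (ps k)" "L2_tendsto leb01 (\<lambda>k. step_fun (ps k)) \<xi>"
    using step_fun_dense[OF \<xi>] by blast
  have "\<exists>Z. L2_tendsto M (\<lambda>k. step_integral B (ps k)) Z"
  proof (rule L2_complete)
    show "in_L2 M (step_integral B (ps k))" for k using ps(1) by (rule in_L2_step_integral)
    fix e :: real assume e: "e > 0"
    then have "ennreal (e/4) > 0" by simp
    then have "\<forall>\<^sub>F k in sequentially. sqn leb01 (\<lambda>s. step_fun (ps k) s - \<xi> s) < ennreal (e/4)"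
      using ps(2) by (auto simp: L2_tendsto_iff_sqn intro: order_tendstoD)
    then obtain N where N: "\<And>k. k \<ge> N \<Longrightarrow> sqn leb01 (\<lambda>s. step_fun (ps k) s - \<xi> s) < ennreal (e/4)"
      by (auto simp: eventually_sequentially)
    have "sqn M (\<lambda>\<omega>. step_integral B (ps m) \<omega> - step_integral B (ps n) \<omega>) < ennreal e" if "m \<ge> N" "n \<ge> N" for m n
    proof -
      have [measurable]: "\<xi> \<in> borel_measurable leb01" using \<xi> by (simp add: in_L2_def)
      have "sqn M (\<lambda>\<omega>. step_integral B (ps m) \<omega> - step_integral B (ps n) \<omega>) = sqn leb01 (\<lambda>s. step_fun (ps m) s - step_fun (ps n) s)"
        by (rule step_integral_diff[OF ps(1) ps(1)])
      also have "\<dots> \<le> 2 * sqn leb01 (\<lambda>s. step_fun (ps m) s - \<xi> s) + 2 * sqn leb01 (\<lambda>s. \<xi> s - step_fun (ps n) s)"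
        by (rule sqn_triangle) measurable
      also have "\<dots> < 2 * ennreal (e/4) + 2 * ennreal (e/4)"
        using N[OF that(1)] N[OF that(2)] sqn_minus_commute[of leb01 \<xi> "step_fun (ps n)"]
        by (intro add_strict_mono ennreal_mult_strict_left_mono) auto
      also have "\<dots> = ennreal e" using e by (simp flip: ennreal_plus ennreal_numeral ennreal_mult)
      finally show ?thesis .
    qed
    then show "\<exists>N. \<forall>m\<ge>N. \<forall>n\<ge>N. sqn M (\<lambda>\<omega>. step_integral B (ps m) \<omega> - step_integral B (ps n) \<omega>) < ennreal e" by blast
  qed
  then show ?thesis using has_wiener_integralI[OF ps] by blast
qed

section \<open>The integral map: linearity, Gaussian law, isometry\<close>

abbreviation W :: "(real \<Rightarrow> real) \<Rightarrow> 'a \<Rightarrow> real"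
  where "W \<equiv> wiener_integral M B"

lemma has_wiener_integral_W: "in_L2 leb01 \<xi> \<Longrightarrow> has_wiener_integral M B \<xi> (W \<xi>)"
  unfolding wiener_integral_def by (rule someI_ex[OF has_wiener_integral_exists])

lemma has_wiener_integral_cong_AE:
  fixes \<xi> :: "real \<Rightarrow> 'b::euclidean_space"
  assumes Z: "has_wiener_integral M Y \<xi> Z" and "\<eta> \<in> borel_measurable leb01" "AE s in leb01. \<eta> s = \<xi> s"
    "Z' \<in> borel_measurable M" "AE \<omega> in M. Z' \<omega> = Z \<omega>"
  shows "has_wiener_integral M Y \<eta> Z'"
proof -
  obtain ps where ps: "\<And>k. valid_steps (ps k)" "L2_tendsto leb01 (\<lambda>k. step_fun (ps k)) \<xi>"
    "L2_tendsto M (\<lambda>k. step_integral Y (ps k)) Z" using Z by (rule has_wiener_integralE) blast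
  have "L2_tendsto leb01 (\<lambda>k. step_fun (ps k)) \<eta>"
    by (rule L2_tendsto_cong_AE[OF ps(2)]) (use assms in auto)
  moreover have "L2_tendsto M (\<lambda>k. step_integral Y (ps k)) Z'"
    by (rule L2_tendsto_cong_AE[OF ps(3)])
      (use assms L2_tendsto_in_L2(1)[OF ps(3)] in \<open>auto simp: in_L2_def\<close>)
  ultimately show ?thesis by (rule has_wiener_integralI[OF ps(1)])
qed

lemma has_wiener_integral_add:
  fixes \<xi> \<eta> :: "real \<Rightarrow> 'b::euclidean_space"
  assumes Z: "has_wiener_integral M Y \<xi> Z" and Z': "has_wiener_integral M Y \<eta> Z'"
  shows "has_wiener_integral M Y (\<lambda>s. \<xi> s + \<eta> s) (\<lambda>\<omega>. Z \<omega> + Z' \<omega>)"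
proof -
  obtain ps where ps: "\<And>k. valid_steps (ps k)" "L2_tendsto leb01 (\<lambda>k. step_fun (ps k)) \<xi>"
    "L2_tendsto M (\<lambda>k. step_integral Y (ps k)) Z" using Z by (rule has_wiener_integralE) blast
  obtain qs where qs: "\<And>k. valid_steps (qs k)" "L2_tendsto leb01 (\<lambda>k. step_fun (qs k)) \<eta>"
    "L2_tendsto M (\<lambda>k. step_integral Y (qs k)) Z'" using Z' by (rule has_wiener_integralE) blast
  have eq: "step_fun (ps k @ qs k) = (\<lambda>s. step_fun (ps k) s + step_fun (qs k) s)"
      "step_integral Y (ps k @ qs k) = (\<lambda>\<omega>. step_integral Y (ps k) \<omega> + step_integral Y (qs k) \<omega>)" for k
    by (auto simp: fun_eq_iff)
  show ?thesis
    by (rule has_wiener_integralI[of "\<lambda>k. ps k @ qs k"])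
      (simp_all add: eq ps(1) qs(1) L2_tendsto_add[OF ps(2) qs(2)] L2_tendsto_add[OF ps(3) qs(3)])
qed

lemma has_wiener_integral_linear:
  fixes \<xi> :: "real \<Rightarrow> 'b::euclidean_space" and g :: "'b \<Rightarrow> 'c::euclidean_space"
  assumes Z: "has_wiener_integral M Y \<xi> Z" and g: "linear g"
  shows "has_wiener_integral M Y (\<lambda>s. g (\<xi> s)) (\<lambda>\<omega>. g (Z \<omega>))"
proof -
  obtain ps where ps: "\<And>k. valid_steps (ps k)" "L2_tendsto leb01 (\<lambda>k. step_fun (ps k)) \<xi>"
    "L2_tendsto M (\<lambda>k. step_integral Y (ps k)) Z" using Z by (rule has_wiener_integralE) blast
  have eq: "step_fun (map_steps g (ps k)) = (\<lambda>s. g (step_fun (ps k) s))"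
      "step_integral Y (map_steps g (ps k)) = (\<lambda>\<omega>. g (step_integral Y (ps k) \<omega>))" for k
    using g by (auto simp: fun_eq_iff linear_step_fun linear_step_integral)
  show ?thesis
    by (rule has_wiener_integralI[of "\<lambda>k. map_steps g (ps k)"])
      (simp_all add: eq ps(1) L2_tendsto_linear[OF ps(2) g] L2_tendsto_linear[OF ps(3) g])
qed

text \<open>\<open>iexp\<close> is Lipschitz, so the characteristic functions of the approximating
  step integrals converge, and their exponents converge with the squared norms of the step
  functions.\<close>

lemma has_wiener_integral_gaussian:
  assumes Z: "has_wiener_integral M B \<xi> Z"
  shows "gaussian M Z (LINT s|leb01. (\<xi> s)\<^sup>2)"
proof -
  obtain ps where ps: "\<And>k. valid_steps (ps k)" "L2_tendsto leb01 (\<lambda>k. step_fun (ps k)) \<xi>"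
    "L2_tendsto M (\<lambda>k. step_integral B (ps k)) Z" using Z by (rule has_wiener_integralE) blast
  have [measurable]: "Z \<in> borel_measurable M" using L2_tendsto_in_L2(2)[OF ps(3)] by (simp add: in_L2_def)
  have [measurable]: "step_integral B (ps k) \<in> borel_measurable M" for k using ps(1) by measurable
  show ?thesis
  proof (rule gaussianI[OF prob_space_axioms])
    fix t :: real
    have one: "in_L2 M (\<lambda>_. 1::real)" by (simp add: in_L2_def)
    have "(\<lambda>k. LINT s|leb01. step_fun (ps k) s * step_fun (ps k) s) \<longlonglongrightarrow> (LINT s|leb01. \<xi> s * \<xi> s)"
      by (rule L2_tendsto_integral_mult[OF ps(2) ps(2)])
    then have 1: "(\<lambda>k. complex_of_real (exp (- (t\<^sup>2 * (LINT s|leb01. (step_fun (ps k) s)\<^sup>2)) / 2)))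
        \<longlonglongrightarrow> complex_of_real (exp (- (t\<^sup>2 * (LINT s|leb01. (\<xi> s)\<^sup>2)) / 2))"
      by (intro tendsto_intros) (simp_all add: power2_eq_square)
    have "L2_tendsto M (\<lambda>k \<omega>. iexp (t * step_integral B (ps k) \<omega>)) (\<lambda>\<omega>. iexp (t * Z \<omega>))"
    proof (rule L2_tendsto_bound[OF ps(3), where C="\<bar>t\<bar>"])
      show "in_L2 M (\<lambda>\<omega>. iexp (t * step_integral B (ps k) \<omega>))" "in_L2 M (\<lambda>\<omega>. iexp (t * Z \<omega>))" for k
        by (rule in_L2_bounded[where C=1]; simp add: finite_measure_axioms)+
      have "norm (iexp x - iexp y) \<le> \<bar>x - y\<bar>" for x y :: real
      proof -
        have "iexp x - iexp y = iexp y * (iexp (x - y) - 1)" by (simp add: algebra_simps flip: exp_add)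
        then have "norm (iexp x - iexp y) = norm (iexp (x - y) - 1)" by (simp add: norm_mult)
        also have "\<dots> \<le> \<bar>x - y\<bar>" using iexp_approx1[of "x - y" 0] by simp
        finally show ?thesis .
      qed
      then show "AE \<omega> in M. norm (iexp (t * step_integral B (ps k) \<omega>) - iexp (t * Z \<omega>))
          \<le> \<bar>t\<bar> * norm (step_integral B (ps k) \<omega> - Z \<omega>)" for k
        by (intro AE_I2) (metis abs_mult real_norm_def right_diff_distrib)
    qed
    from L2_tendsto_integral_mult[OF this L2_tendsto_const[OF in_L2_of_real[OF one]]]
    have 2: "(\<lambda>k. LINT \<omega>|M. iexp (t * step_integral B (ps k) \<omega>)) \<longlonglongrightarrow> (LINT \<omega>|M. iexp (t * Z \<omega>))" by simp
    show "(LINT \<omega>|M. iexp (t * Z \<omega>)) = complex_of_real (exp (- (t\<^sup>2 * (LINT s|leb01. (\<xi> s)\<^sup>2)) / 2))"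
      using LIMSEQ_unique[OF 2] 1 by (simp only: step_integral_char[OF ps(1)])
  qed simp_all
qed

lemma W_gaussian: "in_L2 leb01 \<xi> \<Longrightarrow> gaussian M (W \<xi>) (LINT s|leb01. (\<xi> s)\<^sup>2)"
  by (intro has_wiener_integral_gaussian has_wiener_integral_W)

lemma W_measurable [measurable (raw)]: "in_L2 leb01 \<xi> \<Longrightarrow> W \<xi> \<in> borel_measurable M"
  using W_gaussian gaussian_measurable by blast

lemma in_L2_W: "in_L2 leb01 \<xi> \<Longrightarrow> in_L2 M (W \<xi>)"
  by (rule gaussian_in_L2[OF W_gaussian])

lemma W_isometry: "in_L2 leb01 \<xi> \<Longrightarrow> sqn M (W \<xi>) = sqn leb01 \<xi>"
  using gaussian_sqn[OF W_gaussian] sqn_eq_integral[of leb01 \<xi>] by simp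

lemma W_eqI: "has_wiener_integral M B \<xi> Z \<Longrightarrow> AE \<omega> in M. W \<xi> \<omega> = Z \<omega>"
  using has_wiener_integral_unique[OF has_wiener_integral_W, of \<xi> \<xi> Z] has_wiener_integral_in_L2 by blast

lemma W_add: "in_L2 leb01 \<xi> \<Longrightarrow> in_L2 leb01 \<eta> \<Longrightarrow> AE \<omega> in M. W (\<lambda>s. \<xi> s + \<eta> s) \<omega> = W \<xi> \<omega> + W \<eta> \<omega>"
  by (intro W_eqI has_wiener_integral_add has_wiener_integral_W)

lemma W_scale: "in_L2 leb01 \<xi> \<Longrightarrow> AE \<omega> in M. W (\<lambda>s. c * \<xi> s) \<omega> = c * W \<xi> \<omega>"
  by (intro W_eqI has_wiener_integral_linear[where g="(*) c"] has_wiener_integral_W)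
    (simp_all add: bounded_linear.linear[OF bounded_linear_mult_right])

lemma W_diff:
  assumes "in_L2 leb01 \<xi>" "in_L2 leb01 \<eta>"
  shows "AE \<omega> in M. W (\<lambda>s. \<xi> s - \<eta> s) \<omega> = W \<xi> \<omega> - W \<eta> \<omega>"
  using W_add[OF assms(1) in_L2_mult_left[OF assms(2), of "-1"]] W_scale[OF assms(2), of "-1"]
  by eventually_elim simp

lemma W_tendsto:
  assumes \<xi>: "L2_tendsto leb01 \<xi> \<eta>"
  shows "L2_tendsto M (\<lambda>k. W (\<xi> k)) (W \<eta>)"
proof -
  note L2 = L2_tendsto_in_L2[OF \<xi>]
  have "sqn M (\<lambda>\<omega>. W (\<xi> k) \<omega> - W \<eta> \<omega>) = sqn leb01 (\<lambda>s. \<xi> k s - \<eta> s)" for k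
  proof -
    have "sqn M (\<lambda>\<omega>. W (\<xi> k) \<omega> - W \<eta> \<omega>) = sqn M (W (\<lambda>s. \<xi> k s - \<eta> s))"
      by (rule sqn_cong_AE) (use W_diff[OF L2(1)[of k] L2(2)] in \<open>auto elim: eventually_mono\<close>)
    then show ?thesis by (simp add: W_isometry in_L2_diff L2)
  qed
  then show ?thesis using \<xi> by (simp add: L2_tendsto_iff_sqn in_L2_W)
qed

lemma has_wiener_integral_indicator:
  assumes t: "0 \<le> t" "t \<le> 1"
  shows "has_wiener_integral M B (indicator {0<..t}) (B t)"
proof -
  have v: "valid_steps [(1::real, 0, t)]" using t by simp
  have "has_wiener_integral M B (step_fun [(1::real, 0, t)]) (step_integral B [(1, 0, t)])"
    by (rule has_wiener_integralI[OF v L2_tendsto_const[OF in_L2_step_fun] L2_tendsto_const[OF in_L2_step_integral[OF v]]])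
  moreover have "step_fun [(1::real, 0, t)] = indicator {0<..t}" by (auto simp: fun_eq_iff)
  moreover have "AE \<omega> in M. B t \<omega> = step_integral B [(1, 0, t)] \<omega>"
    using BM by (intro AE_I2) (auto simp: brownian_motion_def)
  moreover have "indicator {0<..t} \<in> borel_measurable leb01" by (rule borel_measurable_leb01) simp
  ultimately show ?thesis
    using has_wiener_integral_cong_AE[of B "indicator {0<..t}" "step_integral B [(1, 0, t)]" "indicator {0<..t}" "B t"]
      B_measurable[OF t] by simp
qed

end

section \<open>Tensor products\<close>

context prob_space
begin

abbreviation P :: "('a \<times> real) measure"
  where "P \<equiv> M \<Otimes>\<^sub>M leb01"

lemma sigma_finite_leb01: "sigma_finite_measure leb01"
  using finite_measure_leb01 by (simp add: finite_measure_def)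

lemma pair_sigma_finite_P: "pair_sigma_finite M leb01"
  by (intro pair_sigma_finite.intro sigma_finite_measure_axioms sigma_finite_leb01)

lemma sqn_tensor:
  fixes F :: "'a \<Rightarrow> 'b::euclidean_space" and h :: "real \<Rightarrow> real"
  assumes [measurable]: "F \<in> borel_measurable M" "h \<in> borel_measurable leb01"
  shows "sqn P (\<lambda>p. h (snd p) *\<^sub>R F (fst p)) = sqn leb01 h * sqn M F"
proof -
  interpret leb: sigma_finite_measure leb01 by (rule sigma_finite_leb01)
  have "sqn P (\<lambda>p. h (snd p) *\<^sub>R F (fst p)) = (\<integral>\<^sup>+\<omega>. \<integral>\<^sup>+s. ennreal ((norm (h s *\<^sub>R F \<omega>))\<^sup>2) \<partial>leb01 \<partial>M)"
    unfolding sqn_def by (subst leb.nn_integral_fst[symmetric]) auto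
  also have "\<dots> = (\<integral>\<^sup>+\<omega>. \<integral>\<^sup>+s. ennreal ((norm (F \<omega>))\<^sup>2) * ennreal ((norm (h s))\<^sup>2) \<partial>leb01 \<partial>M)"
    by (simp add: power_mult_distrib ennreal_mult mult.commute)
  also have "\<dots> = sqn leb01 h * sqn M F"
    unfolding sqn_def by (simp add: nn_integral_cmult nn_integral_multc mult.commute)
  finally show ?thesis .
qed

lemma in_L2_tensor:
  fixes F :: "'a \<Rightarrow> 'b::euclidean_space" and h :: "real \<Rightarrow> real"
  assumes "in_L2 M F" "in_L2 leb01 h"
  shows "in_L2 P (\<lambda>p. h (snd p) *\<^sub>R F (fst p))"
proof -
  have [measurable]: "F \<in> borel_measurable M" "h \<in> borel_measurable leb01" using assms by (auto simp: in_L2_def)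
  have "sqn P (\<lambda>p. h (snd p) *\<^sub>R F (fst p)) < \<infinity>"
    using assms by (simp add: sqn_tensor in_L2_iff_sqn ennreal_mult_less_top)
  then show ?thesis by (simp add: in_L2_iff_sqn)
qed

lemma L2_tendsto_tensor:
  fixes F :: "nat \<Rightarrow> 'a \<Rightarrow> 'b::euclidean_space" and h :: "real \<Rightarrow> real"
  assumes F: "L2_tendsto M F Z" and h: "in_L2 leb01 h"
  shows "L2_tendsto P (\<lambda>k p. h (snd p) *\<^sub>R F k (fst p)) (\<lambda>p. h (snd p) *\<^sub>R Z (fst p))"
proof (rule L2_tendsto_le[OF F])
  note L2 = L2_tendsto_in_L2[OF F]
  have [measurable]: "h \<in> borel_measurable leb01" "F k \<in> borel_measurable M" "Z \<in> borel_measurable M" for k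
    using h L2 by (auto simp: in_L2_def)
  show "in_L2 P (\<lambda>p. h (snd p) *\<^sub>R F k (fst p))" "in_L2 P (\<lambda>p. h (snd p) *\<^sub>R Z (fst p))" for k
    by (intro in_L2_tensor L2 h)+
  show "sqn P (\<lambda>p. h (snd p) *\<^sub>R F k (fst p) - h (snd p) *\<^sub>R Z (fst p))
      \<le> ennreal (LINT s|leb01. (norm (h s))\<^sup>2) * sqn M (\<lambda>\<omega>. F k \<omega> - Z \<omega>)" for k
    using sqn_tensor[of "\<lambda>\<omega>. F k \<omega> - Z \<omega>" h] sqn_eq_integral[OF h] by (simp add: scaleR_diff_right)
qed

lemma integral_tensor:
  fixes F :: "'a \<Rightarrow> 'b::euclidean_space" and h :: "real \<Rightarrow> real"
  assumes F: "integrable M F" and h: "integrable leb01 h"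
  shows "(LINT p|P. h (snd p) *\<^sub>R F (fst p)) = (LINT s|leb01. h s) *\<^sub>R (LINT \<omega>|M. F \<omega>)"
proof -
  interpret pair_sigma_finite M leb01 by (rule pair_sigma_finite_P)
  have [measurable]: "F \<in> borel_measurable M" "h \<in> borel_measurable leb01" using assms by auto
  have "integrable P (\<lambda>p. h (snd p) *\<^sub>R F (fst p))"
  proof (rule Fubini_integrable)
    show "integrable M (\<lambda>\<omega>. LINT s|leb01. norm (h (snd (\<omega>, s)) *\<^sub>R F (fst (\<omega>, s))))" using F by simp
    show "AE \<omega> in M. integrable leb01 (\<lambda>s. h (snd (\<omega>, s)) *\<^sub>R F (fst (\<omega>, s)))" using h by simp
  qed measurable
  from integral_fst'[OF this] show ?thesis using h F by simp
qed

text \<open>The predicate need not be measurable, so it is first replaced by the complement of a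
  measurable null set.\<close>

lemma AE_fst_P:
  assumes "AE \<omega> in M. Q \<omega>"
  shows "AE p in P. Q (fst p)"
proof -
  interpret pair_sigma_finite M leb01 by (rule pair_sigma_finite_P)
  obtain N where N: "{\<omega> \<in> space M. \<not> Q \<omega>} \<subseteq> N" "emeasure M N = 0" "N \<in> sets M"
    using assms by (rule AE_E)
  have [measurable]: "N \<in> sets M" by fact
  have "AE \<omega> in M. \<omega> \<notin> N" by (rule AE_I[of _ _ N]) (use N in auto)
  then have "AE p in P. fst p \<notin> N"
    by (intro AE_pair_measure) (auto elim: eventually_mono)
  then show ?thesis using AE_space
  proof eventually_elim
    fix p assume "fst p \<notin> N" "p \<in> space P"
    then show "Q (fst p)" using N(1) by (auto simp: space_pair_measure)
  qed
qed

lemma in_L2_const: "in_L2 M (\<lambda>_. c)"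
  by (simp add: in_L2_def)

lemma iterated_integral_P:
  fixes U :: "'a \<times> real \<Rightarrow> 'b::euclidean_space"
  assumes "integrable P U"
  shows "(LINT \<omega>|M. LINT s|leb01. U (\<omega>, s)) = (LINT p|P. U p)"
proof -
  interpret pair_sigma_finite M leb01 by (rule pair_sigma_finite_P)
  show ?thesis by (rule integral_fst'[OF assms])
qed

end


section \<open>Exponential functionals\<close>

context brownian
begin

abbreviation e :: "(real \<Rightarrow> real) \<Rightarrow> 'a \<Rightarrow> complex"
  where "e \<equiv> exp_functional M B"

abbreviation ip :: "(real \<Rightarrow> real) \<Rightarrow> (real \<Rightarrow> real) \<Rightarrow> real"
  where "ip \<xi> \<eta> \<equiv> LINT s|leb01. \<xi> s * \<eta> s"

lemma e_def: "e \<xi> \<omega> = iexp (W \<xi> \<omega>)"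
  by (simp add: exp_functional_def)

lemma norm_e [simp]: "cmod (e \<xi> \<omega>) = 1"
  by (simp add: e_def)

lemma e_measurable [measurable]: "in_L2 leb01 \<xi> \<Longrightarrow> e \<xi> \<in> borel_measurable M"
  unfolding e_def[abs_def] by measurable

lemma in_L2_e: "in_L2 leb01 \<xi> \<Longrightarrow> in_L2 M (e \<xi>)"
  by (rule in_L2_bounded[OF finite_measure_axioms, where C=1]) auto

text \<open>The Gaussian characteristic function at 1. Since products of exponentials are again
  exponentials, the expectations of products below reduce to this formula.\<close>

lemma integral_e: "in_L2 leb01 \<xi> \<Longrightarrow> (LINT \<omega>|M. e \<xi> \<omega>) = complex_of_real (exp (- ip \<xi> \<xi> / 2))"
  using gaussian_char[OF W_gaussian, of \<xi> 1] by (simp add: e_def power2_eq_square)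

lemma e_add:
  assumes "in_L2 leb01 \<xi>" "in_L2 leb01 \<eta>"
  shows "AE \<omega> in M. e (\<lambda>s. \<xi> s + \<eta> s) \<omega> = e \<xi> \<omega> * e \<eta> \<omega>"
  using W_add[OF assms] by eventually_elim (simp add: e_def distrib_left exp_add)

lemma e_minus:
  assumes "in_L2 leb01 \<xi>"
  shows "AE \<omega> in M. e (\<lambda>s. - \<xi> s) \<omega> = cnj (e \<xi> \<omega>)"
  using W_scale[OF assms, of "-1"] by eventually_elim (simp add: e_def exp_cnj)

lemma e_zero: "AE \<omega> in M. e (\<lambda>s. 0) \<omega> = 1"
  using W_scale[OF in_L2_zero, of 0] by eventually_elim (simp add: e_def)

lemma ip_commute: "ip \<xi> \<eta> = ip \<eta> \<xi>"
  by (simp add: mult.commute)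

lemma ip_add_scaled:
  assumes "in_L2 leb01 \<xi>" "in_L2 leb01 \<eta>"
  shows "ip (\<lambda>s. \<xi> s + c * \<eta> s) (\<lambda>s. \<xi> s + c * \<eta> s) = ip \<xi> \<xi> + 2 * c * ip \<xi> \<eta> + c\<^sup>2 * ip \<eta> \<eta>"
proof -
  note i = in_L2_mult(1)[OF assms(1) assms(1)] in_L2_mult(1)[OF assms(1) assms(2)] in_L2_mult(1)[OF assms(2) assms(2)]
  have "ip (\<lambda>s. \<xi> s + c * \<eta> s) (\<lambda>s. \<xi> s + c * \<eta> s)
      = (LINT s|leb01. \<xi> s * \<xi> s + 2 * c * (\<xi> s * \<eta> s) + c\<^sup>2 * (\<eta> s * \<eta> s))"
    by (simp add: algebra_simps power2_eq_square)
  then show ?thesis using i by simp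
qed

lemma norm_iexp_taylor2: "cmod (iexp y - (1 + \<i> * y)) \<le> y\<^sup>2 / 2"
proof -
  have "(\<Sum>k\<le>1. (\<i> * complex_of_real y) ^ k / fact k) = 1 + \<i> * y" by simp
  moreover have "\<bar>y\<bar> ^ Suc 1 / fact (Suc 1) = y\<^sup>2 / 2" by (simp add: power2_eq_square)
  ultimately show ?thesis using iexp_approx1[of y 1] by (simp only:)
qed

text \<open>Bounded replacement for a factor \<open>x\<close>: the difference quotient of \<open>t \<mapsto> - \<i> e\<^bsup>itx\<^esup>\<close> at 0 with step \<open>1/(k+1)\<close>.\<close>

definition dq :: "nat \<Rightarrow> real \<Rightarrow> complex"
  where "dq k x = - \<i> * of_nat (Suc k) * (iexp (x / real (Suc k)) - 1)"

lemma norm_dq: "cmod (dq k x) \<le> \<bar>x\<bar>"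
proof -
  have "cmod (iexp (x / real (Suc k)) - 1) \<le> \<bar>x / real (Suc k)\<bar>"
    using iexp_approx1[of "x / real (Suc k)" 0] by simp
  then have "real (Suc k) * cmod (iexp (x / real (Suc k)) - 1) \<le> real (Suc k) * \<bar>x / real (Suc k)\<bar>"
    by (intro mult_left_mono) auto
  then show ?thesis unfolding dq_def norm_mult norm_minus_cancel norm_of_nat norm_ii
    by (simp add: abs_divide del: of_nat_Suc)
qed

lemma dq_tendsto: "(\<lambda>k. dq k x) \<longlonglongrightarrow> complex_of_real x"
proof -
  have "cmod (dq k x - x) \<le> x\<^sup>2 * inverse (real (Suc k))" for k
  proof -
    have k: "complex_of_real (real (Suc k)) \<noteq> 0" by (simp del: of_nat_Suc)
    have "dq k x - x = - \<i> * of_nat (Suc k) * (iexp (x / real (Suc k)) - (1 + \<i> * (x / real (Suc k))))"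
      using k by (simp add: dq_def right_diff_distrib distrib_left del: of_nat_Suc)
    then have "cmod (dq k x - x) = real (Suc k) * cmod (iexp (x / real (Suc k)) - (1 + \<i> * (x / real (Suc k))))"
      by (simp only: norm_mult norm_minus_cancel norm_of_nat norm_ii mult_1)
    also have "\<dots> \<le> real (Suc k) * ((x / real (Suc k))\<^sup>2 / 2)"
      by (intro mult_left_mono norm_iexp_taylor2) simp
    also have "\<dots> \<le> x\<^sup>2 * inverse (real (Suc k))"
      by (simp add: power2_eq_square divide_simps del: of_nat_Suc)
    finally show ?thesis .
  qed
  then have "\<forall>\<^sub>F k in sequentially. cmod (dq k x - x) \<le> x\<^sup>2 * inverse (real (Suc k))"
    by (intro always_eventually allI)
  from Lim_null_comparison[OF this tendsto_mult_right_zero[OF LIMSEQ_inverse_real_of_nat]]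
  have "(\<lambda>k. dq k x - x) \<longlonglongrightarrow> 0" .
  then show ?thesis by (simp add: LIM_zero_iff)
qed

text \<open>A combination of two exponentials reproduces \<open>e \<zeta>\<close> times a bounded
  substitute for \<open>W \<eta>\<close>; in this way unbounded factors are reached from inside the
  span.\<close>

lemma dq_e:
  assumes "in_L2 leb01 \<eta>" "in_L2 leb01 \<zeta>"
  shows "AE \<omega> in M. - \<i> * of_nat (Suc k) * (e (\<lambda>s. \<zeta> s + 1 / real (Suc k) * \<eta> s) \<omega> - e \<zeta> \<omega>) = dq k (W \<eta> \<omega>) * e \<zeta> \<omega>"
  using e_add[OF assms(2) in_L2_mult_left[OF assms(1), of "1 / real (Suc k)"]] W_scale[OF assms(1), of "1 / real (Suc k)"]
proof eventually_elim
  fix \<omega>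
  assume 1: "e (\<lambda>s. \<zeta> s + 1 / real (Suc k) * \<eta> s) \<omega> = e \<zeta> \<omega> * e (\<lambda>s. 1 / real (Suc k) * \<eta> s) \<omega>"
    and 2: "W (\<lambda>s. 1 / real (Suc k) * \<eta> s) \<omega> = 1 / real (Suc k) * W \<eta> \<omega>"
  have "e (\<lambda>s. 1 / real (Suc k) * \<eta> s) \<omega> = iexp (W \<eta> \<omega> / real (Suc k))"
    unfolding e_def 2 by simp
  then show "- \<i> * of_nat (Suc k) * (e (\<lambda>s. \<zeta> s + 1 / real (Suc k) * \<eta> s) \<omega> - e \<zeta> \<omega>) = dq k (W \<eta> \<omega>) * e \<zeta> \<omega>"
    unfolding 1 dq_def by (simp add: algebra_simps)
qed

lemma dq_measurable [measurable]: "dq k \<in> borel_measurable borel"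
  unfolding dq_def[abs_def] by measurable

text \<open>Gaussian integration by parts, obtained by differentiating the expectation of
  \<open>e (\<zeta> + c \<eta>)\<close> in \<open>c\<close> at 0. The bound \<open>norm_dq\<close>
  makes \<open>\<bar>W \<eta>\<bar>\<close> a dominating function for the difference
  quotients.\<close>

lemma integral_W_e:
  assumes \<eta>: "in_L2 leb01 \<eta>" and \<zeta>: "in_L2 leb01 \<zeta>"
  shows "(LINT \<omega>|M. W \<eta> \<omega> * e \<zeta> \<omega>) = \<i> * ip \<eta> \<zeta> * (LINT \<omega>|M. e \<zeta> \<omega>)"
proof -
  have [measurable]: "e \<zeta> \<in> borel_measurable M" "W \<eta> \<in> borel_measurable M" using \<eta> \<zeta> by auto
  have "integrable M (W \<eta>)" by (rule in_L2_integrable[OF finite_measure_axioms in_L2_W[OF \<eta>]])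
  then have 1: "(\<lambda>k. LINT \<omega>|M. dq k (W \<eta> \<omega>) * e \<zeta> \<omega>) \<longlonglongrightarrow> (LINT \<omega>|M. W \<eta> \<omega> * e \<zeta> \<omega>)"
    by (intro integral_dominated_convergence[where w="\<lambda>\<omega>. \<bar>W \<eta> \<omega>\<bar>"])
      (auto simp: norm_mult norm_dq intro!: tendsto_mult_right dq_tendsto)
  \<comment> \<open>\<open>f c\<close> is the expectation of the exponential with integrand
    \<open>\<zeta> + c * \<eta>\<close>, so the integrals of the quotients become difference
    quotients of a real function.\<close>
  define f where "f c = exp (- (ip \<zeta> \<zeta> + 2 * c * ip \<zeta> \<eta> + c\<^sup>2 * ip \<eta> \<eta>) / 2)" for c
  have eq: "(LINT \<omega>|M. dq k (W \<eta> \<omega>) * e \<zeta> \<omega>) = - \<i> * ((f (inverse (real (Suc k))) - f 0) / inverse (real (Suc k)))" for k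
  proof -
    let ?\<zeta> = "\<lambda>s. \<zeta> s + 1 / real (Suc k) * \<eta> s"
    have z: "in_L2 leb01 ?\<zeta>" by (intro in_L2_add in_L2_mult_left \<eta> \<zeta>)
    have i: "integrable M (e \<zeta>)" "integrable M (e ?\<zeta>)"
      by (intro in_L2_integrable finite_measure_axioms in_L2_e \<zeta> z)+
    have [measurable]: "e ?\<zeta> \<in> borel_measurable M" using z by (rule e_measurable)
    have "(LINT \<omega>|M. dq k (W \<eta> \<omega>) * e \<zeta> \<omega>) = (LINT \<omega>|M. - \<i> * of_nat (Suc k) * (e ?\<zeta> \<omega> - e \<zeta> \<omega>))"
    proof (rule integral_cong_AE)
      show "AE \<omega> in M. dq k (W \<eta> \<omega>) * e \<zeta> \<omega> = - \<i> * of_nat (Suc k) * (e ?\<zeta> \<omega> - e \<zeta> \<omega>)"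
        using dq_e[OF \<eta> \<zeta>, of k] by eventually_elim (rule sym)
    qed measurable
    also have "\<dots> = - \<i> * of_nat (Suc k) * ((LINT \<omega>|M. e ?\<zeta> \<omega>) - (LINT \<omega>|M. e \<zeta> \<omega>))"
      using i by (simp del: of_nat_Suc)
    also have "(LINT \<omega>|M. e ?\<zeta> \<omega>) = f (inverse (real (Suc k)))"
      unfolding integral_e[OF z] ip_add_scaled[OF \<zeta> \<eta>] f_def by (simp only: inverse_eq_divide)
    also have "(LINT \<omega>|M. e \<zeta> \<omega>) = f 0" unfolding integral_e[OF \<zeta>] f_def by simp
    finally show ?thesis by (simp add: field_simps del: of_nat_Suc)
  qed
  have "DERIV f 0 :> - ip \<zeta> \<eta> * f 0"
    unfolding f_def by (auto intro!: derivative_eq_intros)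
  then have "((\<lambda>h. (f h - f 0) / h) \<longlongrightarrow> - ip \<zeta> \<eta> * f 0) (at 0)" by (simp add: DERIV_def)
  moreover have "filterlim (\<lambda>k. inverse (real (Suc k))) (at 0) sequentially"
    using LIMSEQ_inverse_real_of_nat by (simp add: filterlim_at)
  ultimately have "(\<lambda>k. (f (inverse (real (Suc k))) - f 0) / inverse (real (Suc k))) \<longlonglongrightarrow> - ip \<zeta> \<eta> * f 0"
    by (rule filterlim_compose)
  then have "(\<lambda>k. - \<i> * complex_of_real ((f (inverse (real (Suc k))) - f 0) / inverse (real (Suc k))))
      \<longlonglongrightarrow> - \<i> * complex_of_real (- ip \<zeta> \<eta> * f 0)"
    by (intro tendsto_intros tendsto_of_real)
  from LIMSEQ_unique[OF 1 this[folded eq]]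
  have "(LINT \<omega>|M. W \<eta> \<omega> * e \<zeta> \<omega>) = - \<i> * complex_of_real (- ip \<zeta> \<eta> * f 0)" .
  moreover have "(LINT \<omega>|M. e \<zeta> \<omega>) = f 0" unfolding integral_e[OF \<zeta>] f_def by simp
  ultimately show ?thesis by (simp add: ip_commute[of \<zeta> \<eta>])
qed


section \<open>Finite sums of exponentials and their gradients\<close>

definition expsum :: "(complex \<times> (real \<Rightarrow> real)) list \<Rightarrow> 'a \<Rightarrow> complex"
  where "expsum ps \<omega> = (\<Sum>(c, \<xi>)\<leftarrow>ps. c * e \<xi> \<omega>)"

definition egrad :: "(real \<Rightarrow> real) \<Rightarrow> 'a \<times> real \<Rightarrow> complex"
  where "egrad \<xi> p = \<xi> (snd p) *\<^sub>R (\<i> * e \<xi> (fst p))"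

text \<open>The gradient is attached to the list and not to the functional it represents; that
  almost surely equal sums have equal gradients is only a consequence of closability.\<close>

definition expgrad :: "(complex \<times> (real \<Rightarrow> real)) list \<Rightarrow> 'a \<times> real \<Rightarrow> complex"
  where "expgrad ps p = (\<Sum>(c, \<xi>)\<leftarrow>ps. c * egrad \<xi> p)"

definition valid_exp :: "(complex \<times> (real \<Rightarrow> real)) list \<Rightarrow> bool"
  where "valid_exp ps \<longleftrightarrow> (\<forall>(c, \<xi>)\<in>set ps. in_L2 leb01 \<xi>)"

lemma exp_simps [simp]:
  "valid_exp []" "valid_exp ((c, \<xi>) # ps) \<longleftrightarrow> in_L2 leb01 \<xi> \<and> valid_exp ps"
  "valid_exp (ps @ qs) \<longleftrightarrow> valid_exp ps \<and> valid_exp qs"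
  "expsum [] \<omega> = 0" "expsum ((c, \<xi>) # ps) \<omega> = c * e \<xi> \<omega> + expsum ps \<omega>"
  "expsum (ps @ qs) \<omega> = expsum ps \<omega> + expsum qs \<omega>"
  "expgrad [] p = 0" "expgrad ((c, \<xi>) # ps) p = c * egrad \<xi> p + expgrad ps p"
  "expgrad (ps @ qs) p = expgrad ps p + expgrad qs p"
  by (simp_all add: valid_exp_def expsum_def expgrad_def ball_Un)

lemma exp_scale:
  "valid_exp (map (\<lambda>(d, \<xi>). (c * d, \<xi>)) ps) \<longleftrightarrow> valid_exp ps"
  "expsum (map (\<lambda>(d, \<xi>). (c * d, \<xi>)) ps) \<omega> = c * expsum ps \<omega>"
  "expgrad (map (\<lambda>(d, \<xi>). (c * d, \<xi>)) ps) p = c * expgrad ps p"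
  by (induction ps) (auto simp: distrib_left mult.assoc)

definition exp_graph :: "(('a \<Rightarrow> complex) \<times> ('a \<times> real \<Rightarrow> complex)) set"
  where "exp_graph = {(expsum ps, expgrad ps) |ps. valid_exp ps}"

abbreviation exp_deriv :: "('a \<Rightarrow> complex) \<Rightarrow> ('a \<times> real \<Rightarrow> complex) \<Rightarrow> bool"
  where "exp_deriv \<equiv> graph_closure M P exp_graph"

lemma in_L2_egrad: "in_L2 leb01 \<xi> \<Longrightarrow> in_L2 P (egrad \<xi>)"
  unfolding egrad_def[abs_def]
  by (intro in_L2_tensor[of "\<lambda>\<omega>. \<i> * e \<xi> \<omega>"] in_L2_mult_left in_L2_e)

lemma in_L2_exp:
  assumes "valid_exp ps"
  shows "in_L2 M (expsum ps)" "in_L2 P (expgrad ps)"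
proof -
  have "in_L2 M (\<lambda>\<omega>. expsum ps \<omega>) \<and> in_L2 P (\<lambda>p. expgrad ps p)"
    using assms
  proof (induction ps)
    case Nil then show ?case by (simp add: in_L2_zero)
  next
    case (Cons q ps)
    obtain c \<xi> where q: "q = (c, \<xi>)" by (cases q) auto
    with Cons show ?case by (auto intro!: in_L2_add in_L2_mult_left in_L2_e in_L2_egrad)
  qed
  then show "in_L2 M (expsum ps)" "in_L2 P (expgrad ps)" by simp_all
qed

lemma exp_deriv_expsum: "valid_exp ps \<Longrightarrow> exp_deriv (expsum ps) (expgrad ps)"
  by (rule graph_closure_base) (auto simp: exp_graph_def intro: in_L2_exp)

lemma exp_deriv_add:
  "exp_deriv Z U \<Longrightarrow> exp_deriv Z' U' \<Longrightarrow> exp_deriv (\<lambda>x. Z x + Z' x) (\<lambda>p. U p + U' p)"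
proof (rule graph_closure_add)
  fix F G F' G' assume "(F, G) \<in> exp_graph" "(F', G') \<in> exp_graph"
  then obtain ps qs where "valid_exp ps" "valid_exp qs" "F = expsum ps" "G = expgrad ps" "F' = expsum qs" "G' = expgrad qs"
    by (auto simp: exp_graph_def)
  then show "(\<lambda>x. F x + F' x, \<lambda>x. G x + G' x) \<in> exp_graph"
    unfolding exp_graph_def by (intro CollectI exI[of _ "ps @ qs"]) (auto simp: fun_eq_iff)
qed

lemma exp_deriv_mult: "exp_deriv Z U \<Longrightarrow> exp_deriv (\<lambda>x. c * Z x) (\<lambda>p. c * U p)"
proof (rule graph_closure_mult)
  fix F G assume "(F, G) \<in> exp_graph"
  then obtain ps where "valid_exp ps" "F = expsum ps" "G = expgrad ps"
    by (auto simp: exp_graph_def)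
  then show "(\<lambda>x. c * F x, \<lambda>x. c * G x) \<in> exp_graph"
    unfolding exp_graph_def by (intro CollectI exI[of _ "map (\<lambda>(d, \<xi>). (c * d, \<xi>)) ps"]) (auto simp: fun_eq_iff exp_scale)
qed

lemma exp_deriv_diff:
  assumes "exp_deriv Z U" "exp_deriv Z' U'"
  shows "exp_deriv (\<lambda>x. Z x - Z' x) (\<lambda>p. U p - U' p)"
  using exp_deriv_add[OF assms(1) exp_deriv_mult[OF assms(2), of "-1"]] by simp

text \<open>Conjugation sends \<open>(c, \<xi>)\<close> to \<open>(cnj c, - \<xi>)\<close>, so
  gradients of sums are stable under it. This upgrades bilinear orthogonality to Hermitian
  orthogonality in the closability proof.\<close>

lemma expgrad_cnj:
  assumes "valid_exp ps"
  shows "\<exists>qs. valid_exp qs \<and> (AE p in P. expgrad qs p = cnj (expgrad ps p))"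
  using assms
proof (induction ps)
  case Nil
  then show ?case by (intro exI[of _ "[]"]) simp
next
  case (Cons q ps)
  obtain c \<xi> where q: "q = (c, \<xi>)" by (cases q) auto
  from Cons obtain qs where qs: "valid_exp qs" "AE p in P. expgrad qs p = cnj (expgrad ps p)" by (auto simp: q)
  have \<xi>: "in_L2 leb01 \<xi>" using Cons by (simp add: q)
  have "AE p in P. e (\<lambda>s. - \<xi> s) (fst p) = cnj (e \<xi> (fst p))"
    by (rule AE_fst_P[OF e_minus[OF \<xi>]])
  with qs(2) have "AE p in P. expgrad ((cnj c, \<lambda>s. - \<xi> s) # qs) p = cnj (expgrad (q # ps) p)"
    by eventually_elim (simp add: q egrad_def)
  then show ?case using qs(1) \<xi> by (intro exI[of _ "(cnj c, \<lambda>s. - \<xi> s) # qs"]) (simp add: in_L2_minus)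
qed

section \<open>Integration by parts and closability of the gradient\<close>

lemma integral_grad_e:
  assumes \<xi>: "in_L2 leb01 \<xi>" and \<eta>: "in_L2 leb01 \<eta>"
  shows "(LINT p|P. egrad \<xi> p * egrad \<eta> p)
    = - ip \<xi> \<eta> * (LINT \<omega>|M. e (\<lambda>s. \<xi> s + \<eta> s) \<omega>)"
proof -
  have "(LINT p|P. egrad \<xi> p * egrad \<eta> p)
      = (LINT p|P. (\<xi> (snd p) * \<eta> (snd p)) *\<^sub>R (- (e \<xi> (fst p) * e \<eta> (fst p))))"
    by (rule Bochner_Integration.integral_cong) (simp_all add: egrad_def scaleR_conv_of_real algebra_simps)
  also have "\<dots> = ip \<xi> \<eta> *\<^sub>R (LINT \<omega>|M. - (e \<xi> \<omega> * e \<eta> \<omega>))"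
    using in_L2_mult(1)[OF in_L2_e[OF \<xi>] in_L2_e[OF \<eta>]]
    by (intro integral_tensor[of "\<lambda>\<omega>. - (e \<xi> \<omega> * e \<eta> \<omega>)" "\<lambda>s. \<xi> s * \<eta> s"] in_L2_mult \<xi> \<eta>) simp
  also have "(LINT \<omega>|M. - (e \<xi> \<omega> * e \<eta> \<omega>)) = - (LINT \<omega>|M. e \<xi> \<omega> * e \<eta> \<omega>)" by simp
  also have "(LINT \<omega>|M. e \<xi> \<omega> * e \<eta> \<omega>) = (LINT \<omega>|M. e (\<lambda>s. \<xi> s + \<eta> s) \<omega>)"
    by (rule integral_cong_AE)
      (use e_add[OF \<xi> \<eta>] \<xi> \<eta> in \<open>auto elim: eventually_mono intro!: borel_measurable_times e_measurable in_L2_add\<close>)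
  finally show ?thesis by (simp add: scaleR_conv_of_real)
qed

text \<open>Minus twice the generator of the Ornstein--Uhlenbeck semigroup, applied to \<open>e \<eta>\<close>.\<close>

definition ou_e :: "(real \<Rightarrow> real) \<Rightarrow> 'a \<Rightarrow> complex"
  where "ou_e \<eta> \<omega> = (\<i> * W \<eta> \<omega> + ip \<eta> \<eta>) * e \<eta> \<omega>"

lemma in_L2_ou_e:
  assumes \<eta>: "in_L2 leb01 \<eta>"
  shows "in_L2 M (ou_e \<eta>)"
proof -
  have "in_L2 M (\<lambda>\<omega>. \<i> * complex_of_real (W \<eta> \<omega>) + ip \<eta> \<eta>)"
    by (intro in_L2_add in_L2_mult_left in_L2_of_real in_L2_W \<eta> in_L2_const)
  then show ?thesis
    unfolding ou_e_def[abs_def]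
    by (rule in_L2_bound[where C=1]) (use \<eta> in \<open>auto simp: norm_mult intro!: borel_measurable_times\<close>)
qed

text \<open>Integrating \<open>W \<eta>\<close> against \<open>e (\<xi> + \<eta>)\<close> produces
  \<open>\<i>\<close> times the inner product of \<eta> with \<open>\<xi> + \<eta>\<close>; the
  constant \<open>ip \<eta> \<eta>\<close> in \<open>ou_e\<close> cancels the diagonal part and
  leaves \<open>- ip \<xi> \<eta>\<close>.\<close>

lemma integral_by_parts_e:
  assumes \<xi>: "in_L2 leb01 \<xi>" and \<eta>: "in_L2 leb01 \<eta>"
  shows "(LINT p|P. egrad \<xi> p * egrad \<eta> p)
    = (LINT \<omega>|M. e \<xi> \<omega> * ou_e \<eta> \<omega>)"
proof -
  let ?\<zeta> = "\<lambda>s. \<xi> s + \<eta> s"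
  have z: "in_L2 leb01 ?\<zeta>" by (intro in_L2_add \<xi> \<eta>)
  have [measurable]: "e \<xi> \<in> borel_measurable M" "e \<eta> \<in> borel_measurable M" "e ?\<zeta> \<in> borel_measurable M" "W \<eta> \<in> borel_measurable M"
    using \<xi> \<eta> z by auto
  have "(LINT \<omega>|M. e \<xi> \<omega> * ou_e \<eta> \<omega>) = (LINT \<omega>|M. \<i> * (complex_of_real (W \<eta> \<omega>) * e ?\<zeta> \<omega>) + ip \<eta> \<eta> * e ?\<zeta> \<omega>)"
  proof (rule integral_cong_AE)
    show "AE \<omega> in M. e \<xi> \<omega> * ou_e \<eta> \<omega> = \<i> * (complex_of_real (W \<eta> \<omega>) * e ?\<zeta> \<omega>) + ip \<eta> \<eta> * e ?\<zeta> \<omega>"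
      using e_add[OF \<xi> \<eta>] by eventually_elim (simp only: ou_e_def distrib_left distrib_right mult_ac)
    show "(\<lambda>\<omega>. e \<xi> \<omega> * ou_e \<eta> \<omega>) \<in> borel_measurable M" unfolding ou_e_def by measurable
  qed measurable
  also have "\<dots> = \<i> * (LINT \<omega>|M. complex_of_real (W \<eta> \<omega>) * e ?\<zeta> \<omega>) + ip \<eta> \<eta> * (LINT \<omega>|M. e ?\<zeta> \<omega>)"
    using in_L2_mult(1)[OF in_L2_of_real[OF in_L2_W[OF \<eta>]] in_L2_e[OF z]]
      in_L2_integrable[OF finite_measure_axioms in_L2_e[OF z]] by simp
  also have "\<dots> = (ip \<eta> \<eta> - ip \<eta> ?\<zeta>) * (LINT \<omega>|M. e ?\<zeta> \<omega>)"
    unfolding integral_W_e[OF \<eta> z] by (simp add: algebra_simps)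
  also have "ip \<eta> \<eta> - ip \<eta> ?\<zeta> = - ip \<xi> \<eta>"
    using in_L2_mult(1)[OF \<eta> \<xi>] in_L2_mult(1)[OF \<eta> \<eta>] by (simp add: distrib_left mult.commute)
  finally show ?thesis unfolding integral_grad_e[OF \<xi> \<eta>] by simp
qed

lemma integral_by_parts:
  assumes ps: "valid_exp ps" and \<eta>: "in_L2 leb01 \<eta>"
  shows "(LINT p|P. expgrad ps p * egrad \<eta> p) = (LINT \<omega>|M. expsum ps \<omega> * ou_e \<eta> \<omega>)"
  using ps
proof (induction ps)
  case (Cons q ps)
  obtain c \<xi> where q: "q = (c, \<xi>)" by (cases q) auto
  have \<xi>: "in_L2 leb01 \<xi>" and ps: "valid_exp ps" using Cons by (auto simp: q)
  note i = in_L2_mult(1)[OF in_L2_exp(2)[OF ps] in_L2_egrad[OF \<eta>]] in_L2_mult(1)[OF in_L2_egrad[OF \<xi>] in_L2_egrad[OF \<eta>]]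
    in_L2_mult(1)[OF in_L2_exp(1)[OF ps] in_L2_ou_e[OF \<eta>]] in_L2_mult(1)[OF in_L2_e[OF \<xi>] in_L2_ou_e[OF \<eta>]]
  have "(LINT p|P. expgrad (q # ps) p * egrad \<eta> p)
      = (LINT p|P. c * (egrad \<xi> p * egrad \<eta> p)
          + expgrad ps p * egrad \<eta> p)"
    by (rule Bochner_Integration.integral_cong) (simp_all only: q exp_simps distrib_right mult.assoc)
  also have "\<dots> = c * (LINT p|P. egrad \<xi> p * egrad \<eta> p)
      + (LINT p|P. expgrad ps p * egrad \<eta> p)"
    using i by (subst Bochner_Integration.integral_add) auto
  also have "\<dots> = c * (LINT \<omega>|M. e \<xi> \<omega> * ou_e \<eta> \<omega>) + (LINT \<omega>|M. expsum ps \<omega> * ou_e \<eta> \<omega>)"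
    unfolding integral_by_parts_e[OF \<xi> \<eta>] Cons(1)[OF ps] ..
  also have "\<dots> = (LINT \<omega>|M. c * (e \<xi> \<omega> * ou_e \<eta> \<omega>) + expsum ps \<omega> * ou_e \<eta> \<omega>)"
    using i by (subst Bochner_Integration.integral_add) auto
  also have "\<dots> = (LINT \<omega>|M. expsum (q # ps) \<omega> * ou_e \<eta> \<omega>)"
    by (rule Bochner_Integration.integral_cong) (simp_all only: q exp_simps distrib_right mult.assoc)
  finally show ?case .
qed simp

text \<open>Integration by parts moves the gradient off the sequence that tends to 0, so its limit
  \<open>V\<close> is orthogonal to all gradients of exponential sums. But \<open>V\<close> is
  itself a limit of such gradients, hence zero.\<close>

lemma exp_deriv_closable:
  assumes V: "exp_deriv (\<lambda>_. 0) V"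
  shows "AE p in P. V p = 0"
proof -
  obtain F G where FG: "\<And>k. (F k, G k) \<in> exp_graph" "L2_tendsto M F (\<lambda>_. 0)" "L2_tendsto P G V"
    using graph_closureE[OF V] by blast
  have "\<exists>ps. valid_exp ps \<and> F k = expsum ps \<and> G k = expgrad ps" for k
    using FG(1)[of k] by (auto simp: exp_graph_def)
  then obtain ps where ps: "\<And>k. valid_exp (ps k)" "\<And>k. F k = expsum (ps k)" "\<And>k. G k = expgrad (ps k)" by metis
  have V2: "in_L2 P V" using FG(3) by (rule L2_tendsto_in_L2)
  have orth1: "(LINT p|P. V p * egrad \<eta> p) = 0" if \<eta>: "in_L2 leb01 \<eta>" for \<eta>
  proof -
    have "(\<lambda>k. LINT p|P. G k p * egrad \<eta> p) \<longlonglongrightarrow> (LINT p|P. V p * egrad \<eta> p)"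
      by (intro L2_tendsto_integral_mult FG L2_tendsto_const in_L2_egrad \<eta>)
    moreover have "(\<lambda>k. LINT \<omega>|M. F k \<omega> * ou_e \<eta> \<omega>) \<longlonglongrightarrow> (LINT \<omega>|M. 0 * ou_e \<eta> \<omega>)"
      by (intro L2_tendsto_integral_mult FG L2_tendsto_const in_L2_ou_e \<eta>)
    moreover have "(LINT p|P. G k p * egrad \<eta> p) = (LINT \<omega>|M. F k \<omega> * ou_e \<eta> \<omega>)" for k
      unfolding ps by (rule integral_by_parts[OF ps(1) \<eta>])
    ultimately have "(LINT p|P. V p * egrad \<eta> p) = (LINT \<omega>|M. 0 * ou_e \<eta> \<omega>)"
      by (intro LIMSEQ_unique[of "\<lambda>k. LINT p|P. G k p * egrad \<eta> p"]) simp_all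
    then show ?thesis by simp
  qed
  have orth2: "(LINT p|P. V p * expgrad qs p) = 0" if "valid_exp qs" for qs
    using that
  proof (induction qs)
    case (Cons q qs)
    obtain c \<xi> where q: "q = (c, \<xi>)" by (cases q) auto
    have \<xi>: "in_L2 leb01 \<xi>" and qs: "valid_exp qs" using Cons by (auto simp: q)
    note i = in_L2_mult(1)[OF V2 in_L2_egrad[OF \<xi>]] in_L2_mult(1)[OF V2 in_L2_exp(2)[OF qs]]
    have "(LINT p|P. V p * expgrad (q # qs) p)
        = (LINT p|P. c * (V p * egrad \<xi> p) + V p * expgrad qs p)"
      by (rule Bochner_Integration.integral_cong) (simp_all only: q exp_simps distrib_left mult_ac)
    also have "\<dots> = 0"
      using i Cons(1)[OF qs] orth1[OF \<xi>] by (subst Bochner_Integration.integral_add) auto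
    finally show ?case .
  qed simp
  \<comment> \<open>The bilinear pairing of \<open>V\<close> with itself could vanish for nonzero
    complex \<open>V\<close>; pairing with the conjugates of \<open>G k\<close>, which are gradients
    as well, yields the squared norm in the limit.\<close>
  have "(LINT p|P. V p * cnj (G k p)) = 0" for k
  proof -
    obtain qs where qs: "valid_exp qs" "AE p in P. expgrad qs p = cnj (G k p)"
      using expgrad_cnj[OF ps(1)[of k]] by (auto simp: ps)
    have [measurable]: "V \<in> borel_measurable P" "G k \<in> borel_measurable P" "expgrad qs \<in> borel_measurable P"
      using V2 L2_tendsto_in_L2(1)[OF FG(3)] in_L2_exp(2)[OF qs(1)] by (auto simp: in_L2_def)
    have "(LINT p|P. V p * cnj (G k p)) = (LINT p|P. V p * expgrad qs p)"
      by (rule integral_cong_AE) (use qs(2) in \<open>auto elim: eventually_mono\<close>)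
    then show ?thesis using orth2[OF qs(1)] by simp
  qed
  moreover have "(\<lambda>k. LINT p|P. V p * cnj (G k p)) \<longlonglongrightarrow> (LINT p|P. V p * cnj (V p))"
    by (intro L2_tendsto_integral_mult L2_tendsto_const V2 L2_tendsto_linear[OF FG(3)]
        bounded_linear.linear[OF bounded_linear_cnj])
  ultimately have "(LINT p|P. V p * cnj (V p)) = 0" by (simp add: LIMSEQ_const_iff)
  moreover have "complex_of_real (LINT p|P. (cmod (V p))\<^sup>2) = (LINT p|P. V p * cnj (V p))"
    by (simp only: integral_complex_of_real[symmetric] complex_norm_square)
  ultimately have "(LINT p|P. (cmod (V p))\<^sup>2) = 0" by simp
  then have "sqn P V = 0" using sqn_eq_integral[OF V2] by simp
  then show ?thesis using V2 by (simp add: sqn_eq_0_iff in_L2_measurable)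
qed

lemma exp_deriv_unique:
  assumes U: "exp_deriv Z U" and V: "exp_deriv Y V" and eq: "AE \<omega> in M. Z \<omega> = Y \<omega>"
  shows "AE p in P. U p = V p"
proof -
  have D: "exp_deriv (\<lambda>x. Z x - Y x) (\<lambda>p. U p - V p)" using U V by (rule exp_deriv_diff)
  have "exp_deriv (\<lambda>_. 0) (\<lambda>p. U p - V p)"
    by (rule graph_closure_cong_AE[OF D]) (use eq graph_closure_in_L2(2)[OF D] in \<open>auto simp: in_L2_def elim: eventually_mono\<close>)
  then have "AE p in P. U p - V p = 0" by (rule exp_deriv_closable)
  then show ?thesis by eventually_elim simp
qed

end

section \<open>Polynomial functionals and the Malliavin derivative\<close>

locale wiener =
  fixes M :: "(real \<Rightarrow> real) measure"
  assumes wiener: "wiener_space M"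
begin

sublocale brownian M coord
  by standard (use wiener in \<open>simp add: wiener_space_def\<close>)

definition valid_poly :: "('b::euclidean_space \<times> (real \<Rightarrow> real) list) list \<Rightarrow> bool"
  where "valid_poly qs \<longleftrightarrow> (\<forall>(c, hs)\<in>set qs. \<forall>h\<in>set hs. in_L2 leb01 h)"

definition poly_graph :: "(((real \<Rightarrow> real) \<Rightarrow> 'b::euclidean_space) \<times> ((real \<Rightarrow> real) \<times> real \<Rightarrow> 'b)) set"
  where "poly_graph = {(polynomial_functional M qs, polynomial_gradient M qs) |qs. valid_poly qs}"

text \<open>In this form the derivative can be compared with the closure of the exponential
  graph.\<close>

lemma has_malliavin_derivative_iff: "has_malliavin_derivative M Z U \<longleftrightarrow> graph_closure M P poly_graph Z U"
proof
  assume "has_malliavin_derivative M Z U"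
  then obtain qs where "\<And>k. valid_poly (qs k)" "L2_tendsto M (\<lambda>k. polynomial_functional M (qs k)) Z"
      "L2_tendsto P (\<lambda>k. polynomial_gradient M (qs k)) U"
    by (auto simp: has_malliavin_derivative_def valid_poly_def)
  then show "graph_closure M P poly_graph Z U"
    by (intro graph_closureI[of "\<lambda>k. polynomial_functional M (qs k)" "\<lambda>k. polynomial_gradient M (qs k)"])
      (auto simp: poly_graph_def)
next
  assume "graph_closure M P poly_graph Z U"
  then obtain F G where FG: "\<And>k. (F k, G k) \<in> poly_graph" "L2_tendsto M F Z" "L2_tendsto P G U"
    using graph_closureE by blast
  have "\<exists>qs. valid_poly qs \<and> F k = polynomial_functional M qs \<and> G k = polynomial_gradient M qs" for k
    using FG(1)[of k] by (auto simp: poly_graph_def)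
  then obtain qs where qs: "\<And>k. valid_poly (qs k)" "\<And>k. F k = polynomial_functional M (qs k)"
      "\<And>k. G k = polynomial_gradient M (qs k)" by metis
  have "F = (\<lambda>k. polynomial_functional M (qs k))" "G = (\<lambda>k. polynomial_gradient M (qs k))"
    using qs by auto
  with FG qs(1) show "has_malliavin_derivative M Z U"
    unfolding has_malliavin_derivative_def valid_poly_def by blast
qed

lemma has_malliavin_derivative_in_L2:
  "has_malliavin_derivative M Z U \<Longrightarrow> in_L2 M Z" "has_malliavin_derivative M Z U \<Longrightarrow> in_L2 P U"
  unfolding has_malliavin_derivative_iff by (auto dest: graph_closure_in_L2)

lemma linear_polynomial:
  assumes g: "linear g"
  shows "polynomial_functional M (map (\<lambda>(c, hs). (g c, hs)) qs) \<omega> = g (polynomial_functional M qs \<omega>)"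
    "polynomial_gradient M (map (\<lambda>(c, hs). (g c, hs)) qs) p = g (polynomial_gradient M qs p)"
  by (induction qs) (auto simp: polynomial_functional_def polynomial_gradient_def linear_0[OF g] linear_add[OF g]
      linear_scale[OF g] case_prod_beta)

text \<open>A linear map acts on the coefficients of polynomials and commutes with the gradient. The
  instances needed are conjugation, the real part and the embedding of the reals.\<close>

lemma has_malliavin_derivative_linear:
  fixes g :: "'b::euclidean_space \<Rightarrow> 'c::euclidean_space"
  assumes D: "has_malliavin_derivative M Z U" and g: "linear g"
  shows "has_malliavin_derivative M (\<lambda>\<omega>. g (Z \<omega>)) (\<lambda>p. g (U p))"
proof -
  obtain F G where FG: "\<And>k. (F k, G k) \<in> poly_graph" "L2_tendsto M F Z" "L2_tendsto P G U"
    using D graph_closureE unfolding has_malliavin_derivative_iff by blast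
  have "((\<lambda>\<omega>. g (F k \<omega>)), (\<lambda>p. g (G k p))) \<in> poly_graph" for k
  proof -
    obtain qs where qs: "valid_poly qs" "F k = polynomial_functional M qs" "G k = polynomial_gradient M qs"
      using FG(1)[of k] by (auto simp: poly_graph_def)
    show ?thesis unfolding poly_graph_def
      by (intro CollectI exI[of _ "map (\<lambda>(c, hs). (g c, hs)) qs"])
        (use qs in \<open>auto simp: fun_eq_iff linear_polynomial[OF g] valid_poly_def\<close>)
  qed
  from graph_closureI[OF this L2_tendsto_linear[OF FG(2) g] L2_tendsto_linear[OF FG(3) g]]
  show ?thesis unfolding has_malliavin_derivative_iff .
qed

lemma poly_simps [simp]:
  "polynomial_functional M [] \<omega> = 0" "polynomial_gradient M [] p = 0" "valid_poly []"
  "polynomial_functional M ((c, hs) # qs) \<omega> = (\<Prod>i<length hs. W (hs ! i) \<omega>) *\<^sub>R c + polynomial_functional M qs \<omega>"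
  "polynomial_gradient M ((c, hs) # qs) p =
    (\<Sum>j<length hs. (hs ! j) (snd p) * (\<Prod>i\<in>{..<length hs} - {j}. W (hs ! i) (fst p))) *\<^sub>R c + polynomial_gradient M qs p"
  "polynomial_functional M (qs @ rs) \<omega> = polynomial_functional M qs \<omega> + polynomial_functional M rs \<omega>"
  "polynomial_gradient M (qs @ rs) p = polynomial_gradient M qs p + polynomial_gradient M rs p"
  "valid_poly ((c, hs) # qs) \<longleftrightarrow> (\<forall>h\<in>set hs. in_L2 leb01 h) \<and> valid_poly qs"
  "valid_poly (qs @ rs) \<longleftrightarrow> valid_poly qs \<and> valid_poly rs"
  by (simp_all add: polynomial_functional_def polynomial_gradient_def valid_poly_def case_prod_beta ball_Un)

lemma poly_graph_add:
  assumes "(F, G) \<in> poly_graph" "(F', G') \<in> poly_graph"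
  shows "(\<lambda>x. F x + F' x, \<lambda>x. G x + G' x) \<in> poly_graph"
proof -
  obtain ps qs where "valid_poly ps" "valid_poly qs" "F = polynomial_functional M ps" "G = polynomial_gradient M ps"
      "F' = polynomial_functional M qs" "G' = polynomial_gradient M qs"
    using assms by (auto simp: poly_graph_def)
  then show ?thesis
    unfolding poly_graph_def by (intro CollectI exI[of _ "ps @ qs"]) (auto simp: fun_eq_iff)
qed

lemma poly_closure_add:
  assumes "graph_closure M P poly_graph Z U" "graph_closure M P poly_graph Z' U'"
  shows "graph_closure M P poly_graph (\<lambda>x. Z x + Z' x) (\<lambda>x. U x + U' x)"
  by (rule graph_closure_add[OF _ assms]) (rule poly_graph_add)

subsection \<open>Exponentials are limits of polynomials\<close>

definition taylor :: "(real \<Rightarrow> real) \<Rightarrow> nat \<Rightarrow> (real \<Rightarrow> real) \<Rightarrow> complex"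
  where "taylor \<xi> n \<omega> = (\<Sum>k<n. (\<i> * W \<xi> \<omega>) ^ k / fact k)"

text \<open>All Taylor polynomials are dominated by \<open>exp \<bar>W \<xi> \<omega>\<bar>\<close>,
  which is square integrable because Gaussian variables have exponential moments.\<close>

lemma taylor_tendsto:
  assumes \<xi>: "in_L2 leb01 \<xi>"
  shows "L2_tendsto M (taylor \<xi>) (e \<xi>)"
proof (rule L2_tendsto_dominated[where g="\<lambda>\<omega>. exp \<bar>W \<xi> \<omega>\<bar>"])
  have [measurable]: "W \<xi> \<in> borel_measurable M" "e \<xi> \<in> borel_measurable M" using \<xi> by auto
  show "taylor \<xi> k \<in> borel_measurable M" for k unfolding taylor_def[abs_def] by measurable
  show "e \<xi> \<in> borel_measurable M" by measurable
  have "(exp \<bar>x\<bar>)\<^sup>2 = exp (2 * \<bar>x\<bar>)" for x :: real by (simp add: power2_eq_square flip: exp_add)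
  then show "in_L2 M (\<lambda>\<omega>. exp \<bar>W \<xi> \<omega>\<bar>)"
    using gaussian_exp_abs[OF W_gaussian[OF \<xi>], of 2] by (simp add: in_L2_def)
  have exp_series: "(\<lambda>k. \<Sum>j<k. y ^ j / fact j) \<longlonglongrightarrow> exp y" for y :: complex
  proof -
    have "y ^ j /\<^sub>R fact j = y ^ j / fact j" for j
      by (simp add: scaleR_conv_of_real divide_inverse mult.commute)
    then show ?thesis using exp_converges[of y] by (simp add: sums_def)
  qed
  show "AE \<omega> in M. (\<lambda>k. taylor \<xi> k \<omega>) \<longlonglongrightarrow> e \<xi> \<omega>"
    unfolding taylor_def e_def by (intro AE_I2 exp_series)
  show "AE \<omega> in M. norm (taylor \<xi> k \<omega>) \<le> exp \<bar>W \<xi> \<omega>\<bar>" for k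
  proof (rule AE_I2)
    fix \<omega>
    have s: "summable (\<lambda>j. \<bar>W \<xi> \<omega>\<bar> ^ j / fact j)"
      using summable_exp[of "\<bar>W \<xi> \<omega>\<bar>"] by (simp add: divide_inverse mult.commute)
    have "norm (taylor \<xi> k \<omega>) \<le> (\<Sum>j<k. norm ((\<i> * W \<xi> \<omega>) ^ j / fact j))"
      unfolding taylor_def by (rule norm_sum)
    also have "\<dots> = (\<Sum>j<k. \<bar>W \<xi> \<omega>\<bar> ^ j / fact j)"
      by (simp add: norm_divide norm_power norm_mult)
    also have "\<dots> \<le> (\<Sum>j. \<bar>W \<xi> \<omega>\<bar> ^ j / fact j)"
      by (rule sum_le_suminf[OF s]) auto
    also have "\<dots> = exp \<bar>W \<xi> \<omega>\<bar>" by (simp add: exp_def divide_inverse mult.commute scaleR_conv_of_real)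
    finally show "norm (taylor \<xi> k \<omega>) \<le> exp \<bar>W \<xi> \<omega>\<bar>" .
  qed
qed

text \<open>Differentiating lowers the degree by one: the gradient of a Taylor polynomial is
  \<open>\<i> * \<xi>\<close> times the preceding one, so one limit theorem serves for the
  functionals and for the gradients.\<close>

lemma taylor_poly:
  fixes \<xi> :: "real \<Rightarrow> real" and n :: nat and c :: complex
  defines "qs \<equiv> map (\<lambda>k. (c * \<i> ^ k / fact k, replicate k \<xi>)) [0..<n]"
  shows "polynomial_functional M qs \<omega> = c * taylor \<xi> n \<omega>"
    and "polynomial_gradient M qs p = c * (\<xi> (snd p) *\<^sub>R (\<i> * taylor \<xi> (n - 1) (fst p)))"
proof -
  have "polynomial_functional M qs \<omega> = (\<Sum>k<n. (\<Prod>i<k. W \<xi> \<omega>) *\<^sub>R (c * \<i> ^ k / fact k))"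
    unfolding qs_def polynomial_functional_def
    by (simp add: o_def interv_sum_list_conv_sum_set_nat atLeast0LessThan)
  also have "\<dots> = c * taylor \<xi> n \<omega>"
    unfolding taylor_def sum_distrib_left by (intro sum.cong) (simp_all add: scaleR_conv_of_real power_mult_distrib)
  finally show "polynomial_functional M qs \<omega> = c * taylor \<xi> n \<omega>" .
  have pr: "(\<Prod>i\<in>{..<k} - {j}. W \<xi> \<omega>) = W \<xi> \<omega> ^ (k - 1)" if "j < k" for j k \<omega>
    using that by simp
  have "polynomial_gradient M qs p
      = (\<Sum>k<n. (\<Sum>j<k. \<xi> (snd p) * (\<Prod>i\<in>{..<k} - {j}. W \<xi> (fst p))) *\<^sub>R (c * \<i> ^ k / fact k))"
    unfolding qs_def polynomial_gradient_def
    by (simp add: o_def interv_sum_list_conv_sum_set_nat atLeast0LessThan case_prod_beta)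
  also have "\<dots> = (\<Sum>k<n. (of_nat k * \<xi> (snd p) * W \<xi> (fst p) ^ (k - 1)) *\<^sub>R (c * \<i> ^ k / fact k))"
    by (intro sum.cong refl arg_cong2[where f=scaleR]) (simp add: pr)
  also have "\<dots> = c * (\<xi> (snd p) *\<^sub>R (\<i> * taylor \<xi> (n - 1) (fst p)))"
  proof (cases n)
    case (Suc m)
    \<comment> \<open>The constant term has no factor to differentiate, so the index is shifted;
      \<open>Suc k / fact (Suc k) = 1 / fact k\<close> then restores the Taylor
      coefficients.\<close>
    have "(\<Sum>k<n. (of_nat k * \<xi> (snd p) * W \<xi> (fst p) ^ (k - 1)) *\<^sub>R (c * \<i> ^ k / fact k))
        = (\<Sum>k<m. (of_nat (Suc k) * \<xi> (snd p) * W \<xi> (fst p) ^ k) *\<^sub>R (c * \<i> ^ Suc k / fact (Suc k)))"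
      unfolding Suc by (subst sum.lessThan_Suc_shift) simp
    also have "\<dots> = (\<Sum>k<m. c * (\<xi> (snd p) *\<^sub>R (\<i> * ((\<i> * W \<xi> (fst p)) ^ k / fact k))))"
    proof (intro sum.cong refl)
      fix k
      have "of_nat (Suc k) / fact (Suc k) = (1 / fact k :: complex)"
        by (simp add: divide_simps del: of_nat_Suc)
      then have *: "of_nat (Suc k) * (x / fact (Suc k)) = x / fact k" for x :: complex
        by (metis (no_types, lifting) mult.left_commute times_divide_eq_right mult.right_neutral)
      have "(of_nat (Suc k) * \<xi> (snd p) * W \<xi> (fst p) ^ k) *\<^sub>R (c * \<i> ^ Suc k / fact (Suc k))
          = of_nat (Suc k) * ((of_real (\<xi> (snd p)) * of_real (W \<xi> (fst p) ^ k) * (c * \<i> ^ Suc k)) / fact (Suc k))"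
        by (simp only: scaleR_conv_of_real of_real_mult of_real_of_nat_eq times_divide_eq_right mult.assoc)
      also have "\<dots> = (of_real (\<xi> (snd p)) * of_real (W \<xi> (fst p) ^ k) * (c * \<i> ^ Suc k)) / fact k" by (rule *)
      also have "\<dots> = c * (\<xi> (snd p) *\<^sub>R (\<i> * ((\<i> * W \<xi> (fst p)) ^ k / fact k)))"
        by (simp add: scaleR_conv_of_real power_mult_distrib mult_ac)
      finally show "(of_nat (Suc k) * \<xi> (snd p) * W \<xi> (fst p) ^ k) *\<^sub>R (c * \<i> ^ Suc k / fact (Suc k))
          = c * (\<xi> (snd p) *\<^sub>R (\<i> * ((\<i> * W \<xi> (fst p)) ^ k / fact k)))" .
    qed
    also have "\<dots> = c * (\<xi> (snd p) *\<^sub>R (\<i> * taylor \<xi> m (fst p)))"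
      by (simp only: taylor_def sum_distrib_left scaleR_sum_right)
    finally show ?thesis by (simp add: Suc)
  qed (simp add: taylor_def)
  finally show "polynomial_gradient M qs p = c * (\<xi> (snd p) *\<^sub>R (\<i> * taylor \<xi> (n - 1) (fst p)))" .
qed

lemma poly_closure_exp_term:
  assumes \<xi>: "in_L2 leb01 \<xi>"
  shows "graph_closure M P poly_graph (\<lambda>\<omega>. c * e \<xi> \<omega>) (\<lambda>p. c * egrad \<xi> p)"
proof (rule graph_closureI)
  show "(\<lambda>\<omega>. c * taylor \<xi> (Suc n) \<omega>, \<lambda>p. c * (\<xi> (snd p) *\<^sub>R (\<i> * taylor \<xi> n (fst p)))) \<in> poly_graph" for n
    unfolding poly_graph_def
    by (intro CollectI exI[of _ "map (\<lambda>k. (c * \<i> ^ k / fact k, replicate k \<xi>)) [0..<Suc n]"])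
      (use \<xi> in \<open>auto simp del: upt_Suc simp: fun_eq_iff taylor_poly valid_poly_def\<close>)
  have "strict_mono Suc" by (simp add: strict_mono_Suc_iff)
  from L2_tendsto_mult_left[OF L2_tendsto_subseq[OF taylor_tendsto[OF \<xi>] this]]
  show "L2_tendsto M (\<lambda>n \<omega>. c * taylor \<xi> (Suc n) \<omega>) (\<lambda>\<omega>. c * e \<xi> \<omega>)" .
  show "L2_tendsto P (\<lambda>n p. c * (\<xi> (snd p) *\<^sub>R (\<i> * taylor \<xi> n (fst p)))) (\<lambda>p. c * egrad \<xi> p)"
    unfolding egrad_def
    by (intro L2_tendsto_mult_left[where F="\<lambda>n p. \<xi> (snd p) *\<^sub>R (\<i> * taylor \<xi> n (fst p))"]
        L2_tendsto_tensor[where F="\<lambda>n \<omega>. \<i> * taylor \<xi> n \<omega>" and Z="\<lambda>\<omega>. \<i> * e \<xi> \<omega>"]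
        L2_tendsto_mult_left taylor_tendsto \<xi>)
qed

lemma poly_closure_exp:
  assumes "(F, G) \<in> exp_graph"
  shows "graph_closure M P poly_graph F G"
proof -
  obtain ps where ps: "valid_exp ps" "F = expsum ps" "G = expgrad ps" using assms by (auto simp: exp_graph_def)
  have "graph_closure M P poly_graph (\<lambda>\<omega>. expsum ps \<omega>) (\<lambda>p. expgrad ps p)"
    using ps(1)
  proof (induction ps)
    case Nil
    have "(\<lambda>_. 0, \<lambda>_. 0) \<in> poly_graph" unfolding poly_graph_def by (intro CollectI exI[of _ "[]"]) auto
    from graph_closure_base[OF this in_L2_zero in_L2_zero] show ?case by simp
  next
    case (Cons q ps)
    obtain c \<xi> where q: "q = (c, \<xi>)" by (cases q) auto
    have "in_L2 leb01 \<xi>" "valid_exp ps" using Cons(2) by (simp_all add: q)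
    from poly_closure_add[OF poly_closure_exp_term[OF this(1), of c] Cons(1)[OF this(2)]]
    show ?case by (simp add: q)
  qed
  then show ?thesis by (simp add: ps)
qed

subsection \<open>Polynomials are limits of exponentials\<close>

text \<open>Recursive forms of the monomial and its gradient. They follow the Leibniz rule factor by
  factor and so suit induction over the list, whereas \<open>polynomial_gradient\<close> deletes an
  index from a product.\<close>

primrec pw :: "(real \<Rightarrow> real) list \<Rightarrow> (real \<Rightarrow> real) \<Rightarrow> real" where
  "pw [] \<omega> = 1"
| "pw (h # hs) \<omega> = W h \<omega> * pw hs \<omega>"

primrec dpw :: "(real \<Rightarrow> real) list \<Rightarrow> (real \<Rightarrow> real) \<times> real \<Rightarrow> real" where
  "dpw [] p = 0"
| "dpw (h # hs) p = h (snd p) * pw hs (fst p) + W h (fst p) * dpw hs p"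

lemma pw_eq_prod: "pw hs \<omega> = (\<Prod>i<length hs. W (hs ! i) \<omega>)"
  by (induction hs) (simp_all add: prod.lessThan_Suc_shift del: prod.lessThan_Suc)

lemma dpw_eq_sum: "dpw hs p = (\<Sum>j<length hs. (hs ! j) (snd p) * (\<Prod>i\<in>{..<length hs} - {j}. W (hs ! i) (fst p)))"
proof (induction hs)
  case (Cons h hs)
  let ?n = "length hs"
  have 0: "{..<Suc ?n} - {0} = Suc ` {..<?n}" by (auto simp: lessThan_Suc_eq_insert_0)
  have S: "{..<Suc ?n} - {Suc j} = insert 0 (Suc ` ({..<?n} - {j}))" for j
    by (auto simp: lessThan_Suc_eq_insert_0)
  have "(\<Sum>j<length (h # hs). ((h # hs) ! j) (snd p) * (\<Prod>i\<in>{..<length (h # hs)} - {j}. W ((h # hs) ! i) (fst p)))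
      = h (snd p) * (\<Prod>i\<in>{..<Suc ?n} - {0}. W ((h # hs) ! i) (fst p))
        + (\<Sum>j<?n. (hs ! j) (snd p) * (\<Prod>i\<in>{..<Suc ?n} - {Suc j}. W ((h # hs) ! i) (fst p)))"
    by (simp add: sum.lessThan_Suc_shift del: prod.lessThan_Suc sum.lessThan_Suc)
  also have "\<dots> = h (snd p) * pw hs (fst p)
        + (\<Sum>j<?n. (hs ! j) (snd p) * (W h (fst p) * (\<Prod>i\<in>{..<?n} - {j}. W (hs ! i) (fst p))))"
    unfolding 0 S by (simp add: prod.reindex pw_eq_prod)
  also have "\<dots> = dpw (h # hs) p" by (simp add: Cons sum_distrib_left mult_ac)
  finally show ?case ..
qed simp

lemma pw_append: "pw (gs @ hs) \<omega> = pw gs \<omega> * pw hs \<omega>"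
  by (induction gs) auto

lemma pw_measurable [measurable (raw)]: "\<forall>h\<in>set hs. in_L2 leb01 h \<Longrightarrow> pw hs \<in> borel_measurable M"
proof (induction hs)
  case Nil
  then show ?case by (simp add: fun_eq_iff[symmetric])
next
  case (Cons h hs)
  have "pw (h # hs) = (\<lambda>\<omega>. W h \<omega> * pw hs \<omega>)" by (simp add: fun_eq_iff)
  then show ?case using Cons by simp
qed

text \<open>One factor is split off by \<open>a b <= a^2 + b^2\<close> with \<open>a\<close> and
  \<open>b\<close> the powers of the two factors. This doubles the exponent, so the induction needs
  all \<open>n\<close>; even exponents keep the terms nonnegative.\<close>

lemma pw_moments: "\<forall>h\<in>set hs. in_L2 leb01 h \<Longrightarrow> integrable M (\<lambda>\<omega>. pw hs \<omega> ^ (2 * n))"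
proof (induction hs arbitrary: n)
  case (Cons h hs)
  have [measurable]: "pw hs \<in> borel_measurable M" "W h \<in> borel_measurable M" using Cons by auto
  have i: "integrable M (\<lambda>\<omega>. W h \<omega> ^ (2 * (2 * n)) + pw hs \<omega> ^ (2 * (2 * n)))"
    by (intro Bochner_Integration.integrable_add gaussian_power[OF W_gaussian] Cons(1)) (use Cons(2) in auto)
  have "norm ((W h \<omega> * pw hs \<omega>) ^ (2 * n)) \<le> norm (W h \<omega> ^ (2 * (2 * n)) + pw hs \<omega> ^ (2 * (2 * n)))" for \<omega>
  proof -
    let ?a = "W h \<omega> ^ (2 * n)" and ?b = "pw hs \<omega> ^ (2 * n)"
    have nonneg: "0 \<le> ?a" "0 \<le> ?b" by (simp_all add: power_mult)
    have "2 * ?a * ?b \<le> ?a\<^sup>2 + ?b\<^sup>2" by (rule sum_squares_bound)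
    moreover have "0 \<le> ?a * ?b" using nonneg by (rule mult_nonneg_nonneg)
    moreover have "?a\<^sup>2 = W h \<omega> ^ (2 * (2 * n))" "?b\<^sup>2 = pw hs \<omega> ^ (2 * (2 * n))"
      by (simp_all only: power_mult[symmetric] mult_ac)
    ultimately show ?thesis by (simp add: power_mult_distrib)
  qed
  then show ?case
    by (intro Bochner_Integration.integrable_bound[OF i]) auto
qed simp

lemma in_L2_pw: "\<forall>h\<in>set hs. in_L2 leb01 h \<Longrightarrow> in_L2 M (pw hs)"
  using pw_moments[of hs 1] by (simp add: in_L2_def pw_measurable)

text \<open>In the Leibniz rule the factor \<open>W h\<close> multiplies the remaining gradient. The
  extra monomial \<open>gs\<close> absorbs it, so that the induction closes.\<close>

lemma in_L2_pw_dpw: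
  "\<forall>h\<in>set hs. in_L2 leb01 h \<Longrightarrow> \<forall>g\<in>set gs. in_L2 leb01 g \<Longrightarrow> in_L2 P (\<lambda>p. pw gs (fst p) * dpw hs p)"
proof (induction hs arbitrary: gs)
  case (Cons h hs)
  have 1: "in_L2 P (\<lambda>p. h (snd p) *\<^sub>R pw (gs @ hs) (fst p))"
    using Cons by (intro in_L2_tensor in_L2_pw) auto
  have 2: "in_L2 P (\<lambda>p. pw (h # gs) (fst p) * dpw hs p)"
    using Cons by (intro Cons(1)) auto
  from in_L2_add[OF 1 2] show ?case
    by (simp add: pw_append algebra_simps)
qed (simp add: in_L2_zero)

lemma in_L2_dpw: "\<forall>h\<in>set hs. in_L2 leb01 h \<Longrightarrow> in_L2 P (dpw hs)"
  using in_L2_pw_dpw[of hs "[]"] by simp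

text \<open>The product rule at the level of quotients: the gradient at the shifted point carries
  the extra integrand \<open>\<eta> / (k + 1)\<close>, whose small factor is cancelled by the
  quotient and leaves \<eta> times the shifted exponential.\<close>

lemma AE_dq_egrad:
  assumes \<eta>: "in_L2 leb01 \<eta>" and \<zeta>: "in_L2 leb01 \<zeta>"
  shows "AE p in P. - \<i> * of_nat (Suc k) * (egrad (\<lambda>s. \<zeta> s + 1 / real (Suc k) * \<eta> s) p - egrad \<zeta> p)
    = dq k (W \<eta> (fst p)) * egrad \<zeta> p + \<eta> (snd p) *\<^sub>R e (\<lambda>s. \<zeta> s + 1 / real (Suc k) * \<eta> s) (fst p)"
  using AE_fst_P[OF dq_e[OF \<eta> \<zeta>, of k]]
proof eventually_elim
  fix p :: "(real \<Rightarrow> real) \<times> real"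
  let ?E = "e (\<lambda>s. \<zeta> s + 1 / real (Suc k) * \<eta> s) (fst p)"
  assume eq: "- \<i> * of_nat (Suc k) * (?E - e \<zeta> (fst p)) = dq k (W \<eta> (fst p)) * e \<zeta> (fst p)"
  have k: "complex_of_nat (Suc k) \<noteq> 0" by (simp del: of_nat_Suc)
  have "- \<i> * of_nat (Suc k) * (egrad (\<lambda>s. \<zeta> s + 1 / real (Suc k) * \<eta> s) p - egrad \<zeta> p)
      = (\<i> * \<zeta> (snd p)) * (- \<i> * of_nat (Suc k) * (?E - e \<zeta> (fst p))) + \<eta> (snd p) * ?E"
    using k by (simp add: egrad_def scaleR_conv_of_real algebra_simps del: of_nat_Suc)
  then show "- \<i> * of_nat (Suc k) * (egrad (\<lambda>s. \<zeta> s + 1 / real (Suc k) * \<eta> s) p - egrad \<zeta> p)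
    = dq k (W \<eta> (fst p)) * egrad \<zeta> p + \<eta> (snd p) *\<^sub>R ?E"
    unfolding eq by (simp add: egrad_def scaleR_conv_of_real mult_ac)
qed

lemma e_diff_tendsto:
  assumes \<eta>: "in_L2 leb01 \<eta>" and \<zeta>: "in_L2 leb01 \<zeta>"
  shows "AE \<omega> in M. (\<lambda>k. e (\<lambda>s. \<zeta> s + 1 / real (Suc k) * \<eta> s) \<omega>) \<longlonglongrightarrow> e \<zeta> \<omega>"
proof -
  have "AE \<omega> in M. \<forall>k. - \<i> * of_nat (Suc k) * (e (\<lambda>s. \<zeta> s + 1 / real (Suc k) * \<eta> s) \<omega> - e \<zeta> \<omega>) = dq k (W \<eta> \<omega>) * e \<zeta> \<omega>"
    using dq_e[OF \<eta> \<zeta>] by (simp only: AE_all_countable) blast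
  then show ?thesis
  proof eventually_elim
    fix \<omega>
    let ?E = "\<lambda>k. e (\<lambda>s. \<zeta> s + 1 / real (Suc k) * \<eta> s) \<omega>"
    assume eq: "\<forall>k. - \<i> * of_nat (Suc k) * (?E k - e \<zeta> \<omega>) = dq k (W \<eta> \<omega>) * e \<zeta> \<omega>"
    have "norm (?E k - e \<zeta> \<omega>) \<le> \<bar>W \<eta> \<omega>\<bar> * inverse (real (Suc k))" for k
    proof -
      have "real (Suc k) * norm (?E k - e \<zeta> \<omega>) = norm (- \<i> * of_nat (Suc k) * (?E k - e \<zeta> \<omega>))"
        by (simp only: norm_mult norm_minus_cancel norm_ii norm_of_nat mult_1)
      also have "\<dots> = norm (dq k (W \<eta> \<omega>))" by (simp only: eq norm_mult norm_e mult_1_right)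
      also have "\<dots> \<le> \<bar>W \<eta> \<omega>\<bar>" by (rule norm_dq)
      finally show ?thesis by (simp add: field_simps del: of_nat_Suc)
    qed
    then have "\<forall>\<^sub>F k in sequentially. norm (?E k - e \<zeta> \<omega>) \<le> \<bar>W \<eta> \<omega>\<bar> * inverse (real (Suc k))"
      by (intro always_eventually allI)
    from Lim_null_comparison[OF this tendsto_mult_right_zero[OF LIMSEQ_inverse_real_of_nat]]
    show "?E \<longlonglongrightarrow> e \<zeta> \<omega>" by (simp only: LIM_zero_iff)
  qed
qed

text \<open>A factor \<open>W h\<close> arises by differentiating \<open>e (\<zeta> + c h)\<close>
  in \<open>c\<close>. The induction hypothesis is therefore needed at \<zeta> and at nearby points,
  and for this reason the monomial is accompanied by an exponential with arbitrary \<zeta>;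
  monomials alone are the case \<open>\<zeta> = 0\<close>.\<close>

lemma exp_deriv_pw:
  assumes "\<forall>h\<in>set hs. in_L2 leb01 h" "in_L2 leb01 \<zeta>"
  shows "exp_deriv (\<lambda>\<omega>. pw hs \<omega> *\<^sub>R e \<zeta> \<omega>) (\<lambda>p. dpw hs p *\<^sub>R e \<zeta> (fst p) + pw hs (fst p) *\<^sub>R egrad \<zeta> p)"
  using assms
proof (induction hs arbitrary: \<zeta>)
  case Nil
  have "exp_deriv (expsum [(1, \<zeta>)]) (expgrad [(1, \<zeta>)])"
    using Nil by (intro exp_deriv_expsum) simp
  then show ?case by (simp add: expsum_def[abs_def] expgrad_def[abs_def])
next
  case (Cons h hs)
  have \<zeta>: "in_L2 leb01 \<zeta>" and h: "in_L2 leb01 h" and hs: "\<forall>g\<in>set hs. in_L2 leb01 g" using Cons by auto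
  define \<zeta>' where "\<zeta>' k s = \<zeta> s + 1 / real (Suc k) * h s" for k s
  have \<zeta>': "in_L2 leb01 (\<zeta>' k)" for k unfolding \<zeta>'_def by (intro in_L2_add in_L2_mult_left \<zeta> h)
  define D where "D \<eta> p = dpw hs p *\<^sub>R e \<eta> (fst p) + pw hs (fst p) *\<^sub>R egrad \<eta> p" for \<eta> p
  define c where "c k = - \<i> * of_nat (Suc k)" for k
  have [measurable]: "pw hs \<in> borel_measurable M" "W h \<in> borel_measurable M" "e \<zeta> \<in> borel_measurable M"
      "e (\<zeta>' k) \<in> borel_measurable M" "dpw hs \<in> borel_measurable P" "egrad \<zeta> \<in> borel_measurable P"
      "h \<in> borel_measurable leb01" for k
    using hs h \<zeta> \<zeta>' in_L2_dpw[OF hs] in_L2_egrad[OF \<zeta>] by (auto simp: in_L2_def)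
  have D: "exp_deriv (\<lambda>\<omega>. pw hs \<omega> *\<^sub>R e \<eta> \<omega>) (D \<eta>)" if "in_L2 leb01 \<eta>" for \<eta>
    using Cons(1)[OF hs that] unfolding D_def .
  have quot: "exp_deriv (\<lambda>\<omega>. c k * (pw hs \<omega> *\<^sub>R e (\<zeta>' k) \<omega> - pw hs \<omega> *\<^sub>R e \<zeta> \<omega>)) (\<lambda>p. c k * (D (\<zeta>' k) p - D \<zeta> p))" for k
    by (intro exp_deriv_mult exp_deriv_diff D \<zeta> \<zeta>')
  \<comment> \<open>\<open>F\<close> and \<open>G\<close> are almost everywhere the quotients in
    \<open>quot\<close>, written so that the growing factor \<open>Suc k\<close> is hidden in
    \<open>dq\<close> and bounds uniform in \<open>k\<close> become visible.\<close>
  define F where "F k \<omega> = pw hs \<omega> *\<^sub>R (dq k (W h \<omega>) * e \<zeta> \<omega>)" for k \<omega>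
  define G where "G k p = dq k (W h (fst p)) * (dpw hs p *\<^sub>R e \<zeta> (fst p) + pw hs (fst p) *\<^sub>R egrad \<zeta> p)
      + (h (snd p) * pw hs (fst p)) *\<^sub>R e (\<zeta>' k) (fst p)" for k p
  have FG: "exp_deriv (F k) (G k)" for k
  proof (rule graph_closure_cong_AE[OF quot])
    show "F k \<in> borel_measurable M" unfolding F_def by measurable
    show "G k \<in> borel_measurable P" unfolding G_def by measurable
    show "AE \<omega> in M. F k \<omega> = c k * (pw hs \<omega> *\<^sub>R e (\<zeta>' k) \<omega> - pw hs \<omega> *\<^sub>R e \<zeta> \<omega>)"
      using dq_e[OF h \<zeta>, of k]
    proof eventually_elim
      fix \<omega> assume eq: "- \<i> * of_nat (Suc k) * (e (\<lambda>s. \<zeta> s + 1 / real (Suc k) * h s) \<omega> - e \<zeta> \<omega>) = dq k (W h \<omega>) * e \<zeta> \<omega>"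
      show "F k \<omega> = c k * (pw hs \<omega> *\<^sub>R e (\<zeta>' k) \<omega> - pw hs \<omega> *\<^sub>R e \<zeta> \<omega>)"
        unfolding F_def eq[symmetric] c_def \<zeta>'_def by (simp add: scaleR_conv_of_real algebra_simps)
    qed
    show "AE p in P. G k p = c k * (D (\<zeta>' k) p - D \<zeta> p)"
      using AE_fst_P[OF dq_e[OF h \<zeta>, of k]] AE_dq_egrad[OF h \<zeta>, of k]
    proof eventually_elim
      fix p :: "(real \<Rightarrow> real) \<times> real"
      assume 1: "- \<i> * of_nat (Suc k) * (e (\<lambda>s. \<zeta> s + 1 / real (Suc k) * h s) (fst p) - e \<zeta> (fst p)) = dq k (W h (fst p)) * e \<zeta> (fst p)"
        and 2: "- \<i> * of_nat (Suc k) * (egrad (\<lambda>s. \<zeta> s + 1 / real (Suc k) * h s) p - egrad \<zeta> p)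
          = dq k (W h (fst p)) * egrad \<zeta> p + h (snd p) *\<^sub>R e (\<lambda>s. \<zeta> s + 1 / real (Suc k) * h s) (fst p)"
      have "c k * (D (\<zeta>' k) p - D \<zeta> p) = dpw hs p *\<^sub>R (c k * (e (\<zeta>' k) (fst p) - e \<zeta> (fst p)))
          + pw hs (fst p) *\<^sub>R (c k * (egrad (\<zeta>' k) p - egrad \<zeta> p))"
        unfolding D_def by (simp add: scaleR_conv_of_real algebra_simps)
      also have "c k * (e (\<zeta>' k) (fst p) - e \<zeta> (fst p)) = dq k (W h (fst p)) * e \<zeta> (fst p)"
        using 1 unfolding c_def \<zeta>'_def[abs_def] .
      also have "c k * (egrad (\<zeta>' k) p - egrad \<zeta> p) = dq k (W h (fst p)) * egrad \<zeta> p + h (snd p) *\<^sub>R e (\<zeta>' k) (fst p)"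
        using 2 unfolding c_def \<zeta>'_def[abs_def] .
      finally show "G k p = c k * (D (\<zeta>' k) p - D \<zeta> p)"
        unfolding G_def by (simp add: scaleR_conv_of_real algebra_simps)
    qed
  qed
  show ?case
  proof (rule graph_closure_closed[OF FG])
    have p2: "in_L2 M (pw (h # hs))" using h hs by (intro in_L2_pw) auto
    have "L2_tendsto M F (\<lambda>\<omega>. pw hs \<omega> *\<^sub>R (complex_of_real (W h \<omega>) * e \<zeta> \<omega>))"
    proof (rule L2_tendsto_dominated[OF _ _ in_L2_norm[OF p2]])
      show "F k \<in> borel_measurable M" for k unfolding F_def by measurable
      show "AE \<omega> in M. norm (F k \<omega>) \<le> norm (pw (h # hs) \<omega>)" for k
        using norm_dq by (intro AE_I2) (auto simp: F_def norm_mult abs_mult mult.commute[of "\<bar>pw hs _\<bar>"] intro!: mult_right_mono)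
      show "AE \<omega> in M. (\<lambda>k. F k \<omega>) \<longlonglongrightarrow> pw hs \<omega> *\<^sub>R (complex_of_real (W h \<omega>) * e \<zeta> \<omega>)"
        unfolding F_def by (intro AE_I2 tendsto_intros dq_tendsto)
    qed measurable
    then show "L2_tendsto M F (\<lambda>\<omega>. pw (h # hs) \<omega> *\<^sub>R e \<zeta> \<omega>)"
      by (simp add: scaleR_conv_of_real mult_ac)
    \<comment> \<open>One summand for each term of \<open>G k\<close>:
      \<open>\<bar>W h\<bar>\<close> replaces \<open>dq\<close> by \<open>norm_dq\<close>, and
      exponentials have modulus 1.\<close>
    define g where "g p = \<bar>pw [h] (fst p) * dpw hs p\<bar> + \<bar>\<zeta> (snd p) *\<^sub>R pw (h # hs) (fst p)\<bar> + \<bar>h (snd p) *\<^sub>R pw hs (fst p)\<bar>" for p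
    have g: "in_L2 P g"
      unfolding g_def real_norm_def[symmetric]
      by (intro in_L2_add in_L2_norm in_L2_pw_dpw in_L2_tensor in_L2_pw \<zeta>) (use h hs in auto)
    have "L2_tendsto P G (\<lambda>p. complex_of_real (W h (fst p)) * (dpw hs p *\<^sub>R e \<zeta> (fst p) + pw hs (fst p) *\<^sub>R egrad \<zeta> p)
      + (h (snd p) * pw hs (fst p)) *\<^sub>R e \<zeta> (fst p))"
    proof (rule L2_tendsto_dominated[OF _ _ g])
      show "G k \<in> borel_measurable P" for k unfolding G_def by measurable
      show "AE p in P. norm (G k p) \<le> g p" for k
      proof (rule AE_I2)
        fix p
        have "norm (G k p) \<le> norm (dq k (W h (fst p))) * (norm (dpw hs p *\<^sub>R e \<zeta> (fst p)) + norm (pw hs (fst p) *\<^sub>R egrad \<zeta> p))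
            + norm ((h (snd p) * pw hs (fst p)) *\<^sub>R e (\<zeta>' k) (fst p))"
          unfolding G_def
          by (intro order_trans[OF norm_triangle_ineq] add_mono order_refl order_trans[OF norm_mult_ineq]
              mult_left_mono norm_triangle_ineq norm_ge_zero)
        also have "\<dots> \<le> \<bar>W h (fst p)\<bar> * (norm (dpw hs p *\<^sub>R e \<zeta> (fst p)) + norm (pw hs (fst p) *\<^sub>R egrad \<zeta> p))
            + norm ((h (snd p) * pw hs (fst p)) *\<^sub>R e (\<zeta>' k) (fst p))"
          by (intro add_mono mult_right_mono norm_dq) auto
        also have "\<dots> = g p"
          by (simp add: g_def egrad_def norm_mult abs_mult algebra_simps)
        finally show "norm (G k p) \<le> g p" .
      qed
      show "AE p in P. (\<lambda>k. G k p) \<longlonglongrightarrow> complex_of_real (W h (fst p)) * (dpw hs p *\<^sub>R e \<zeta> (fst p) + pw hs (fst p) *\<^sub>R egrad \<zeta> p)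
          + (h (snd p) * pw hs (fst p)) *\<^sub>R e \<zeta> (fst p)"
        using AE_fst_P[OF e_diff_tendsto[OF h \<zeta>]]
      proof eventually_elim
        fix p :: "(real \<Rightarrow> real) \<times> real" assume "(\<lambda>k. e (\<lambda>s. \<zeta> s + 1 / real (Suc k) * h s) (fst p)) \<longlonglongrightarrow> e \<zeta> (fst p)"
        then have "(\<lambda>k. e (\<zeta>' k) (fst p)) \<longlonglongrightarrow> e \<zeta> (fst p)" unfolding \<zeta>'_def[abs_def] .
        then show "(\<lambda>k. G k p) \<longlonglongrightarrow> complex_of_real (W h (fst p)) * (dpw hs p *\<^sub>R e \<zeta> (fst p) + pw hs (fst p) *\<^sub>R egrad \<zeta> p)
          + (h (snd p) * pw hs (fst p)) *\<^sub>R e \<zeta> (fst p)"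
          unfolding G_def by (intro tendsto_intros dq_tendsto)
      qed
    qed measurable
    then show "L2_tendsto P G (\<lambda>p. dpw (h # hs) p *\<^sub>R e \<zeta> (fst p) + pw (h # hs) (fst p) *\<^sub>R egrad \<zeta> p)"
      by (simp add: scaleR_conv_of_real algebra_simps)
  qed
qed

lemma exp_deriv_monomial:
  assumes hs: "\<forall>h\<in>set hs. in_L2 leb01 h"
  shows "exp_deriv (\<lambda>\<omega>. pw hs \<omega> *\<^sub>R c) (\<lambda>p. dpw hs p *\<^sub>R c)"
proof -
  have [measurable]: "pw hs \<in> borel_measurable M" "dpw hs \<in> borel_measurable P"
    using hs in_L2_dpw[OF hs] by (auto simp: in_L2_def)
  have "exp_deriv (\<lambda>\<omega>. complex_of_real (pw hs \<omega>)) (\<lambda>p. complex_of_real (dpw hs p))"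
  proof (rule graph_closure_cong_AE[OF exp_deriv_pw[OF hs in_L2_zero]])
    show "AE \<omega> in M. complex_of_real (pw hs \<omega>) = pw hs \<omega> *\<^sub>R e (\<lambda>s. 0) \<omega>"
      using e_zero by eventually_elim (simp add: scaleR_conv_of_real)
    show "AE p in P. complex_of_real (dpw hs p) = dpw hs p *\<^sub>R e (\<lambda>s. 0) (fst p) + pw hs (fst p) *\<^sub>R egrad (\<lambda>s. 0) p"
      using AE_fst_P[OF e_zero] by eventually_elim (simp add: scaleR_conv_of_real egrad_def)
  qed measurable
  from exp_deriv_mult[OF this, of c] show ?thesis by (simp add: scaleR_conv_of_real mult.commute)
qed

lemma exp_closure_poly:
  assumes "(F, G) \<in> poly_graph"
  shows "exp_deriv F G"
proof -
  obtain qs where qs: "valid_poly qs" "F = polynomial_functional M qs" "G = polynomial_gradient M qs"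
    using assms by (auto simp: poly_graph_def)
  have "exp_deriv (\<lambda>\<omega>. polynomial_functional M qs \<omega>) (\<lambda>p. polynomial_gradient M qs p)"
    using qs(1)
  proof (induction qs)
    case Nil
    show ?case using exp_deriv_expsum[of "[]"] by (simp add: expsum_def[abs_def] expgrad_def[abs_def])
  next
    case (Cons q qs)
    obtain c hs where q: "q = (c, hs)" by (cases q) auto
    have 1: "exp_deriv (\<lambda>\<omega>. pw hs \<omega> *\<^sub>R c) (\<lambda>p. dpw hs p *\<^sub>R c)"
      using Cons by (intro exp_deriv_monomial) (auto simp: q)
    have 2: "exp_deriv (\<lambda>\<omega>. polynomial_functional M qs \<omega>) (\<lambda>p. polynomial_gradient M qs p)"
      using Cons by (auto simp: q)
    from exp_deriv_add[OF 1 2] show ?case by (simp add: q pw_eq_prod dpw_eq_sum)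
  qed
  then show ?thesis by (simp add: qs)
qed

text \<open>Each graph lies in the closure of the other. From here on the derivative inherits what
  is known for exponentials, above all uniqueness.\<close>

lemma has_malliavin_derivative_iff_exp: "has_malliavin_derivative M Z U \<longleftrightarrow> exp_deriv Z U"
  unfolding has_malliavin_derivative_iff
  using graph_closure_mono[of exp_graph M P poly_graph Z U] graph_closure_mono[of poly_graph M P exp_graph Z U]
    poly_closure_exp exp_closure_poly by blast

lemma malliavin_derivative_unique:
  assumes "has_malliavin_derivative M Z U" "has_malliavin_derivative M Y V" "AE \<omega> in M. Z \<omega> = Y \<omega>"
  shows "AE p in P. U p = (V p :: complex)"
  using exp_deriv_unique assms unfolding has_malliavin_derivative_iff_exp by blast

text \<open>Closability was proved for complex functionals; real ones are embedded, and the
  embedding reflects equality.\<close>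

lemma malliavin_derivative_unique_real:
  fixes Z :: "(real \<Rightarrow> real) \<Rightarrow> real"
  assumes "has_malliavin_derivative M Z U" "has_malliavin_derivative M Z V"
  shows "AE p in P. U p = V p"
proof -
  have lin: "linear complex_of_real" by (rule bounded_linear.linear[OF bounded_linear_of_real])
  have "AE p in P. complex_of_real (U p) = complex_of_real (V p)"
    by (rule malliavin_derivative_unique[OF has_malliavin_derivative_linear[OF assms(1) lin]
        has_malliavin_derivative_linear[OF assms(2) lin]]) simp
  then show ?thesis by simp
qed

lemma has_malliavin_derivative_some: "has_malliavin_derivative M Z U \<Longrightarrow> has_malliavin_derivative M Z (malliavin_derivative M Z)"
  unfolding malliavin_derivative_def by (rule someI[of "has_malliavin_derivative M Z"])

end

section \<open>The quadratic form and its closure\<close>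

context wiener
begin

section \<open>Rules for the derivative of complex functionals\<close>

abbreviation D :: "((real \<Rightarrow> real) \<Rightarrow> complex) \<Rightarrow> (real \<Rightarrow> real) \<times> real \<Rightarrow> complex"
  where "D \<equiv> malliavin_derivative M"

abbreviation has_D :: "((real \<Rightarrow> real) \<Rightarrow> complex) \<Rightarrow> ((real \<Rightarrow> real) \<times> real \<Rightarrow> complex) \<Rightarrow> bool"
  where "has_D \<equiv> has_malliavin_derivative M"

lemma has_D_add: "has_D Z U \<Longrightarrow> has_D Z' U' \<Longrightarrow> has_D (\<lambda>x. Z x + Z' x) (\<lambda>p. U p + U' p)"
  unfolding has_malliavin_derivative_iff_exp by (rule exp_deriv_add)

lemma has_D_diff: "has_D Z U \<Longrightarrow> has_D Z' U' \<Longrightarrow> has_D (\<lambda>x. Z x - Z' x) (\<lambda>p. U p - U' p)"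
  unfolding has_malliavin_derivative_iff_exp by (rule exp_deriv_diff)

lemma has_D_mult: "has_D Z U \<Longrightarrow> has_D (\<lambda>x. c * Z x) (\<lambda>p. c * U p)"
  unfolding has_malliavin_derivative_iff_exp by (rule exp_deriv_mult)

lemma has_D_cnj:
  assumes "has_D Z U" shows "has_D (\<lambda>x. cnj (Z x)) (\<lambda>p. cnj (U p))"
  by (rule has_malliavin_derivative_linear[OF assms bounded_linear.linear[OF bounded_linear_cnj]])

lemma has_D_e: "in_L2 leb01 \<xi> \<Longrightarrow> has_D (e \<xi>) (egrad \<xi>)"
  unfolding has_malliavin_derivative_iff_exp
  using exp_deriv_expsum[of "[(1, \<xi>)]"] by (simp add: expsum_def[abs_def] expgrad_def[abs_def])

section \<open>The span of the exponentials\<close>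

lemma exp_algebra_iff:
  "F \<in> exp_algebra M \<longleftrightarrow> F \<in> borel_measurable M \<and> (\<exists>ps. valid_exp ps \<and> (AE \<omega> in M. F \<omega> = expsum ps \<omega>))"
  by (simp add: exp_algebra_def valid_exp_def expsum_def)

lemma exp_algebraI: "F \<in> borel_measurable M \<Longrightarrow> valid_exp ps \<Longrightarrow> (AE \<omega> in M. F \<omega> = expsum ps \<omega>) \<Longrightarrow> F \<in> exp_algebra M"
  by (auto simp: exp_algebra_iff)

lemma exp_algebra_expsum: "valid_exp ps \<Longrightarrow> expsum ps \<in> exp_algebra M"
  by (rule exp_algebraI) (auto intro: in_L2_measurable in_L2_exp)

lemma exp_algebra_e: "in_L2 leb01 \<xi> \<Longrightarrow> e \<xi> \<in> exp_algebra M"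
  using exp_algebra_expsum[of "[(1, \<xi>)]"] by (simp add: expsum_def[abs_def])

lemma exp_algebra_add:
  assumes "F \<in> exp_algebra M" "G \<in> exp_algebra M"
  shows "(\<lambda>\<omega>. F \<omega> + G \<omega>) \<in> exp_algebra M"
proof -
  obtain ps qs where "F \<in> borel_measurable M" "valid_exp ps" "AE \<omega> in M. F \<omega> = expsum ps \<omega>"
      "G \<in> borel_measurable M" "valid_exp qs" "AE \<omega> in M. G \<omega> = expsum qs \<omega>"
    using assms by (auto simp: exp_algebra_iff)
  then show ?thesis by (intro exp_algebraI[of _ "ps @ qs"]) (auto elim: eventually_elim2)
qed

lemma exp_algebra_mult:
  assumes "F \<in> exp_algebra M"
  shows "(\<lambda>\<omega>. c * F \<omega>) \<in> exp_algebra M"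
proof -
  obtain ps where "F \<in> borel_measurable M" "valid_exp ps" "AE \<omega> in M. F \<omega> = expsum ps \<omega>"
    using assms by (auto simp: exp_algebra_iff)
  then show ?thesis
    by (intro exp_algebraI[of _ "map (\<lambda>(d, \<xi>). (c * d, \<xi>)) ps"]) (auto simp: exp_scale elim: eventually_mono)
qed

lemma exp_algebra_diff:
  assumes "F \<in> exp_algebra M" "G \<in> exp_algebra M"
  shows "(\<lambda>\<omega>. F \<omega> - G \<omega>) \<in> exp_algebra M"
  using exp_algebra_add[OF assms(1) exp_algebra_mult[OF assms(2), of "-1"]] by simp

lemma expsum_cnj:
  assumes "valid_exp ps"
  shows "\<exists>qs. valid_exp qs \<and> (AE \<omega> in M. expsum qs \<omega> = cnj (expsum ps \<omega>))"
  using assms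
proof (induction ps)
  case Nil
  then show ?case by (intro exI[of _ "[]"]) simp
next
  case (Cons q ps)
  obtain c \<xi> where q: "q = (c, \<xi>)" by (cases q) auto
  from Cons obtain qs where qs: "valid_exp qs" "AE \<omega> in M. expsum qs \<omega> = cnj (expsum ps \<omega>)" by (auto simp: q)
  have \<xi>: "in_L2 leb01 \<xi>" using Cons by (simp add: q)
  have "AE \<omega> in M. expsum ((cnj c, \<lambda>s. - \<xi> s) # qs) \<omega> = cnj (expsum (q # ps) \<omega>)"
    using qs(2) e_minus[OF \<xi>] by eventually_elim (simp add: q)
  then show ?case using qs(1) \<xi> by (intro exI[of _ "(cnj c, \<lambda>s. - \<xi> s) # qs"]) (simp add: in_L2_minus)
qed

lemma exp_algebra_cnj:
  assumes "F \<in> exp_algebra M"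
  shows "(\<lambda>\<omega>. cnj (F \<omega>)) \<in> exp_algebra M"
proof -
  obtain ps where F: "F \<in> borel_measurable M" "valid_exp ps" "AE \<omega> in M. F \<omega> = expsum ps \<omega>"
    using assms by (auto simp: exp_algebra_iff)
  obtain qs where qs: "valid_exp qs" "AE \<omega> in M. expsum qs \<omega> = cnj (expsum ps \<omega>)"
    using expsum_cnj[OF F(2)] by blast
  have "AE \<omega> in M. cnj (F \<omega>) = expsum qs \<omega>" using F(3) qs(2) by eventually_elim simp
  then show ?thesis using F(1) by (intro exp_algebraI[OF _ qs(1)]) auto
qed

lemma exp_algebra_has_D:
  assumes "F \<in> exp_algebra M"
  shows "\<exists>ps. valid_exp ps \<and> has_D F (expgrad ps)"
proof -
  obtain ps where F: "F \<in> borel_measurable M" "valid_exp ps" "AE \<omega> in M. F \<omega> = expsum ps \<omega>"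
    using assms by (auto simp: exp_algebra_iff)
  have "exp_deriv F (expgrad ps)"
    by (rule graph_closure_cong_AE[OF exp_deriv_expsum[OF F(2)]])
      (use F in_L2_exp(2)[OF F(2)] in \<open>auto simp: in_L2_def\<close>)
  then show ?thesis using F(2) unfolding has_malliavin_derivative_iff_exp by blast
qed

section \<open>The bilinear form given by the derivative\<close>

definition ou_bilinear :: "((real \<Rightarrow> real) \<Rightarrow> complex) \<Rightarrow> ((real \<Rightarrow> real) \<Rightarrow> complex) \<Rightarrow> complex"
  where "ou_bilinear F G = (LINT p|P. D F p * D G p) / 2"

lemma ou_bilinear_eq:
  assumes F: "has_D F U" and G: "has_D G V"
  shows "ou_bilinear F G = (LINT p|P. U p * V p) / 2"
proof -
  note DF = has_malliavin_derivative_some[OF F] and DG = has_malliavin_derivative_some[OF G]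
  have [measurable]: "U \<in> borel_measurable P" "V \<in> borel_measurable P" "D F \<in> borel_measurable P" "D G \<in> borel_measurable P"
    using has_malliavin_derivative_in_L2(2)[OF F] has_malliavin_derivative_in_L2(2)[OF G]
      has_malliavin_derivative_in_L2(2)[OF DF] has_malliavin_derivative_in_L2(2)[OF DG] by (simp_all add: in_L2_def)
  have "AE p in P. D F p = U p" "AE p in P. D G p = V p"
    using malliavin_derivative_unique[OF DF F] malliavin_derivative_unique[OF DG G] by simp_all
  then have "AE p in P. D F p * D G p = U p * V p" by eventually_elim simp
  then have "(LINT p|P. D F p * D G p) = (LINT p|P. U p * V p)" by (intro integral_cong_AE) measurable
  then show ?thesis by (simp add: ou_bilinear_def)
qed

text \<open>The chosen derivative may be replaced by any other by uniqueness. Uniqueness is proved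
  separately for real and for complex values, so here it enters as the hypothesis
  \<open>eq\<close>.\<close>

lemma ou_form_eq_iterated:
  fixes Z :: "(real \<Rightarrow> real) \<Rightarrow> 'b::{euclidean_space, real_normed_field}"
  assumes Z: "has_malliavin_derivative M Z U" and eq: "AE p in P. malliavin_derivative M Z p = U p"
  shows "ou_form M Z = (LINT p|P. U p * U p) / 2"
proof -
  note DZ = has_malliavin_derivative_in_L2(2)[OF has_malliavin_derivative_some[OF Z]]
  note U = has_malliavin_derivative_in_L2(2)[OF Z]
  have [measurable]: "U \<in> borel_measurable P" "malliavin_derivative M Z \<in> borel_measurable P"
    using DZ U by (simp_all add: in_L2_def)
  have "(LINT \<omega>|M. LINT s|leb01. malliavin_derivative M Z (\<omega>, s) * malliavin_derivative M Z (\<omega>, s))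
      = (LINT p|P. malliavin_derivative M Z p * malliavin_derivative M Z p)"
    by (rule iterated_integral_P[OF in_L2_mult(1)[OF DZ DZ]])
  also have "\<dots> = (LINT p|P. U p * U p)"
    by (rule integral_cong_AE) (use eq in \<open>auto elim: eventually_mono\<close>)
  finally show ?thesis by (simp add: ou_form_def power2_eq_square)
qed

lemma ou_form_complex: "has_D Z U \<Longrightarrow> ou_form M Z = (LINT p|P. U p * U p) / 2"
  using malliavin_derivative_unique[OF has_malliavin_derivative_some] by (intro ou_form_eq_iterated) auto

lemma ou_form_real:
  fixes Z :: "(real \<Rightarrow> real) \<Rightarrow> real"
  shows "has_malliavin_derivative M Z U \<Longrightarrow> ou_form M Z = (LINT p|P. U p * U p) / 2"
  using malliavin_derivative_unique_real[OF has_malliavin_derivative_some] by (intro ou_form_eq_iterated) auto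

text \<open>The delicate clause is compatibility with almost sure equality, since a functional may
  have several representations as a sum of exponentials. Uniqueness of the derivative settles it,
  and thereby the existence of a form with the prescribed values.\<close>

lemma is_exp_form_ou_bilinear: "is_exp_form M ou_bilinear"
  unfolding is_exp_form_def
proof (intro conjI ballI allI impI)
  fix F G assume "F \<in> exp_algebra M" "G \<in> exp_algebra M"
  show "ou_bilinear F G = ou_bilinear G F" by (simp add: ou_bilinear_def mult.commute)
next
  fix F G H assume "F \<in> exp_algebra M" "G \<in> exp_algebra M" "H \<in> exp_algebra M"
  then obtain U V Y where D: "has_D F U" "has_D G V" "has_D H Y" using exp_algebra_has_D by metis
  note L2 = D[THEN has_malliavin_derivative_in_L2(2)]
  show "ou_bilinear (\<lambda>\<omega>. F \<omega> + G \<omega>) H = ou_bilinear F H + ou_bilinear G H"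
    unfolding ou_bilinear_eq[OF has_D_add[OF D(1,2)] D(3)] ou_bilinear_eq[OF D(1,3)] ou_bilinear_eq[OF D(2,3)]
    using in_L2_mult(1)[OF L2(1,3)] in_L2_mult(1)[OF L2(2,3)] by (simp add: distrib_right add_divide_distrib)
  show "ou_bilinear F H = ou_bilinear G H" if "AE \<omega> in M. F \<omega> = G \<omega>"
  proof -
    have "AE p in P. U p = V p" by (rule malliavin_derivative_unique[OF D(1,2) that])
    then show ?thesis unfolding ou_bilinear_eq[OF D(1,3)] ou_bilinear_eq[OF D(2,3)]
      by (intro arg_cong2[where f="(/)"] integral_cong_AE) (use L2 in \<open>auto simp: in_L2_def elim: eventually_mono\<close>)
  qed
next
  fix c F H assume "F \<in> exp_algebra M" "H \<in> exp_algebra M"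
  then obtain U Y where D: "has_D F U" "has_D H Y" using exp_algebra_has_D by metis
  show "ou_bilinear (\<lambda>\<omega>. c * F \<omega>) H = c * ou_bilinear F H"
    unfolding ou_bilinear_eq[OF has_D_mult[OF D(1)] D(2)] ou_bilinear_eq[OF D] by (simp add: mult.assoc)
next
  fix \<xi> \<eta> :: "real \<Rightarrow> real" assume L2: "in_L2 leb01 \<xi>" "in_L2 leb01 \<eta>"
  show "ou_bilinear (e \<xi>) (e \<eta>) = - (1/2) * (LINT \<omega>|M. e (\<lambda>s. \<xi> s + \<eta> s) \<omega>) * complex_of_real (LINT s|leb01. \<xi> s * \<eta> s)"
    unfolding ou_bilinear_eq[OF has_D_e[OF L2(1)] has_D_e[OF L2(2)]] integral_grad_e[OF L2] by simp
qed

lemma is_exp_formD: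
  assumes "is_exp_form M b"
  shows "F \<in> exp_algebra M \<Longrightarrow> G \<in> exp_algebra M \<Longrightarrow> b F G = b G F"
    and "F \<in> exp_algebra M \<Longrightarrow> G \<in> exp_algebra M \<Longrightarrow> H \<in> exp_algebra M \<Longrightarrow>
      b (\<lambda>\<omega>. F \<omega> + G \<omega>) H = b F H + b G H"
    and "F \<in> exp_algebra M \<Longrightarrow> H \<in> exp_algebra M \<Longrightarrow> b (\<lambda>\<omega>. c * F \<omega>) H = c * b F H"
    and "F \<in> exp_algebra M \<Longrightarrow> G \<in> exp_algebra M \<Longrightarrow> H \<in> exp_algebra M \<Longrightarrow>
      (AE \<omega> in M. F \<omega> = G \<omega>) \<Longrightarrow> b F H = b G H"
    and "in_L2 leb01 \<xi> \<Longrightarrow> in_L2 leb01 \<eta> \<Longrightarrow> b (e \<xi>) (e \<eta>) =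
      - (1/2) * (LINT \<omega>|M. e (\<lambda>s. \<xi> s + \<eta> s) \<omega>) * complex_of_real (LINT s|leb01. \<xi> s * \<eta> s)"
proof -
  note d = assms[unfolded is_exp_form_def]
  note d2 = d[THEN conjunct2] note d3 = d2[THEN conjunct2] note d4 = d3[THEN conjunct2]
  show "F \<in> exp_algebra M \<Longrightarrow> G \<in> exp_algebra M \<Longrightarrow> b F G = b G F"
    by (rule d[THEN conjunct1, rule_format])
  show "F \<in> exp_algebra M \<Longrightarrow> G \<in> exp_algebra M \<Longrightarrow> H \<in> exp_algebra M \<Longrightarrow>
      b (\<lambda>\<omega>. F \<omega> + G \<omega>) H = b F H + b G H"
    by (rule d2[THEN conjunct1, rule_format])
  show "F \<in> exp_algebra M \<Longrightarrow> H \<in> exp_algebra M \<Longrightarrow> b (\<lambda>\<omega>. c * F \<omega>) H = c * b F H"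
    by (rule d3[THEN conjunct1, rule_format])
  show "F \<in> exp_algebra M \<Longrightarrow> G \<in> exp_algebra M \<Longrightarrow> H \<in> exp_algebra M \<Longrightarrow>
      (AE \<omega> in M. F \<omega> = G \<omega>) \<Longrightarrow> b F H = b G H"
    by (rule d4[THEN conjunct1, rule_format])
  show "in_L2 leb01 \<xi> \<Longrightarrow> in_L2 leb01 \<eta> \<Longrightarrow> b (e \<xi>) (e \<eta>) =
      - (1/2) * (LINT \<omega>|M. e (\<lambda>s. \<xi> s + \<eta> s) \<omega>) * complex_of_real (LINT s|leb01. \<xi> s * \<eta> s)"
    by (rule d4[THEN conjunct2, rule_format])
qed

text \<open>Values on pairs of exponentials determine the form, one argument at a time, with
  symmetry exchanging the arguments.\<close>

lemma is_exp_form_unique: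
  assumes b: "is_exp_form M b" and b': "is_exp_form M b'" and F: "F \<in> exp_algebra M" and G: "G \<in> exp_algebra M"
  shows "b F G = b' F G"
proof -
  \<comment> \<open>For a fixed second argument, agreement on exponentials extends to the whole
    span. It is used twice: with an exponential as second argument, then with an arbitrary
    one.\<close>
  have step: "b F H = b' F H"
    if b: "is_exp_form M b" and b': "is_exp_form M b'" and F: "F \<in> exp_algebra M" and H: "H \<in> exp_algebra M"
      and gen: "\<And>\<xi>. in_L2 leb01 \<xi> \<Longrightarrow> b (e \<xi>) H = b' (e \<xi>) H" for b b' F H
  proof -
    obtain ps where ps: "valid_exp ps" "AE \<omega> in M. F \<omega> = expsum ps \<omega>"
      using F by (auto simp: exp_algebra_iff)
    have scale: "b (\<lambda>\<omega>. c * F \<omega>) H = c * b F H" "b' (\<lambda>\<omega>. c * F \<omega>) H = c * b' F H"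
      if "F \<in> exp_algebra M" for c F
      by (rule is_exp_formD(3)[OF b that H] is_exp_formD(3)[OF b' that H])+
    have add: "b (\<lambda>\<omega>. F \<omega> + G \<omega>) H = b F H + b G H" "b' (\<lambda>\<omega>. F \<omega> + G \<omega>) H = b' F H + b' G H"
      if "F \<in> exp_algebra M" "G \<in> exp_algebra M" for F G
      by (rule is_exp_formD(2)[OF b that H] is_exp_formD(2)[OF b' that H])+
    have "b (\<lambda>\<omega>. expsum ps \<omega>) H = b' (\<lambda>\<omega>. expsum ps \<omega>) H"
      using ps(1)
    proof (induction ps)
      case Nil
      show ?case using scale[OF exp_algebra_expsum[of "[]"], of 0] by simp
    next
      case (Cons q ps)
      obtain c \<xi> where q: "q = (c, \<xi>)" by (cases q) auto
      have \<xi>: "in_L2 leb01 \<xi>" and ps: "valid_exp ps" using Cons by (auto simp: q)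
      note m = exp_algebra_mult[OF exp_algebra_e[OF \<xi>], of c] exp_algebra_expsum[OF ps]
      show ?case
        using add[OF m] scale[OF exp_algebra_e[OF \<xi>], of c] gen[OF \<xi>] Cons(1)[OF ps] by (simp add: q)
    qed
    moreover have "b F H = b (expsum ps) H" "b' F H = b' (expsum ps) H"
      by (rule is_exp_formD(4)[OF b F exp_algebra_expsum[OF ps(1)] H ps(2)]
          is_exp_formD(4)[OF b' F exp_algebra_expsum[OF ps(1)] H ps(2)])+
    ultimately show ?thesis by simp
  qed
  have sym: "b F G = b G F" "b' F G = b' G F" if "F \<in> exp_algebra M" "G \<in> exp_algebra M" for F G
    by (rule is_exp_formD(1)[OF b that] is_exp_formD(1)[OF b' that])+
  have ee: "b (e \<xi>) (e \<eta>) = b' (e \<xi>) (e \<eta>)" if "in_L2 leb01 \<xi>" "in_L2 leb01 \<eta>" for \<xi> \<eta>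
    unfolding is_exp_formD(5)[OF b that] is_exp_formD(5)[OF b' that] ..
  have "b G (e \<eta>) = b' G (e \<eta>)" if "in_L2 leb01 \<eta>" for \<eta>
    by (rule step[OF b b' G exp_algebra_e[OF that]]) (rule ee[OF _ that])
  then show ?thesis
    using sym G exp_algebra_e by (intro step[OF b b' F G]) metis
qed

section \<open>Closability and the closure of the form\<close>

context
  fixes b assumes b: "is_exp_form M b"
begin

lemma exp_form_eq:
  assumes "F \<in> exp_algebra M" "G \<in> exp_algebra M" "has_D F U" "has_D G V"
  shows "b F G = (LINT p|P. U p * V p) / 2"
  using is_exp_form_unique[OF b is_exp_form_ou_bilinear assms(1,2)] ou_bilinear_eq[OF assms(3,4)] by simp

lemma form_energy_eq:
  assumes F: "F \<in> exp_algebra M" and U: "has_D F U"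
  shows "form_energy b F = complex_of_real ((LINT p|P. (cmod (U p))\<^sup>2) / 2)"
proof -
  have "form_energy b F = (LINT p|P. U p * cnj (U p)) / 2"
    unfolding form_energy_def by (rule exp_form_eq[OF F exp_algebra_cnj[OF F] U has_D_cnj[OF U]])
  also have "(LINT p|P. U p * cnj (U p)) = complex_of_real (LINT p|P. (cmod (U p))\<^sup>2)"
    by (simp only: integral_complex_of_real[symmetric] complex_norm_square)
  finally show ?thesis by simp
qed

lemma sqn_derivative_diff:
  assumes F: "F \<in> exp_algebra M" "has_D F U" and G: "G \<in> exp_algebra M" "has_D G V"
  shows "sqn P (\<lambda>p. U p - V p) = ennreal (2 * cmod (form_energy b (\<lambda>\<omega>. F \<omega> - G \<omega>)))"
proof -
  have D: "has_D (\<lambda>\<omega>. F \<omega> - G \<omega>) (\<lambda>p. U p - V p)" by (rule has_D_diff[OF F(2) G(2)])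
  have "cmod (form_energy b (\<lambda>\<omega>. F \<omega> - G \<omega>)) = (LINT p|P. (cmod (U p - V p))\<^sup>2) / 2"
    unfolding form_energy_eq[OF exp_algebra_diff[OF F(1) G(1)] D] norm_of_real by simp
  then show ?thesis using sqn_eq_integral[OF has_malliavin_derivative_in_L2(2)[OF D]] by simp
qed

text \<open>The energy of a difference is half the squared distance of the gradients, so being
  form-Cauchy is convergence of the gradients by completeness. This translates closures of the form
  into closures of graphs.\<close>

lemma form_Cauchy_iff:
  assumes F: "\<And>k. F k \<in> exp_algebra M" "\<And>k. has_D (F k) (U k)"
  shows "form_Cauchy b F \<longleftrightarrow> (\<exists>V. L2_tendsto P U V)"
proof
  assume C: "form_Cauchy b F"
  show "\<exists>V. L2_tendsto P U V"
  proof (rule L2_complete)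
    show "in_L2 P (U k)" for k by (rule has_malliavin_derivative_in_L2(2)[OF F(2)])
    fix r :: real assume "r > 0"
    then obtain N where N: "\<And>m n. m \<ge> N \<Longrightarrow> n \<ge> N \<Longrightarrow> cmod (form_energy b (\<lambda>\<omega>. F m \<omega> - F n \<omega>)) < r / 2"
      using C unfolding form_Cauchy_def by (meson half_gt_zero)
    have "sqn P (\<lambda>p. U m p - U n p) < ennreal r" if "m \<ge> N" "n \<ge> N" for m n
      unfolding sqn_derivative_diff[OF F F] using N[OF that] by (simp add: ennreal_less_iff)
    then show "\<exists>N. \<forall>m\<ge>N. \<forall>n\<ge>N. sqn P (\<lambda>p. U m p - U n p) < ennreal r" by blast
  qed
next
  assume "\<exists>V. L2_tendsto P U V"
  then obtain V where V: "L2_tendsto P U V" ..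
  note L2 = L2_tendsto_in_L2[OF V]
  have [measurable]: "U k \<in> borel_measurable P" "V \<in> borel_measurable P" for k using L2 by (auto simp: in_L2_def)
  show "form_Cauchy b F"
    unfolding form_Cauchy_def
  proof (intro allI impI)
    fix r :: real assume r: "r > 0"
    then have "ennreal (r / 2) > 0" by simp
    then have "\<forall>\<^sub>F k in sequentially. sqn P (\<lambda>p. U k p - V p) < ennreal (r / 2)"
      using V by (auto simp: L2_tendsto_iff_sqn intro: order_tendstoD)
    then obtain N where N: "\<And>k. k \<ge> N \<Longrightarrow> sqn P (\<lambda>p. U k p - V p) < ennreal (r / 2)"
      by (auto simp: eventually_sequentially)
    have "cmod (form_energy b (\<lambda>\<omega>. F m \<omega> - F n \<omega>)) < r" if "m \<ge> N" "n \<ge> N" for m n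
    proof -
      have "sqn P (\<lambda>p. U m p - U n p) \<le> 2 * sqn P (\<lambda>p. U m p - V p) + 2 * sqn P (\<lambda>p. V p - U n p)"
        by (rule sqn_triangle) measurable
      also have "\<dots> < 2 * ennreal (r / 2) + 2 * ennreal (r / 2)"
        using N[OF that(1)] N[OF that(2)] sqn_minus_commute[of P V "U n"]
        by (intro add_strict_mono ennreal_mult_strict_left_mono) auto
      also have "\<dots> = ennreal (2 * r)" using r by (simp flip: ennreal_plus ennreal_numeral ennreal_mult)
      finally have "ennreal (2 * cmod (form_energy b (\<lambda>\<omega>. F m \<omega> - F n \<omega>))) < ennreal (2 * r)"
        unfolding sqn_derivative_diff[OF F F] .
      then show ?thesis by (simp add: ennreal_less_iff)
    qed
    then show "\<exists>N. \<forall>m\<ge>N. \<forall>n\<ge>N. cmod (form_energy b (\<lambda>\<omega>. F m \<omega> - F n \<omega>)) < r" by blast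
  qed
qed

lemma exp_algebra_derivatives:
  assumes "\<And>k. F k \<in> exp_algebra M"
  obtains U where "\<And>k. has_D (F k) (U k)"
proof -
  have "\<exists>U. has_D (F k) U" for k using exp_algebra_has_D[OF assms] by blast
  then show thesis using that choice[of "\<lambda>k U. has_D (F k) U"] by blast
qed

lemma has_D_closed:
  assumes "\<And>k. has_D (F k) (U k)" "L2_tendsto M F Z" "L2_tendsto P U V"
  shows "has_D Z V"
  using assms unfolding has_malliavin_derivative_iff_exp by (rule graph_closure_closed)

text \<open>The gradients converge to a derivative of 0, which vanishes by closability of the
  gradient; the energies converge to half its squared norm.\<close>

lemma form_closable_exp_algebra: "form_closable M (exp_algebra M) b"
  unfolding form_closable_def
proof (intro allI impI, elim conjE)
  fix F assume F: "\<forall>k. F k \<in> exp_algebra M" and F0: "L2_tendsto M F (\<lambda>_. 0)" and C: "form_Cauchy b F"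
  obtain U where U: "\<And>k. has_D (F k) (U k)" using exp_algebra_derivatives[of F] F by blast
  obtain V where V: "L2_tendsto P U V" using form_Cauchy_iff[of F U] F U C by blast
  have "has_D (\<lambda>_. 0) V" by (rule has_D_closed[OF U F0 V])
  then have V0: "AE p in P. V p = 0" unfolding has_malliavin_derivative_iff_exp by (rule exp_deriv_closable)
  have "(\<lambda>k. LINT p|P. U k p * cnj (U k p)) \<longlonglongrightarrow> (LINT p|P. V p * cnj (V p))"
    by (intro L2_tendsto_integral_mult V L2_tendsto_linear[OF V bounded_linear.linear[OF bounded_linear_cnj]])
  moreover have "(LINT p|P. V p * cnj (V p)) = 0"
    by (rule integral_eq_zero_AE) (use V0 in \<open>auto elim: eventually_mono\<close>)
  ultimately have "(\<lambda>k. (LINT p|P. U k p * cnj (U k p)) / 2) \<longlonglongrightarrow> 0 / 2" by (intro tendsto_divide) auto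
  moreover have "form_energy b (F k) = (LINT p|P. U k p * cnj (U k p)) / 2" for k
    unfolding form_energy_def using F U by (intro exp_form_eq exp_algebra_cnj has_D_cnj) auto
  ultimately show "(\<lambda>k. form_energy b (F k)) \<longlonglongrightarrow> 0" by (simp only: div_0)
qed

text \<open>The class \<open>A\<close> is a parameter so that the whole span and its real-valued
  members are handled together.\<close>

lemma form_closureI:
  assumes F: "\<And>k. F k \<in> A" "A \<subseteq> exp_algebra M" "\<And>k. has_D (F k) (U k)"
    and Z: "L2_tendsto M F Z" and V: "L2_tendsto P U V"
  shows "form_closure M A b Z ((LINT p|P. V p * V p) / 2)"
proof -
  have "form_Cauchy b F" using F V by (subst form_Cauchy_iff[of F U]) auto
  moreover have "(\<lambda>k. b (F k) (F k)) \<longlonglongrightarrow> (LINT p|P. V p * V p) / 2"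
  proof -
    have "b (F k) (F k) = (LINT p|P. U k p * U k p) / 2" for k using F by (intro exp_form_eq) auto
    then show ?thesis by (simp only:) (intro tendsto_divide L2_tendsto_integral_mult V tendsto_const; simp)
  qed
  ultimately show ?thesis unfolding form_closure_def using F(1) Z by blast
qed

lemma form_closureD:
  assumes "form_closure M A b Z c" "A \<subseteq> exp_algebra M"
  shows "\<exists>V. has_D Z V \<and> c = (LINT p|P. V p * V p) / 2"
proof -
  obtain F where F: "\<And>k. F k \<in> exp_algebra M" "L2_tendsto M F Z" "form_Cauchy b F" "(\<lambda>k. b (F k) (F k)) \<longlonglongrightarrow> c"
    using assms unfolding form_closure_def by blast
  obtain U where U: "\<And>k. has_D (F k) (U k)" using exp_algebra_derivatives[of F] F by blast
  obtain V where V: "L2_tendsto P U V" using form_Cauchy_iff[of F U] F U by blast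
  have "b (F k) (F k) = (LINT p|P. U k p * U k p) / 2" for k using F U by (intro exp_form_eq) auto
  then have "(\<lambda>k. b (F k) (F k)) \<longlonglongrightarrow> (LINT p|P. V p * V p) / 2"
    by (simp only:) (intro tendsto_divide L2_tendsto_integral_mult V tendsto_const; simp)
  then have "c = (LINT p|P. V p * V p) / 2" by (rule LIMSEQ_unique[OF F(4)])
  then show ?thesis using has_D_closed[OF U F(2) V] by blast
qed

lemma has_D_approx:
  assumes "has_D Z V"
  obtains F U where "\<And>k. F k \<in> exp_algebra M" "\<And>k. has_D (F k) (U k)" "L2_tendsto M F Z" "L2_tendsto P U V"
proof -
  obtain F U where FU: "\<And>k. (F k, U k) \<in> exp_graph" "L2_tendsto M F Z" "L2_tendsto P U V"
    using assms graph_closureE unfolding has_malliavin_derivative_iff_exp by blast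
  have "F k \<in> exp_algebra M \<and> has_D (F k) (U k)" for k
  proof -
    obtain ps where "valid_exp ps" "F k = expsum ps" "U k = expgrad ps"
      using FU(1)[of k] by (auto simp: exp_graph_def)
    then show ?thesis
      using exp_algebra_expsum exp_deriv_expsum unfolding has_malliavin_derivative_iff_exp by auto
  qed
  with FU(2,3) show thesis by (intro that[of F U]) auto
qed

lemma form_closure_exp_algebra:
  "form_closure M (exp_algebra M) b Z c \<longleftrightarrow> Z \<in> D21 M \<and> c = ou_form M Z"
proof
  assume "form_closure M (exp_algebra M) b Z c"
  then obtain V where "has_D Z V" "c = (LINT p|P. V p * V p) / 2" using form_closureD by blast
  then show "Z \<in> D21 M \<and> c = ou_form M Z" by (auto simp: D21_def ou_form_complex)
next
  assume "Z \<in> D21 M \<and> c = ou_form M Z"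
  then obtain V where V: "has_D Z V" "c = (LINT p|P. V p * V p) / 2" using ou_form_complex by (auto simp: D21_def)
  obtain F U where "\<And>k. F k \<in> exp_algebra M" "\<And>k. has_D (F k) (U k)" "L2_tendsto M F Z" "L2_tendsto P U V"
    using has_D_approx[OF V(1)] by blast
  then show "form_closure M (exp_algebra M) b Z c"
    unfolding V(2) by (intro form_closureI[of F _ U]) auto
qed

lemma real_exp_algebra_subset: "real_exp_algebra M \<subseteq> exp_algebra M"
  by (auto simp: real_exp_algebra_def)

lemma form_closable_real_exp_algebra: "form_closable M (real_exp_algebra M) b"
  using form_closable_exp_algebra real_exp_algebra_subset unfolding form_closable_def by blast

text \<open>The span is stable under conjugation, hence under real parts. Approximants of a real
  functional can thus be made real, and taking real parts preserves convergence of functionals and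
  gradients.\<close>

lemma exp_algebra_Re:
  assumes "F \<in> exp_algebra M"
  shows "(\<lambda>\<omega>. complex_of_real (Re (F \<omega>))) \<in> real_exp_algebra M"
proof -
  have "(\<lambda>\<omega>. 1/2 * (F \<omega> + cnj (F \<omega>))) \<in> exp_algebra M"
    by (intro exp_algebra_mult exp_algebra_add exp_algebra_cnj assms)
  then show ?thesis by (simp add: real_exp_algebra_def complex_add_cnj)
qed

lemma form_closure_real_exp_algebra:
  fixes Z :: "(real \<Rightarrow> real) \<Rightarrow> real"
  shows "form_closure M (real_exp_algebra M) b (\<lambda>\<omega>. complex_of_real (Z \<omega>)) c
    \<longleftrightarrow> Z \<in> D21 M \<and> c = complex_of_real (ou_form M Z)"
proof -
  \<comment> \<open>On real functionals \<open>ou_form\<close> is a different instance, built from a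
    chosen real derivative. Its value is expressed by any real derivative \<open>V\<close>, embedded
    in the complex numbers.\<close>
  have ou: "complex_of_real (ou_form M Z) = (LINT p|P. complex_of_real (V p) * complex_of_real (V p)) / 2"
    if "has_malliavin_derivative M Z V" for V
    unfolding ou_form_real[OF that] of_real_mult[symmetric] integral_complex_of_real by simp
  show ?thesis
  proof
    assume "form_closure M (real_exp_algebra M) b (\<lambda>\<omega>. complex_of_real (Z \<omega>)) c"
    then obtain V where V: "has_D (\<lambda>\<omega>. complex_of_real (Z \<omega>)) V" "c = (LINT p|P. V p * V p) / 2"
      using form_closureD[OF _ real_exp_algebra_subset] by blast
    have Z: "has_malliavin_derivative M Z (\<lambda>p. Re (V p))"
      using has_malliavin_derivative_linear[OF V(1) linear_Re_Complex(3)] by simp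
    have "c = ou_form M (\<lambda>\<omega>. complex_of_real (Z \<omega>))" unfolding V(2) by (rule ou_form_complex[OF V(1), symmetric])
    also have "\<dots> = complex_of_real (ou_form M Z)"
      unfolding ou[OF Z] by (rule ou_form_complex[OF has_malliavin_derivative_linear[OF Z linear_Re_Complex(2)]])
    finally show "Z \<in> D21 M \<and> c = complex_of_real (ou_form M Z)" using Z by (auto simp: D21_def)
  next
    assume "Z \<in> D21 M \<and> c = complex_of_real (ou_form M Z)"
    then obtain V where V: "has_malliavin_derivative M Z V" and c: "c = complex_of_real (ou_form M Z)"
      by (auto simp: D21_def)
    have "has_D (\<lambda>\<omega>. complex_of_real (Z \<omega>)) (\<lambda>p. complex_of_real (V p))"
      by (rule has_malliavin_derivative_linear[OF V linear_Re_Complex(2)])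
    then obtain F U where FU: "\<And>k. F k \<in> exp_algebra M" "\<And>k. has_D (F k) (U k)"
        "L2_tendsto M F (\<lambda>\<omega>. complex_of_real (Z \<omega>))" "L2_tendsto P U (\<lambda>p. complex_of_real (V p))"
      using has_D_approx by blast
    show "form_closure M (real_exp_algebra M) b (\<lambda>\<omega>. complex_of_real (Z \<omega>)) c"
      unfolding c ou[OF V]
    proof (rule form_closureI[OF _ real_exp_algebra_subset])
      show "(\<lambda>\<omega>. complex_of_real (Re (F k \<omega>))) \<in> real_exp_algebra M" for k by (rule exp_algebra_Re[OF FU(1)])
      show "has_D (\<lambda>\<omega>. complex_of_real (Re (F k \<omega>))) (\<lambda>p. complex_of_real (Re (U k p)))" for k
        by (rule has_malliavin_derivative_linear[OF FU(2) linear_Re_Complex(1)])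
      show "L2_tendsto M (\<lambda>k \<omega>. complex_of_real (Re (F k \<omega>))) (\<lambda>\<omega>. complex_of_real (Z \<omega>))"
        using L2_tendsto_linear[OF FU(3) linear_Re_Complex(1)] by simp
      show "L2_tendsto P (\<lambda>k p. complex_of_real (Re (U k p))) (\<lambda>p. complex_of_real (V p))"
        using L2_tendsto_linear[OF FU(4) linear_Re_Complex(1)] by simp
    qed
  qed
qed

end

end

section \<open>The perturbed motion\<close>

lemma exp_diff_quotient_tendsto:
  fixes y :: "nat \<Rightarrow> real"
  assumes y: "y \<longlonglongrightarrow> 0" and ay: "(\<lambda>n. a n * y n) \<longlonglongrightarrow> l"
  shows "(\<lambda>n. a n * (exp (y n) - 1)) \<longlonglongrightarrow> l"
proof -
  \<comment> \<open>The difference quotient with its removable singularity filled in, so that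
    indices with \<open>y n = 0\<close> need no exclusion.\<close>
  define g where "g x = (if x = 0 then 1 else (exp x - 1) / x)" for x :: real
  have "(g \<longlongrightarrow> 1) (at 0)"
    using lim_exp_minus_1[where 'a=real] by (rule Lim_transform_eventually) (auto simp: g_def eventually_at_filter)
  then have "isCont g 0" by (simp add: isCont_def g_def)
  then have "(\<lambda>n. g (y n)) \<longlonglongrightarrow> g 0" using y by (rule isCont_tendsto_compose)
  then have "(\<lambda>n. (a n * y n) * g (y n)) \<longlonglongrightarrow> l * g 0" using ay by (intro tendsto_mult)
  moreover have "(a n * y n) * g (y n) = a n * (exp (y n) - 1)" for n
    by (cases "y n = 0") (simp_all add: g_def)
  moreover have "g 0 = 1" by (simp add: g_def)
  ultimately show ?thesis by (simp only: mult_1_right)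
qed

text \<open>The expression is an almost perfect square. Up to the factor
  \<open>exp (- 2 * x n)\<close>, the deviation is \<open>exp (- c n / n^2) - 1\<close>, and
  multiplied by \<open>n^2\<close> it yields the limit; the square itself vanishes in the
  limit.\<close>

lemma second_difference_limit:
  fixes b c :: "nat \<Rightarrow> real"
  assumes b: "b \<longlonglongrightarrow> 0" and c: "c \<longlonglongrightarrow> c0"
  shows "(\<lambda>n. (real n)\<^sup>2 * (exp (- 4 * b n / real n - 2 * c n / (real n)\<^sup>2)
      - 2 * exp (- 2 * b n / real n - c n / (2 * (real n)\<^sup>2)) + 1)) \<longlonglongrightarrow> - c0"
proof -
  \<comment> \<open>Chosen so that the middle exponential is \<open>exp (- x n)\<close>; the first
    one is then its square times \<open>exp (- c n / n^2)\<close>.\<close>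
  define x where "x n = 2 * b n / real n + c n / (2 * (real n)\<^sup>2)" for n
  have inv: "(\<lambda>n. inverse (real n)) \<longlonglongrightarrow> 0" by (rule lim_inverse_n)
  have x: "x \<longlonglongrightarrow> 0"
  proof -
    have L0: "2 * 0 * 0 + c0 * (0 * 0) / 2 = (0::real)" by simp
    have "(\<lambda>n. 2 * b n * inverse (real n) + c n * (inverse (real n) * inverse (real n)) / 2) \<longlonglongrightarrow> 2 * 0 * 0 + c0 * (0 * 0) / 2"
      by (intro tendsto_intros b c inv) auto
    note lim0 = this[unfolded L0]
    have xeq: "x = (\<lambda>n. 2 * b n * inverse (real n) + c n * (inverse (real n) * inverse (real n)) / 2)"
      unfolding x_def[abs_def]
      by (intro ext) (simp only: divide_inverse power2_eq_square inverse_mult_distrib mult_ac)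
    show ?thesis unfolding xeq by (rule lim0)
  qed
  \<comment> \<open>\<open>n * x n\<close> is \<open>2 * b n\<close> up to a term of order
    \<open>1 / n\<close>; this is where \<open>b\<close> tending to 0, the asymptotic decorrelation,
    enters.\<close>
  have "(\<lambda>n. real n * (- x n)) \<longlonglongrightarrow> 0"
  proof -
    have "(\<lambda>n. - (2 * b n + c n * inverse (real n) / 2)) \<longlonglongrightarrow> - (2 * 0 + c0 * 0 / 2)"
      by (intro tendsto_intros b c inv) auto
    then have "(\<lambda>n. - (2 * b n + c n * inverse (real n) / 2)) \<longlonglongrightarrow> 0" by simp
    then show ?thesis
      by (rule Lim_transform_eventually)
        (auto simp: eventually_sequentially x_def field_simps power2_eq_square intro!: exI[of _ 1])
  qed
  from exp_diff_quotient_tendsto[OF _ this] x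
  have 1: "(\<lambda>n. real n * (exp (- x n) - 1)) \<longlonglongrightarrow> 0" using tendsto_minus[OF x] by simp
  have cn: "(\<lambda>n. - c n / (real n)\<^sup>2) \<longlonglongrightarrow> 0"
  proof -
    have "(\<lambda>n. - c n * (inverse (real n) * inverse (real n))) \<longlonglongrightarrow> - c0 * (0 * 0)"
      by (intro tendsto_intros c inv)
    then show ?thesis by (simp add: divide_inverse power2_eq_square)
  qed
  have "(\<lambda>n. (real n)\<^sup>2 * (- c n / (real n)\<^sup>2)) \<longlonglongrightarrow> - c0"
    by (rule Lim_transform_eventually[OF tendsto_minus[OF c]])
      (auto simp: eventually_sequentially intro!: exI[of _ 1])
  from exp_diff_quotient_tendsto[OF cn this]
  have 2: "(\<lambda>n. (real n)\<^sup>2 * (exp (- c n / (real n)\<^sup>2) - 1)) \<longlonglongrightarrow> - c0" .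
  have "(\<lambda>n. (real n * (exp (- x n) - 1))\<^sup>2 + exp (- 2 * x n) * ((real n)\<^sup>2 * (exp (- c n / (real n)\<^sup>2) - 1)))
      \<longlonglongrightarrow> 0\<^sup>2 + exp (- 2 * 0) * (- c0)"
    by (intro tendsto_intros 1 2 x)
  moreover have "(real n * (exp (- x n) - 1))\<^sup>2 + exp (- 2 * x n) * ((real n)\<^sup>2 * (exp (- c n / (real n)\<^sup>2) - 1))
      = (real n)\<^sup>2 * (exp (- 4 * b n / real n - 2 * c n / (real n)\<^sup>2)
      - 2 * exp (- 2 * b n / real n - c n / (2 * (real n)\<^sup>2)) + 1)" for n
  proof -
    have e1: "exp (- 4 * b n / real n - 2 * c n / (real n)\<^sup>2) = exp (- 2 * x n) * exp (- c n / (real n)\<^sup>2)"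
      unfolding exp_add[symmetric] x_def by (intro arg_cong[where f=exp]) (simp add: field_simps)
    have e2: "exp (- 2 * b n / real n - c n / (2 * (real n)\<^sup>2)) = exp (- x n)"
      unfolding x_def by (intro arg_cong[where f=exp]) simp
    have e3: "exp (- 2 * x n) = (exp (- x n))\<^sup>2" unfolding power2_eq_square exp_add[symmetric] by simp
    show ?thesis unfolding e1 e2 e3 by (simp add: algebra_simps power2_eq_square)
  qed
  ultimately show ?thesis by simp
qed

section \<open>Wiener integrals with respect to the perturbed motion\<close>

locale perturbed_wiener = wiener M for M +
  fixes f :: "real \<Rightarrow> real"
  assumes bounded_f: "bounded (range f)"
    and riemann_f: "f riemann_integrable_on {0..1}"
    and periodic_f: "\<And>x. f (x + 1) = f x"
    and mean_f: "integral {0..1} f = 0"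
begin

lemma f_bound: "\<exists>C>0. \<forall>x. \<bar>f x\<bar> \<le> C"
proof -
  obtain C where C: "\<And>x. \<bar>f x\<bar> \<le> C" using bounded_f by (auto simp: bounded_iff)
  then have "\<bar>f x\<bar> \<le> max C 1" for x by (meson le_max_iff_disj)
  then show ?thesis by (intro exI[of _ "max C 1"]) auto
qed

lemma f_integrable: "f integrable_on {0..1}"
  by (rule riemann_integrable_imp_integrable_on[OF riemann_f])

lemma f_scaled_measurable [measurable]: "(\<lambda>s. f (real n * s)) \<in> borel_measurable leb01"
proof -
  obtain C where "\<And>x. \<bar>f x\<bar> \<le> C" using f_bound by blast
  then show ?thesis by (intro measurable_scaled f_integrable periodic_f) auto
qed

lemma in_L2_mult_f: "in_L2 leb01 \<xi> \<Longrightarrow> in_L2 leb01 (\<lambda>s. \<xi> s * f (real n * s))"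
proof -
  assume \<xi>: "in_L2 leb01 \<xi>"
  then have [measurable]: "\<xi> \<in> borel_measurable leb01" by (simp add: in_L2_def)
  obtain C where C: "\<And>x. \<bar>f x\<bar> \<le> C" using f_bound by blast
  show ?thesis
    by (rule in_L2_bound[OF \<xi>, where C=C]) (auto simp: abs_mult mult.commute[of C] intro!: AE_I2 mult_left_mono C)
qed

text \<open>The density of the perturbed integrator with respect to the original one. For
  \<open>n = 0\<close> the quotient \<open>1 / 0\<close> is 0, so \<open>\<mu> 0\<close> is the
  constant 1 and the later statements hold for all \<open>n\<close>.\<close>

definition \<mu> :: "nat \<Rightarrow> real \<Rightarrow> real"
  where "\<mu> n s = 1 + 1 / real n * f (real n * s)"

lemma mu_bound: "\<exists>C\<ge>0. \<forall>s. \<bar>\<mu> n s\<bar> \<le> C"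
proof -
  obtain C where C: "C > 0" "\<And>x. \<bar>f x\<bar> \<le> C" using f_bound by blast
  have "\<bar>\<mu> n s\<bar> \<le> 1 + 1 / real n * C" for s
  proof -
    have "\<bar>\<mu> n s\<bar> \<le> \<bar>1\<bar> + \<bar>1 / real n * f (real n * s)\<bar>" unfolding \<mu>_def by (rule abs_triangle_ineq)
    also have "\<dots> \<le> 1 + 1 / real n * C" using C(2) by (auto simp: abs_mult intro!: divide_right_mono)
    finally show ?thesis .
  qed
  then show ?thesis using C(1) by (intro exI[of _ "1 + 1 / real n * C"]) auto
qed

lemma mu_measurable [measurable]: "\<mu> n \<in> borel_measurable leb01"
  unfolding \<mu>_def[abs_def] by measurable

lemma in_L2_mult_mu: "in_L2 leb01 \<xi> \<Longrightarrow> in_L2 leb01 (\<lambda>s. \<xi> s * \<mu> n s)"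
proof -
  assume \<xi>: "in_L2 leb01 \<xi>"
  then have [measurable]: "\<xi> \<in> borel_measurable leb01" by (simp add: in_L2_def)
  obtain C where C: "\<And>x. \<bar>\<mu> n x\<bar> \<le> C" using mu_bound by blast
  show ?thesis
    by (rule in_L2_bound[OF \<xi>, where C=C]) (auto simp: abs_mult mult.commute[of C] intro!: AE_I2 mult_left_mono C)
qed

lemma L2_tendsto_mult_mu:
  assumes \<xi>: "L2_tendsto leb01 \<xi> \<eta>"
  shows "L2_tendsto leb01 (\<lambda>k s. \<xi> k s * \<mu> n s) (\<lambda>s. \<eta> s * \<mu> n s)"
proof -
  obtain C where C: "\<And>x. \<bar>\<mu> n x\<bar> \<le> C" using mu_bound by blast
  show ?thesis
  proof (rule L2_tendsto_bound[OF \<xi>, where C=C])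
    show "in_L2 leb01 (\<lambda>s. \<xi> k s * \<mu> n s)" "in_L2 leb01 (\<lambda>s. \<eta> s * \<mu> n s)" for k
      by (rule in_L2_mult_mu[OF L2_tendsto_in_L2(1)[OF \<xi>]], rule in_L2_mult_mu[OF L2_tendsto_in_L2(2)[OF \<xi>]])
    show "AE s in leb01. norm (\<xi> k s * \<mu> n s - \<eta> s * \<mu> n s) \<le> C * norm (\<xi> k s - \<eta> s)" for k
      using C by (intro AE_I2) (auto simp: abs_mult mult.commute[of C] simp flip: left_diff_distrib intro!: mult_left_mono)
  qed
qed

abbreviation Bn :: "nat \<Rightarrow> real \<Rightarrow> (real \<Rightarrow> real) \<Rightarrow> real"
  where "Bn \<equiv> perturbed_motion M f"

lemma in_L2_indicator: "in_L2 leb01 (indicator {0<..t} :: real \<Rightarrow> real)"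
  by (intro in_L2_bounded[OF finite_measure_leb01, where C=1] borel_measurable_leb01) (auto simp: indicator_def)

lemma has_wiener_integral_Bn:
  assumes t: "0 \<le> t" "t \<le> 1"
  shows "has_wiener_integral M coord (\<lambda>s. indicator {0<..t} s * \<mu> n s) (Bn n t)"
proof -
  let ?g = "\<lambda>s. indicator {0..t} s * (1 / real n * f (real n * s))"
  let ?h = "\<lambda>s. 1 / real n * (indicator {0<..t} s * f (real n * s))"
  have h: "in_L2 leb01 ?h" by (intro in_L2_mult_left in_L2_mult_f in_L2_indicator)
  \<comment> \<open>The definition of the perturbed motion uses the closed interval
    \<open>[0,t]\<close>, step functions the half-open one; they differ only at 0.\<close>
  have gh: "AE s in leb01. ?g s = ?h s"
    using AE_leb01_greater by eventually_elim (auto simp: indicator_def)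
  have [measurable]: "indicator {0..t} \<in> borel_measurable leb01" by (rule borel_measurable_leb01) simp
  have g: "in_L2 leb01 ?g" by (rule in_L2_cong_AE[OF h _ gh]) measurable
  have "has_wiener_integral M coord ?h (W ?g)"
    by (rule has_wiener_integral_cong_AE[OF has_wiener_integral_W[OF g] in_L2_measurable[OF h] _ W_measurable[OF g] AE_I2[OF refl]])
      (rule eventually_mono[OF gh], rule sym)
  from has_wiener_integral_add[OF has_wiener_integral_indicator[OF t] this]
  have "has_wiener_integral M coord (\<lambda>s. indicator {0<..t} s + ?h s) (\<lambda>\<omega>. coord t \<omega> + W ?g \<omega>)" .
  then show ?thesis by (simp add: perturbed_motion_def[abs_def] \<mu>_def algebra_simps)
qed

lemma has_wiener_integral_step_Bn:
  fixes ps :: "(real \<times> real \<times> real) list"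
  shows "valid_steps ps \<Longrightarrow> has_wiener_integral M coord (\<lambda>s. step_fun ps s * \<mu> n s) (\<lambda>\<omega>. step_integral (Bn n) ps \<omega>)"
proof (induction ps)
  case Nil
  have "has_wiener_integral M coord (step_fun ([] :: (real \<times> real \<times> real) list)) (step_integral coord [])"
    by (rule has_wiener_integralI[of "\<lambda>_. []"])
      (auto intro!: L2_tendsto_const simp: in_L2_zero step_fun_def[abs_def] step_integral_def[abs_def])
  then show ?case by (simp add: step_fun_def[abs_def] step_integral_def[abs_def])
next
  case (Cons p ps)
  obtain c a b where p: "p = (c, a, b)" by (cases p) auto
  have ab: "0 \<le> a" "a \<le> b" "b \<le> 1" "valid_steps ps" using Cons(2) by (auto simp: p)
  have lin: "linear (\<lambda>x::real. c * x)" for c by (rule bounded_linear.linear[OF bounded_linear_mult_right])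
  have "has_wiener_integral M coord
      (\<lambda>s. (c * (indicator {0<..b} s * \<mu> n s) + (- c) * (indicator {0<..a} s * \<mu> n s)) + step_fun ps s * \<mu> n s)
      (\<lambda>\<omega>. (c * Bn n b \<omega> + (- c) * Bn n a \<omega>) + step_integral (Bn n) ps \<omega>)"
    by (rule has_wiener_integral_add[OF has_wiener_integral_add[OF
        has_wiener_integral_linear[OF has_wiener_integral_Bn lin] has_wiener_integral_linear[OF has_wiener_integral_Bn lin]] Cons(1)])
      (use ab in auto)
  also have "(\<lambda>s. (c * (indicator {0<..b} s * \<mu> n s) + (- c) * (indicator {0<..a} s * \<mu> n s)) + step_fun ps s * \<mu> n s)
      = (\<lambda>s. step_fun (p # ps) s * \<mu> n s)"
    using ab by (auto simp: fun_eq_iff p indicator_def algebra_simps)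
  also have "(\<lambda>\<omega>. (c * Bn n b \<omega> + (- c) * Bn n a \<omega>) + step_integral (Bn n) ps \<omega>) = (\<lambda>\<omega>. step_integral (Bn n) (p # ps) \<omega>)"
    by (auto simp: fun_eq_iff p algebra_simps)
  finally show ?case .
qed

text \<open>Stated for an arbitrary approximating sequence, and so for the one behind the chosen
  integral too. The uniqueness result for \<open>coord\<close> does not speak about the integrator
  \<open>Bn\<close>; this lemma identifies its integral instead.\<close>

lemma step_integral_Bn_tendsto:
  assumes ps: "\<And>k. valid_steps (ps k)" and \<xi>: "L2_tendsto leb01 (\<lambda>k. step_fun (ps k)) \<xi>"
  shows "L2_tendsto M (\<lambda>k. step_integral (Bn n) (ps k)) (W (\<lambda>s. \<xi> s * \<mu> n s))"
proof (rule L2_tendsto_cong_AE[OF W_tendsto[OF L2_tendsto_mult_mu[OF \<xi>]]])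
  note h = has_wiener_integral_step_Bn[OF ps, where n=n]
  show "step_integral (Bn n) (ps k) \<in> borel_measurable M" for k
    using has_wiener_integral_in_L2(2)[OF h] by (simp add: in_L2_def)
  show "W (\<lambda>s. \<xi> s * \<mu> n s) \<in> borel_measurable M"
    by (intro W_measurable in_L2_mult_mu L2_tendsto_in_L2(2)[OF \<xi>])
  show "AE \<omega> in M. step_integral (Bn n) (ps k) \<omega> = W (\<lambda>s. step_fun (ps k) s * \<mu> n s) \<omega>" for k
    using W_eqI[OF h[of k]] by eventually_elim simp
qed simp

lemma has_wiener_integral_Bn_W:
  assumes \<xi>: "in_L2 leb01 \<xi>"
  shows "has_wiener_integral M (Bn n) \<xi> (W (\<lambda>s. \<xi> s * \<mu> n s))"
proof -
  obtain ps where ps: "\<And>k. valid_steps (ps k)" "L2_tendsto leb01 (\<lambda>k. step_fun (ps k)) \<xi>"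
    using step_fun_dense[OF \<xi>] by blast
  show ?thesis by (rule has_wiener_integralI[OF ps step_integral_Bn_tendsto[OF ps]])
qed

lemma wiener_integral_Bn:
  assumes \<xi>: "in_L2 leb01 \<xi>"
  shows "wiener_integral M (Bn n) \<xi> \<in> borel_measurable M"
    and "AE \<omega> in M. wiener_integral M (Bn n) \<xi> \<omega> = W (\<lambda>s. \<xi> s * \<mu> n s) \<omega>"
proof -
  have h: "has_wiener_integral M (Bn n) \<xi> (wiener_integral M (Bn n) \<xi>)"
    unfolding wiener_integral_def by (rule someI[of "has_wiener_integral M (Bn n) \<xi>"], rule has_wiener_integral_Bn_W[OF \<xi>])
  then obtain ps where ps: "\<And>k. valid_steps (ps k)" "L2_tendsto leb01 (\<lambda>k. step_fun (ps k)) \<xi>"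
    "L2_tendsto M (\<lambda>k. step_integral (Bn n) (ps k)) (wiener_integral M (Bn n) \<xi>)"
    by (rule has_wiener_integralE) blast
  show "wiener_integral M (Bn n) \<xi> \<in> borel_measurable M"
    using L2_tendsto_in_L2(2)[OF ps(3)] by (simp add: in_L2_def)
  show "AE \<omega> in M. wiener_integral M (Bn n) \<xi> \<omega> = W (\<lambda>s. \<xi> s * \<mu> n s) \<omega>"
    by (rule L2_tendsto_unique[OF ps(3) step_integral_Bn_tendsto[OF ps(1,2)]])
qed

section \<open>The fluctuation and the oscillating inner products\<close>

definition G :: "(real \<Rightarrow> real) \<Rightarrow> nat \<Rightarrow> (real \<Rightarrow> real) \<Rightarrow> real"
  where "G \<xi> n = W (\<lambda>s. \<xi> s * f (real n * s))"

abbreviation en :: "(real \<Rightarrow> real) \<Rightarrow> nat \<Rightarrow> (real \<Rightarrow> real) \<Rightarrow> complex"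
  where "en \<xi> n \<equiv> exp_functional M (Bn n) \<xi>"

lemma en_measurable: "in_L2 leb01 \<xi> \<Longrightarrow> en \<xi> n \<in> borel_measurable M"
  unfolding exp_functional_def[abs_def] using wiener_integral_Bn(1)[of \<xi> n] by measurable

lemma en_eq_mu: "in_L2 leb01 \<xi> \<Longrightarrow> AE \<omega> in M. en \<xi> n \<omega> = e (\<lambda>s. \<xi> s * \<mu> n s) \<omega>"
  using wiener_integral_Bn(2)[of \<xi> n] by (auto simp: exp_functional_def elim!: eventually_mono)

lemma en_eq:
  assumes \<xi>: "in_L2 leb01 \<xi>"
  shows "AE \<omega> in M. en \<xi> n \<omega> = e \<xi> \<omega> * iexp (G \<xi> n \<omega> / real n)"
proof -
  let ?h = "\<lambda>s. \<xi> s * f (real n * s)"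
  have h: "in_L2 leb01 ?h" by (rule in_L2_mult_f[OF \<xi>])
  have eq: "(\<lambda>s. \<xi> s * \<mu> n s) = (\<lambda>s. \<xi> s + 1 / real n * ?h s)" by (simp add: fun_eq_iff \<mu>_def algebra_simps)
  show ?thesis
    using en_eq_mu[OF \<xi>, of n] e_add[OF \<xi> in_L2_mult_left[OF h, of "1 / real n"]] W_scale[OF h, of "1 / real n"]
    unfolding eq
  proof eventually_elim
    fix \<omega>
    assume 1: "en \<xi> n \<omega> = e (\<lambda>s. \<xi> s + 1 / real n * ?h s) \<omega>"
      and 2: "e (\<lambda>s. \<xi> s + 1 / real n * ?h s) \<omega> = e \<xi> \<omega> * e (\<lambda>s. 1 / real n * ?h s) \<omega>"
      and 3: "W (\<lambda>s. 1 / real n * ?h s) \<omega> = 1 / real n * W ?h \<omega>"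
    have "e (\<lambda>s. 1 / real n * ?h s) \<omega> = iexp (G \<xi> n \<omega> / real n)"
      unfolding e_def 3 G_def by simp
    then show "en \<xi> n \<omega> = e \<xi> \<omega> * iexp (G \<xi> n \<omega> / real n)" using 1 2 by simp
  qed
qed

lemma ip_f_tendsto:
  assumes \<xi>: "in_L2 leb01 \<xi>" and \<eta>: "in_L2 leb01 \<eta>"
  shows "(\<lambda>n. ip \<eta> (\<lambda>s. \<xi> s * f (real n * s))) \<longlonglongrightarrow> 0"
proof -
  obtain C where C: "\<And>x. \<bar>f x\<bar> \<le> C" using f_bound by blast
  have "(\<lambda>n. LINT s|leb01. (\<eta> s * \<xi> s) * f (real n * s)) \<longlonglongrightarrow> (LINT s|leb01. \<eta> s * \<xi> s) * integral {0..1} f"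
    by (rule riemann_lebesgue[OF C f_integrable periodic_f in_L2_mult(1)[OF \<eta> \<xi>]])
  then show ?thesis by (simp add: mean_f mult.assoc)
qed

lemma L2_norm01_square: "(L2_norm01 f)\<^sup>2 = (LINT s|leb01. (f s)\<^sup>2)"
  unfolding L2_norm01_def by simp

lemma ip_f_square_tendsto:
  assumes \<xi>: "in_L2 leb01 \<xi>"
  shows "(\<lambda>n. ip (\<lambda>s. \<xi> s * f (real n * s)) (\<lambda>s. \<xi> s * f (real n * s))) \<longlonglongrightarrow> ip \<xi> \<xi> * (L2_norm01 f)\<^sup>2"
proof -
  obtain C where C: "C > 0" "\<And>x. \<bar>f x\<bar> \<le> C" using f_bound by blast
  have bd: "\<bar>(f x)\<^sup>2\<bar> \<le> C\<^sup>2" for x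
    using power_mono[OF C(2)[of x], of 2] by simp
  have "f \<in> borel_measurable leb01" using f_scaled_measurable[of 1] by simp
  then have "Bochner_Integration.integrable leb01 (\<lambda>s. (f s)\<^sup>2)"
    by (intro in_L2_integrable[OF finite_measure_leb01] in_L2_bounded[OF finite_measure_leb01, where C="C\<^sup>2"])
      (use bd in auto)
  then have int: "(\<lambda>s. (f s)\<^sup>2) integrable_on {0..1}" and eq: "integral {0..1} (\<lambda>s. (f s)\<^sup>2) = (L2_norm01 f)\<^sup>2"
    unfolding L2_norm01_square by (auto intro!: integrable_on_lebesgue_on lebesgue_integral_eq_integral[symmetric])
  have "(\<lambda>n. LINT s|leb01. (\<xi> s * \<xi> s) * (f (real n * s))\<^sup>2) \<longlonglongrightarrow> ip \<xi> \<xi> * integral {0..1} (\<lambda>s. (f s)\<^sup>2)"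
    by (rule riemann_lebesgue[OF bd int _ in_L2_mult(1)[OF \<xi> \<xi>]]) (simp add: periodic_f)
  then show ?thesis unfolding eq by (simp add: power2_eq_square mult_ac)
qed

section \<open>The limit of the second moments\<close>

lemma second_moment_limit:
  assumes \<xi>: "in_L2 leb01 \<xi>"
  shows "(\<lambda>n. (of_nat n)\<^sup>2 * (LINT \<omega>|M. (en \<xi> n \<omega> - e \<xi> \<omega>)\<^sup>2)) \<longlonglongrightarrow>
    - (LINT \<omega>|M. exp (2 * \<i> * complex_of_real (W \<xi> \<omega>))) * complex_of_real (LINT s|leb01. (\<xi> s)\<^sup>2)
      * complex_of_real ((L2_norm01 f)\<^sup>2)"
proof -
  define h where "h n s = \<xi> s * f (real n * s)" for n s
  have h: "in_L2 leb01 (h n)" for n unfolding h_def by (rule in_L2_mult_f[OF \<xi>])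
  define a where "a = ip \<xi> \<xi>"
  define b where "b n = ip \<xi> (h n)" for n
  define c where "c n = ip (h n) (h n)" for n
  have b: "b \<longlonglongrightarrow> 0" unfolding b_def h_def by (rule ip_f_tendsto[OF \<xi> \<xi>])
  have c: "c \<longlonglongrightarrow> a * (L2_norm01 f)\<^sup>2" unfolding c_def h_def a_def by (rule ip_f_square_tendsto[OF \<xi>])
  have two: "in_L2 leb01 (\<lambda>s. 2 * \<xi> s)" by (rule in_L2_mult_left[OF \<xi>])
  have nrm: "ip (\<lambda>s. 2 * \<xi> s + r * h n s) (\<lambda>s. 2 * \<xi> s + r * h n s) = 4 * a + 4 * r * b n + r\<^sup>2 * c n" for r n
    unfolding ip_add_scaled[OF two h] a_def b_def c_def by (simp add: mult.assoc)
  have nrm0: "ip (\<lambda>s. 2 * \<xi> s) (\<lambda>s. 2 * \<xi> s) = 4 * a"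
  proof -
    have "(\<lambda>s. 2 * \<xi> s * (2 * \<xi> s)) = (\<lambda>s. 4 * (\<xi> s * \<xi> s))" by auto
    then show ?thesis by (simp add: a_def)
  qed
  have int: "integrable M (e \<zeta>)" if "in_L2 leb01 \<zeta>" for \<zeta>
    by (rule in_L2_integrable[OF finite_measure_axioms in_L2_e[OF that]])
  have z: "in_L2 leb01 (\<lambda>s. 2 * \<xi> s + r * h n s)" for r n by (intro in_L2_add two in_L2_mult_left h)
  have E: "(LINT \<omega>|M. (en \<xi> n \<omega> - e \<xi> \<omega>)\<^sup>2) = complex_of_real (exp (- 2 * a) *
      (exp (- 4 * b n / real n - 2 * c n / (real n)\<^sup>2) - 2 * exp (- 2 * b n / real n - c n / (2 * (real n)\<^sup>2)) + 1))" for n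
  proof -
    have meas: "en \<xi> n \<in> borel_measurable M" "e \<xi> \<in> borel_measurable M" using \<xi> by (auto intro: en_measurable)
    let ?r = "1 / real n"
    \<comment> \<open>Expanding the square gives three exponentials with integrands
      \<open>2 * \<xi> + r * h n\<close>, where \<open>r\<close> is \<open>2 / n\<close>,
      \<open>1 / n\<close> and 0. Their expectations involve only \<open>a\<close>,
      \<open>b n\<close> and \<open>c n\<close>.\<close>
    let ?A = "\<lambda>s. 2 * \<xi> s + (2 * ?r) * h n s" and ?B = "\<lambda>s. 2 * \<xi> s + ?r * h n s" and ?C = "\<lambda>s. 2 * \<xi> s"
    have ae: "AE \<omega> in M. (en \<xi> n \<omega> - e \<xi> \<omega>)\<^sup>2 = e ?A \<omega> - 2 * e ?B \<omega> + e ?C \<omega>"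
      using en_eq[OF \<xi>, of n] W_add[OF two in_L2_mult_left[OF h, of "2 * ?r" n]] W_scale[OF h[of n], of "2 * ?r"]
        W_add[OF two in_L2_mult_left[OF h, of "?r" n]] W_scale[OF h[of n], of "?r"] W_scale[OF \<xi>, of 2]
    proof eventually_elim
      fix \<omega>
      assume 1: "en \<xi> n \<omega> = e \<xi> \<omega> * iexp (G \<xi> n \<omega> / real n)"
        and 2: "W ?A \<omega> = W ?C \<omega> + W (\<lambda>s. (2 * ?r) * h n s) \<omega>" and 3: "W (\<lambda>s. (2 * ?r) * h n s) \<omega> = (2 * ?r) * W (h n) \<omega>"
        and 4: "W ?B \<omega> = W ?C \<omega> + W (\<lambda>s. ?r * h n s) \<omega>" and 5: "W (\<lambda>s. ?r * h n s) \<omega> = ?r * W (h n) \<omega>"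
        and 6: "W ?C \<omega> = 2 * W \<xi> \<omega>"
      have G: "G \<xi> n \<omega> = W (h n) \<omega>" unfolding G_def h_def[abs_def] ..
      define x where "x = iexp (W \<xi> \<omega>)"
      define y where "y = iexp (W (h n) \<omega> / real n)"
      have dbl: "iexp (2 * u) = (iexp u)\<^sup>2" for u
      proof -
        have "\<i> * complex_of_real (2 * u) = \<i> * complex_of_real u + \<i> * complex_of_real u" by (simp add: algebra_simps)
        then show ?thesis by (simp only: exp_add power2_eq_square)
      qed
      have C: "e ?C \<omega> = x\<^sup>2" unfolding e_def 6 x_def by (rule dbl)
      have A: "e ?A \<omega> = x\<^sup>2 * y\<^sup>2"
      proof -
        have "e ?A \<omega> = iexp (2 * W \<xi> \<omega>) * iexp (2 * (W (h n) \<omega> / real n))"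
          unfolding e_def 2 3 6 exp_add[symmetric] by (simp add: distrib_left)
        then show ?thesis unfolding x_def y_def dbl .
      qed
      have B: "e ?B \<omega> = x\<^sup>2 * y"
      proof -
        have "e ?B \<omega> = iexp (2 * W \<xi> \<omega>) * iexp (W (h n) \<omega> / real n)"
          unfolding e_def 4 5 6 exp_add[symmetric] by (simp add: distrib_left)
        then show ?thesis unfolding x_def y_def dbl .
      qed
      have "en \<xi> n \<omega> = x * y" unfolding 1 e_def G x_def y_def ..
      moreover have "e \<xi> \<omega> = x" unfolding e_def x_def ..
      ultimately show "(en \<xi> n \<omega> - e \<xi> \<omega>)\<^sup>2 = e ?A \<omega> - 2 * e ?B \<omega> + e ?C \<omega>"
        unfolding A B C by (simp add: power2_eq_square algebra_simps)
    qed
    have [measurable]: "e ?A \<in> borel_measurable M" "e ?B \<in> borel_measurable M" "e ?C \<in> borel_measurable M"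
      by (intro e_measurable z two)+
    note meas[measurable]
    have "(LINT \<omega>|M. (en \<xi> n \<omega> - e \<xi> \<omega>)\<^sup>2) = (LINT \<omega>|M. e ?A \<omega> - 2 * e ?B \<omega> + e ?C \<omega>)"
      by (rule integral_cong_AE[OF _ _ ae]) measurable
    also have "\<dots> = (LINT \<omega>|M. e ?A \<omega>) - 2 * (LINT \<omega>|M. e ?B \<omega>) + (LINT \<omega>|M. e ?C \<omega>)"
      using int[OF z] int[OF two] by (simp del: times_divide_eq_left times_divide_eq_right)
    also have "\<dots> = complex_of_real (exp (- (4 * a + 4 * (2 * ?r) * b n + (2 * ?r)\<^sup>2 * c n) / 2)
        - 2 * exp (- (4 * a + 4 * ?r * b n + ?r\<^sup>2 * c n) / 2) + exp (- (4 * a) / 2))"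
      unfolding integral_e[OF z] integral_e[OF two] nrm nrm0 by simp
    also have "exp (- (4 * a + 4 * (2 * ?r) * b n + (2 * ?r)\<^sup>2 * c n) / 2)
      = exp (- 2 * a) * exp (- 4 * b n / real n - 2 * c n / (real n)\<^sup>2)"
      unfolding exp_add[symmetric] by (intro arg_cong[where f=exp])
        (simp add: power_mult_distrib power_divide divide_simps, simp add: algebra_simps)
    also have "exp (- (4 * a + 4 * ?r * b n + ?r\<^sup>2 * c n) / 2)
      = exp (- 2 * a) * exp (- 2 * b n / real n - c n / (2 * (real n)\<^sup>2))"
      unfolding exp_add[symmetric] by (intro arg_cong[where f=exp]) (simp add: power_divide divide_simps, simp add: algebra_simps)
    also have "exp (- (4 * a) / 2) = exp (- 2 * a)" by simp
    finally show ?thesis by (simp add: algebra_simps)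
  qed
  have "(\<lambda>n. complex_of_real (exp (- 2 * a) * ((real n)\<^sup>2 * (exp (- 4 * b n / real n - 2 * c n / (real n)\<^sup>2)
      - 2 * exp (- 2 * b n / real n - c n / (2 * (real n)\<^sup>2)) + 1))))
      \<longlonglongrightarrow> complex_of_real (exp (- 2 * a) * - (a * (L2_norm01 f)\<^sup>2))"
    by (intro tendsto_of_real tendsto_mult tendsto_const second_difference_limit b c)
  moreover have "complex_of_real (exp (- 2 * a) * - (a * (L2_norm01 f)\<^sup>2)) =
    - (LINT \<omega>|M. exp (2 * \<i> * complex_of_real (W \<xi> \<omega>)))
      * complex_of_real (LINT s|leb01. (\<xi> s)\<^sup>2) * complex_of_real ((L2_norm01 f)\<^sup>2)"
  proof -
    have "(LINT \<omega>|M. exp (2 * \<i> * complex_of_real (W \<xi> \<omega>))) = (LINT \<omega>|M. iexp (2 * W \<xi> \<omega>))"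
      by (simp add: mult_ac)
    also have "\<dots> = complex_of_real (exp (- (2\<^sup>2 * (LINT s|leb01. (\<xi> s)\<^sup>2)) / 2))"
      by (rule gaussian_char[OF W_gaussian[OF \<xi>]])
    finally have "(LINT \<omega>|M. exp (2 * \<i> * complex_of_real (W \<xi> \<omega>))) = complex_of_real (exp (- 2 * a))"
      by (simp add: a_def power2_eq_square)
    then show ?thesis by (simp add: a_def power2_eq_square)
  qed
  moreover have "(of_nat n)\<^sup>2 * (LINT \<omega>|M. (en \<xi> n \<omega> - e \<xi> \<omega>)\<^sup>2) =
      complex_of_real (exp (- 2 * a) * ((real n)\<^sup>2 * (exp (- 4 * b n / real n - 2 * c n / (real n)\<^sup>2)
      - 2 * exp (- 2 * b n / real n - c n / (2 * (real n)\<^sup>2)) + 1)))" for n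
    unfolding E by (simp only: of_real_mult of_real_power of_real_of_nat_eq mult_ac)
  ultimately show ?thesis by (simp only:)
qed

end

section \<open>Stable convergence in law\<close>

context prob_space
begin

lemma integral_uniform_measure:
  fixes g :: "'a \<Rightarrow> 'b::euclidean_space"
  assumes A[measurable]: "A \<in> sets M" and pos: "prob A > 0" and [measurable]: "g \<in> borel_measurable M"
  shows "(LINT \<omega>|uniform_measure M A. g \<omega>) = (LINT \<omega>|M. indicator A \<omega> *\<^sub>R g \<omega>) /\<^sub>R prob A"
proof -
  have "uniform_measure M A = density M (\<lambda>\<omega>. ennreal (indicator A \<omega> / prob A))"
    unfolding uniform_measure_def
    by (intro density_cong) (auto simp: emeasure_eq_measure divide_ennreal[OF _ pos] indicator_def
        simp flip: ennreal_1 ennreal_0 split: if_splits)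
  then have "(LINT \<omega>|uniform_measure M A. g \<omega>) = (LINT \<omega>|M. (indicator A \<omega> / prob A) *\<^sub>R g \<omega>)"
    by (simp add: integral_density)
  also have "\<dots> = (LINT \<omega>|M. inverse (prob A) *\<^sub>R (indicator A \<omega> *\<^sub>R g \<omega>))"
    by (simp only: scaleR_scaleR divide_inverse mult.commute)
  also have "\<dots> = (LINT \<omega>|M. indicator A \<omega> *\<^sub>R g \<omega>) /\<^sub>R prob A" by (rule integral_scaleR_right)
  finally show ?thesis .
qed

text \<open>Divided by \<open>prob A\<close>, the hypothesis is convergence of characteristic
  functions under the conditional measure, where Levy's continuity theorem applies. The unnormalised
  form admits null sets, for which both sides vanish.\<close>

lemma conditional_weak_convergence:
  fixes G :: "nat \<Rightarrow> 'a \<Rightarrow> real" and R :: "'b \<Rightarrow> real" and g :: "real \<Rightarrow> real"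
  assumes A[measurable]: "A \<in> sets M" and G[measurable]: "\<And>n. G n \<in> borel_measurable M"
    and N: "prob_space N" and R[measurable]: "R \<in> borel_measurable N"
    and char: "\<And>t. (\<lambda>n. LINT \<omega>|M. indicator A \<omega> *\<^sub>R iexp (t * G n \<omega>)) \<longlonglongrightarrow> prob A *\<^sub>R (LINT w|N. iexp (t * R w))"
    and g: "continuous_on UNIV g" "\<And>x. \<bar>g x\<bar> \<le> C"
  shows "(\<lambda>n. LINT \<omega>|M. indicator A \<omega> * g (G n \<omega>)) \<longlonglongrightarrow> prob A * (LINT w|N. g (R w))"
proof (cases "prob A = 0")
  case True
  have "AE \<omega> in M. \<omega> \<notin> A" using True by (simp add: AE_iff_measurable[of A] emeasure_eq_measure prob_eq_0)
  then have "(LINT \<omega>|M. indicator A \<omega> * g (G n \<omega>)) = 0" for n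
    by (intro integral_eq_zero_AE) (auto elim: eventually_mono)
  then show ?thesis by (simp add: True)
next
  case False
  then have pos: "prob A > 0" by (simp add: zero_less_measure_iff)
  have [measurable]: "g \<in> borel_measurable borel" using g(1) by (rule borel_measurable_continuous_onI)
  define MA where "MA = uniform_measure M A"
  have MA: "prob_space MA"
    unfolding MA_def using False by (intro prob_space_uniform_measure) (auto simp: emeasure_eq_measure)
  interpret MA: prob_space MA by (rule MA)
  interpret N: prob_space N by (rule N)
  have GA[measurable]: "G n \<in> borel_measurable MA" for n unfolding MA_def by measurable
  have intA: "(LINT \<omega>|MA. F \<omega>) = (LINT \<omega>|M. indicator A \<omega> *\<^sub>R F \<omega>) /\<^sub>R prob A"
    if "F \<in> borel_measurable M" for F :: "'a \<Rightarrow> 'c::euclidean_space"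
    unfolding MA_def by (rule integral_uniform_measure[OF A pos that])
  have "weak_conv_m (\<lambda>n. distr MA borel (G n)) (distr N borel R)"
  proof (rule levy_continuity)
    show "real_distribution (distr MA borel (G n))" for n by (rule MA.real_distribution_distr) measurable
    show "real_distribution (distr N borel R)" by (rule N.real_distribution_distr) measurable
    fix t
    have "char (distr MA borel (G n)) t = (LINT \<omega>|M. indicator A \<omega> *\<^sub>R iexp (t * G n \<omega>)) /\<^sub>R prob A" for n
      unfolding char_def by (subst integral_distr) (auto intro!: intA)
    moreover have "(\<lambda>n. (LINT \<omega>|M. indicator A \<omega> *\<^sub>R iexp (t * G n \<omega>)) /\<^sub>R prob A)
        \<longlonglongrightarrow> (prob A *\<^sub>R (LINT w|N. iexp (t * R w))) /\<^sub>R prob A"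
      by (intro tendsto_scaleR tendsto_const char)
    moreover have "(prob A *\<^sub>R (LINT w|N. iexp (t * R w))) /\<^sub>R prob A = char (distr N borel R) t"
      unfolding char_def using False by (subst integral_distr) auto
    ultimately show "(\<lambda>n. char (distr MA borel (G n)) t) \<longlonglongrightarrow> char (distr N borel R) t" by simp
  qed
  from weak_conv_imp_integral_bdd_continuous_conv[OF _ _ this, of g C]
  have "(\<lambda>n. LINT x|distr MA borel (G n). g x) \<longlonglongrightarrow> (LINT x|distr N borel R. g x)"
    using g MA.real_distribution_distr[OF GA] N.real_distribution_distr[OF R]
    by (auto simp: continuous_on_eq_continuous_at)
  then have "(\<lambda>n. prob A * (LINT x|distr MA borel (G n). g x)) \<longlonglongrightarrow> prob A * (LINT x|distr N borel R. g x)"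
    by (intro tendsto_intros)
  moreover have "prob A * (LINT x|distr MA borel (G n). g x) = (LINT \<omega>|M. indicator A \<omega> * g (G n \<omega>))" for n
  proof -
    have "(LINT x|distr MA borel (G n). g x) = (LINT \<omega>|MA. g (G n \<omega>))" by (rule integral_distr) measurable
    also have "\<dots> = (LINT \<omega>|M. indicator A \<omega> *\<^sub>R g (G n \<omega>)) /\<^sub>R prob A" by (rule intA) measurable
    finally show ?thesis using False by simp
  qed
  moreover have "(LINT x|distr N borel R. g x) = (LINT w|N. g (R w))" by (rule integral_distr) measurable
  ultimately show ?thesis by simp
qed

text \<open>On each of the finitely many level sets of \<open>S\<close> the integrand is a fixed
  bounded continuous function of \<open>G n\<close>, so conditional convergence in law applies to
  each piece.\<close>

lemma stable_convergence_simple: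
  fixes G :: "nat \<Rightarrow> 'a \<Rightarrow> real" and R :: "'b \<Rightarrow> real" and h :: "'c \<Rightarrow> real \<Rightarrow> real"
  assumes S: "simple_function M S" and G[measurable]: "\<And>n. G n \<in> borel_measurable M"
    and N: "prob_space N" and R[measurable]: "R \<in> borel_measurable N"
    and char: "\<And>A t. A \<in> sets M \<Longrightarrow>
      (\<lambda>n. LINT \<omega>|M. indicator A \<omega> *\<^sub>R iexp (t * G n \<omega>)) \<longlonglongrightarrow> prob A *\<^sub>R (LINT w|N. iexp (t * R w))"
    and h: "\<And>y. continuous_on UNIV (h y)" "\<And>y x. \<bar>h y x\<bar> \<le> C"
  shows "(\<lambda>n. LINT \<omega>|M. h (S \<omega>) (G n \<omega>)) \<longlonglongrightarrow> (LINT \<omega>|M. LINT w|N. h (S \<omega>) (R w))"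
proof -
  have fin: "finite (S ` space M)" and sets[measurable]: "\<And>y. S -` {y} \<inter> space M \<in> sets M"
    using S by (auto simp: simple_function_def) (metis (no_types, lifting) S simple_functionD(2))
  have [measurable]: "h y \<in> borel_measurable borel" for y using h(1) by (rule borel_measurable_continuous_onI)
  have i: "integrable M (\<lambda>\<omega>. indicator (S -` {y} \<inter> space M) \<omega> * h y (G n \<omega>))" for y n
  proof (rule integrable_const_bound[where B=C])
    show "AE \<omega> in M. norm (indicator (S -` {y} \<inter> space M) \<omega> * h y (G n \<omega>)) \<le> C"
      using h(2)[of y] order_trans[OF abs_ge_zero h(2)] by (intro AE_I2) (auto simp: indicator_def abs_mult)
  qed measurable
  have split: "F (S \<omega>) = (\<Sum>y\<in>S ` space M. indicator (S -` {y} \<inter> space M) \<omega> * F y)"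
    if \<omega>: "\<omega> \<in> space M" for F :: "'c \<Rightarrow> real" and \<omega>
  proof -
    have "(\<Sum>y\<in>S ` space M. indicator (S -` {y} \<inter> space M) \<omega> * F y) = (\<Sum>y\<in>S ` space M. if y = S \<omega> then F y else 0)"
      using \<omega> by (intro sum.cong) (auto simp: indicator_def)
    also have "\<dots> = F (S \<omega>)" using \<omega> fin by (subst sum.delta) auto
    finally show ?thesis ..
  qed
  have "(LINT \<omega>|M. h (S \<omega>) (G n \<omega>)) = (LINT \<omega>|M. (\<Sum>y\<in>S ` space M. indicator (S -` {y} \<inter> space M) \<omega> * h y (G n \<omega>)))" for n
    by (rule Bochner_Integration.integral_cong[OF refl]) (rule split)
  also have "\<dots> n = (\<Sum>y\<in>S ` space M. LINT \<omega>|M. indicator (S -` {y} \<inter> space M) \<omega> * h y (G n \<omega>))" for n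
    by (rule Bochner_Integration.integral_sum[OF i])
  finally have eq1: "(LINT \<omega>|M. h (S \<omega>) (G n \<omega>)) = \<dots> n" for n .
  have "(LINT \<omega>|M. LINT w|N. h (S \<omega>) (R w))
      = (LINT \<omega>|M. (\<Sum>y\<in>S ` space M. indicator (S -` {y} \<inter> space M) \<omega> * (LINT w|N. h y (R w))))"
    by (rule Bochner_Integration.integral_cong[OF refl]) (rule split)
  also have "\<dots> = (\<Sum>y\<in>S ` space M. prob (S -` {y} \<inter> space M) * (LINT w|N. h y (R w)))"
    by (subst Bochner_Integration.integral_sum) (auto simp: integrable_indicator_iff emeasure_eq_measure Int_absorb2)
  finally have eq2: "(LINT \<omega>|M. LINT w|N. h (S \<omega>) (R w)) = (\<Sum>y\<in>S ` space M. prob (S -` {y} \<inter> space M) * (LINT w|N. h y (R w)))" .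
  show ?thesis unfolding eq1 eq2
    by (intro tendsto_sum conditional_weak_convergence[OF sets G N R char[OF sets] h])
qed

text \<open>A continuous \<open>h\<close> is uniformly continuous on bounded sets only. Two
  exceptional events are therefore split off, a large \<open>U\<close> and a large distance of
  \<open>U\<close> and \<open>V\<close>; there the difference is at most
  \<open>2 * C\<close>.\<close>

lemma integral_diff_le:
  fixes h :: "'c::euclidean_space \<Rightarrow> real"
  assumes [measurable]: "U \<in> borel_measurable M" "V \<in> borel_measurable M" "h \<in> borel_measurable borel"
    and bound: "\<And>x. \<bar>h x\<bar> \<le> C"
    and close: "\<And>u v. norm u \<le> K \<Longrightarrow> dist u v \<le> \<delta> \<Longrightarrow> \<bar>h u - h v\<bar> \<le> \<epsilon>"
    and "0 \<le> \<epsilon>"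
  shows "\<bar>(LINT \<omega>|M. h (U \<omega>)) - (LINT \<omega>|M. h (V \<omega>))\<bar>
    \<le> \<epsilon> + 2 * C * (prob {\<omega>\<in>space M. norm (U \<omega>) > K} + prob {\<omega>\<in>space M. dist (U \<omega>) (V \<omega>) > \<delta>})"
proof -
  let ?A = "{\<omega>\<in>space M. norm (U \<omega>) > K}" and ?B = "{\<omega>\<in>space M. dist (U \<omega>) (V \<omega>) > \<delta>}"
  have C: "0 \<le> C" using order_trans[OF abs_ge_zero bound] .
  have i: "integrable M (\<lambda>\<omega>. h (U \<omega>))" "integrable M (\<lambda>\<omega>. h (V \<omega>))"
    by (rule integrable_const_bound[where B=C]; use bound in auto)+
  have "\<bar>(LINT \<omega>|M. h (U \<omega>)) - (LINT \<omega>|M. h (V \<omega>))\<bar> = \<bar>LINT \<omega>|M. h (U \<omega>) - h (V \<omega>)\<bar>" using i by simp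
  also have "\<dots> \<le> (LINT \<omega>|M. \<bar>h (U \<omega>) - h (V \<omega>)\<bar>)" by (rule integral_abs_bound)
  also have "\<dots> \<le> (LINT \<omega>|M. \<epsilon> + 2 * C * (indicator ?A \<omega> + indicator ?B \<omega>))"
  proof (rule integral_mono)
    show "integrable M (\<lambda>\<omega>. \<bar>h (U \<omega>) - h (V \<omega>)\<bar>)" using i by simp
    show "integrable M (\<lambda>\<omega>. \<epsilon> + 2 * C * (indicator ?A \<omega> + indicator ?B \<omega>))"
      by (intro Bochner_Integration.integrable_add integrable_mult_right integrable_const)
        (auto simp: integrable_indicator_iff emeasure_eq_measure)
    fix \<omega> assume \<omega>: "\<omega> \<in> space M"
    show "\<bar>h (U \<omega>) - h (V \<omega>)\<bar> \<le> \<epsilon> + 2 * C * (indicator ?A \<omega> + indicator ?B \<omega>)"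
    proof (cases "norm (U \<omega>) \<le> K \<and> dist (U \<omega>) (V \<omega>) \<le> \<delta>")
      case True
      then have "\<bar>h (U \<omega>) - h (V \<omega>)\<bar> \<le> \<epsilon>" using close by blast
      moreover have "0 \<le> 2 * C * (indicator ?A \<omega> + indicator ?B \<omega>)" using C by simp
      ultimately show ?thesis by linarith
    next
      case False
      then have "1 \<le> (indicator ?A \<omega> + indicator ?B \<omega> :: real)" using \<omega> by (auto simp: indicator_def)
      then have "2 * C * 1 \<le> 2 * C * (indicator ?A \<omega> + indicator ?B \<omega>)" using C by (intro mult_left_mono) auto
      moreover have "\<bar>h (U \<omega>) - h (V \<omega>)\<bar> \<le> 2 * C" using bound[of "U \<omega>"] bound[of "V \<omega>"] by linarith
      ultimately show ?thesis using \<open>0 \<le> \<epsilon>\<close> by linarith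
    qed
  qed
  also have "\<dots> = \<epsilon> + 2 * C * (prob ?A + prob ?B)"
    by (subst Bochner_Integration.integral_add) (auto simp: prob_space integrable_indicator_iff emeasure_eq_measure Int_absorb2)
  finally show ?thesis .
qed

lemma prob_norm_tail:
  fixes X :: "'a \<Rightarrow> 'c::euclidean_space"
  assumes [measurable]: "X \<in> borel_measurable M" and "e > 0"
  shows "\<exists>K>0. prob {\<omega>\<in>space M. norm (X \<omega>) > K} < e"
proof -
  have "(\<lambda>k. LINT \<omega>|M. indicator {\<omega>\<in>space M. norm (X \<omega>) > real k} \<omega>) \<longlonglongrightarrow> (LINT \<omega>|M. (0::real))"
  proof (rule integral_dominated_convergence[where w="\<lambda>_. 1"])
    show "AE \<omega> in M. (\<lambda>k. indicator {\<omega>\<in>space M. norm (X \<omega>) > real k} \<omega> :: real) \<longlonglongrightarrow> 0"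
    proof (rule AE_I2, rule tendsto_eventually)
      fix \<omega>
      obtain n where n: "norm (X \<omega>) < real n" using reals_Archimedean2 by blast
      have "(indicator {\<omega>\<in>space M. norm (X \<omega>) > real k} \<omega> :: real) = 0" if "k \<ge> n" for k
        using n that by (auto simp: indicator_def)
      then show "\<forall>\<^sub>F k in sequentially. (indicator {\<omega>\<in>space M. norm (X \<omega>) > real k} \<omega> :: real) = 0"
        unfolding eventually_sequentially by blast
    qed
  qed (auto simp: indicator_def)
  then have "(\<lambda>k. prob {\<omega>\<in>space M. norm (X \<omega>) > real k}) \<longlonglongrightarrow> 0" by (simp add: Int_absorb2)
  then have "\<forall>\<^sub>F k in sequentially. prob {\<omega>\<in>space M. norm (X \<omega>) > real k} < e"
    using \<open>e > 0\<close> by (rule order_tendstoD)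
  then have "\<forall>\<^sub>F k in sequentially. prob {\<omega>\<in>space M. norm (X \<omega>) > real k} < e \<and> k \<ge> 1"
    using eventually_ge_at_top[of "1::nat"] by eventually_elim simp
  then obtain k where "prob {\<omega>\<in>space M. norm (X \<omega>) > real k} < e" "k \<ge> 1"
    using eventually_happens'[OF sequentially_bot] by blast
  then show ?thesis by (intro exI[of _ "real k"]) auto
qed

lemma prob_dist_tendsto_0:
  fixes S :: "'a \<Rightarrow> 'c::euclidean_space"
  assumes [measurable]: "S \<in> borel_measurable M" "\<And>m. T m \<in> borel_measurable M"
    and lim: "\<And>\<omega>. \<omega> \<in> space M \<Longrightarrow> (\<lambda>m. T m \<omega>) \<longlonglongrightarrow> S \<omega>" and "\<delta> > 0"
  shows "(\<lambda>m. prob {\<omega>\<in>space M. dist (S \<omega>) (T m \<omega>) > \<delta>}) \<longlonglongrightarrow> 0"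
proof -
  have "(\<lambda>m. LINT \<omega>|M. indicator {\<omega>\<in>space M. dist (S \<omega>) (T m \<omega>) > \<delta>} \<omega>) \<longlonglongrightarrow> (LINT \<omega>|M. (0::real))"
  proof (rule integral_dominated_convergence[where w="\<lambda>_. 1"])
    show "AE \<omega> in M. (\<lambda>m. indicator {\<omega>\<in>space M. dist (S \<omega>) (T m \<omega>) > \<delta>} \<omega> :: real) \<longlonglongrightarrow> 0"
    proof (rule AE_I2, rule tendsto_eventually)
      fix \<omega> assume "\<omega> \<in> space M"
      then have "\<forall>\<^sub>F m in sequentially. dist (T m \<omega>) (S \<omega>) < \<delta>"
        using lim \<open>\<delta> > 0\<close> by (auto dest: tendstoD)
      then show "\<forall>\<^sub>F m in sequentially. (indicator {\<omega>\<in>space M. dist (S \<omega>) (T m \<omega>) > \<delta>} \<omega> :: real) = 0"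
        by eventually_elim (auto simp: indicator_def dist_commute)
    qed
  qed (auto simp: indicator_def)
  then show ?thesis by (simp add: Int_absorb2)
qed

text \<open>\<open>Y n\<close> differs from \<open>(X, E \<sqdot> G n)\<close> by a remainder that is small where \<open>G n\<close> is bounded, and
  the pair \<open>(X, E)\<close> is approximated by simple functions, on whose level sets \<open>G n\<close> converges in law.\<close>

lemma stable_convergence:
  fixes G :: "nat \<Rightarrow> 'a \<Rightarrow> real" and R :: "'b \<Rightarrow> real" and X :: "'a \<Rightarrow> real" and E :: "'a \<Rightarrow> complex"
    and Y :: "nat \<Rightarrow> 'a \<Rightarrow> complex" and h :: "real \<times> complex \<Rightarrow> real"
  assumes X[measurable]: "X \<in> borel_measurable M" and E[measurable]: "E \<in> borel_measurable M"
    and Y[measurable]: "\<And>n. Y n \<in> borel_measurable M"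
    and G[measurable]: "\<And>n. G n \<in> borel_measurable M"
    and N: "prob_space N" and R[measurable]: "R \<in> borel_measurable N"
    and char: "\<And>A t. A \<in> sets M \<Longrightarrow>
      (\<lambda>n. LINT \<omega>|M. indicator A \<omega> *\<^sub>R iexp (t * G n \<omega>)) \<longlonglongrightarrow> prob A *\<^sub>R (LINT w|N. iexp (t * R w))"
    and tight: "\<And>\<epsilon>. \<epsilon> > 0 \<Longrightarrow> \<exists>K>0. \<forall>n. prob {\<omega>\<in>space M. \<bar>G n \<omega>\<bar> > K} < \<epsilon>"
    and Y_le: "\<And>n. AE \<omega> in M. norm (Y n \<omega>) \<le> \<bar>G n \<omega>\<bar>"
    and Y_close: "\<And>n. n > 0 \<Longrightarrow> AE \<omega> in M. norm (Y n \<omega> - E \<omega> * G n \<omega>) \<le> (G n \<omega>)\<^sup>2 / real n"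
    and h: "continuous_on UNIV h" "bounded (range h)"
  shows "(\<lambda>n. LINT \<omega>|M. h (X \<omega>, Y n \<omega>)) \<longlonglongrightarrow> (LINT \<omega>|M. LINT w|N. h (X \<omega>, E \<omega> * R w))"
proof -
  interpret N: prob_space N by (rule N)
  obtain C where C: "\<And>x. \<bar>h x\<bar> \<le> C" "C > 0" using h(2) unfolding bounded_pos by auto
  have [measurable]: "h \<in> borel_measurable borel" using h(1) by (rule borel_measurable_continuous_onI)
  have hc: "isCont h x" for x using h(1) by (cases x) (simp add: continuous_on_eq_continuous_at)
  define S where "S \<omega> = (X \<omega>, E \<omega>)" for \<omega>
  have [measurable]: "S \<in> borel_measurable M" unfolding S_def by measurable
  obtain T where T: "\<And>m. simple_function M (T m)" "\<And>\<omega>. \<omega> \<in> space M \<Longrightarrow> (\<lambda>m. T m \<omega>) \<longlonglongrightarrow> S \<omega>"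
    using borel_measurable_implies_sequence_metric[OF \<open>S \<in> borel_measurable M\<close>, of 0] by blast
  have [measurable]: "T m \<in> borel_measurable M" for m using T(1) by (rule borel_measurable_simple_function)
  define k where "k y x = h (fst y, snd y * complex_of_real x)" for y :: "real \<times> complex" and x :: real
  have kc: "continuous_on UNIV (k y)" for y
    unfolding k_def by (intro continuous_on_compose2[OF h(1)] continuous_intros) auto
  have kb: "\<bar>k y x\<bar> \<le> C" for y x unfolding k_def by (rule C)
  define L where "L m = (LINT \<omega>|M. LINT w|N. k (T m \<omega>) (R w))" for m
  have L: "(\<lambda>n. LINT \<omega>|M. k (T m \<omega>) (G n \<omega>)) \<longlonglongrightarrow> L m" for m
    unfolding L_def by (rule stable_convergence_simple[OF T(1) G N R char kc kb])
  have km: "(\<lambda>p. k (fst p) (snd p)) \<in> borel_measurable borel"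
    unfolding k_def by (intro borel_measurable_continuous_onI continuous_on_compose2[OF h(1)] continuous_intros) auto
  have kS: "(\<lambda>x. k (F (fst x)) (R (snd x))) \<in> borel_measurable (M \<Otimes>\<^sub>M N)" if "F \<in> borel_measurable M" for F
    using measurable_compose[OF _ km, of "\<lambda>x. (F (fst x), R (snd x))" "M \<Otimes>\<^sub>M N"] that by simp
    have m: "(\<lambda>\<omega>. LINT w|N. k (F \<omega>) (R w)) \<in> borel_measurable M" if "F \<in> borel_measurable M" for F
      using N.borel_measurable_lebesgue_integral[of "\<lambda>\<omega> w. k (F \<omega>) (R w)" M] kS[OF that] by (simp add: case_prod_beta)
    have kint: "integrable N (\<lambda>w. k y (R w))" for y
      by (rule N.integrable_const_bound[where B=C]) (use kb borel_measurable_continuous_onI[OF kc] in auto)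
  have LT: "L \<longlonglongrightarrow> (LINT \<omega>|M. LINT w|N. k (S \<omega>) (R w))"
    unfolding L_def
  proof (rule integral_dominated_convergence[where w="\<lambda>_. C"])
    show "AE \<omega> in M. norm (LINT w|N. k (T m \<omega>) (R w)) \<le> C" for m
    proof (rule AE_I2)
      fix \<omega>
      have "norm (LINT w|N. k (T m \<omega>) (R w)) \<le> (LINT w|N. norm (k (T m \<omega>) (R w)))" by (rule integral_norm_bound)
      also have "\<dots> \<le> (LINT w|N. C)" using kint kb by (intro integral_mono) auto
      finally show "norm (LINT w|N. k (T m \<omega>) (R w)) \<le> C" by (simp add: N.prob_space)
    qed
    show "AE \<omega> in M. (\<lambda>m. LINT w|N. k (T m \<omega>) (R w)) \<longlonglongrightarrow> (LINT w|N. k (S \<omega>) (R w))"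
    proof (rule AE_I2)
      fix \<omega> assume \<omega>: "\<omega> \<in> space M"
      show "(\<lambda>m. LINT w|N. k (T m \<omega>) (R w)) \<longlonglongrightarrow> (LINT w|N. k (S \<omega>) (R w))"
      proof (rule integral_dominated_convergence[where w="\<lambda>_. C"])
        show "AE w in N. (\<lambda>m. k (T m \<omega>) (R w)) \<longlonglongrightarrow> k (S \<omega>) (R w)"
          unfolding k_def by (intro AE_I2 isCont_tendsto_compose[OF hc] tendsto_intros T(2)[OF \<omega>])
      qed (use kb borel_measurable_integrable[OF kint] in auto)
    qed
  qed (use m in auto)
  show ?thesis
  proof (rule LIMSEQ_I)
    fix r :: real assume r: "r > 0"
    \<comment> \<open>The exceptional events will have probability at most
      \<open>2 * \<epsilon>\<close> each, so \<open>integral_diff_le\<close> gives \<open>\<epsilon>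
      + 2 * C * (2 * \<epsilon> + 2 * \<epsilon>) = \<epsilon> * (1 + 8 * C)\<close>, which is to be
      \<open>r / 4\<close>.\<close>
    define \<epsilon> where "\<epsilon> = r / (4 * (1 + 8 * C))"
    have \<epsilon>: "\<epsilon> > 0" using r C(2) by (simp add: \<epsilon>_def)
    obtain K1 where K1: "K1 > 0" "prob {\<omega>\<in>space M. norm (X \<omega>) > K1} < \<epsilon>" using prob_norm_tail[OF X \<epsilon>] by blast
    obtain K2 where K2: "K2 > 0" "\<And>n. prob {\<omega>\<in>space M. \<bar>G n \<omega>\<bar> > K2} < \<epsilon>" using tight[OF \<epsilon>] by blast
    \<comment> \<open>The norm of the pair is at most \<open>\<bar>X\<bar> + \<bar>G n\<bar>\<close>
      almost surely, so the two tail bounds add.\<close>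
    define K where "K = K1 + K2"
    \<comment> \<open>The radius exceeds \<open>K\<close> by 1 because \<open>v\<close> may lie at
      distance \<delta>, at most 1, from a point of norm at most \<open>K\<close>.\<close>
    have "compact (cball (0 :: real \<times> complex) (K + 1))" by simp
    then have "uniformly_continuous_on (cball 0 (K + 1)) h"
      by (intro compact_uniformly_continuous continuous_on_subset[OF h(1)]) auto
    then obtain d where d: "d > 0" "\<And>u v. u \<in> cball 0 (K + 1) \<Longrightarrow> v \<in> cball 0 (K + 1) \<Longrightarrow> dist v u < d \<Longrightarrow> dist (h v) (h u) < \<epsilon>"
      unfolding uniformly_continuous_on_def using \<epsilon> by meson
    define \<delta> where "\<delta> = min 1 (d / 2)"
    have \<delta>: "\<delta> > 0" "\<delta> \<le> 1" "\<delta> < d" using d(1) by (auto simp: \<delta>_def)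
    have close: "\<bar>h u - h v\<bar> \<le> \<epsilon>" if "norm u \<le> K" "dist u v \<le> \<delta>" for u v
    proof -
      have "norm v \<le> norm u + dist u v" by (metis dist_norm norm_triangle_sub norm_minus_commute)
      then have "u \<in> cball 0 (K + 1)" "v \<in> cball 0 (K + 1)" using that \<delta> by auto
      from d(2)[OF this(2,1)] that(2) \<delta>(3) show ?thesis by (simp add: dist_real_def)
    qed
    \<comment> \<open>Three errors share \<delta>: in \<open>X\<close>, in \<open>E\<close>
      multiplied by \<open>\<bar>G n\<bar>\<close>, and in the remainder. Dividing by
      \<open>K2 + 1\<close> makes both the first and the amplified second at most
      \<open>\<delta> / 3\<close>.\<close>
    define \<delta>' where "\<delta>' = \<delta> / (3 * (K2 + 1))"
    have \<delta>': "\<delta>' > 0" using \<delta>(1) K2(1) by (simp add: \<delta>'_def)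
    have "\<forall>\<^sub>F m in sequentially. prob {\<omega>\<in>space M. dist (S \<omega>) (T m \<omega>) > \<delta>'} < \<epsilon>"
      by (rule order_tendstoD(2)[OF prob_dist_tendsto_0 \<epsilon>]) (use T(2) \<delta>' in auto)
    moreover have "\<forall>\<^sub>F m in sequentially. dist (L m) (LINT \<omega>|M. LINT w|N. k (S \<omega>) (R w)) < r / 4"
      using LT r by (intro tendstoD) auto
    ultimately have "\<forall>\<^sub>F m in sequentially. prob {\<omega>\<in>space M. dist (S \<omega>) (T m \<omega>) > \<delta>'} < \<epsilon> \<and>
        dist (L m) (LINT \<omega>|M. LINT w|N. k (S \<omega>) (R w)) < r / 4" by eventually_elim simp
    then obtain m where m: "prob {\<omega>\<in>space M. dist (S \<omega>) (T m \<omega>) > \<delta>'} < \<epsilon>"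
        "dist (L m) (LINT \<omega>|M. LINT w|N. k (S \<omega>) (R w)) < r / 4"
      using eventually_happens'[OF sequentially_bot] by blast
    obtain n1 where n1: "\<And>n. n \<ge> n1 \<Longrightarrow> dist (LINT \<omega>|M. k (T m \<omega>) (G n \<omega>)) (L m) < r / 4"
      using metric_LIMSEQ_D[OF L[of m], of "r / 4"] r by auto
    \<comment> \<open>Beyond \<open>n2\<close> the remainder, at most \<open>K2^2 / n\<close> where
      \<open>\<bar>G n\<bar>\<close> is at most \<open>K2\<close>, stays below
      \<open>\<delta> / 3\<close>.\<close>
    obtain n2 where n2: "3 * K2\<^sup>2 / \<delta> < real n2" using reals_Archimedean2 by blast
    have "norm ((LINT \<omega>|M. h (X \<omega>, Y n \<omega>)) - (LINT \<omega>|M. LINT w|N. k (S \<omega>) (R w))) < r" if n: "n \<ge> max n1 (max n2 1)" for n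
    proof -
      define U where "U \<omega> = (X \<omega>, Y n \<omega>)" for \<omega>
      define V where "V \<omega> = (fst (T m \<omega>), snd (T m \<omega>) * complex_of_real (G n \<omega>))" for \<omega>
      have [measurable]: "(\<lambda>\<omega>. fst (T m \<omega>)) \<in> borel_measurable M" "(\<lambda>\<omega>. snd (T m \<omega>)) \<in> borel_measurable M"
        using measurable_compose[OF \<open>T m \<in> borel_measurable M\<close> borel_measurable_continuous_onI[of fst]]
          measurable_compose[OF \<open>T m \<in> borel_measurable M\<close> borel_measurable_continuous_onI[of snd]]
        by (simp_all add: continuous_on_fst continuous_on_snd)
      have [measurable]: "U \<in> borel_measurable M" "V \<in> borel_measurable M" unfolding U_def V_def by measurable
      have n0: "n > 0" "n \<ge> n2" "n \<ge> n1" using n by auto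
      have small: "K2\<^sup>2 / real n \<le> \<delta> / 3"
      proof -
        have "3 * K2\<^sup>2 / \<delta> \<le> real n" using n2 n0(2) by linarith
        then have "3 * K2\<^sup>2 \<le> real n * \<delta>" using \<delta>(1) by (simp add: pos_divide_le_eq)
        then show ?thesis using n0(1) by (simp add: pos_divide_le_eq field_simps)
      qed
      have "prob {\<omega>\<in>space M. norm (U \<omega>) > K} \<le> prob ({\<omega>\<in>space M. norm (X \<omega>) > K1} \<union> {\<omega>\<in>space M. \<bar>G n \<omega>\<bar> > K2})"
      proof (rule finite_measure_mono_AE)
        show "AE \<omega> in M. \<omega> \<in> {\<omega>\<in>space M. norm (U \<omega>) > K} \<longrightarrow> \<omega> \<in> {\<omega>\<in>space M. norm (X \<omega>) > K1} \<union> {\<omega>\<in>space M. \<bar>G n \<omega>\<bar> > K2}"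
          using Y_le[of n]
        proof eventually_elim
          fix \<omega> assume le: "norm (Y n \<omega>) \<le> \<bar>G n \<omega>\<bar>"
          have "norm (U \<omega>) \<le> norm (X \<omega>) + norm (Y n \<omega>)" unfolding U_def by (rule norm_Pair_le)
          then show "\<omega> \<in> {\<omega>\<in>space M. norm (U \<omega>) > K} \<longrightarrow> \<omega> \<in> {\<omega>\<in>space M. norm (X \<omega>) > K1} \<union> {\<omega>\<in>space M. \<bar>G n \<omega>\<bar> > K2}"
            using le unfolding K_def by auto
        qed
      qed measurable
      also have "\<dots> \<le> prob {\<omega>\<in>space M. norm (X \<omega>) > K1} + prob {\<omega>\<in>space M. \<bar>G n \<omega>\<bar> > K2}"
        by (rule measure_Un_le) measurable
      finally have p1: "prob {\<omega>\<in>space M. norm (U \<omega>) > K} \<le> 2 * \<epsilon>" using K1(2) K2(2)[of n] by linarith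
      have "prob {\<omega>\<in>space M. dist (U \<omega>) (V \<omega>) > \<delta>} \<le> prob ({\<omega>\<in>space M. dist (S \<omega>) (T m \<omega>) > \<delta>'} \<union> {\<omega>\<in>space M. \<bar>G n \<omega>\<bar> > K2})"
      proof (rule finite_measure_mono_AE)
        show "AE \<omega> in M. \<omega> \<in> {\<omega>\<in>space M. dist (U \<omega>) (V \<omega>) > \<delta>} \<longrightarrow>
            \<omega> \<in> {\<omega>\<in>space M. dist (S \<omega>) (T m \<omega>) > \<delta>'} \<union> {\<omega>\<in>space M. \<bar>G n \<omega>\<bar> > K2}"
          using Y_close[OF n0(1)]
        proof eventually_elim
          fix \<omega> assume yc: "norm (Y n \<omega> - E \<omega> * G n \<omega>) \<le> (G n \<omega>)\<^sup>2 / real n"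
          have "dist (U \<omega>) (V \<omega>) \<le> \<delta>" if a: "dist (S \<omega>) (T m \<omega>) \<le> \<delta>'" and b: "\<bar>G n \<omega>\<bar> \<le> K2"
          proof -
            have x: "dist (X \<omega>) (fst (T m \<omega>)) \<le> \<delta>'" and e: "dist (E \<omega>) (snd (T m \<omega>)) \<le> \<delta>'"
              using dist_fst_le[of "S \<omega>" "T m \<omega>"] dist_snd_le[of "S \<omega>" "T m \<omega>"] a by (auto simp: S_def)
            have "\<delta>' \<le> \<delta>' * (K2 + 1)" using \<delta>' K2(1) by simp
            also have "\<delta>' * (K2 + 1) = \<delta> / 3" using K2(1) by (simp add: \<delta>'_def field_simps)
            finally have d1: "\<delta>' \<le> \<delta> / 3" .
            have "norm ((E \<omega> - snd (T m \<omega>)) * G n \<omega>) = dist (E \<omega>) (snd (T m \<omega>)) * \<bar>G n \<omega>\<bar>"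
              by (simp add: norm_mult dist_norm)
            also have "\<dots> \<le> \<delta>' * (K2 + 1)" using e b \<delta>' by (intro mult_mono) auto
            also have "\<delta>' * (K2 + 1) = \<delta> / 3" using K2(1) by (simp add: \<delta>'_def field_simps)
            finally have d2: "norm ((E \<omega> - snd (T m \<omega>)) * G n \<omega>) \<le> \<delta> / 3" .
            have "(G n \<omega>)\<^sup>2 \<le> K2\<^sup>2" using b power_mono[of "\<bar>G n \<omega>\<bar>" K2 2] by simp
            then have "(G n \<omega>)\<^sup>2 / real n \<le> K2\<^sup>2 / real n" by (intro divide_right_mono) auto
            then have d3: "norm (Y n \<omega> - E \<omega> * G n \<omega>) \<le> \<delta> / 3" using yc small by linarith
            \<comment> \<open>The second component separates the linearisation error of
              \<open>Y n\<close> from the error of replacing \<open>E\<close> by its simple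
              approximation.\<close>
            have "U \<omega> - V \<omega> = (X \<omega> - fst (T m \<omega>), (Y n \<omega> - E \<omega> * G n \<omega>) + (E \<omega> - snd (T m \<omega>)) * G n \<omega>)"
              by (simp add: U_def V_def algebra_simps)
            then have "dist (U \<omega>) (V \<omega>) \<le> norm (X \<omega> - fst (T m \<omega>)) + norm ((Y n \<omega> - E \<omega> * G n \<omega>) + (E \<omega> - snd (T m \<omega>)) * G n \<omega>)"
              unfolding dist_norm by (simp only: norm_Pair_le)
            also have "\<dots> \<le> \<delta> / 3 + (\<delta> / 3 + \<delta> / 3)"
              using x d1 by (intro add_mono order_trans[OF norm_triangle_ineq] d2 d3) (simp add: dist_norm)
            finally show ?thesis by simp
          qed
          then show "\<omega> \<in> {\<omega>\<in>space M. dist (U \<omega>) (V \<omega>) > \<delta>} \<longrightarrow>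
            \<omega> \<in> {\<omega>\<in>space M. dist (S \<omega>) (T m \<omega>) > \<delta>'} \<union> {\<omega>\<in>space M. \<bar>G n \<omega>\<bar> > K2}"
            by (auto simp: not_le[symmetric])
        qed
      qed measurable
      also have "\<dots> \<le> prob {\<omega>\<in>space M. dist (S \<omega>) (T m \<omega>) > \<delta>'} + prob {\<omega>\<in>space M. \<bar>G n \<omega>\<bar> > K2}"
        by (rule measure_Un_le) measurable
      finally have p2: "prob {\<omega>\<in>space M. dist (U \<omega>) (V \<omega>) > \<delta>} \<le> 2 * \<epsilon>" using m(1) K2(2)[of n] by linarith
      have "\<bar>(LINT \<omega>|M. h (U \<omega>)) - (LINT \<omega>|M. h (V \<omega>))\<bar>
          \<le> \<epsilon> + 2 * C * (prob {\<omega>\<in>space M. norm (U \<omega>) > K} + prob {\<omega>\<in>space M. dist (U \<omega>) (V \<omega>) > \<delta>})"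
        by (rule integral_diff_le) (use C(1) close \<epsilon> in auto)
      also have "\<dots> \<le> \<epsilon> + 2 * C * (2 * \<epsilon> + 2 * \<epsilon>)"
        using p1 p2 C(2) by (intro add_left_mono mult_left_mono add_mono) auto
      also have "\<dots> = \<epsilon> * (1 + 8 * C)" by (simp add: algebra_simps)
      also have "\<dots> = r / 4"
      proof -
        have "r / (4 * D) * D = r / 4" if "D > 0" for D :: real using that by simp
        from this[of "1 + 8 * C"] show ?thesis using C(2) unfolding \<epsilon>_def by simp
      qed
      finally have "\<bar>(LINT \<omega>|M. h (X \<omega>, Y n \<omega>)) - (LINT \<omega>|M. k (T m \<omega>) (G n \<omega>))\<bar> \<le> r / 4"
        unfolding U_def V_def k_def .
      then show ?thesis using n1[OF n0(3)] m(2) r unfolding dist_real_def real_norm_def by linarith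
    qed
    then have "\<exists>no. \<forall>n\<ge>no. norm ((LINT \<omega>|M. h (X \<omega>, Y n \<omega>)) - (LINT \<omega>|M. LINT w|N. k (S \<omega>) (R w))) < r"
      by blast
    then show "\<exists>no. \<forall>n\<ge>no. norm ((LINT \<omega>|M. h (X \<omega>, Y n \<omega>)) - (LINT \<omega>|M. LINT w|N. h (X \<omega>, E \<omega> * R w))) < r"
      unfolding k_def S_def fst_conv snd_conv .
  qed
qed

end

section \<open>Totality of the exponentials and the limit theorem\<close>

context wiener
begin

text \<open>Products of exponentials are exponentials almost surely, so the span is an algebra; this
  is what the density theorem requires.\<close>

lemma exp_algebra_times:
  assumes "F \<in> exp_algebra M" "G \<in> exp_algebra M"
  shows "(\<lambda>\<omega>. F \<omega> * G \<omega>) \<in> exp_algebra M"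
proof -
  obtain ps qs where F: "F \<in> borel_measurable M" "valid_exp ps" "AE \<omega> in M. F \<omega> = expsum ps \<omega>"
    and G: "G \<in> borel_measurable M" "valid_exp qs" "AE \<omega> in M. G \<omega> = expsum qs \<omega>"
    using assms by (auto simp: exp_algebra_iff)
  have single: "\<exists>rs. valid_exp rs \<and> (AE \<omega> in M. expsum rs \<omega> = c * e \<xi> \<omega> * expsum qs \<omega>)"
    if \<xi>: "in_L2 leb01 \<xi>" for c \<xi>
    using G(2)
  proof (induction qs)
    case Nil
    then show ?case by (intro exI[of _ "[]"]) simp
  next
    case (Cons q qs)
    obtain d \<eta> where q: "q = (d, \<eta>)" by (cases q) auto
    from Cons obtain rs where rs: "valid_exp rs" "AE \<omega> in M. expsum rs \<omega> = c * e \<xi> \<omega> * expsum qs \<omega>" by (auto simp: q)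
    have \<eta>: "in_L2 leb01 \<eta>" using Cons by (simp add: q)
    have "AE \<omega> in M. expsum ((c * d, \<lambda>s. \<xi> s + \<eta> s) # rs) \<omega> = c * e \<xi> \<omega> * expsum (q # qs) \<omega>"
      using rs(2) e_add[OF \<xi> \<eta>] by eventually_elim (simp add: q algebra_simps)
    then show ?case using rs(1) \<xi> \<eta> by (intro exI[of _ "(c * d, \<lambda>s. \<xi> s + \<eta> s) # rs"]) (simp add: in_L2_add)
  qed
  have "\<exists>rs. valid_exp rs \<and> (AE \<omega> in M. expsum rs \<omega> = expsum ps \<omega> * expsum qs \<omega>)"
    using F(2)
  proof (induction ps)
    case Nil
    then show ?case by (intro exI[of _ "[]"]) simp
  next
    case (Cons q ps)
    obtain c \<xi> where q: "q = (c, \<xi>)" by (cases q) auto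
    from Cons obtain rs where rs: "valid_exp rs" "AE \<omega> in M. expsum rs \<omega> = expsum ps \<omega> * expsum qs \<omega>" by (auto simp: q)
    have \<xi>: "in_L2 leb01 \<xi>" using Cons by (simp add: q)
    obtain us where us: "valid_exp us" "AE \<omega> in M. expsum us \<omega> = c * e \<xi> \<omega> * expsum qs \<omega>" using single[OF \<xi>] by blast
    have "AE \<omega> in M. expsum (us @ rs) \<omega> = expsum (q # ps) \<omega> * expsum qs \<omega>"
      using rs(2) us(2) by eventually_elim (simp add: q distrib_right)
    then show ?case using rs(1) us(1) by (intro exI[of _ "us @ rs"]) simp
  qed
  then obtain rs where rs: "valid_exp rs" "AE \<omega> in M. expsum rs \<omega> = expsum ps \<omega> * expsum qs \<omega>" by blast
  have "AE \<omega> in M. F \<omega> * G \<omega> = expsum rs \<omega>" using F(3) G(3) rs(2) by eventually_elim simp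
  then show ?thesis using F(1) G(1) by (intro exp_algebraI[OF _ rs(1)]) auto
qed

lemma exp_algebra_const: "(\<lambda>_. c) \<in> exp_algebra M"
proof (rule exp_algebraI[of _ "[(c, \<lambda>s. 0)]"])
  show "AE \<omega> in M. c = expsum [(c, \<lambda>s. 0)] \<omega>" using e_zero by eventually_elim simp
qed (simp_all add: in_L2_zero)

text \<open>The density theorem asks for bounds at every point of the space, while members of
  \<open>exp_algebra\<close> agree with trigonometric sums only almost surely; so boundedness is
  made part of the definition.\<close>

definition trig_algebra :: "((real \<Rightarrow> real) \<Rightarrow> real) set"
  where "trig_algebra = {g \<in> borel_measurable M. (\<exists>C. \<forall>\<omega>\<in>space M. \<bar>g \<omega>\<bar> \<le> C) \<and> (\<lambda>\<omega>. complex_of_real (g \<omega>)) \<in> exp_algebra M}"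

text \<open>\<open>u * \<omega> t\<close> is almost surely the Wiener integral of \<open>u\<close>
  times the indicator of \<open>(0,t]\<close>, and the sine is the imaginary part
  \<open>(z - cnj z) / (2 * \<i>)\<close> of the corresponding exponential \<open>z\<close>.\<close>

lemma trig_algebra_sin_coord:
  assumes t: "0 \<le> t" "t \<le> 1"
  shows "(\<lambda>\<omega>. sin (u * \<omega> t)) \<in> trig_algebra"
proof -
  have B[measurable]: "(\<lambda>\<omega>. \<omega> t) \<in> borel_measurable M" using B_measurable[OF t] by (simp add: coord_def[abs_def])
  let ?\<xi> = "\<lambda>s. u * indicator {0<..t} s"
  have ind: "in_L2 leb01 (indicator {0<..t} :: real \<Rightarrow> real)"
    by (rule has_wiener_integral_in_L2(1)[OF has_wiener_integral_indicator[OF t]])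
  have \<xi>: "in_L2 leb01 ?\<xi>" by (rule in_L2_mult_left[OF ind])
  have "(\<lambda>\<omega>. complex_of_real (sin (u * \<omega> t))) \<in> exp_algebra M"
  proof (rule exp_algebraI[of _ "[(1 / (2 * \<i>), ?\<xi>), (- 1 / (2 * \<i>), \<lambda>s. - ?\<xi> s)]"])
    show "AE \<omega> in M. complex_of_real (sin (u * \<omega> t)) = expsum [(1 / (2 * \<i>), ?\<xi>), (- 1 / (2 * \<i>), \<lambda>s. - ?\<xi> s)] \<omega>"
      using W_scale[OF ind, of u] W_eqI[OF has_wiener_integral_indicator[OF t]] e_minus[OF \<xi>]
    proof eventually_elim
      fix \<omega>
      assume 1: "W ?\<xi> \<omega> = u * W (indicator {0<..t}) \<omega>" and 2: "W (indicator {0<..t}) \<omega> = coord t \<omega>"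
        and 3: "e (\<lambda>s. - ?\<xi> s) \<omega> = cnj (e ?\<xi> \<omega>)"
      have E: "e ?\<xi> \<omega> = iexp (u * \<omega> t)" unfolding e_def 1 2 coord_def ..
      have "expsum [(1 / (2 * \<i>), ?\<xi>), (- 1 / (2 * \<i>), \<lambda>s. - ?\<xi> s)] \<omega> = (iexp (u * \<omega> t) - cnj (iexp (u * \<omega> t))) / (2 * \<i>)"
        unfolding exp_simps 3 E diff_divide_distrib
        by (simp only: minus_divide_left[symmetric] mult_minus_left times_divide_eq_left mult_1_left add_0_right
            diff_conv_add_uminus)
      also have "\<dots> = complex_of_real (Im (iexp (u * \<omega> t)))"
      proof -
        have "(z - cnj z) / (2 * \<i>) = complex_of_real (Im z)" for z by (simp add: complex_eq_iff Re_divide Im_divide)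
        then show ?thesis .
      qed
      also have "Im (iexp (u * \<omega> t)) = sin (u * \<omega> t)" by (simp add: Im_exp)
      finally show "complex_of_real (sin (u * \<omega> t)) = expsum [(1 / (2 * \<i>), ?\<xi>), (- 1 / (2 * \<i>), \<lambda>s. - ?\<xi> s)] \<omega>" ..
    qed
  qed (use \<xi> in_L2_minus[OF \<xi>] in simp_all)
  then show ?thesis unfolding trig_algebra_def by (auto intro!: exI[of _ 1])
qed

text \<open>Coordinates are unbounded and thus not in the algebra at hand, but
  \<open>\<omega> t\<close> is the pointwise limit of \<open>c * sin (\<omega> t / c)\<close> as
  \<open>c\<close> grows. The coordinates in turn generate the \<sigma>-algebra of path
  space.\<close>

lemma trig_algebra_generates:
  assumes N: "space N = space M" and A: "trig_algebra \<subseteq> borel_measurable N"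
  shows "sets M \<subseteq> sets N"
proof -
  let ?\<Omega> = "{\<omega>::real \<Rightarrow> real. continuous_on {0..1} \<omega> \<and> \<omega> 0 = 0}"
  let ?C = "restrict_space (\<Pi>\<^sub>M t\<in>{0..1::real}. (borel :: real measure)) ?\<Omega>"
  have sM: "sets M = sets ?C" using wiener by (simp add: wiener_space_def)
  then have sp: "space M = space ?C" by (rule sets_eq_imp_space_eq)
  have coord: "(\<lambda>\<omega>. \<omega> t) \<in> borel_measurable N" if t: "t \<in> {0..1}" for t
  proof (rule borel_measurable_LIMSEQ_real)
    show "(\<lambda>\<omega>. real (Suc k) * sin (1 / real (Suc k) * \<omega> t)) \<in> borel_measurable N" for k
      using A trig_algebra_sin_coord[of t "1 / real (Suc k)"] t by (intro borel_measurable_times) auto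
    fix \<omega> :: "real \<Rightarrow> real"
    show "(\<lambda>k. real (Suc k) * sin (1 / real (Suc k) * \<omega> t)) \<longlonglongrightarrow> \<omega> t"
    proof -
      have "((\<lambda>x::real. sin (x * \<omega> t) / x) \<longlongrightarrow> \<omega> t) (at 0)"
      proof -
        have "((\<lambda>x. sin (x * \<omega> t)) has_real_derivative \<omega> t) (at 0)"
          by (auto intro!: derivative_eq_intros)
        then show ?thesis by (simp add: DERIV_def)
      qed
      moreover have "filterlim (\<lambda>k. inverse (real (Suc k))) (at 0) sequentially"
        using LIMSEQ_inverse_real_of_nat by (simp add: filterlim_at)
      ultimately have lim: "(\<lambda>k. sin (inverse (real (Suc k)) * \<omega> t) / inverse (real (Suc k))) \<longlonglongrightarrow> \<omega> t"
        by (rule filterlim_compose)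
      have "sin (inverse c * x) / inverse c = c * sin (1 / c * x)" for c x :: real by (simp add: field_simps)
      then show ?thesis by (intro tendsto_cong[THEN iffD1, OF _ lim] always_eventually allI)
    qed
  qed
  have "(\<lambda>\<omega>. \<omega>) \<in> measurable N ?C"
  proof (rule measurable_restrict_space2)
    show "(\<lambda>\<omega>. \<omega>) \<in> space N \<rightarrow> ?\<Omega>" by (auto simp: N sp space_restrict_space)
    show "(\<lambda>\<omega>. \<omega>) \<in> measurable N (\<Pi>\<^sub>M t\<in>{0..1::real}. (borel :: real measure))"
    proof (rule measurable_PiM_single)
      show "(\<lambda>\<omega>. \<omega>) \<in> space N \<rightarrow> (\<Pi>\<^sub>E t\<in>{0..1}. space (borel :: real measure))"
        by (auto simp: N sp space_restrict_space space_PiM)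
      fix A :: "real set" and t :: real assume "t \<in> {0..1}" "A \<in> sets borel"
      then show "{\<omega> \<in> space N. \<omega> t \<in> A} \<in> sets N"
        using measurable_sets[OF coord, of t A] by (simp add: vimage_def Int_def conj_commute)
    qed
  qed
  from measurable_sets[OF this] have "A \<inter> space N \<in> sets N" if "A \<in> sets M" for A
    using that sM by simp
  then show ?thesis using sets.sets_into_space N by (metis Int_absorb2 subsetI)
qed

lemma trig_algebra_dense:
  fixes g :: "(real \<Rightarrow> real) \<Rightarrow> real"
  assumes g: "in_L2 M g"
  shows "\<exists>F. (\<forall>k. F k \<in> trig_algebra) \<and> L2_tendsto M F g"
proof (rule L2_dense_algebra[OF finite_measure_axioms _ _ _ _ _ trig_algebra_generates g])
  fix f h :: "(real \<Rightarrow> real) \<Rightarrow> real" and c :: real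
  show "f \<in> trig_algebra \<Longrightarrow> f \<in> borel_measurable M" "f \<in> trig_algebra \<Longrightarrow> \<exists>C. \<forall>x\<in>space M. \<bar>f x\<bar> \<le> C"
    by (auto simp: trig_algebra_def)
  show "(\<lambda>_. c) \<in> trig_algebra" using exp_algebra_const by (auto simp: trig_algebra_def)
  assume f: "f \<in> trig_algebra" and h: "h \<in> trig_algebra"
  obtain C C' where C: "\<forall>x\<in>space M. \<bar>f x\<bar> \<le> C" "\<forall>x\<in>space M. \<bar>h x\<bar> \<le> C'"
    using f h by (auto simp: trig_algebra_def)
  have "\<bar>f x + h x\<bar> \<le> C + C'" "\<bar>f x * h x\<bar> \<le> C * C'" if x: "x \<in> space M" for x
  proof -
    have *: "\<bar>f x\<bar> \<le> C" "\<bar>h x\<bar> \<le> C'" using C x by auto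
    then show "\<bar>f x + h x\<bar> \<le> C + C'" by linarith
    show "\<bar>f x * h x\<bar> \<le> C * C'" unfolding abs_mult using * by (intro mult_mono) auto
  qed
  then show "(\<lambda>x. f x + h x) \<in> trig_algebra" "(\<lambda>x. f x * h x) \<in> trig_algebra"
    using f h exp_algebra_add[of "\<lambda>x. complex_of_real (f x)" "\<lambda>x. complex_of_real (h x)"]
      exp_algebra_times[of "\<lambda>x. complex_of_real (f x)" "\<lambda>x. complex_of_real (h x)"]
    by (auto simp: trig_algebra_def)
qed

text \<open>For almost every \<omega> the derivative of \<open>e \<xi>\<close> is, as a function of
  \<open>s\<close>, the integrand \<xi> times the constant \<open>\<i> * e \<xi> \<omega>\<close>,
  and this constant passes through the integral in the second variable.\<close>

lemma has_wiener_integral_sharp: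
  assumes \<xi>: "in_L2 leb01 \<xi>" and U: "has_D (e \<xi>) U"
  shows "AE \<omega> in M. has_wiener_integral M coord (\<lambda>s. U (\<omega>, s)) (\<lambda>w. W \<xi> w *\<^sub>R (\<i> * e \<xi> \<omega>))"
proof -
  interpret pair_sigma_finite M leb01 by (rule pair_sigma_finite_P)
  have [measurable]: "U \<in> borel_measurable P" using has_malliavin_derivative_in_L2(2)[OF U] by (simp add: in_L2_def)
  have "AE p in P. U p = egrad \<xi> p" by (rule malliavin_derivative_unique[OF U has_D_e[OF \<xi>]]) simp
  then have "AE \<omega> in M. AE s in leb01. U (\<omega>, s) = egrad \<xi> (\<omega>, s)" by (rule AE_pair)
  then show ?thesis using AE_space
  proof eventually_elim
    fix \<omega> assume eq: "AE s in leb01. U (\<omega>, s) = egrad \<xi> (\<omega>, s)" and \<omega>: "\<omega> \<in> space M"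
    have lin: "linear (\<lambda>x::real. x *\<^sub>R (\<i> * e \<xi> \<omega>))" by (rule bounded_linear.linear[OF bounded_linear_scaleR_left])
    show "has_wiener_integral M coord (\<lambda>s. U (\<omega>, s)) (\<lambda>w. W \<xi> w *\<^sub>R (\<i> * e \<xi> \<omega>))"
    proof (rule has_wiener_integral_cong_AE[OF has_wiener_integral_linear[OF has_wiener_integral_W[OF \<xi>] lin]])
      show "(\<lambda>s. U (\<omega>, s)) \<in> borel_measurable leb01" using \<omega> by measurable
      show "AE s in leb01. U (\<omega>, s) = \<xi> s *\<^sub>R (\<i> * e \<xi> \<omega>)" using eq by (simp add: egrad_def)
      show "(\<lambda>w. W \<xi> w *\<^sub>R (\<i> * e \<xi> \<omega>)) \<in> borel_measurable M" using W_measurable[OF \<xi>] by measurable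
    qed simp
  qed
qed

lemma is_sharp_e:
  assumes \<xi>: "in_L2 leb01 \<xi>"
  shows "is_sharp M (e \<xi>) (\<lambda>(\<omega>, w). W \<xi> w *\<^sub>R (\<i> * e \<xi> \<omega>))"
proof -
  have [measurable]: "W \<xi> \<in> borel_measurable M" "e \<xi> \<in> borel_measurable M" using \<xi> by auto
  show ?thesis
    unfolding is_sharp_def
    using has_wiener_integral_sharp[OF \<xi> has_malliavin_derivative_some[OF has_D_e[OF \<xi>]]] by simp
qed

text \<open>\<open>sharp\<close> is a choice; it is pinned down because, for almost every \<omega>,
  uniqueness of the Wiener integral determines it for almost every \<open>w\<close>.\<close>

lemma sharp_e:
  assumes \<xi>: "in_L2 leb01 \<xi>"
  shows "sharp M (e \<xi>) \<in> borel_measurable (M \<Otimes>\<^sub>M M)"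
    and "AE \<omega> in M. AE w in M. sharp M (e \<xi>) (\<omega>, w) = W \<xi> w *\<^sub>R (\<i> * e \<xi> \<omega>)"
proof -
  have s: "is_sharp M (e \<xi>) (sharp M (e \<xi>))"
    unfolding sharp_def by (rule someI[of "is_sharp M (e \<xi>)"], rule is_sharp_e[OF \<xi>])
  show "sharp M (e \<xi>) \<in> borel_measurable (M \<Otimes>\<^sub>M M)" using s by (simp add: is_sharp_def)
  have "AE \<omega> in M. has_wiener_integral M coord (\<lambda>s. D (e \<xi>) (\<omega>, s)) (\<lambda>w. sharp M (e \<xi>) (\<omega>, w))"
    using s by (simp add: is_sharp_def)
  then show "AE \<omega> in M. AE w in M. sharp M (e \<xi>) (\<omega>, w) = W \<xi> w *\<^sub>R (\<i> * e \<xi> \<omega>)"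
    using has_wiener_integral_sharp[OF \<xi> has_malliavin_derivative_some[OF has_D_e[OF \<xi>]]]
    by eventually_elim (rule has_wiener_integral_unique, auto)
qed

end

section \<open>Joint convergence in law\<close>

context perturbed_wiener
begin

context
  fixes \<xi> :: "real \<Rightarrow> real" assumes \<xi>: "in_L2 leb01 \<xi>"
begin

abbreviation osc :: "nat \<Rightarrow> real \<Rightarrow> real"
  where "osc n s \<equiv> \<xi> s * f (real n * s)"

lemma G_gaussian: "gaussian M (G \<xi> n) (ip (osc n) (osc n))"
  using W_gaussian[OF in_L2_mult_f[OF \<xi>], of n] by (simp add: G_def power2_eq_square)

lemma G_measurable [measurable]: "G \<xi> n \<in> borel_measurable M"
  by (rule gaussian_measurable[OF G_gaussian])

definition limit_char :: "real \<Rightarrow> real"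
  where "limit_char t = exp (- (t\<^sup>2 * (ip \<xi> \<xi> * (L2_norm01 f)\<^sup>2)) / 2)"

lemma limit_char_eq: "(LINT w|M. iexp (t * (L2_norm01 f * W \<xi> w))) = complex_of_real (limit_char t)"
  using gaussian_char[OF W_gaussian[OF \<xi>], of "t * L2_norm01 f"]
  by (simp add: limit_char_def power2_eq_square mult_ac)

lemma limit_char_bounds: "0 \<le> limit_char t" "limit_char t \<le> 1"
proof -
  have "0 \<le> ip \<xi> \<xi>" by (intro integral_nonneg_AE) auto
  then show "0 \<le> limit_char t" "limit_char t \<le> 1" by (simp_all add: limit_char_def)
qed

text \<open>The product is the exponential with integrand \<open>\<zeta> + t * osc n\<close>. In its
  squared norm the cross term tends to 0, so the expectation factorises in the limit.\<close>

lemma exp_limit: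
  assumes \<zeta>: "in_L2 leb01 \<zeta>"
  shows "(\<lambda>n. LINT \<omega>|M. e \<zeta> \<omega> * iexp (t * G \<xi> n \<omega>)) \<longlonglongrightarrow> (LINT \<omega>|M. e \<zeta> \<omega>) * limit_char t"
proof -
  have [measurable]: "e \<zeta> \<in> borel_measurable M" using \<zeta> by simp
  note osc = in_L2_mult_f[OF \<xi>]
  have eq: "(LINT \<omega>|M. e \<zeta> \<omega> * iexp (t * G \<xi> n \<omega>))
      = complex_of_real (exp (- (ip \<zeta> \<zeta> + 2 * t * ip \<zeta> (osc n) + t\<^sup>2 * ip (osc n) (osc n)) / 2))" for n
  proof -
    have z: "in_L2 leb01 (\<lambda>s. \<zeta> s + t * osc n s)" by (intro in_L2_add \<zeta> in_L2_mult_left osc)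
    then have [measurable]: "e (\<lambda>s. \<zeta> s + t * osc n s) \<in> borel_measurable M" by simp
    have "AE \<omega> in M. e \<zeta> \<omega> * iexp (t * G \<xi> n \<omega>) = e (\<lambda>s. \<zeta> s + t * osc n s) \<omega>"
      using e_add[OF \<zeta> in_L2_mult_left[OF osc, of t n]] W_scale[OF osc[of n], of t]
    proof eventually_elim
      fix \<omega>
      assume 1: "e (\<lambda>s. \<zeta> s + t * osc n s) \<omega> = e \<zeta> \<omega> * e (\<lambda>s. t * osc n s) \<omega>"
        and 2: "W (\<lambda>s. t * osc n s) \<omega> = t * W (osc n) \<omega>"
      have "e (\<lambda>s. t * osc n s) \<omega> = iexp (t * G \<xi> n \<omega>)" unfolding e_def 2 G_def ..
      then show "e \<zeta> \<omega> * iexp (t * G \<xi> n \<omega>) = e (\<lambda>s. \<zeta> s + t * osc n s) \<omega>" using 1 by simp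
    qed
    then have "(LINT \<omega>|M. e \<zeta> \<omega> * iexp (t * G \<xi> n \<omega>)) = (LINT \<omega>|M. e (\<lambda>s. \<zeta> s + t * osc n s) \<omega>)"
      by (rule integral_cong_AE[rotated 2]) measurable
    then show ?thesis unfolding integral_e[OF z] ip_add_scaled[OF \<zeta> osc] .
  qed
  have "(\<lambda>n. complex_of_real (exp (- (ip \<zeta> \<zeta> + 2 * t * ip \<zeta> (osc n) + t\<^sup>2 * ip (osc n) (osc n)) / 2)))
      \<longlonglongrightarrow> complex_of_real (exp (- (ip \<zeta> \<zeta> + 2 * t * 0 + t\<^sup>2 * (ip \<xi> \<xi> * (L2_norm01 f)\<^sup>2)) / 2))"
    by (intro tendsto_intros ip_f_tendsto[OF \<xi> \<zeta>] ip_f_square_tendsto[OF \<xi>]) simp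
  also have "exp (- (ip \<zeta> \<zeta> + 2 * t * 0 + t\<^sup>2 * (ip \<xi> \<xi> * (L2_norm01 f)\<^sup>2)) / 2) = exp (- ip \<zeta> \<zeta> / 2) * limit_char t"
    unfolding limit_char_def exp_add[symmetric] by (intro arg_cong[where f=exp]) (simp add: field_simps)
  finally show ?thesis unfolding eq integral_e[OF \<zeta>] by (simp only: of_real_mult)
qed

lemma in_L2_iexp_G: "in_L2 M (\<lambda>\<omega>. iexp (t * G \<xi> n \<omega>))"
  by (rule in_L2_bounded[OF finite_measure_axioms, where C=1]) auto

lemma expsum_limit:
  assumes "valid_exp ps"
  shows "(\<lambda>n. LINT \<omega>|M. expsum ps \<omega> * iexp (t * G \<xi> n \<omega>)) \<longlonglongrightarrow> (LINT \<omega>|M. expsum ps \<omega>) * limit_char t"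
  using assms
proof (induction ps)
  case (Cons q ps)
  obtain c \<zeta> where q: "q = (c, \<zeta>)" by (cases q) auto
  have \<zeta>: "in_L2 leb01 \<zeta>" and ps: "valid_exp ps" using Cons by (auto simp: q)
  note i = in_L2_mult(1)[OF in_L2_e[OF \<zeta>] in_L2_iexp_G] in_L2_mult(1)[OF in_L2_exp(1)[OF ps] in_L2_iexp_G]
    in_L2_integrable[OF finite_measure_axioms in_L2_e[OF \<zeta>]] in_L2_integrable[OF finite_measure_axioms in_L2_exp(1)[OF ps]]
  have 1: "(LINT \<omega>|M. expsum (q # ps) \<omega> * iexp (t * G \<xi> n \<omega>))
      = c * (LINT \<omega>|M. e \<zeta> \<omega> * iexp (t * G \<xi> n \<omega>)) + (LINT \<omega>|M. expsum ps \<omega> * iexp (t * G \<xi> n \<omega>))" for n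
  proof -
    have "(LINT \<omega>|M. expsum (q # ps) \<omega> * iexp (t * G \<xi> n \<omega>))
        = (LINT \<omega>|M. c * (e \<zeta> \<omega> * iexp (t * G \<xi> n \<omega>)) + expsum ps \<omega> * iexp (t * G \<xi> n \<omega>))"
      by (rule Bochner_Integration.integral_cong) (simp_all only: q exp_simps distrib_right mult.assoc)
    then show ?thesis using i(1)[of t n] i(2)[of t n] by simp
  qed
  have 2: "(LINT \<omega>|M. expsum (q # ps) \<omega>) = c * (LINT \<omega>|M. e \<zeta> \<omega>) + (LINT \<omega>|M. expsum ps \<omega>)"
    using i(3,4) by (simp add: q)
  show ?case unfolding 1 2 distrib_right mult.assoc
    by (intro tendsto_intros exp_limit \<zeta> Cons(1)[OF ps])
next
  case Nil
  have "expsum [] = (\<lambda>\<omega>. 0)" by (rule ext) simp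
  then show ?case by simp
qed

lemma trig_limit:
  assumes F: "F \<in> trig_algebra"
  shows "(\<lambda>n. LINT \<omega>|M. complex_of_real (F \<omega>) * iexp (t * G \<xi> n \<omega>)) \<longlonglongrightarrow> (LINT \<omega>|M. complex_of_real (F \<omega>)) * limit_char t"
proof -
  obtain ps where ps: "valid_exp ps" "AE \<omega> in M. complex_of_real (F \<omega>) = expsum ps \<omega>" and [measurable]: "F \<in> borel_measurable M"
    using F by (auto simp: trig_algebra_def exp_algebra_iff)
  have [measurable]: "expsum ps \<in> borel_measurable M" using in_L2_exp(1)[OF ps(1)] by (simp add: in_L2_def)
  have 1: "(LINT \<omega>|M. complex_of_real (F \<omega>) * iexp (t * G \<xi> n \<omega>)) = (LINT \<omega>|M. expsum ps \<omega> * iexp (t * G \<xi> n \<omega>))" for n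
    by (rule integral_cong_AE, measurable) (use ps(2) in eventually_elim, simp)
  have 2: "(LINT \<omega>|M. complex_of_real (F \<omega>)) = (LINT \<omega>|M. expsum ps \<omega>)"
    by (rule integral_cong_AE[OF _ _ ps(2)]) measurable
  show ?thesis unfolding 1 2 by (rule expsum_limit[OF ps(1)])
qed

text \<open>\<open>iexp\<close> has modulus 1, so approximating the indicator in mean square by
  \<open>trig_algebra\<close> costs an error uniform in \<open>n\<close>, and the two limits can be
  exchanged.\<close>

lemma indicator_limit:
  assumes A[measurable]: "A \<in> sets M"
  shows "(\<lambda>n. LINT \<omega>|M. indicator A \<omega> *\<^sub>R iexp (t * G \<xi> n \<omega>)) \<longlonglongrightarrow> prob A *\<^sub>R (LINT w|M. iexp (t * (L2_norm01 f * W \<xi> w)))"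
proof -
  have A2: "in_L2 M (indicator A :: (real \<Rightarrow> real) \<Rightarrow> real)"
    by (rule in_L2_bounded[OF finite_measure_axioms, where C=1]) (auto simp: indicator_def)
  obtain F where F: "\<And>k. F k \<in> trig_algebra" "L2_tendsto M F (indicator A)" using trig_algebra_dense[OF A2] by blast
  note F2 = L2_tendsto_linear[OF F(2) linear_Re_Complex(2)] note L2 = L2_tendsto_in_L2[OF F2]
  define \<Phi> where "\<Phi> Z n = (LINT \<omega>|M. Z \<omega> * iexp (t * G \<xi> n \<omega>))" for Z n
  \<comment> \<open>On a probability space this distance bounds the error in the expectation against
    \<open>iexp\<close> for every \<open>n\<close>, and also the error in the limit because
    \<open>limit_char t\<close> is at most 1.\<close>
  define d where "d k = sqrt (LINT \<omega>|M. (norm (complex_of_real (F k \<omega>) - complex_of_real (indicator A \<omega>)))\<^sup>2)" for k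
  have d: "d \<longlonglongrightarrow> 0"
    using tendsto_real_sqrt[OF F2[unfolded L2_tendsto_iff_integral, THEN conjunct2, THEN conjunct2]]
    unfolding d_def real_sqrt_zero .
  have le: "norm (\<Phi> (\<lambda>\<omega>. complex_of_real (F k \<omega>)) n - \<Phi> (\<lambda>\<omega>. complex_of_real (indicator A \<omega>)) n) \<le> d k" for k n
  proof -
    have "\<Phi> (\<lambda>\<omega>. complex_of_real (F k \<omega>)) n - \<Phi> (\<lambda>\<omega>. complex_of_real (indicator A \<omega>)) n
        = (LINT \<omega>|M. (complex_of_real (F k \<omega>) - complex_of_real (indicator A \<omega>)) * iexp (t * G \<xi> n \<omega>))"
      unfolding \<Phi>_def left_diff_distrib
      by (rule Bochner_Integration.integral_diff[symmetric])
        (rule in_L2_mult(1)[OF L2(1) in_L2_iexp_G], rule in_L2_mult(1)[OF L2(2) in_L2_iexp_G])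
    then show ?thesis
      using in_L2_mult(2)[OF in_L2_diff[OF L2(1)[of k] L2(2)] in_L2_iexp_G[of t n]] unfolding d_def
      by (simp add: prob_space)
  qed
  have le': "norm ((LINT \<omega>|M. complex_of_real (F k \<omega>)) * limit_char t - complex_of_real (prob A) * limit_char t) \<le> d k" for k
  proof -
    note i = in_L2_integrable[OF finite_measure_axioms L2(1)[of k]] in_L2_integrable[OF finite_measure_axioms L2(2)]
    have "norm ((LINT \<omega>|M. complex_of_real (F k \<omega>)) - (LINT \<omega>|M. complex_of_real (indicator A \<omega>)))
        = norm (LINT \<omega>|M. (complex_of_real (F k \<omega>) - complex_of_real (indicator A \<omega>)) * 1)"
      using i by (simp only: mult_1_right Bochner_Integration.integral_diff)
    also have "\<dots> \<le> d k"
      using in_L2_mult(2)[OF in_L2_diff[OF L2(1)[of k] L2(2)] in_L2_const[of 1]] unfolding d_def by (simp add: prob_space)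
    also have "(LINT \<omega>|M. complex_of_real (indicator A \<omega>)) = complex_of_real (prob A)"
      unfolding integral_complex_of_real using sets.sets_into_space[OF A] by (simp add: Int_absorb2)
    finally have "norm ((LINT \<omega>|M. complex_of_real (F k \<omega>)) - complex_of_real (prob A)) \<le> d k" .
    moreover have "norm ((LINT \<omega>|M. complex_of_real (F k \<omega>)) * limit_char t - complex_of_real (prob A) * limit_char t)
        \<le> norm ((LINT \<omega>|M. complex_of_real (F k \<omega>)) - complex_of_real (prob A)) * 1"
      unfolding left_diff_distrib[symmetric] norm_mult using limit_char_bounds by (intro mult_left_mono) auto
    ultimately show ?thesis by simp
  qed
  have "(\<lambda>n. \<Phi> (\<lambda>\<omega>. complex_of_real (indicator A \<omega>)) n) \<longlonglongrightarrow> complex_of_real (prob A) * limit_char t"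
  proof (rule LIMSEQ_I)
    fix r :: real assume r: "r > 0"
    obtain k where "norm (d k - 0) < r / 3" using LIMSEQ_D[OF d, of "r / 3"] r by auto
    then have k: "d k < r / 3" by auto
    obtain n0 where n0: "\<And>n. n \<ge> n0 \<Longrightarrow>
        norm (\<Phi> (\<lambda>\<omega>. complex_of_real (F k \<omega>)) n - (LINT \<omega>|M. complex_of_real (F k \<omega>)) * limit_char t) < r / 3"
      using LIMSEQ_D[OF trig_limit[OF F(1)[of k], of t], of "r / 3"] r unfolding \<Phi>_def by auto
    have "norm (\<Phi> (\<lambda>\<omega>. complex_of_real (indicator A \<omega>)) n - complex_of_real (prob A) * limit_char t) < r" if "n \<ge> n0" for n
    proof -
      let ?a = "\<Phi> (\<lambda>\<omega>. complex_of_real (indicator A \<omega>)) n" and ?b = "\<Phi> (\<lambda>\<omega>. complex_of_real (F k \<omega>)) n"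
        and ?c = "(LINT \<omega>|M. complex_of_real (F k \<omega>)) * complex_of_real (limit_char t)"
        and ?d = "complex_of_real (prob A) * complex_of_real (limit_char t)"
      have "norm (?a - ?d) = norm ((?b - ?c) + (?c - ?d) - (?b - ?a))" by (simp add: algebra_simps)
      also have "\<dots> \<le> norm (?b - ?c) + norm (?c - ?d) + norm (?b - ?a)"
        by (intro order_trans[OF norm_triangle_ineq4] add_right_mono norm_triangle_ineq)
      also have "\<dots> < r" using n0[OF that] le[of k n] le'[of k] k by linarith
      finally show ?thesis .
    qed
    then show "\<exists>no. \<forall>n\<ge>no. norm (\<Phi> (\<lambda>\<omega>. complex_of_real (indicator A \<omega>)) n - complex_of_real (prob A) * limit_char t) < r" by blast
  qed
  then show ?thesis unfolding limit_char_eq \<Phi>_def by (simp add: scaleR_conv_of_real)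
qed

lemma G_tight:
  assumes \<epsilon>: "\<epsilon> > 0"
  shows "\<exists>K>0. \<forall>n. prob {\<omega>\<in>space M. \<bar>G \<xi> n \<omega>\<bar> > K} < \<epsilon>"
proof -
  have "Bseq (\<lambda>n. ip (osc n) (osc n))"
    by (rule convergent_imp_Bseq[OF convergentI[OF ip_f_square_tendsto[OF \<xi>]]])
  then obtain s where s: "s > 0" "\<And>n. ip (osc n) (osc n) \<le> s"
    unfolding Bseq_def by (metis abs_le_iff real_norm_def)
  \<comment> \<open>Adding 1 ensures \<open>K >= 1\<close>, so Chebyshev's bound
    \<open>s / K^2\<close> is at most \<open>s / K\<close>, which is below \<epsilon>.\<close>
  define K where "K = s / \<epsilon> + 1"
  have K: "K \<ge> 1" "s / \<epsilon> < K" using s \<epsilon> by (auto simp: K_def)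
  have "prob {\<omega>\<in>space M. \<bar>G \<xi> n \<omega>\<bar> > K} < \<epsilon>" for n
  proof -
    have "prob {\<omega>\<in>space M. \<bar>G \<xi> n \<omega>\<bar> > K} \<le> prob {\<omega>\<in>space M. \<bar>G \<xi> n \<omega>\<bar> \<ge> K}"
      by (intro finite_measure_mono) auto
    also have "\<dots> \<le> (LINT \<omega>|M. (G \<xi> n \<omega>)\<^sup>2) / K\<^sup>2"
      using K(1) gaussian_square(2)[OF G_gaussian] by (intro second_moment_method) auto
    also have "\<dots> \<le> s / K\<^sup>2"
      unfolding gaussian_square(1)[OF G_gaussian] using s(2)[of n] by (intro divide_right_mono) auto
    also have "\<dots> \<le> s / K"
      using K(1) s(1) by (intro divide_left_mono) (auto simp: power2_eq_square intro: mult_pos_pos)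
    also have "\<dots> < \<epsilon>" using K \<epsilon> by (simp add: pos_divide_less_eq mult.commute)
    finally show ?thesis .
  qed
  then show ?thesis using K(1) by (intro exI[of _ K]) auto
qed

lemma convergence_in_law:
  fixes X :: "(real \<Rightarrow> real) \<Rightarrow> real"
  assumes X[measurable]: "X \<in> borel_measurable M"
  shows "conv_in_law M (\<lambda>n \<omega>. (X \<omega>, of_nat n * (en \<xi> n \<omega> - e \<xi> \<omega>)))
    (M \<Otimes>\<^sub>M M) (\<lambda>(\<omega>, w). (X \<omega>, complex_of_real (L2_norm01 f) * sharp M (e \<xi>) (\<omega>, w)))"
  unfolding conv_in_law_def
proof (intro conjI allI impI)
  have [measurable]: "e \<xi> \<in> borel_measurable M" "en \<xi> n \<in> borel_measurable M" "W \<xi> \<in> borel_measurable M"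
      "sharp M (e \<xi>) \<in> borel_measurable (M \<Otimes>\<^sub>M M)" for n
    using \<xi> en_measurable[OF \<xi>] sharp_e(1)[OF \<xi>] by auto
  show "(\<lambda>\<omega>. (X \<omega>, of_nat n * (en \<xi> n \<omega> - e \<xi> \<omega>))) \<in> borel_measurable M" for n by measurable
  show lm: "(\<lambda>(\<omega>, w). (X \<omega>, complex_of_real (L2_norm01 f) * sharp M (e \<xi>) (\<omega>, w))) \<in> borel_measurable (M \<Otimes>\<^sub>M M)"
    by measurable
  fix h :: "real \<times> complex \<Rightarrow> real"
  assume h: "continuous_on UNIV h" "bounded (range h)"
  have hm[measurable]: "h \<in> borel_measurable borel" using h(1) by (rule borel_measurable_continuous_onI)
  have Y: "AE \<omega> in M. of_nat n * (en \<xi> n \<omega> - e \<xi> \<omega>) = e \<xi> \<omega> * (of_nat n * (iexp (G \<xi> n \<omega> / real n) - 1))" for n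
    using en_eq[OF \<xi>, of n] by eventually_elim (simp add: algebra_simps)
  \<comment> \<open>Here the factor \<open>E\<close> of \<open>stable_convergence\<close> is
    \<open>\<i> * e \<xi>\<close>, the first Taylor coefficient, and the limit variable is
    \<open>L2_norm01 f * W \<xi>\<close> on a second copy of the Wiener space.\<close>
  have "(\<lambda>n. LINT \<omega>|M. h (X \<omega>, of_nat n * (en \<xi> n \<omega> - e \<xi> \<omega>)))
      \<longlonglongrightarrow> (LINT \<omega>|M. LINT w|M. h (X \<omega>, (\<i> * e \<xi> \<omega>) * complex_of_real (L2_norm01 f * W \<xi> w)))"
  proof (rule stable_convergence[where G="G \<xi>", OF X _ _ G_measurable prob_space_axioms _ indicator_limit G_tight _ _ h])
    show "AE \<omega> in M. norm (of_nat n * (en \<xi> n \<omega> - e \<xi> \<omega>)) \<le> \<bar>G \<xi> n \<omega>\<bar>" for n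
      using Y[of n]
    proof eventually_elim
      fix \<omega> assume eq: "of_nat n * (en \<xi> n \<omega> - e \<xi> \<omega>) = e \<xi> \<omega> * (of_nat n * (iexp (G \<xi> n \<omega> / real n) - 1))"
      have "norm (of_nat n * (en \<xi> n \<omega> - e \<xi> \<omega>)) = real n * norm (iexp (G \<xi> n \<omega> / real n) - 1)"
        unfolding eq norm_mult norm_e norm_of_nat by simp
      also have "\<dots> \<le> real n * \<bar>G \<xi> n \<omega> / real n\<bar>"
        using iexp_approx1[of "G \<xi> n \<omega> / real n" 0] by (intro mult_left_mono) auto
      also have "\<dots> \<le> \<bar>G \<xi> n \<omega>\<bar>" by simp
      finally show "norm (of_nat n * (en \<xi> n \<omega> - e \<xi> \<omega>)) \<le> \<bar>G \<xi> n \<omega>\<bar>" .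
    qed
    show "AE \<omega> in M. norm (of_nat n * (en \<xi> n \<omega> - e \<xi> \<omega>) - (\<i> * e \<xi> \<omega>) * G \<xi> n \<omega>) \<le> (G \<xi> n \<omega>)\<^sup>2 / real n" if n: "n > 0" for n
      using Y[of n]
    proof eventually_elim
      fix \<omega> assume eq: "of_nat n * (en \<xi> n \<omega> - e \<xi> \<omega>) = e \<xi> \<omega> * (of_nat n * (iexp (G \<xi> n \<omega> / real n) - 1))"
      let ?y = "G \<xi> n \<omega> / real n"
      have "of_nat n * (en \<xi> n \<omega> - e \<xi> \<omega>) - (\<i> * e \<xi> \<omega>) * G \<xi> n \<omega> = e \<xi> \<omega> * (of_nat n * (iexp ?y - (1 + \<i> * ?y)))"
        unfolding eq using n by (simp add: algebra_simps)
      then have "norm (of_nat n * (en \<xi> n \<omega> - e \<xi> \<omega>) - (\<i> * e \<xi> \<omega>) * G \<xi> n \<omega>) = real n * norm (iexp ?y - (1 + \<i> * ?y))"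
        by (simp only: norm_mult norm_e norm_of_nat mult_1)
      also have "\<dots> \<le> real n * (?y\<^sup>2 / 2)" by (intro mult_left_mono norm_iexp_taylor2) simp
      also have "\<dots> \<le> (G \<xi> n \<omega>)\<^sup>2 / real n" using n by (simp add: power2_eq_square field_simps)
      finally show "norm (of_nat n * (en \<xi> n \<omega> - e \<xi> \<omega>) - (\<i> * e \<xi> \<omega>) * G \<xi> n \<omega>) \<le> (G \<xi> n \<omega>)\<^sup>2 / real n" .
    qed
  qed measurable
  \<comment> \<open>For almost every \<omega> the product of the two factors is the norm of
    \<open>f\<close> times the sharp functional; afterwards the iterated integral is read as one
    over the product space.\<close>
  also have "(LINT \<omega>|M. LINT w|M. h (X \<omega>, (\<i> * e \<xi> \<omega>) * complex_of_real (L2_norm01 f * W \<xi> w)))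
      = (LINT \<omega>|M. LINT w|M. h (X \<omega>, complex_of_real (L2_norm01 f) * sharp M (e \<xi>) (\<omega>, w)))"
  proof (rule integral_cong_AE)
    show "AE \<omega> in M. (LINT w|M. h (X \<omega>, (\<i> * e \<xi> \<omega>) * complex_of_real (L2_norm01 f * W \<xi> w)))
        = (LINT w|M. h (X \<omega>, complex_of_real (L2_norm01 f) * sharp M (e \<xi>) (\<omega>, w)))"
      using sharp_e(2)[OF \<xi>] AE_space
    proof eventually_elim
      fix \<omega> assume eq: "AE w in M. sharp M (e \<xi>) (\<omega>, w) = W \<xi> w *\<^sub>R (\<i> * e \<xi> \<omega>)" and \<omega>: "\<omega> \<in> space M"
      show "(LINT w|M. h (X \<omega>, (\<i> * e \<xi> \<omega>) * complex_of_real (L2_norm01 f * W \<xi> w)))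
        = (LINT w|M. h (X \<omega>, complex_of_real (L2_norm01 f) * sharp M (e \<xi>) (\<omega>, w)))"
      proof (rule integral_cong_AE)
        show "(\<lambda>w. h (X \<omega>, complex_of_real (L2_norm01 f) * sharp M (e \<xi>) (\<omega>, w))) \<in> borel_measurable M" using \<omega> by measurable
        show "AE w in M. h (X \<omega>, (\<i> * e \<xi> \<omega>) * complex_of_real (L2_norm01 f * W \<xi> w))
            = h (X \<omega>, complex_of_real (L2_norm01 f) * sharp M (e \<xi>) (\<omega>, w))"
          using eq by eventually_elim (simp add: scaleR_conv_of_real mult_ac)
      qed measurable
    qed
  qed measurable
  also have "\<dots> = (LINT p|(M \<Otimes>\<^sub>M M). h (X (fst p), complex_of_real (L2_norm01 f) * sharp M (e \<xi>) p))"
  proof -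
    interpret PM: pair_prob_space M M by standard
    obtain C where C: "\<And>x. \<bar>h x\<bar> \<le> C" using h(2) unfolding bounded_pos by auto
    have "integrable (M \<Otimes>\<^sub>M M) (\<lambda>p. h (X (fst p), complex_of_real (L2_norm01 f) * sharp M (e \<xi>) p))"
      by (rule PM.P.integrable_const_bound[where B=C]) (use C in auto)
    from PM.integral_fst'[OF this] show ?thesis by simp
  qed
  finally show "(\<lambda>n. LINT \<omega>|M. h (X \<omega>, of_nat n * (en \<xi> n \<omega> - e \<xi> \<omega>)))
      \<longlonglongrightarrow> (LINT x|(M \<Otimes>\<^sub>M M). h (case x of (\<omega>, w) \<Rightarrow> (X \<omega>, complex_of_real (L2_norm01 f) * sharp M (e \<xi>) (\<omega>, w))))"
    by (simp add: case_prod_beta)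
qed

end

end

text \<open>The existence clause keeps the statement about all forms \<open>b\<close> from being
  vacuous. The closure is described twice: for the complex-bilinear form on the whole span, and on
  its real-valued members, where it is the usual Dirichlet form.\<close>

theorem theorem7:
  fixes M :: "(real \<Rightarrow> real) measure" and f \<xi> :: "real \<Rightarrow> real"
  assumes "wiener_space M"
    and "bounded (range f)"
    and "f riemann_integrable_on {0..1}"
    and "\<And>x. f (x + 1) = f x"
    and "integral {0..1} f = 0"
    and "in_L2 leb01 \<xi>"
  shows
    "(\<forall>X :: (real \<Rightarrow> real) \<Rightarrow> real. X \<in> borel_measurable M \<longrightarrow>
        conv_in_law
          M (\<lambda>n \<omega>. (X \<omega>, of_nat n * (exp_functional M (perturbed_motion M f n) \<xi> \<omega>
                                      - exp_functional M coord \<xi> \<omega>)))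
          (M \<Otimes>\<^sub>M M) (\<lambda>(\<omega>, w). (X \<omega>, complex_of_real (L2_norm01 f)
                                      * sharp M (exp_functional M coord \<xi>) (\<omega>, w))))
     \<and> (\<lambda>n. (of_nat n)\<^sup>2 * (LINT \<omega>|M. (exp_functional M (perturbed_motion M f n) \<xi> \<omega>
                                      - exp_functional M coord \<xi> \<omega>)\<^sup>2))
        \<longlonglongrightarrow> - (LINT \<omega>|M. exp (2 * \<i> * complex_of_real (wiener_integral M coord \<xi> \<omega>)))
             * complex_of_real (LINT s|leb01. (\<xi> s)\<^sup>2) * complex_of_real ((L2_norm01 f)\<^sup>2)
     \<and> (\<exists>b. is_exp_form M b)
     \<and> (\<forall>b. is_exp_form M b \<longrightarrow>
          form_closable M (exp_algebra M) b
          \<and> (\<forall>(Z :: (real \<Rightarrow> real) \<Rightarrow> complex) c.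
               form_closure M (exp_algebra M) b Z c \<longleftrightarrow> Z \<in> D21 M \<and> c = ou_form M Z)
          \<and> form_closable M (real_exp_algebra M) b
          \<and> (\<forall>(Z :: (real \<Rightarrow> real) \<Rightarrow> real) c.
               form_closure M (real_exp_algebra M) b (\<lambda>\<omega>. complex_of_real (Z \<omega>)) c
               \<longleftrightarrow> Z \<in> D21 M \<and> c = complex_of_real (ou_form M Z)))"
proof -
  interpret perturbed_wiener M f
    by unfold_locales (use assms in auto)
  show ?thesis
    using convergence_in_law[OF assms(6)] second_moment_limit[OF assms(6)] is_exp_form_ou_bilinear
      form_closable_exp_algebra form_closure_exp_algebra form_closable_real_exp_algebra form_closure_real_exp_algebra
    by blast
qed

end
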